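(* There exist a universal constant $C>0$ and constants $c_p>0$ depending only on $p$ such that the following holds. Let $p'\in[1,2]$ and $p\ge1$. Let $(\mu^{(1)},\mu^{(2)})$ be probability measures on $\mathbb{R}^d$ satisfying the spiked transport model with a spike of dimension $k$. If $\mu^{(1)}$ and $\mu^{(2)}$ satisfy $T_{p'}(\sigma^2)$, then $$\mathbb{E}\,|\hat W_{p,k}-W_p(\mu^{(1)},\mu^{(2)})|\;\le\; C\,\sigma\left(r_{p,k}(n)+c_p\cdot n^{\left(\frac1{p'}-\frac1p\right)_+}\sqrt{\frac{dk\log n}{n}}\right),$$ where $\hat W_{p,k}=\tilde W_{p,k}(\mu^{(1)}_n,\mu^{(2)}_n)$.
   Context: $x_+=\max\{x,0\}$. $W_p$ is the $p$-Wasserstein distance for the Euclidean norm. Spiked transport model with spike $\mathcal U$ of dimension $k$: $\mathcal U\subseteq\mathbb{R}^d$ is a linear subspace of dimension $k$, and there are random variables $X^{(1)},X^{(2)}$ taking values in $\mathcal U$ and a random variable $Z$ taking values in $\mathcal U^\perp$, independent of $(X^{(1)},X^{(2)})$, such that $\mu^{(i)}=\mathrm{Law}(X^{(i)}+Z)$ for $i=1,2$. $T_q(\sigma^2)$ (with $\sigma>0$): a probability measure $\mu$ on $\mathbb{R}^d$ with finite $q$-th moment satisfies $T_q(\sigma^2)$ if $W_q(\nu,\mu)\le\sqrt{2\sigma^2D(\nu\|\mu)}$ for all probability measures $\nu$ on $\mathbb{R}^d$ with finite $q$-th moment, $D$ being the Kullback–Leibler divergence. $\mathcal V_k(\mathbb{R}^d)$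 is the set of $k\times d$ real matrices with orthonormal rows; $\mu_U$ is the law of $UY$ with $Y\sim\mu$; $\tilde W_{p,k}(\mu,\nu)=\sup_{U\in\mathcal V_k(\mathbb{R}^d)}W_p(\mu_U,\nu_U)$. $\mu^{(i)}_n$ is the empirical measure of $n$ i.i.d. samples from $\mu^{(i)}$. Rate: $r_{p,k}(n)=c_p\sqrt k\cdot n^{-1/(2p)}$ if $k<2p$; $r_{p,k}(n)=c_p\sqrt k\cdot n^{-1/(2p)}(\log n)^{1/p}$ if $k=2p$; $r_{p,k}(n)=c_p\sqrt k\cdot n^{-1/k}$ if $k>2p$.
   Formalization: The sample size is assumed to satisfy n ≥ 2; for n = 1, log n = 0 and the bound fails (p = k = 1, both measures N(0, σ²I_d), d large: the left side grows like σ√d while the right side stays Cσc_1). *)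

theory Defs
  imports "HOL-Probability.Probability"
begin

text \<open>
  The dimensions have to be quantified after the constants of the theorem, so they cannot be types.
  Points of $R^d$ are functions on \<open>{..<d}\<close> (extensional, i.e. \<open>undefined\<close> outside), with the
  product Borel $\sigma$-algebra and the Euclidean norm \<open>L2_set x {..<d}\<close>.
\<close>

type_synonym vec = "nat \<Rightarrow> real"

definition Rd :: "nat \<Rightarrow> vec measure" where
  "Rd d = (\<Pi>\<^sub>M i\<in>{..<d}. borel)"

definition prob_on :: "nat \<Rightarrow> vec measure \<Rightarrow> bool" where
  "prob_on d \<mu> \<longleftrightarrow> prob_space \<mu> \<and> sets \<mu> = sets (Rd d)"

definition finite_moment :: "nat \<Rightarrow> real \<Rightarrow> vec measure \<Rightarrow> bool" where
  "finite_moment d q \<mu> \<longleftrightarrow> (\<integral>\<^sup>+ x. ennreal (L2_set x {..<d} powr q) \<partial>\<mu>) < \<top>"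

text \<open>Real powers on $[0,\infty]$, for exponents \<open>a > 0\<close>.\<close>

definition ennreal_powr :: "ennreal \<Rightarrow> real \<Rightarrow> ennreal" where
  "ennreal_powr x a = (if x = \<top> then \<top> else ennreal (enn2real x powr a))"

definition couplings :: "nat \<Rightarrow> vec measure \<Rightarrow> vec measure \<Rightarrow> (vec \<times> vec) measure set" where
  "couplings d \<mu> \<nu> = {\<pi>. sets \<pi> = sets (Rd d \<Otimes>\<^sub>M Rd d)
      \<and> distr \<pi> (Rd d) fst = \<mu> \<and> distr \<pi> (Rd d) snd = \<nu>}"

definition wasserstein :: "nat \<Rightarrow> real \<Rightarrow> vec measure \<Rightarrow> vec measure \<Rightarrow> ennreal" where
  "wasserstein d p \<mu> \<nu> = ennreal_powr
     (INF \<pi>\<in>couplings d \<mu> \<nu>.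
        \<integral>\<^sup>+ z. ennreal (L2_set (\<lambda>i. fst z i - snd z i) {..<d} powr p) \<partial>\<pi>) (1 / p)"

text \<open>
  $D(\nu\|\mu)$ in $[0,\infty]$; the library's real-valued \<open>KL_divergence\<close> takes the reference
  measure first and is only meaningful under the condition below. If \<open>\<nu>\<close> is absolutely continuous
  with respect to \<open>\<mu>\<close>, the negative part of the log-density is always \<open>\<nu>\<close>-integrable, so
  non-integrability means that the divergence is infinite.
\<close>

definition KL :: "vec measure \<Rightarrow> vec measure \<Rightarrow> ennreal" where
  "KL \<nu> \<mu> = (if absolutely_continuous \<mu> \<nu> \<and> integrable \<nu> (entropy_density (exp 1) \<mu> \<nu>)
             then ennreal (KL_divergence (exp 1) \<mu> \<nu>) else \<top>)"

text \<open>The transport inequality $T_q(\sigma^2)$; the parameter \<open>s\<close> is $\sigma^2$.\<close>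

definition transport_ineq :: "nat \<Rightarrow> real \<Rightarrow> real \<Rightarrow> vec measure \<Rightarrow> bool" where
  "transport_ineq d q s \<mu> \<longleftrightarrow> prob_on d \<mu> \<and> finite_moment d q \<mu> \<and>
     (\<forall>\<nu>. prob_on d \<nu> \<and> finite_moment d q \<nu> \<longrightarrow>
        wasserstein d q \<nu> \<mu> \<le> ennreal_powr (ennreal (2 * s) * KL \<nu> \<mu>) (1 / 2))"

definition lincomb :: "nat \<Rightarrow> nat \<Rightarrow> (nat \<Rightarrow> real) \<Rightarrow> (nat \<Rightarrow> vec) \<Rightarrow> vec" where
  "lincomb d k a b = (\<lambda>i\<in>{..<d}. \<Sum>j<k. a j * b j i)"

definition lin_indep :: "nat \<Rightarrow> nat \<Rightarrow> (nat \<Rightarrow> vec) \<Rightarrow> bool" where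
  "lin_indep d k b \<longleftrightarrow>
     (\<forall>a. lincomb d k a b = (\<lambda>i\<in>{..<d}. 0) \<longrightarrow> (\<forall>j<k. a j = 0))"

definition lin_subspace :: "nat \<Rightarrow> vec set \<Rightarrow> bool" where
  "lin_subspace d S \<longleftrightarrow> S \<subseteq> space (Rd d) \<and> (\<lambda>i\<in>{..<d}. 0) \<in> S \<and>
     (\<forall>x\<in>S. \<forall>y\<in>S. (\<lambda>i\<in>{..<d}. x i + y i) \<in> S) \<and>
     (\<forall>x\<in>S. \<forall>a. (\<lambda>i\<in>{..<d}. a * x i) \<in> S)"

text \<open>A subspace has dimension \<open>k\<close> if it has a basis \<open>b 0, \<dots>, b (k - 1)\<close>.\<close>

definition has_dim :: "nat \<Rightarrow> nat \<Rightarrow> vec set \<Rightarrow> bool" where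
  "has_dim d k S \<longleftrightarrow>
     (\<exists>b. (\<forall>j<k. b j \<in> S) \<and> lin_indep d k b \<and> S = {lincomb d k a b | a. True})"

definition orth_compl :: "nat \<Rightarrow> vec set \<Rightarrow> vec set" where
  "orth_compl d S = {z \<in> space (Rd d). \<forall>u\<in>S. (\<Sum>i<d. u i * z i) = 0}"

text \<open>
  The random variables may live on any probability space. Fixing \<open>\<Omega>\<close> to have points of type
  \<^typ>\<open>nat \<Rightarrow> real\<close> loses nothing: only the joint law of $(X^{(1)},X^{(2)},Z)$ matters, and every
  law on $R^{3d}$ is realised on such a space. Since the pair $(X^{(1)},X^{(2)})$ and $Z$ have
  different types, their independence is that of the generated $\sigma$-algebras
  (\<open>indep_var\<close> needs equal types).
\<close>

definition spiked_by :: "nat \<Rightarrow> vec set \<Rightarrow> vec measure \<Rightarrow> vec measure \<Rightarrow> bool" where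
  "spiked_by d S \<mu>1 \<mu>2 \<longleftrightarrow>
     (\<exists>(\<Omega> :: (nat \<Rightarrow> real) measure) X1 X2 Z. prob_space \<Omega> \<and>
        X1 \<in> measurable \<Omega> (Rd d) \<and> X2 \<in> measurable \<Omega> (Rd d) \<and> Z \<in> measurable \<Omega> (Rd d) \<and>
        (\<forall>\<omega>\<in>space \<Omega>. X1 \<omega> \<in> S \<and> X2 \<omega> \<in> S \<and> Z \<omega> \<in> orth_compl d S) \<and>
        prob_space.indep_set \<Omega>
          (sets (vimage_algebra (space \<Omega>) (\<lambda>\<omega>. (X1 \<omega>, X2 \<omega>)) (Rd d \<Otimes>\<^sub>M Rd d)))
          (sets (vimage_algebra (space \<Omega>) Z (Rd d))) \<and>
        \<mu>1 = distr \<Omega> (Rd d) (\<lambda>\<omega>. \<lambda>i\<in>{..<d}. X1 \<omega> i + Z \<omega> i) \<and>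
        \<mu>2 = distr \<Omega> (Rd d) (\<lambda>\<omega>. \<lambda>i\<in>{..<d}. X2 \<omega> i + Z \<omega> i))"

definition spiked_transport_model :: "nat \<Rightarrow> nat \<Rightarrow> vec measure \<Rightarrow> vec measure \<Rightarrow> bool" where
  "spiked_transport_model d k \<mu>1 \<mu>2 \<longleftrightarrow>
     (\<exists>S. lin_subspace d S \<and> has_dim d k S \<and> spiked_by d S \<mu>1 \<mu>2)"

text \<open>
  $k\times d$ matrices with orthonormal rows; entries outside the index range are irrelevant.
\<close>

definition stiefel :: "nat \<Rightarrow> nat \<Rightarrow> (nat \<Rightarrow> nat \<Rightarrow> real) set" where
  "stiefel k d = {U. \<forall>i<k. \<forall>j<k. (\<Sum>l<d. U i l * U j l) = (if i = j then 1 else 0)}"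

definition proj_law :: "nat \<Rightarrow> nat \<Rightarrow> (nat \<Rightarrow> nat \<Rightarrow> real) \<Rightarrow> vec measure \<Rightarrow> vec measure" where
  "proj_law k d U \<mu> = distr \<mu> (Rd k) (\<lambda>y. \<lambda>i\<in>{..<k}. \<Sum>l<d. U i l * y l)"

definition proj_wasserstein :: "nat \<Rightarrow> nat \<Rightarrow> real \<Rightarrow> vec measure \<Rightarrow> vec measure \<Rightarrow> ennreal" where
  "proj_wasserstein k d p \<mu> \<nu> =
     (SUP U\<in>stiefel k d. wasserstein k p (proj_law k d U \<mu>) (proj_law k d U \<nu>))"

text \<open>The law of \<open>x I\<close> with \<open>I\<close> uniform on \<open>{..<n}\<close>, so repeated points are counted.\<close>

definition empirical :: "nat \<Rightarrow> nat \<Rightarrow> (nat \<Rightarrow> vec) \<Rightarrow> vec measure" where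
  "empirical d n x = distr (uniform_count_measure {..<n}) (Rd d) x"

definition iid_samples ::
    "nat \<Rightarrow> nat \<Rightarrow> vec measure \<Rightarrow> 'w measure \<Rightarrow> (nat \<Rightarrow> 'w \<Rightarrow> vec) \<Rightarrow> bool" where
  "iid_samples d n \<mu> \<Omega> X \<longleftrightarrow> prob_space.indep_vars \<Omega> (\<lambda>_. Rd d) X {..<n} \<and>
     (\<forall>i<n. distr \<Omega> (Rd d) (X i) = \<mu>)"

definition rate :: "real \<Rightarrow> real \<Rightarrow> nat \<Rightarrow> nat \<Rightarrow> real" where
  "rate cp p k n =
     (if real k < 2 * p then cp * sqrt (real k) * real n powr (- 1 / (2 * p))
      else if real k = 2 * p
        then cp * sqrt (real k) * real n powr (- 1 / (2 * p)) * ln (real n) powr (1 / p)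
      else cp * sqrt (real k) * real n powr (- 1 / real k))"

text \<open>$|a-b|$ on $[0,\infty]$, infinite as soon as \<open>a\<close> or \<open>b\<close> is.\<close>

definition ennreal_dist :: "ennreal \<Rightarrow> ennreal \<Rightarrow> ennreal" where
  "ennreal_dist a b = e2ennreal \<bar>enn2ereal a - enn2ereal b\<bar>"

end

theory Submission
  imports Defs
begin

text \<open>
  In the spiked model $W_p(\mu^{(1)},\mu^{(2)})$ is attained by the projection to the spike: a coupling of the
  projections is lifted by adding a common independent copy of the noise. By the triangle inequality the error is
  therefore at most the sum over \<open>i = 1, 2\<close> of $\sup_U W_p((\mu^{(i)}_n)_U,\mu^{(i)}_U)$.

  For fixed \<open>U\<close> this distance is Lipschitz in the sample. Its mean is of the order of the rate, by a greedy coupling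
  along dyadic cells of side $\sigma 2^{-j}$, where exponential weights, integrable because of $T_{p'}$, replace
  compactness of the support. It concentrates because the dual form of $T_{p'}$, stated for pairs of functions with
  $G(x)-H(y)\le|x-y|^{p'}$, tensorizes by induction on the number of samples without an infimal convolution. A union
  bound over a net of matrices with orthonormal rows then controls the supremum.

  The triangle inequality is only needed when one of the first two measures has finite support, so that every coupling
  of them has a density with respect to their product and gluing needs no disintegration.
\<close>

section \<open>Couplings and Wasserstein distances\<close>

text \<open>The constants shape the proof: \<open>c_p\<close> may not depend on \<open>k\<close> or
  \<open>d\<close>, yet each dyadic level carries a factor \<open>D^(k/2)\<close> with
  \<open>D = 5 exp 4\<close>. For \<open>k <= 2 p\<close> it is at most \<open>D^p\<close>. For
  \<open>k > 2 p\<close> the depth \<open>J\<close> is chosen with \<open>D 2^J\<close> of the order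
  of \<open>n^(1/k)\<close>, so that \<open>D^(k/2)\<close> disappears in \<open>sqrt n\<close>; and
  if \<open>n^(1/k) < D\<close>, then \<open>n^(-1/k)\<close> is bounded below and a comparison with
  a point mass suffices. Projections are centred at the mean of the measure, which makes their
  exponential moments depend on \<open>\<sigma>\<close> and \<open>k\<close> alone; the scale
  \<open>4 \<sigma>\<close> used there, once per sample, is the origin of the universal constant 8.

  The second obstacle is measurability: a supremum over uncountably many matrices and an infimum
  over couplings are not measurable by construction. Bounds are therefore passed on as measurable
  majorants, whose integrals can be added, and only for fixed \<open>U\<close> is measurability of
  the distance derived, from its Lipschitz continuity. Roots are mostly replaced by affine bounds,
  so that expectations pass through without Jensen's inequality.\<close>

definition vdist :: "nat \<Rightarrow> vec \<Rightarrow> vec \<Rightarrow> real" where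
  "vdist d x y = L2_set (\<lambda>i. x i - y i) {..<d}"

definition tcost :: "nat \<Rightarrow> real \<Rightarrow> (vec \<times> vec) measure \<Rightarrow> ennreal" where
  "tcost d p \<pi> = (\<integral>\<^sup>+ z. ennreal (vdist d (fst z) (snd z) powr p) \<partial>\<pi>)"

lemma wasserstein_eq_tcost:
  "wasserstein d p \<mu> \<nu> = ennreal_powr (INF \<pi>\<in>couplings d \<mu> \<nu>. tcost d p \<pi>) (1 / p)"
  by (simp add: wasserstein_def tcost_def vdist_def)

lemma vdist_nonneg [simp]: "0 \<le> vdist d x y"
  by (simp add: vdist_def)

lemma vdist_same [simp]: "vdist d x x = 0"
  by (simp add: vdist_def L2_set_0')

lemma vdist_commute: "vdist d x y = vdist d y x"
  unfolding vdist_def L2_set_def by (simp add: power2_commute)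

lemma vdist_triangle: "vdist d x z \<le> vdist d x y + vdist d y z"
proof -
  have "vdist d x z = L2_set (\<lambda>i. (x i - y i) + (y i - z i)) {..<d}"
    by (simp add: vdist_def)
  also have "\<dots> \<le> vdist d x y + vdist d y z"
    unfolding vdist_def by (rule L2_set_triangle_ineq)
  finally show ?thesis .
qed

lemma vdist_le_sum_abs: "vdist d x y \<le> (\<Sum>i<d. \<bar>x i - y i\<bar>)"
  unfolding vdist_def by (rule L2_set_le_sum_abs)

lemma space_Rd: "space (Rd d) = extensional {..<d}"
  by (simp add: Rd_def space_PiM PiE_def)

lemma measurable_Rd_coord [measurable (raw)]:
  assumes "f \<in> measurable M (Rd d)" "i < d"
  shows "(\<lambda>x. f x i) \<in> borel_measurable M"
  using assms measurable_compose[OF _ measurable_component_singleton[of i "{..<d}" "\<lambda>_. borel"]]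
  by (auto simp: Rd_def)

lemma measurable_RdI:
  assumes "\<And>i. i < d \<Longrightarrow> (\<lambda>x. f x i) \<in> borel_measurable M"
    and "\<And>x. x \<in> space M \<Longrightarrow> f x \<in> extensional {..<d}"
  shows "f \<in> measurable M (Rd d)"
  unfolding Rd_def using assms
  by (intro measurable_PiM_single') (auto simp: PiE_def)

lemma measurable_vdist [measurable (raw)]:
  assumes f: "f \<in> measurable M (Rd d)" and g: "g \<in> measurable M (Rd d)"
  shows "(\<lambda>x. vdist d (f x) (g x)) \<in> borel_measurable M"
proof -
  have [measurable]: "\<And>i. i \<in> {..<d} \<Longrightarrow> (\<lambda>x. f x i) \<in> borel_measurable M"
    "\<And>i. i \<in> {..<d} \<Longrightarrow> (\<lambda>x. g x i) \<in> borel_measurable M"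
    using f g by auto
  show ?thesis
    unfolding vdist_def L2_set_def by measurable
qed

lemma prob_onD: "prob_on d \<mu> \<Longrightarrow> prob_space \<mu>" "prob_on d \<mu> \<Longrightarrow> sets \<mu> = sets (Rd d)"
  by (auto simp: prob_on_def)

lemma prob_on_space: "prob_on d \<mu> \<Longrightarrow> space \<mu> = space (Rd d)"
  by (auto simp: prob_on_def dest: sets_eq_imp_space_eq)

lemma prob_on_distr: "prob_space M \<Longrightarrow> f \<in> measurable M (Rd d) \<Longrightarrow> prob_on d (distr M (Rd d) f)"
  by (simp add: prob_on_def prob_space.prob_space_distr)

lemma couplingsD:
  assumes "\<pi> \<in> couplings d \<mu> \<nu>"
  shows "sets \<pi> = sets (Rd d \<Otimes>\<^sub>M Rd d)" "distr \<pi> (Rd d) fst = \<mu>" "distr \<pi> (Rd d) snd = \<nu>"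
    "space \<pi> = space (Rd d) \<times> space (Rd d)"
    "fst \<in> measurable \<pi> (Rd d)" "snd \<in> measurable \<pi> (Rd d)"
proof -
  show s: "sets \<pi> = sets (Rd d \<Otimes>\<^sub>M Rd d)" "distr \<pi> (Rd d) fst = \<mu>" "distr \<pi> (Rd d) snd = \<nu>"
    using assms by (auto simp: couplings_def)
  show "space \<pi> = space (Rd d) \<times> space (Rd d)"
    using sets_eq_imp_space_eq[OF s(1)] by (simp add: space_pair_measure)
  show "fst \<in> measurable \<pi> (Rd d)" "snd \<in> measurable \<pi> (Rd d)"
    by (simp_all add: measurable_cong_sets[OF s(1) refl])
qed

lemma coupling_prob_space:
  assumes "\<pi> \<in> couplings d \<mu> \<nu>" "prob_on d \<mu>"
  shows "prob_space \<pi>"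
proof -
  have "prob_space (distr \<pi> (Rd d) fst)"
    using couplingsD(2)[OF assms(1)] assms(2) by (simp add: prob_on_def)
  then show ?thesis
    using couplingsD(5)[OF assms(1)] by (rule prob_space_distrD[rotated])
qed

lemma joint_law_coupling:
  assumes f: "f \<in> measurable M (Rd d)" and g: "g \<in> measurable M (Rd d)"
  shows "distr M (Rd d \<Otimes>\<^sub>M Rd d) (\<lambda>x. (f x, g x)) \<in> couplings d (distr M (Rd d) f) (distr M (Rd d) g)"
  using f g by (auto simp: couplings_def distr_distr comp_def)

lemma tcost_joint_law:
  assumes [measurable]: "f \<in> measurable M (Rd d)" "g \<in> measurable M (Rd d)"
  shows "tcost d p (distr M (Rd d \<Otimes>\<^sub>M Rd d) (\<lambda>x. (f x, g x)))
    = (\<integral>\<^sup>+ x. ennreal (vdist d (f x) (g x) powr p) \<partial>M)"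
  unfolding tcost_def by (subst nn_integral_distr) auto

lemma ennreal_powr_leI:
  assumes I: "I \<le> ennreal (r powr p)" and "0 \<le> r" "1 \<le> p"
  shows "ennreal_powr I (1 / p) \<le> ennreal r"
proof -
  have top: "I \<noteq> \<top>" using I by (metis ennreal_less_top le_less_trans less_irrefl)
  have "enn2real I \<le> r powr p"
    by (rule enn2real_leI) (use I in auto)
  then have "enn2real I powr (1 / p) \<le> (r powr p) powr (1 / p)"
    using assms by (intro powr_mono2) auto
  then have "enn2real I powr (1 / p) \<le> r"
    using assms by (simp add: powr_powr)
  then show ?thesis using top by (simp add: ennreal_powr_def ennreal_leI)
qed

lemma ennreal_powr_lessD:
  assumes "ennreal_powr I (1 / p) < ennreal r" "1 \<le> p"
  shows "I < ennreal (r powr p)"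
proof -
  have top: "I \<noteq> \<top>" using assms by (auto simp: ennreal_powr_def)
  then have "ennreal (enn2real I powr (1 / p)) < ennreal r"
    using assms by (simp add: ennreal_powr_def)
  then have lt: "enn2real I powr (1 / p) < r" by (simp add: ennreal_less_iff)
  have "(enn2real I powr (1 / p)) powr p < r powr p"
    using lt assms(2) by (intro powr_less_mono2) auto
  then have "enn2real I < r powr p"
    using assms(2) by (simp add: powr_powr)
  then show ?thesis
    using top enn2real_less by blast
qed

lemma ennreal_powr_mono: "I \<le> J \<Longrightarrow> 0 \<le> a \<Longrightarrow> ennreal_powr I a \<le> ennreal_powr J a"
  by (auto simp: ennreal_powr_def top_unique less_top intro!: ennreal_leI powr_mono2 enn2real_mono)

lemma wasserstein_le_coupling:
  assumes "\<pi> \<in> couplings d \<mu> \<nu>" "tcost d p \<pi> \<le> ennreal (r powr p)" "0 \<le> r" "1 \<le> p"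
  shows "wasserstein d p \<mu> \<nu> \<le> ennreal r"
  unfolding wasserstein_eq_tcost using assms by (intro ennreal_powr_leI) (meson INF_lower2)

text \<open>Stands in for the existence of optimal couplings: each use adds an epsilon to the
  distance and removes it afterwards by a limit.\<close>

lemma coupling_of_wasserstein_less:
  assumes "wasserstein d p \<mu> \<nu> < ennreal r" "1 \<le> p"
  obtains \<pi> where "\<pi> \<in> couplings d \<mu> \<nu>" "tcost d p \<pi> \<le> ennreal (r powr p)"
proof -
  have "(INF \<pi>\<in>couplings d \<mu> \<nu>. tcost d p \<pi>) < ennreal (r powr p)"
    using assms unfolding wasserstein_eq_tcost by (rule ennreal_powr_lessD)
  then obtain \<pi> where "\<pi> \<in> couplings d \<mu> \<nu>" "tcost d p \<pi> < ennreal (r powr p)"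
    by (auto simp: INF_less_iff)
  then show ?thesis using that by (auto intro: less_imp_le)
qed

lemma wasserstein_commute: "wasserstein d p \<mu> \<nu> = wasserstein d p \<nu> \<mu>"
proof -
  have *: "(INF \<pi>\<in>couplings d \<nu> \<mu>. tcost d p \<pi>) \<le> (INF \<pi>\<in>couplings d \<mu> \<nu>. tcost d p \<pi>)" for \<mu> \<nu>
  proof (rule INF_greatest)
    fix \<pi> assume \<pi>: "\<pi> \<in> couplings d \<mu> \<nu>"
    note [measurable] = couplingsD(5,6)[OF \<pi>]
    let ?\<pi> = "distr \<pi> (Rd d \<Otimes>\<^sub>M Rd d) (\<lambda>z. (snd z, fst z))"
    have "?\<pi> \<in> couplings d \<nu> \<mu>"
      using joint_law_coupling[OF couplingsD(6,5)[OF \<pi>]] couplingsD(2,3)[OF \<pi>] by simp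
    moreover have "tcost d p ?\<pi> = tcost d p \<pi>"
      by (subst tcost_joint_law) (auto simp: tcost_def vdist_commute)
    ultimately show "(INF \<pi>\<in>couplings d \<nu> \<mu>. tcost d p \<pi>) \<le> tcost d p \<pi>"
      by (intro INF_lower2[of ?\<pi>]) auto
  qed
  show ?thesis
    unfolding wasserstein_eq_tcost using *[of \<mu> \<nu>] *[of \<nu> \<mu>] by (metis order_antisym)
qed

lemma wasserstein_joint_law_le:
  assumes "f \<in> measurable M (Rd d)" "g \<in> measurable M (Rd d)"
    and "(\<integral>\<^sup>+ x. ennreal (vdist d (f x) (g x) powr p) \<partial>M) \<le> ennreal (r powr p)" "0 \<le> r" "1 \<le> p"
  shows "wasserstein d p (distr M (Rd d) f) (distr M (Rd d) g) \<le> ennreal r"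
  using assms by (intro wasserstein_le_coupling[OF joint_law_coupling]) (auto simp: tcost_joint_law)

text \<open>Compares the two infima directly, without an epsilon. It serves both the contraction
  under projections and the lift of couplings in the spiked model.\<close>

lemma wasserstein_mono_of_couplings:
  assumes "\<And>\<pi>. \<pi> \<in> couplings d \<mu> \<nu> \<Longrightarrow> \<exists>\<pi>'\<in>couplings d' \<mu>' \<nu>'. tcost d' p \<pi>' \<le> tcost d p \<pi>" "1 \<le> p"
  shows "wasserstein d' p \<mu>' \<nu>' \<le> wasserstein d p \<mu> \<nu>"
proof -
  have "(INF \<pi>\<in>couplings d' \<mu>' \<nu>'. tcost d' p \<pi>) \<le> (INF \<pi>\<in>couplings d \<mu> \<nu>. tcost d p \<pi>)"
    by (intro INF_mono) (use assms in auto)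
  then show ?thesis
    unfolding wasserstein_eq_tcost using assms(2) by (intro ennreal_powr_mono) auto
qed

lemma wasserstein_contraction:
  assumes T: "T \<in> measurable (Rd d) (Rd d')" and sets: "sets \<mu> = sets (Rd d)" "sets \<nu> = sets (Rd d)"
    and le: "\<And>x y. x \<in> space (Rd d) \<Longrightarrow> y \<in> space (Rd d) \<Longrightarrow> vdist d' (T x) (T y) \<le> vdist d x y" and p: "1 \<le> p"
  shows "wasserstein d' p (distr \<mu> (Rd d') T) (distr \<nu> (Rd d') T) \<le> wasserstein d p \<mu> \<nu>"
proof (rule wasserstein_mono_of_couplings[OF _ p])
  fix \<pi> assume \<pi>: "\<pi> \<in> couplings d \<mu> \<nu>"
  have fm: "(\<lambda>z. T (fst z)) \<in> measurable \<pi> (Rd d')" "(\<lambda>z. T (snd z)) \<in> measurable \<pi> (Rd d')"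
    using measurable_compose[OF couplingsD(5)[OF \<pi>] T] measurable_compose[OF couplingsD(6)[OF \<pi>] T] by auto
  let ?\<pi> = "distr \<pi> (Rd d' \<Otimes>\<^sub>M Rd d') (\<lambda>z. (T (fst z), T (snd z)))"
  have 1: "distr \<pi> (Rd d') (\<lambda>z. T (fst z)) = distr \<mu> (Rd d') T"
    unfolding couplingsD(2)[OF \<pi>, symmetric]
    by (subst distr_distr[OF T couplingsD(5)[OF \<pi>]]) (simp add: comp_def)
  have 2: "distr \<pi> (Rd d') (\<lambda>z. T (snd z)) = distr \<nu> (Rd d') T"
    unfolding couplingsD(3)[OF \<pi>, symmetric]
    by (subst distr_distr[OF T couplingsD(6)[OF \<pi>]]) (simp add: comp_def)
  have "?\<pi> \<in> couplings d' (distr \<mu> (Rd d') T) (distr \<nu> (Rd d') T)"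
    using joint_law_coupling[OF fm] by (simp only: 1 2)
  moreover have "tcost d' p ?\<pi> \<le> tcost d p \<pi>"
    unfolding tcost_joint_law[OF fm] unfolding tcost_def
    using le p couplingsD(4)[OF \<pi>]
    by (intro nn_integral_mono ennreal_leI powr_mono2) auto
  ultimately show "\<exists>\<pi>'\<in>couplings d' (distr \<mu> (Rd d') T) (distr \<nu> (Rd d') T). tcost d' p \<pi>' \<le> tcost d p \<pi>"
    by blast
qed

section \<open>The triangle inequality by gluing\<close>

lemma powr_convex_combination:
  fixes u v t p :: real
  assumes "0 \<le> u" "0 \<le> v" "0 \<le> t" "t \<le> 1" "1 \<le> p"
  shows "(t * u + (1 - t) * v) powr p \<le> t * u powr p + (1 - t) * v powr p"
proof -
  have le: "s powr p \<le> s" if "0 \<le> s" "s \<le> 1" for s :: real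
    using that powr_mono'[of 1 p s] assms by (cases "s = 0") auto
  consider "u = 0" | "v = 0" | "0 < u" "0 < v" using assms by linarith
  then show ?thesis
  proof cases
    case 1
    then show ?thesis using assms le[of "1 - t"] by (simp add: powr_mult mult_right_mono)
  next
    case 2
    then show ?thesis using assms le[of "t"] by (simp add: powr_mult mult_right_mono)
  next
    case 3
    then show ?thesis
      using convex_onD[OF powr_convex[OF assms(5)], of "1 - t" u v] assms by (simp add: algebra_simps)
  qed
qed

text \<open>Convexity of the \<open>p\<close>-th power, applied to \<open>a / r\<close> and
  \<open>b / s\<close> with weights \<open>r / (r + s)\<close> and \<open>s / (r + s)\<close>. It
  replaces Minkowski's inequality: if the \<open>p\<close>-th moments of \<open>a\<close> and
  \<open>b\<close> are at most \<open>r powr p\<close> and \<open>s powr p\<close>, integration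
  gives \<open>(r + s) powr p\<close> for the sum.\<close>

lemma powr_sum_le_weighted:
  fixes a b r s p :: real
  assumes "0 \<le> a" "0 \<le> b" "0 < r" "0 < s" "1 \<le> p"
  shows "(a + b) powr p \<le> (r + s) powr p * (r / (r + s) * (a powr p / r powr p) + s / (r + s) * (b powr p / s powr p))"
proof -
  have w: "1 - r / (r + s) = s / (r + s)" using assms by (simp add: field_simps)
  have "(r + s) * (r / (r + s) * (a / r) + (1 - r / (r + s)) * (b / s)) = (r + s) * ((a + b) / (r + s))"
    unfolding w using assms by (simp add: add_divide_distrib)
  then have "a + b = (r + s) * (r / (r + s) * (a / r) + (1 - r / (r + s)) * (b / s))"
    using assms by simp
  then have "(a + b) powr p = (r + s) powr p * (r / (r + s) * (a / r) + (1 - r / (r + s)) * (b / s)) powr p"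
    using assms by (simp add: powr_mult)
  also have "\<dots> \<le> (r + s) powr p * (r / (r + s) * (a / r) powr p + (1 - r / (r + s)) * (b / s) powr p)"
    using assms by (intro mult_left_mono powr_convex_combination) auto
  finally show ?thesis using assms unfolding w by (simp add: powr_divide)
qed

lemma emeasure_distr_indicator:
  assumes "f \<in> measurable M N" "A \<in> sets N"
  shows "emeasure (distr M N f) A = (\<integral>\<^sup>+x. indicator A (f x) \<partial>M)"
proof -
  have "emeasure (distr M N f) A = (\<integral>\<^sup>+y. indicator A y \<partial>distr M N f)" using assms by simp
  also have "\<dots> = (\<integral>\<^sup>+x. indicator A (f x) \<partial>M)" using assms by (intro nn_integral_distr) auto
  finally show ?thesis .
qed

text \<open>A coupling of $\alpha,\beta$ that has a density with respect to $\alpha\otimes\beta$ can be glued to any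
  coupling of $\beta,\gamma$ without disintegration: weight the product of $\alpha$ and the latter by that density.\<close>

lemma gluing:
  assumes \<alpha>: "prob_on d \<alpha>" and \<beta>: "prob_on d \<beta>"
    and \<pi>: "\<pi> \<in> couplings d \<alpha> \<beta>" and \<rho>: "\<rho> \<in> couplings d \<beta> \<gamma>"
    and ac: "absolutely_continuous (\<alpha> \<Otimes>\<^sub>M \<beta>) \<pi>"
  shows "\<exists>\<Gamma>. sets \<Gamma> = sets (Rd d \<Otimes>\<^sub>M (Rd d \<Otimes>\<^sub>M Rd d)) \<and>
    (\<forall>f\<in>borel_measurable (Rd d \<Otimes>\<^sub>M Rd d). (\<integral>\<^sup>+w. f (fst w, fst (snd w)) \<partial>\<Gamma>) = integral\<^sup>N \<pi> f) \<and>
    (\<forall>f\<in>borel_measurable (Rd d \<Otimes>\<^sub>M Rd d). (\<integral>\<^sup>+w. f (snd w) \<partial>\<Gamma>) = integral\<^sup>N \<rho> f)"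
proof -
  interpret \<alpha>: prob_space \<alpha> using \<alpha> by (rule prob_onD)
  interpret \<beta>: prob_space \<beta> using \<beta> by (rule prob_onD)
  interpret \<rho>: prob_space \<rho> using coupling_prob_space[OF \<rho> \<beta>] .
  interpret \<alpha>\<beta>: pair_prob_space \<alpha> \<beta> ..
  interpret \<alpha>\<rho>: pair_prob_space \<alpha> \<rho> ..
  note [measurable_cong] = prob_onD(2)[OF \<alpha>] prob_onD(2)[OF \<beta>] couplingsD(1)[OF \<rho>]
  have s\<alpha>\<beta>: "sets (\<alpha> \<Otimes>\<^sub>M \<beta>) = sets (Rd d \<Otimes>\<^sub>M Rd d)"
    using prob_onD(2)[OF \<alpha>] prob_onD(2)[OF \<beta>] by (intro sets_pair_measure_cong)
  have s\<alpha>\<rho>: "sets (\<alpha> \<Otimes>\<^sub>M \<rho>) = sets (Rd d \<Otimes>\<^sub>M (Rd d \<Otimes>\<^sub>M Rd d))"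
    using prob_onD(2)[OF \<alpha>] couplingsD(1)[OF \<rho>] by (intro sets_pair_measure_cong)
  define h where "h = RN_deriv (\<alpha> \<Otimes>\<^sub>M \<beta>) \<pi>"
  have h0: "h \<in> borel_measurable (\<alpha> \<Otimes>\<^sub>M \<beta>)" unfolding h_def by measurable
  then have h[measurable]: "h \<in> borel_measurable (Rd d \<Otimes>\<^sub>M Rd d)"
    by (simp add: measurable_cong_sets[OF s\<alpha>\<beta> refl])
  have \<pi>h: "integral\<^sup>N \<pi> f = (\<integral>\<^sup>+z. h z * f z \<partial>(\<alpha> \<Otimes>\<^sub>M \<beta>))" if "f \<in> borel_measurable (Rd d \<Otimes>\<^sub>M Rd d)" for f
    unfolding h_def using ac couplingsD(1)[OF \<pi>] that s\<alpha>\<beta>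
    by (intro \<alpha>\<beta>.RN_deriv_nn_integral) (auto simp: measurable_cong_sets[OF s\<alpha>\<beta> refl])
  define g where "g y = (\<integral>\<^sup>+x. h (x, y) \<partial>\<alpha>)" for y
  have g[measurable]: "g \<in> borel_measurable \<beta>"
    unfolding g_def by measurable
  \<comment> \<open>Integrating the density of \<open>\<pi>\<close> over the first variable gives
    the density of its second marginal with respect to \<open>\<beta>\<close>, and that marginal is
    \<open>\<beta>\<close> itself.\<close>
  have "AE y in \<beta>. g y = 1"
  proof (rule \<beta>.density_unique)
    show "density \<beta> g = density \<beta> (\<lambda>_. 1)"
    proof (rule measure_eqI)
      fix B assume "B \<in> sets (density \<beta> g)"
      then have B[measurable]: "B \<in> sets \<beta>" by simp
      then have B'[measurable]: "B \<in> sets (Rd d)" using prob_onD(2)[OF \<beta>] by simp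
      have "emeasure (density \<beta> g) B = (\<integral>\<^sup>+y. (\<integral>\<^sup>+x. h (x, y) \<partial>\<alpha>) * indicator B y \<partial>\<beta>)"
        unfolding g_def[symmetric] using B by (simp add: emeasure_density)
      also have "\<dots> = (\<integral>\<^sup>+y. \<integral>\<^sup>+x. h (x, y) * indicator B y \<partial>\<alpha> \<partial>\<beta>)"
      proof (rule nn_integral_cong)
        fix y assume "y \<in> space \<beta>"
        then have [measurable]: "y \<in> space (Rd d)" using prob_on_space[OF \<beta>] by simp
        show "(\<integral>\<^sup>+x. h (x, y) \<partial>\<alpha>) * indicator B y = (\<integral>\<^sup>+x. h (x, y) * indicator B y \<partial>\<alpha>)"
          by (rule nn_integral_multc[symmetric]) measurable
      qed
      also have "\<dots> = (\<integral>\<^sup>+z. h z * indicator B (snd z) \<partial>(\<alpha> \<Otimes>\<^sub>M \<beta>))"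
        by (subst \<alpha>\<beta>.nn_integral_snd[symmetric]) simp_all
      also have "\<dots> = (\<integral>\<^sup>+z. indicator B (snd z) \<partial>\<pi>)"
        by (subst \<pi>h) simp_all
      also have "\<dots> = (\<integral>\<^sup>+y. indicator B y \<partial>distr \<pi> (Rd d) snd)"
        using couplingsD(6)[OF \<pi>] by (subst nn_integral_distr) auto
      also have "\<dots> = emeasure \<beta> B"
        using couplingsD(3)[OF \<pi>] by simp
      finally show "emeasure (density \<beta> g) B = emeasure (density \<beta> (\<lambda>_. 1)) B"
        by (simp add: density_1)
    qed simp
  qed simp_all
  then have "AE y in distr \<rho> (Rd d) fst. g y = 1"
    unfolding couplingsD(2)[OF \<rho>] .
  then have g1: "AE v in \<rho>. g (fst v) = 1"
    using couplingsD(5)[OF \<rho>] by (rule AE_distrD[rotated])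
  \<comment> \<open>The weight sees the first two coordinates only. Against the first marginal of
    \<open>\<rho>\<close> it restores \<open>\<pi>\<close>; integrating out the first coordinate
    produces the factor \<open>g\<close>, which is 1 almost everywhere, so \<open>\<rho>\<close> is
    kept.\<close>
  define \<Gamma> where "\<Gamma> = density (\<alpha> \<Otimes>\<^sub>M \<rho>) (\<lambda>w. h (fst w, fst (snd w)))"
  show ?thesis
  proof (intro exI[of _ \<Gamma>] conjI ballI)
    show "sets \<Gamma> = sets (Rd d \<Otimes>\<^sub>M (Rd d \<Otimes>\<^sub>M Rd d))"
      using s\<alpha>\<rho> by (simp add: \<Gamma>_def)
    fix f :: "vec \<times> vec \<Rightarrow> ennreal" assume f[measurable]: "f \<in> borel_measurable (Rd d \<Otimes>\<^sub>M Rd d)"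
    have "(\<integral>\<^sup>+w. f (fst w, fst (snd w)) \<partial>\<Gamma>)
        = (\<integral>\<^sup>+w. h (fst w, fst (snd w)) * f (fst w, fst (snd w)) \<partial>(\<alpha> \<Otimes>\<^sub>M \<rho>))"
      unfolding \<Gamma>_def by (rule nn_integral_density) measurable
    also have "\<dots> = (\<integral>\<^sup>+x. \<integral>\<^sup>+v. h (x, fst v) * f (x, fst v) \<partial>\<rho> \<partial>\<alpha>)"
      by (subst \<rho>.nn_integral_fst[symmetric]) simp_all
    also have "\<dots> = (\<integral>\<^sup>+x. \<integral>\<^sup>+y. h (x, y) * f (x, y) \<partial>\<beta> \<partial>\<alpha>)"
    proof (rule nn_integral_cong)
      fix x assume x: "x \<in> space \<alpha>"
      then have [measurable]: "x \<in> space (Rd d)" using prob_on_space[OF \<alpha>] by simp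
      have "(\<integral>\<^sup>+y. h (x, y) * f (x, y) \<partial>\<beta>) = (\<integral>\<^sup>+y. h (x, y) * f (x, y) \<partial>distr \<rho> (Rd d) fst)"
        using couplingsD(2)[OF \<rho>] by simp
      also have "\<dots> = (\<integral>\<^sup>+v. h (x, fst v) * f (x, fst v) \<partial>\<rho>)"
        using couplingsD(5)[OF \<rho>] by (subst nn_integral_distr) auto
      finally show "(\<integral>\<^sup>+v. h (x, fst v) * f (x, fst v) \<partial>\<rho>) = (\<integral>\<^sup>+y. h (x, y) * f (x, y) \<partial>\<beta>)" ..
    qed
    also have "\<dots> = integral\<^sup>N \<pi> f"
      unfolding \<pi>h[OF f] by (subst \<beta>.nn_integral_fst[symmetric]) simp_all
    finally show "(\<integral>\<^sup>+w. f (fst w, fst (snd w)) \<partial>\<Gamma>) = integral\<^sup>N \<pi> f" .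
  next
    fix f :: "vec \<times> vec \<Rightarrow> ennreal" assume f[measurable]: "f \<in> borel_measurable (Rd d \<Otimes>\<^sub>M Rd d)"
    have "(\<integral>\<^sup>+w. f (snd w) \<partial>\<Gamma>) = (\<integral>\<^sup>+w. h (fst w, fst (snd w)) * f (snd w) \<partial>(\<alpha> \<Otimes>\<^sub>M \<rho>))"
      unfolding \<Gamma>_def by (rule nn_integral_density) measurable
    also have "\<dots> = (\<integral>\<^sup>+v. \<integral>\<^sup>+x. h (x, fst v) * f v \<partial>\<alpha> \<partial>\<rho>)"
      by (subst \<alpha>\<rho>.nn_integral_snd[symmetric]) simp_all
    also have "\<dots> = (\<integral>\<^sup>+v. g (fst v) * f v \<partial>\<rho>)"
    proof (rule nn_integral_cong)
      fix v assume "v \<in> space \<rho>"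
      then have "v \<in> space (Rd d) \<times> space (Rd d)" unfolding couplingsD(4)[OF \<rho>] .
      then have v: "fst v \<in> space \<beta>" unfolding prob_on_space[OF \<beta>] mem_Times_iff ..
      show "(\<integral>\<^sup>+x. h (x, fst v) * f v \<partial>\<alpha>) = g (fst v) * f v"
        unfolding g_def by (rule nn_integral_multc[OF measurable_compose[OF measurable_Pair2'[OF v] h0]])
    qed
    also have "\<dots> = (\<integral>\<^sup>+v. f v \<partial>\<rho>)"
      using g1 by (intro nn_integral_cong_AE) auto
    finally show "(\<integral>\<^sup>+w. f (snd w) \<partial>\<Gamma>) = integral\<^sup>N \<rho> f" .
  qed
qed

text \<open>The hypothesis of \<open>gluing\<close>, demanded for all couplings at once because the
  triangle inequality meets an unspecified near-optimal one.\<close>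

definition glueable :: "nat \<Rightarrow> vec measure \<Rightarrow> vec measure \<Rightarrow> bool" where
  "glueable d \<alpha> \<beta> \<longleftrightarrow> (\<forall>\<pi>\<in>couplings d \<alpha> \<beta>. absolutely_continuous (\<alpha> \<Otimes>\<^sub>M \<beta>) \<pi>)"

lemma wasserstein_triangle:
  assumes \<alpha>: "prob_on d \<alpha>" and \<beta>: "prob_on d \<beta>" and gl: "glueable d \<alpha> \<beta>" and p: "1 \<le> p"
  shows "wasserstein d p \<alpha> \<gamma> \<le> wasserstein d p \<alpha> \<beta> + wasserstein d p \<beta> \<gamma>"
proof (cases "wasserstein d p \<alpha> \<beta> = \<top> \<or> wasserstein d p \<beta> \<gamma> = \<top>")
  case False
  show ?thesis
  proof (rule ennreal_le_epsilon)
    fix e :: real assume e: "0 < e"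
    define r where "r = enn2real (wasserstein d p \<alpha> \<beta>) + e / 2"
    define s where "s = enn2real (wasserstein d p \<beta> \<gamma>) + e / 2"
    have r: "r > 0" "s > 0" using e by (auto simp: r_def s_def add_nonneg_pos)
    have "wasserstein d p \<alpha> \<beta> < ennreal r" "wasserstein d p \<beta> \<gamma> < ennreal s"
      using False e by (auto intro!: enn2real_less simp: r_def s_def simp del: ennreal_plus)
    then obtain \<pi> \<rho> where \<pi>: "\<pi> \<in> couplings d \<alpha> \<beta>" "tcost d p \<pi> \<le> ennreal (r powr p)"
      and \<rho>: "\<rho> \<in> couplings d \<beta> \<gamma>" "tcost d p \<rho> \<le> ennreal (s powr p)"
      using coupling_of_wasserstein_less[OF _ p] by metis
    have ac: "absolutely_continuous (\<alpha> \<Otimes>\<^sub>M \<beta>) \<pi>" using gl \<pi> by (auto simp: glueable_def)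
    obtain \<Gamma> where s\<Gamma>: "sets \<Gamma> = sets (Rd d \<Otimes>\<^sub>M (Rd d \<Otimes>\<^sub>M Rd d))"
      and \<Gamma>1: "\<forall>f\<in>borel_measurable (Rd d \<Otimes>\<^sub>M Rd d). (\<integral>\<^sup>+w. f (fst w, fst (snd w)) \<partial>\<Gamma>) = integral\<^sup>N \<pi> f"
      and \<Gamma>2: "\<forall>f\<in>borel_measurable (Rd d \<Otimes>\<^sub>M Rd d). (\<integral>\<^sup>+w. f (snd w) \<partial>\<Gamma>) = integral\<^sup>N \<rho> f"
      using gluing[OF \<alpha> \<beta> \<pi>(1) \<rho>(1) ac] by blast
    note \<Gamma> = s\<Gamma> bspec[OF \<Gamma>1] bspec[OF \<Gamma>2]
    note [measurable_cong] = \<Gamma>(1)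
    have m1[measurable]: "fst \<in> measurable \<Gamma> (Rd d)" and m2[measurable]: "(\<lambda>w. fst (snd w)) \<in> measurable \<Gamma> (Rd d)"
      and m3[measurable]: "(\<lambda>w. snd (snd w)) \<in> measurable \<Gamma> (Rd d)"
      by measurable
    let ?\<xi> = "distr \<Gamma> (Rd d \<Otimes>\<^sub>M Rd d) (\<lambda>w. (fst w, snd (snd w)))"
    have "distr \<Gamma> (Rd d) fst = \<alpha>"
    proof (rule measure_eqI)
      fix A assume "A \<in> sets (distr \<Gamma> (Rd d) fst)"
      then have A[measurable]: "A \<in> sets (Rd d)" by simp
      have "emeasure (distr \<Gamma> (Rd d) fst) A = (\<integral>\<^sup>+w. indicator A (fst w) \<partial>\<Gamma>)"
        by (rule emeasure_distr_indicator) measurable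
      also have "\<dots> = (\<integral>\<^sup>+w. indicator A (fst w) \<partial>\<pi>)"
        using \<Gamma>(2)[of "\<lambda>z. indicator A (fst z)"] by simp
      also have "\<dots> = emeasure (distr \<pi> (Rd d) fst) A"
        by (rule emeasure_distr_indicator[symmetric, OF couplingsD(5)[OF \<pi>(1)] A])
      finally show "emeasure (distr \<Gamma> (Rd d) fst) A = emeasure \<alpha> A"
        using couplingsD(2)[OF \<pi>(1)] by simp
    qed (use prob_onD(2)[OF \<alpha>] in simp)
    moreover have "distr \<Gamma> (Rd d) (\<lambda>w. snd (snd w)) = \<gamma>"
    proof (rule measure_eqI)
      fix A assume "A \<in> sets (distr \<Gamma> (Rd d) (\<lambda>w. snd (snd w)))"
      then have A[measurable]: "A \<in> sets (Rd d)" by simp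
      have "emeasure (distr \<Gamma> (Rd d) (\<lambda>w. snd (snd w))) A = (\<integral>\<^sup>+w. indicator A (snd (snd w)) \<partial>\<Gamma>)"
        by (rule emeasure_distr_indicator) measurable
      also have "\<dots> = (\<integral>\<^sup>+w. indicator A (snd w) \<partial>\<rho>)"
        using \<Gamma>(3)[of "\<lambda>z. indicator A (snd z)"] by simp
      also have "\<dots> = emeasure (distr \<rho> (Rd d) snd) A"
        by (rule emeasure_distr_indicator[symmetric, OF couplingsD(6)[OF \<rho>(1)] A])
      finally show "emeasure (distr \<Gamma> (Rd d) (\<lambda>w. snd (snd w))) A = emeasure \<gamma> A"
        using couplingsD(3)[OF \<rho>(1)] by simp
    qed (use couplingsD(3)[OF \<rho>(1)] sets_distr[of \<rho> "Rd d" snd] in simp)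
    ultimately have \<xi>: "?\<xi> \<in> couplings d \<alpha> \<gamma>"
      using joint_law_coupling[OF m1 m3] by simp
    \<comment> \<open>The weights of \<open>powr_sum_le_weighted\<close> with the
      \<open>p\<close>-th powers of \<open>r\<close> and \<open>s\<close> divided out, so that
      \<open>A * r powr p + B * s powr p\<close> is exactly \<open>(r + s) powr p\<close>.\<close>
    define A B where "A = (r + s) powr p * (r / (r + s)) / r powr p"
      and "B = (r + s) powr p * (s / (r + s)) / s powr p"
    have AB: "0 \<le> A" "0 \<le> B" using r by (auto simp: A_def B_def)
    have "tcost d p ?\<xi> = (\<integral>\<^sup>+w. ennreal (vdist d (fst w) (snd (snd w)) powr p) \<partial>\<Gamma>)"
      by (rule tcost_joint_law) measurable
    also have "\<dots> \<le> (\<integral>\<^sup>+w. ennreal A * ennreal (vdist d (fst w) (fst (snd w)) powr p)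
        + ennreal B * ennreal (vdist d (fst (snd w)) (snd (snd w)) powr p) \<partial>\<Gamma>)"
    proof (rule nn_integral_mono)
      fix w
      have "vdist d (fst w) (snd (snd w)) powr p
        \<le> (vdist d (fst w) (fst (snd w)) + vdist d (fst (snd w)) (snd (snd w))) powr p"
        using p by (intro powr_mono2 vdist_triangle) auto
      also have "\<dots> \<le> A * vdist d (fst w) (fst (snd w)) powr p + B * vdist d (fst (snd w)) (snd (snd w)) powr p"
        using powr_sum_le_weighted[OF vdist_nonneg vdist_nonneg r p, of d "fst w" "fst (snd w)" d "fst (snd w)" "snd (snd w)"]
        by (simp add: A_def B_def algebra_simps)
      finally show "ennreal (vdist d (fst w) (snd (snd w)) powr p) \<le> ennreal A * ennreal (vdist d (fst w) (fst (snd w)) powr p)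
        + ennreal B * ennreal (vdist d (fst (snd w)) (snd (snd w)) powr p)"
        using AB by (simp add: ennreal_mult[symmetric] ennreal_plus[symmetric] ennreal_leI del: ennreal_plus)
    qed
    also have "\<dots> = ennreal A * (\<integral>\<^sup>+w. ennreal (vdist d (fst w) (fst (snd w)) powr p) \<partial>\<Gamma>)
       + ennreal B * (\<integral>\<^sup>+w. ennreal (vdist d (fst (snd w)) (snd (snd w)) powr p) \<partial>\<Gamma>)"
      by (simp add: nn_integral_add nn_integral_cmult)
    also have "\<dots> = ennreal A * tcost d p \<pi> + ennreal B * tcost d p \<rho>"
      using \<Gamma>(2)[of "\<lambda>z. ennreal (vdist d (fst z) (snd z) powr p)"]
        \<Gamma>(3)[of "\<lambda>z. ennreal (vdist d (fst z) (snd z) powr p)"]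
      by (simp add: tcost_def)
    also have "\<dots> \<le> ennreal A * ennreal (r powr p) + ennreal B * ennreal (s powr p)"
      using \<pi>(2) \<rho>(2) by (intro add_mono mult_left_mono) auto
    also have "\<dots> = ennreal (A * r powr p + B * s powr p)"
      using AB by (simp add: ennreal_mult)
    also have "A * r powr p + B * s powr p = (r + s) powr p * (r / (r + s) + s / (r + s))"
    proof -
      have cancel: "x / c * c = x" if "0 < c" for x c :: real using that by simp
      have "A * r powr p = (r + s) powr p * (r / (r + s))" unfolding A_def using r by (intro cancel) auto
      moreover have "B * s powr p = (r + s) powr p * (s / (r + s))" unfolding B_def using r by (intro cancel) auto
      ultimately show ?thesis by (simp only: distrib_left)
    qed
    also have "r / (r + s) + s / (r + s) = 1" using r by (simp add: add_divide_distrib[symmetric])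
    finally have "tcost d p ?\<xi> \<le> ennreal ((r + s) powr p)" by simp
    then have "wasserstein d p \<alpha> \<gamma> \<le> ennreal (r + s)"
      using r p by (intro wasserstein_le_coupling[OF \<xi>]) auto
    also have "r + s = enn2real (wasserstein d p \<alpha> \<beta>) + enn2real (wasserstein d p \<beta> \<gamma>) + e"
      by (simp add: r_def s_def)
    also have "ennreal \<dots> = wasserstein d p \<alpha> \<beta> + wasserstein d p \<beta> \<gamma> + ennreal e"
      using False e by (simp add: less_top)
    finally show "wasserstein d p \<alpha> \<gamma> \<le> wasserstein d p \<alpha> \<beta> + wasserstein d p \<beta> \<gamma> + ennreal e" .
  qed
qed auto

text \<open>Swapping the factors carries null sets of one product measure to null sets of the other,
  and couplings to couplings. Needed when the finitely supported measure stands in second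
  place.\<close>

lemma glueable_commute:
  assumes "prob_on d \<alpha>" "prob_on d \<beta>" "glueable d \<alpha> \<beta>"
  shows "glueable d \<beta> \<alpha>"
  unfolding glueable_def
proof
  interpret \<alpha>: prob_space \<alpha> using assms(1) by (rule prob_onD)
  interpret \<beta>: prob_space \<beta> using assms(2) by (rule prob_onD)
  interpret \<alpha>\<beta>: pair_prob_space \<alpha> \<beta> ..
  fix \<pi> assume \<pi>: "\<pi> \<in> couplings d \<beta> \<alpha>"
  note [measurable_cong] = prob_onD(2)[OF assms(1)] prob_onD(2)[OF assms(2)] couplingsD(1)[OF \<pi>]
  let ?\<pi> = "distr \<pi> (Rd d \<Otimes>\<^sub>M Rd d) (\<lambda>z. (snd z, fst z))"
  have "?\<pi> \<in> couplings d \<alpha> \<beta>"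
    using joint_law_coupling[OF couplingsD(6,5)[OF \<pi>]] couplingsD(2,3)[OF \<pi>] by simp
  then have ac: "absolutely_continuous (\<alpha> \<Otimes>\<^sub>M \<beta>) ?\<pi>" using assms(3) by (auto simp: glueable_def)
  show "absolutely_continuous (\<beta> \<Otimes>\<^sub>M \<alpha>) \<pi>"
    unfolding absolutely_continuous_def
  proof
    fix N assume "N \<in> null_sets (\<beta> \<Otimes>\<^sub>M \<alpha>)"
    then have N: "N \<in> sets (\<beta> \<Otimes>\<^sub>M \<alpha>)" "emeasure (\<beta> \<Otimes>\<^sub>M \<alpha>) N = 0" by auto
    have N'[measurable]: "N \<in> sets (Rd d \<Otimes>\<^sub>M Rd d)"
      using N(1) sets_pair_measure_cong[OF prob_onD(2)[OF assms(2)] prob_onD(2)[OF assms(1)]] by simp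
    let ?N = "(\<lambda>z. (snd z, fst z)) -` N \<inter> space (\<alpha> \<Otimes>\<^sub>M \<beta>)"
    have eq: "?N = (\<lambda>(x, y). (y, x)) -` N \<inter> space (\<alpha> \<Otimes>\<^sub>M \<beta>)" by auto
    have "emeasure (distr (\<alpha> \<Otimes>\<^sub>M \<beta>) (\<beta> \<Otimes>\<^sub>M \<alpha>) (\<lambda>(x, y). (y, x))) N = 0"
    proof -
      interpret \<beta>\<alpha>: pair_prob_space \<beta> \<alpha> ..
      show ?thesis using \<beta>\<alpha>.distr_pair_swap N by simp
    qed
    then have e0: "emeasure (\<alpha> \<Otimes>\<^sub>M \<beta>) ?N = 0"
      unfolding eq using N by (subst (asm) emeasure_distr) auto
    have "?N \<in> sets (\<alpha> \<Otimes>\<^sub>M \<beta>)" using N by measurable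
    then have "?N \<in> null_sets (\<alpha> \<Otimes>\<^sub>M \<beta>)" using e0 by (rule null_setsI[rotated])
    then have "?N \<in> null_sets ?\<pi>"
      using ac unfolding absolutely_continuous_def by (rule subsetD[rotated])
    then have "emeasure ?\<pi> ?N = 0" "?N \<in> sets (Rd d \<Otimes>\<^sub>M Rd d)" by auto
    then have "emeasure \<pi> ((\<lambda>z. (snd z, fst z)) -` ?N \<inter> space \<pi>) = 0"
      by (subst (asm) emeasure_distr) auto
    moreover have "(\<lambda>z. (snd z, fst z)) -` ?N \<inter> space \<pi> = N"
      using sets.sets_into_space[OF N'] couplingsD(4)[OF \<pi>] prob_on_space[OF assms(1)] prob_on_space[OF assms(2)]
      by (auto simp: space_pair_measure)
    ultimately show "N \<in> null_sets \<pi>" using N' couplingsD(1)[OF \<pi>] by (simp add: null_sets_def)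
  qed
qed

text \<open>A null set \<open>N\<close> of the product has, over each atom \<open>a\<close>, a slice
  for which the mass of \<open>a\<close> times the mass of the slice vanishes. So either the atom or
  the slice is null for the corresponding marginal of the coupling, and finitely many atoms cover
  almost every point.\<close>

lemma glueable_finite_support:
  assumes \<alpha>: "prob_on d \<alpha>" and \<beta>: "prob_on d \<beta>" and A: "finite A" "AE x in \<alpha>. x \<in> A"
  shows "glueable d \<alpha> \<beta>"
  unfolding glueable_def
proof
  interpret \<alpha>: prob_space \<alpha> using \<alpha> by (rule prob_onD)
  interpret \<beta>: prob_space \<beta> using \<beta> by (rule prob_onD)
  fix \<pi> assume \<pi>: "\<pi> \<in> couplings d \<alpha> \<beta>"
  interpret \<pi>: prob_space \<pi> by (rule coupling_prob_space[OF \<pi> \<alpha>])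
  show "absolutely_continuous (\<alpha> \<Otimes>\<^sub>M \<beta>) \<pi>"
    unfolding absolutely_continuous_def
  proof
    fix N assume N: "N \<in> null_sets (\<alpha> \<Otimes>\<^sub>M \<beta>)"
    then have N'[measurable]: "N \<in> sets (Rd d \<Otimes>\<^sub>M Rd d)"
      using sets_pair_measure_cong[OF prob_onD(2)[OF \<alpha>] prob_onD(2)[OF \<beta>]] by auto
    have "AE x in distr \<pi> (Rd d) fst. x \<in> A" unfolding couplingsD(2)[OF \<pi>] by (rule A(2))
    then have 1: "AE z in \<pi>. fst z \<in> A" using couplingsD(5)[OF \<pi>] by (rule AE_distrD[rotated])
    have 2: "AE z in \<pi>. \<not> (fst z = a \<and> z \<in> N)" if "a \<in> A \<inter> space (Rd d)" for a
    proof -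
      have a: "a \<in> space (Rd d)" using that by simp
      have sing[measurable]: "{a} \<in> sets (Rd d)"
      proof -
        have "{a} = (\<Pi>\<^sub>E i\<in>{..<d}. {a i})"
          using PiE_singleton[of a "{..<d}"] a by (simp add: space_Rd)
        also have "\<dots> \<in> sets (Rd d)" unfolding Rd_def by (rule sets_PiM_I_finite) auto
        finally show ?thesis .
      qed
      let ?B = "Pair a -` N"
      have B[measurable]: "?B \<in> sets (Rd d)" by (rule sets_Pair1[OF N'])
      have "emeasure \<alpha> {a} * emeasure \<beta> ?B = emeasure (\<alpha> \<Otimes>\<^sub>M \<beta>) ({a} \<times> ?B)"
        using sing B prob_onD(2)[OF \<alpha>] prob_onD(2)[OF \<beta>] by (simp add: \<beta>.emeasure_pair_measure_Times)
      also have "\<dots> \<le> emeasure (\<alpha> \<Otimes>\<^sub>M \<beta>) N" using N by (intro emeasure_mono) auto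
      also have "\<dots> = 0" using N by auto
      finally have "emeasure \<alpha> {a} = 0 \<or> emeasure \<beta> ?B = 0" by simp
      then show ?thesis
      proof
        assume "emeasure \<alpha> {a} = 0"
        then have "AE x in \<alpha>. x \<noteq> a"
          using sing prob_onD(2)[OF \<alpha>] by (intro AE_I[where N="{a}"]) auto
        then have "AE x in distr \<pi> (Rd d) fst. x \<noteq> a" unfolding couplingsD(2)[OF \<pi>] .
        then have "AE z in \<pi>. fst z \<noteq> a" using couplingsD(5)[OF \<pi>] by (rule AE_distrD[rotated])
        then show ?thesis by eventually_elim auto
      next
        assume "emeasure \<beta> ?B = 0"
        then have "AE x in \<beta>. x \<notin> ?B"
          using B prob_onD(2)[OF \<beta>] by (intro AE_I[where N="?B"]) auto
        then have "AE x in distr \<pi> (Rd d) snd. x \<notin> ?B" unfolding couplingsD(3)[OF \<pi>] .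
        then have "AE z in \<pi>. snd z \<notin> ?B" using couplingsD(6)[OF \<pi>] by (rule AE_distrD[rotated])
        then show ?thesis by eventually_elim auto
      qed
    qed
    have "AE z in \<pi>. \<forall>a\<in>A \<inter> space (Rd d). \<not> (fst z = a \<and> z \<in> N)"
      using A 2 by (subst AE_finite_all) auto
    then have "AE z in \<pi>. z \<notin> N" using 1 AE_space[of \<pi>]
    proof eventually_elim
      case (elim z)
      have "z \<in> space (Rd d) \<times> space (Rd d)" using elim(3) unfolding couplingsD(4)[OF \<pi>] .
      then have "fst z \<in> space (Rd d)" by (rule mem_Times_iff[THEN iffD1, THEN conjunct1])
      then show ?case using elim(1,2) by blast
    qed
    moreover have "N \<in> sets \<pi>" unfolding couplingsD(1)[OF \<pi>] by (rule N')
    ultimately show "N \<in> null_sets \<pi>" by (simp only: AE_iff_null_sets)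
  qed
qed

section \<open>Transport inequalities and concentration\<close>

lemma powr_le_tangent_at_1:
  fixes t \<alpha> :: real
  assumes "0 \<le> t" "0 < \<alpha>" "\<alpha> \<le> 1"
  shows "t powr \<alpha> \<le> 1 - \<alpha> + \<alpha> * t"
proof (cases "t = 0")
  case False
  then show ?thesis
    using Youngs_inequality_0[of \<alpha> "1 - \<alpha>" t 1] assms by simp
qed (use assms in auto)

text \<open>A concave power lies below its tangents. The free point \<open>t0\<close> turns
  root-type bounds, such as the transport inequality as a function of the divergence, into affine
  ones that integrate and add up; it is fixed only where the constants are matched.\<close>

lemma powr_le_tangent:
  fixes t t0 \<alpha> :: real
  assumes "0 \<le> t" "0 < t0" "0 < \<alpha>" "\<alpha> \<le> 1"
  shows "t powr \<alpha> \<le> t0 powr \<alpha> * (1 - \<alpha> + \<alpha> * (t / t0))"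
proof -
  have "t powr \<alpha> = t0 powr \<alpha> * (t / t0) powr \<alpha>"
    using assms by (simp add: powr_divide)
  also have "\<dots> \<le> t0 powr \<alpha> * (1 - \<alpha> + \<alpha> * (t / t0))"
    using assms by (intro mult_left_mono powr_le_tangent_at_1) auto
  finally show ?thesis .
qed

text \<open>Each \<open>v i powr q\<close> is at most \<open>v i\<close> times the total to the
  power \<open>q - 1\<close>. The comparison of norms is used to pass from Lipschitz bounds in
  \<open>l^q\<close> to \<open>l^1\<close>, where measurability and integrability are proved, and
  again to compare the exponents \<open>q <= p\<close>.\<close>

lemma sum_powr_le_powr_sum:
  fixes v :: "'i \<Rightarrow> real"
  assumes "finite A" "\<And>i. i \<in> A \<Longrightarrow> 0 \<le> v i" "1 \<le> q"
  shows "(\<Sum>i\<in>A. v i powr q) powr (1 / q) \<le> (\<Sum>i\<in>A. v i)"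
proof -
  let ?S = "\<Sum>i\<in>A. v i"
  have S: "0 \<le> ?S" using assms by (simp add: sum_nonneg)
  have split: "t powr q = t * t powr (q - 1)" if "0 \<le> t" for t :: real
    using that powr_add[of t 1 "q - 1"] by (cases "t = 0") auto
  have "(\<Sum>i\<in>A. v i powr q) \<le> (\<Sum>i\<in>A. v i * ?S powr (q - 1))"
  proof (rule sum_mono)
    fix i assume i: "i \<in> A"
    have "v i powr q = v i * v i powr (q - 1)" using assms i by (simp add: split)
    also have "\<dots> \<le> v i * ?S powr (q - 1)"
      using assms i by (intro mult_left_mono powr_mono2 member_le_sum) auto
    finally show "v i powr q \<le> v i * ?S powr (q - 1)" .
  qed
  also have "\<dots> = ?S powr q" using S by (simp add: split sum_distrib_right)
  finally have "(\<Sum>i\<in>A. v i powr q) powr (1 / q) \<le> (?S powr q) powr (1 / q)"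
    using assms by (intro powr_mono2 sum_nonneg) auto
  then show ?thesis using S assms by (simp add: powr_powr)
qed

lemma le_powr_of_le_add_eps:
  fixes c L q :: real
  assumes "0 \<le> c" "0 < q" "\<And>e. 0 < e \<Longrightarrow> L \<le> (c + e) powr q"
  shows "L \<le> c powr q"
proof (rule tendsto_lowerbound)
  have "((\<lambda>e. (c + e) powr q) \<longlongrightarrow> (c + 0) powr q) (at_right 0)"
    by (rule tendsto_powr') (use assms in \<open>auto intro!: tendsto_eq_intros eventually_at_rightI[of 0 1]\<close>)
  then show "((\<lambda>e. (c + e) powr q) \<longlongrightarrow> c powr q) (at_right 0)" by simp
  show "\<forall>\<^sub>F e in at_right 0. L \<le> (c + e) powr q"
    using assms by (intro eventually_at_rightI[of 0 1]) auto
qed simp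

text \<open>Testing the transport inequality against the measure with density proportional to $e^{G/a}$
  (Bobkov--Goetze) turns it into an exponential inequality for pairs \<open>G x - H y \<le> |x - y|^q\<close>.\<close>

lemma transport_ineq_dual:
  fixes G H :: "vec \<Rightarrow> real"
  assumes T: "transport_ineq d q s \<mu>" and q: "1 \<le> q" and s: "0 < s" and a: "0 < a"
    and tangent: "\<And>D. 0 \<le> D \<Longrightarrow> (2 * s * D) powr (q / 2) \<le> a * D + b"
    and G[measurable]: "G \<in> borel_measurable \<mu>" and H[measurable]: "H \<in> borel_measurable \<mu>"
    and GB: "\<And>x. x \<in> space \<mu> \<Longrightarrow> \<bar>G x\<bar> \<le> B" and HB: "\<And>x. x \<in> space \<mu> \<Longrightarrow> \<bar>H x\<bar> \<le> B"
    and GH: "\<And>x y. x \<in> space \<mu> \<Longrightarrow> y \<in> space \<mu> \<Longrightarrow> G x - H y \<le> vdist d x y powr q"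
  shows "(\<integral>x. exp (G x / a) \<partial>\<mu>) \<le> exp (((\<integral>x. H x \<partial>\<mu>) + b) / a)"
proof -
  have \<mu>: "prob_on d \<mu>" using T by (simp add: transport_ineq_def)
  interpret prob_space \<mu> using \<mu> by (rule prob_onD)
  interpret information_space \<mu> "exp 1" by standard simp
  have space: "space \<mu> = space (Rd d)" using prob_on_space[OF \<mu>] .
  note [measurable_cong] = prob_onD(2)[OF \<mu>]
  define Z where "Z = (\<integral>x. exp (G x / a) \<partial>\<mu>)"
  have ebd: "exp (- B / a) \<le> exp (G x / a)" "exp (G x / a) \<le> exp (B / a)" if "x \<in> space \<mu>" for x
    using GB[OF that] a divide_right_mono[of "- B" "G x" a] by (auto intro!: divide_right_mono simp: abs_le_iff)
  have eint: "integrable \<mu> (\<lambda>x. exp (G x / a))"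
    by (rule integrable_const_bound[where B="exp (B / a)"]) (use ebd in auto)
  have "exp (- B / a) = (\<integral>x. exp (- B / a) \<partial>\<mu>)" by (simp add: prob_space)
  also have "\<dots> \<le> Z" unfolding Z_def by (intro integral_mono eint) (use ebd in auto)
  finally have Z: "0 < Z" by (rule less_le_trans[OF exp_gt_zero])
  define f where "f x = exp (G x / a) / Z" for x
  have [measurable]: "f \<in> borel_measurable \<mu>" unfolding f_def by measurable
  have f0: "0 \<le> f x" for x using Z by (simp add: f_def)
  have fB: "f x \<le> exp (B / a) / Z" if "x \<in> space \<mu>" for x
    unfolding f_def using ebd(2)[OF that] Z by (simp add: divide_right_mono)
  have lnf: "ln (f x) = G x / a - ln Z" for x unfolding f_def using Z by (simp add: ln_div)
  have fint: "integrable \<mu> f" unfolding f_def using eint by simp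
  have f1: "(\<integral>x. f x \<partial>\<mu>) = 1" unfolding f_def using Z by (simp add: Z_def)
  define \<nu> where "\<nu> = density \<mu> (\<lambda>x. ennreal (f x))"
  have \<nu>p: "prob_space \<nu>"
  proof
    show "emeasure \<nu> (space \<nu>) = 1"
      unfolding \<nu>_def using f1 f0 fint by (simp add: emeasure_density nn_integral_eq_integral nn_integral_set_ennreal cong: nn_integral_cong)
  qed
  interpret \<nu>: prob_space \<nu> by fact
  have \<nu>s: "sets \<nu> = sets \<mu>" by (simp add: \<nu>_def)
  have \<nu>: "prob_on d \<nu>" using \<nu>p \<nu>s prob_onD(2)[OF \<mu>] by (simp add: prob_on_def)
  have space\<nu>: "space \<nu> = space \<mu>" by (simp add: \<nu>_def)
  note [measurable_cong] = \<nu>s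
  have [measurable]: "(\<lambda>x. L2_set x {..<d}) \<in> borel_measurable \<mu>"
  proof -
    have [measurable]: "\<And>i. i \<in> {..<d} \<Longrightarrow> (\<lambda>x. x i) \<in> borel_measurable \<mu>" by measurable
    show ?thesis unfolding L2_set_def by measurable
  qed
  \<comment> \<open>Boundedness of \<open>G\<close> makes the density bounded, so
    \<open>\<nu>\<close> inherits the finite moment and is an admissible test measure.\<close>
  have "finite_moment d q \<nu>"
  proof -
    have "(\<integral>\<^sup>+ x. ennreal (L2_set x {..<d} powr q) \<partial>\<nu>)
       = (\<integral>\<^sup>+ x. ennreal (f x) * ennreal (L2_set x {..<d} powr q) \<partial>\<mu>)"
    proof -
      show ?thesis unfolding \<nu>_def by (rule nn_integral_density) measurable
    qed
    also have "\<dots> \<le> (\<integral>\<^sup>+ x. ennreal (exp (B / a) / Z) * ennreal (L2_set x {..<d} powr q) \<partial>\<mu>)"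
      using fB by (intro nn_integral_mono mult_right_mono ennreal_leI) auto
    also have "\<dots> = ennreal (exp (B / a) / Z) * (\<integral>\<^sup>+ x. ennreal (L2_set x {..<d} powr q) \<partial>\<mu>)"
    proof -
      show ?thesis by (rule nn_integral_cmult) measurable
    qed
    also have "\<dots> < \<top>" using T by (simp add: transport_ineq_def finite_moment_def ennreal_mult_less_top)
    finally show ?thesis by (simp add: finite_moment_def)
  qed
  then have W: "wasserstein d q \<nu> \<mu> \<le> ennreal_powr (ennreal (2 * s) * KL \<nu> \<mu>) (1 / 2)"
    using T \<nu> by (simp add: transport_ineq_def)
  have ac: "absolutely_continuous \<mu> \<nu>" unfolding \<nu>_def by (rule absolutely_continuousI_density) measurable
  have "AE x in \<mu>. RN_deriv \<mu> \<nu> x = ennreal (f x)"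
    unfolding \<nu>_def by (rule AE_symmetric, rule RN_deriv_unique) auto
  then have "AE x in \<nu>. RN_deriv \<mu> \<nu> x = ennreal (f x)"
    by (rule absolutely_continuous_AE[rotated -1]) (use ac \<nu>s in auto)
  then have ed: "AE x in \<nu>. entropy_density (exp 1) \<mu> \<nu> x = G x / a - ln Z"
    by eventually_elim (simp add: entropy_density_def f0 lnf log_def)
  have Gint: "integrable \<nu> G"
    by (rule \<nu>.integrable_const_bound[where B=B]) (use GB space\<nu> in auto)
  have Hint: "integrable \<mu> H"
    by (rule integrable_const_bound[where B=B]) (use HB in auto)
  have "integrable \<nu> (\<lambda>x. G x / a - ln Z)" using Gint by simp
  then have edint: "integrable \<nu> (entropy_density (exp 1) \<mu> \<nu>)"
    by (subst integrable_cong_AE[OF _ _ ed]) auto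
  define K where "K = KL_divergence (exp 1) \<mu> \<nu>"
  have Keq: "K = (\<integral>x. G x \<partial>\<nu>) / a - ln Z"
  proof -
    have "K = (\<integral>x. G x / a - ln Z \<partial>\<nu>)"
      unfolding K_def KL_divergence_def by (rule integral_cong_AE) (use ed in auto)
    then show ?thesis using Gint by (simp add: \<nu>.prob_space)
  qed
  have K0: "0 \<le> K"
    unfolding K_def \<nu>_def
  proof (rule KL_nonneg)
    have "integrable \<nu> (\<lambda>x. log (exp 1) (f x))" using Gint by (simp add: log_def lnf)
    then show "integrable \<mu> (\<lambda>x. f x * log (exp 1) (f x))"
      unfolding \<nu>_def by (subst (asm) integrable_real_density) (use f0 in auto)
  qed (use \<nu>p f0 in \<open>auto simp: \<nu>_def\<close>)
  have KL: "KL \<nu> \<mu> = ennreal K" using ac edint by (simp add: KL_def K_def)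
  have Wle: "wasserstein d q \<nu> \<mu> \<le> ennreal (sqrt (2 * s * K))"
  proof -
    have "ennreal_powr (ennreal (2 * s) * KL \<nu> \<mu>) (1 / 2) = ennreal (sqrt (2 * s * K))"
      unfolding KL using s K0 by (simp add: ennreal_mult[symmetric] ennreal_powr_def powr_half_sqrt)
    with W show ?thesis by simp
  qed
  \<comment> \<open>Weak duality: \<open>G x - H y\<close> is integrated against a near-optimal
    coupling of \<open>\<nu>\<close> and \<open>\<mu>\<close>.\<close>
  have "(\<integral>x. G x \<partial>\<nu>) - (\<integral>x. H x \<partial>\<mu>) \<le> sqrt (2 * s * K) powr q"
  proof (rule le_powr_of_le_add_eps)
    fix e :: real assume e: "0 < e"
    let ?r = "sqrt (2 * s * K) + e"
    have "wasserstein d q \<nu> \<mu> < ennreal ?r"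
      using Wle e s K0 by (auto intro!: le_less_trans[OF Wle] ennreal_lessI simp del: ennreal_plus simp: add_nonneg_pos)
    then obtain \<pi> where \<pi>: "\<pi> \<in> couplings d \<nu> \<mu>" "tcost d q \<pi> \<le> ennreal (?r powr q)"
      using coupling_of_wasserstein_less[OF _ q] by blast
    interpret \<pi>: prob_space \<pi> by (rule coupling_prob_space[OF \<pi>(1) \<nu>])
    note [measurable_cong] = couplingsD(1)[OF \<pi>(1)]
    note m[measurable] = couplingsD(5,6)[OF \<pi>(1)]
    have mR: "measurable \<mu> borel = measurable (Rd d) borel"
      by (rule measurable_cong_sets[OF prob_onD(2)[OF \<mu>] refl])
    have mG: "G \<in> measurable (Rd d) borel"
      by (rule subsetD[OF equalityD1[OF mR] G])
    have mH: "H \<in> measurable (Rd d) borel"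
      by (rule subsetD[OF equalityD1[OF mR] H])
    note [measurable] = mG mH
    have sp: "fst z \<in> space \<mu>" "snd z \<in> space \<mu>" if "z \<in> space \<pi>" for z
      unfolding space using that unfolding couplingsD(4)[OF \<pi>(1)] mem_Times_iff by (rule conjunct1, rule conjunct2)
    have c: "integrable \<pi> (\<lambda>z. vdist d (fst z) (snd z) powr q)"
    proof (rule integrableI_bounded)
      have "(\<integral>\<^sup>+ z. ennreal (norm (vdist d (fst z) (snd z) powr q)) \<partial>\<pi>) = tcost d q \<pi>"
        by (simp add: tcost_def)
      also have "\<dots> < \<infinity>" using \<pi>(2) by (rule le_less_trans) simp
      finally show "(\<integral>\<^sup>+ z. ennreal (norm (vdist d (fst z) (snd z) powr q)) \<partial>\<pi>) < \<infinity>" .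
    qed measurable
    have i1: "(\<integral>x. G x \<partial>\<nu>) = (\<integral>z. G (fst z) \<partial>\<pi>)"
      unfolding couplingsD(2)[OF \<pi>(1), symmetric] by (rule integral_distr) measurable
    have i2: "(\<integral>x. H x \<partial>\<mu>) = (\<integral>z. H (snd z) \<partial>\<pi>)"
      unfolding couplingsD(3)[OF \<pi>(1), symmetric] by (rule integral_distr) measurable
    have j1: "integrable \<pi> (\<lambda>z. G (fst z))"
      by (rule \<pi>.integrable_const_bound[where B=B]) (use GB sp in auto)
    have j2: "integrable \<pi> (\<lambda>z. H (snd z))"
      by (rule \<pi>.integrable_const_bound[where B=B]) (use HB sp in auto)
    have "(\<integral>x. G x \<partial>\<nu>) - (\<integral>x. H x \<partial>\<mu>) = (\<integral>z. G (fst z) - H (snd z) \<partial>\<pi>)"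
      unfolding i1 i2 using j1 j2 by simp
    also have "\<dots> \<le> (\<integral>z. vdist d (fst z) (snd z) powr q \<partial>\<pi>)"
      using j1 j2 c GH sp by (intro integral_mono) auto
    also have "\<dots> = enn2real (tcost d q \<pi>)"
      unfolding tcost_def by (rule integral_eq_nn_integral) auto
    also have "\<dots> \<le> ?r powr q" using \<pi>(2) by (intro enn2real_leI) auto
    finally show "(\<integral>x. G x \<partial>\<nu>) - (\<integral>x. H x \<partial>\<mu>) \<le> ?r powr q" .
  qed (use s K0 q in auto)
  also have "sqrt (2 * s * K) powr q = (2 * s * K) powr (q / 2)"
    using s K0 by (simp add: powr_half_sqrt[symmetric] powr_powr)
  also have "\<dots> \<le> a * K + b" using K0 by (rule tangent)
  \<comment> \<open>The slope of the affine bound equals the temperature \<open>a\<close> of the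
    exponential density, so the integral of \<open>G\<close> against \<open>\<nu>\<close> cancels
    and only \<open>a * ln Z\<close> is left.\<close>
  also have "a * K = (\<integral>x. G x \<partial>\<nu>) - a * ln Z"
    unfolding Keq using a by (simp add: right_diff_distrib)
  finally have "a * ln Z \<le> (\<integral>x. H x \<partial>\<mu>) + b" by simp
  then have "ln Z \<le> ((\<integral>x. H x \<partial>\<mu>) + b) / a"
    using a by (simp add: pos_le_divide_eq mult.commute)
  then show ?thesis unfolding Z_def[symmetric] using Z by (simp add: ln_le_cancel_iff[symmetric] ln_ge_iff)
qed

text \<open>The last coordinate is integrated out: \<open>G\<close> becomes \<open>a\<close> times
  the logarithm of its exponential mean, \<open>H\<close> its mean plus \<open>b\<close>. For fixed
  \<open>x\<close> and \<open>x'\<close>, the one-point inequality applied to \<open>G\<close> at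
  \<open>x\<close> and to \<open>H\<close> at \<open>x'\<close> plus the cost of the first
  coordinates shows that the new pair satisfies the hypothesis again. As both functions are given,
  no infimum over points has to be proved measurable.\<close>

lemma exp_transport_tensorize:
  fixes c :: "'a \<Rightarrow> 'a \<Rightarrow> real" and G H :: "(nat \<Rightarrow> 'a) \<Rightarrow> real"
  assumes M: "prob_space M" and a: "0 < a"
    and base: "\<And>G H B. G \<in> borel_measurable M \<Longrightarrow> H \<in> borel_measurable M \<Longrightarrow>
      (\<And>x. x \<in> space M \<Longrightarrow> \<bar>G x\<bar> \<le> B) \<Longrightarrow> (\<And>x. x \<in> space M \<Longrightarrow> \<bar>H x\<bar> \<le> B) \<Longrightarrow>
      (\<And>x y. x \<in> space M \<Longrightarrow> y \<in> space M \<Longrightarrow> G x - H y \<le> c x y) \<Longrightarrow>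
      (\<integral>x. exp (G x / a) \<partial>M) \<le> exp (((\<integral>x. H x \<partial>M) + b) / a)"
    and G: "G \<in> borel_measurable (Pi\<^sub>M {..<n} (\<lambda>_. M))" and H: "H \<in> borel_measurable (Pi\<^sub>M {..<n} (\<lambda>_. M))"
    and GB: "\<And>x. x \<in> space (Pi\<^sub>M {..<n} (\<lambda>_. M)) \<Longrightarrow> \<bar>G x\<bar> \<le> B"
    and HB: "\<And>x. x \<in> space (Pi\<^sub>M {..<n} (\<lambda>_. M)) \<Longrightarrow> \<bar>H x\<bar> \<le> B"
    and GH: "\<And>x y. x \<in> space (Pi\<^sub>M {..<n} (\<lambda>_. M)) \<Longrightarrow> y \<in> space (Pi\<^sub>M {..<n} (\<lambda>_. M)) \<Longrightarrow>
      G x - H y \<le> (\<Sum>i<n. c (x i) (y i))"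
  shows "(\<integral>x. exp (G x / a) \<partial>Pi\<^sub>M {..<n} (\<lambda>_. M)) \<le> exp (((\<integral>x. H x \<partial>Pi\<^sub>M {..<n} (\<lambda>_. M)) + real n * b) / a)"
  using G H GB HB GH
proof (induction n arbitrary: G H B)
  case 0
  then show ?case
    using a by (simp add: PiM_empty space_PiM lebesgue_integral_count_space_finite divide_right_mono)
next
  case (Suc n)
  interpret M: prob_space M by fact
  interpret PP: product_sigma_finite "\<lambda>_. M" by standard
  interpret P: prob_space "Pi\<^sub>M {..<n} (\<lambda>_. M)" by (rule prob_space_PiM) (rule M)
  interpret P': prob_space "Pi\<^sub>M {..<Suc n} (\<lambda>_. M)" by (rule prob_space_PiM) (rule M)
  let ?P = "Pi\<^sub>M {..<n} (\<lambda>_. M)" and ?P' = "Pi\<^sub>M {..<Suc n} (\<lambda>_. M)"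
  have ins: "{..<Suc n} = insert n {..<n}" by auto
  have mu[measurable]: "(\<lambda>(x, y). x(n := y)) \<in> measurable (?P \<Otimes>\<^sub>M M) ?P'"
    unfolding ins by (rule measurable_add_dim)
  have upd: "x(n := y) \<in> space ?P'" if "x \<in> space ?P" "y \<in> space M" for x y
    using measurable_space[OF mu, of "(x, y)"] that by (simp add: space_pair_measure)
  note [measurable] = Suc.prems(1,2)
  have m2: "(\<lambda>z. G ((fst z)(n := snd z))) \<in> borel_measurable (?P \<Otimes>\<^sub>M M)"
    "(\<lambda>z. H ((fst z)(n := snd z))) \<in> borel_measurable (?P \<Otimes>\<^sub>M M)"
    using measurable_compose[OF mu Suc.prems(1)] measurable_compose[OF mu Suc.prems(2)]
    by (simp_all add: split_beta')
  have m1: "(\<lambda>y. G (x(n := y))) \<in> borel_measurable M" "(\<lambda>y. H (x(n := y))) \<in> borel_measurable M"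
    if "x \<in> space ?P" for x
    using measurable_compose[OF measurable_Pair1'[OF that] m2(1)] measurable_compose[OF measurable_Pair1'[OF that] m2(2)]
    by simp_all
  have GB: "\<bar>G (x(n := y))\<bar> \<le> B" and HB: "\<bar>H (x(n := y))\<bar> \<le> B" if "x \<in> space ?P" "y \<in> space M" for x y
    by (rule Suc.prems(3)[OF upd[OF that]], rule Suc.prems(4)[OF upd[OF that]])
  define G' where "G' x = a * ln (\<integral>y. exp (G (x(n := y)) / a) \<partial>M)" for x
  define H' where "H' x = (\<integral>y. H (x(n := y)) \<partial>M) + b" for x
  have ebd: "exp (- B / a) \<le> exp (G (x(n := y)) / a)" "exp (G (x(n := y)) / a) \<le> exp (B / a)"
    if "x \<in> space ?P" "y \<in> space M" for x y
    using GB[OF that] a divide_right_mono[of "- B" "G (x(n := y))" a] by (auto intro!: divide_right_mono simp: abs_le_iff)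
  have eint: "integrable M (\<lambda>y. exp (G (x(n := y)) / a))" if "x \<in> space ?P" for x
    by (rule M.integrable_const_bound[where B="exp (B / a)"]) (use that m1 ebd in \<open>auto intro!: measurable_compose[OF _ borel_measurable_exp]\<close>)
  have Hint: "integrable M (\<lambda>y. H (x(n := y)))" if "x \<in> space ?P" for x
    by (rule M.integrable_const_bound[where B=B]) (use that m1 HB in auto)
  have Zb: "exp (- B / a) \<le> (\<integral>y. exp (G (x(n := y)) / a) \<partial>M)" "(\<integral>y. exp (G (x(n := y)) / a) \<partial>M) \<le> exp (B / a)"
    if x: "x \<in> space ?P" for x
  proof -
    have "(\<integral>y. exp (- B / a) \<partial>M) \<le> (\<integral>y. exp (G (x(n := y)) / a) \<partial>M)"
      using eint[OF x] ebd(1)[OF x] by (intro integral_mono) auto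
    then show "exp (- B / a) \<le> (\<integral>y. exp (G (x(n := y)) / a) \<partial>M)" by (simp add: M.prob_space)
    have "(\<integral>y. exp (G (x(n := y)) / a) \<partial>M) \<le> (\<integral>y. exp (B / a) \<partial>M)"
      using eint[OF x] ebd(2)[OF x] by (intro integral_mono) auto
    then show "(\<integral>y. exp (G (x(n := y)) / a) \<partial>M) \<le> exp (B / a)" by (simp add: M.prob_space)
  qed
  have Zpos: "0 < (\<integral>y. exp (G (x(n := y)) / a) \<partial>M)" if x: "x \<in> space ?P" for x
    by (rule less_le_trans[OF exp_gt_zero Zb(1)[OF x]])
  have IH: "(\<integral>x. exp (G' x / a) \<partial>?P) \<le> exp (((\<integral>x. H' x \<partial>?P) + real n * b) / a)"
  proof (rule Suc.IH)
    show "G' \<in> borel_measurable ?P" unfolding G'_def using m2(1) by measurable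
    show "H' \<in> borel_measurable ?P" unfolding H'_def using m2(2) by measurable
    show "\<bar>G' x\<bar> \<le> B + \<bar>b\<bar>" if x: "x \<in> space ?P" for x
    proof -
      have "- B / a \<le> ln (\<integral>y. exp (G (x(n := y)) / a) \<partial>M)"
        using Zb(1)[OF x] Zpos[OF x] by (simp add: ln_ge_iff)
      moreover have "ln (\<integral>y. exp (G (x(n := y)) / a) \<partial>M) \<le> B / a"
        using Zb(2)[OF x] Zpos[OF x] by (metis ln_exp ln_le_cancel_iff exp_gt_zero)
      ultimately have "\<bar>G' x\<bar> \<le> B" unfolding G'_def using a by (auto simp: field_simps abs_le_iff)
      then show ?thesis by simp
    qed
    show "\<bar>H' x\<bar> \<le> B + \<bar>b\<bar>" if x: "x \<in> space ?P" for x
    proof -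
      have "\<bar>\<integral>y. H (x(n := y)) \<partial>M\<bar> \<le> (\<integral>y. \<bar>H (x(n := y))\<bar> \<partial>M)"
        by (rule integral_abs_bound)
      also have "\<dots> \<le> (\<integral>y. B \<partial>M)"
        using Hint[OF x] HB[OF x] by (intro integral_mono) auto
      finally show ?thesis unfolding H'_def by (simp add: M.prob_space)
    qed
    show "G' x - H' x' \<le> (\<Sum>i<n. c (x i) (x' i))" if x: "x \<in> space ?P" and x': "x' \<in> space ?P" for x x'
    proof -
      let ?c = "\<Sum>i<n. c (x i) (x' i)"
      \<comment> \<open>The cost of the first \<open>n\<close> coordinates is constant in the last
        one and is absorbed into the second function.\<close>
      have "(\<integral>y. exp (G (x(n := y)) / a) \<partial>M) \<le> exp (((\<integral>y. H (x'(n := y)) + ?c \<partial>M) + b) / a)"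
      proof (rule base)
        fix y y' assume y: "y \<in> space M" "y' \<in> space M"
        have "G (x(n := y)) - H (x'(n := y')) \<le> (\<Sum>i<Suc n. c ((x(n := y)) i) ((x'(n := y')) i))"
          by (rule Suc.prems(5)[OF upd[OF x y(1)] upd[OF x' y(2)]])
        then show "G (x(n := y)) - (H (x'(n := y')) + ?c) \<le> c y y'" by simp
      next
        fix y assume y: "y \<in> space M"
        show "\<bar>G (x(n := y))\<bar> \<le> B + \<bar>?c\<bar>" using GB[OF x y] by simp
        show "\<bar>H (x'(n := y)) + ?c\<bar> \<le> B + \<bar>?c\<bar>" using HB[OF x' y] by simp
      qed (use m1 x x' in auto)
      also have "(\<integral>y. H (x'(n := y)) + ?c \<partial>M) + b = H' x' + ?c"
        unfolding H'_def using Hint[OF x'] by (simp add: M.prob_space)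
      finally have "ln (\<integral>y. exp (G (x(n := y)) / a) \<partial>M) \<le> (H' x' + ?c) / a"
        using Zpos[OF x] by (metis ln_exp ln_le_cancel_iff exp_gt_zero)
      then show ?thesis unfolding G'_def using a by (simp add: field_simps)
    qed
  qed
  have "(\<integral>x. exp (G x / a) \<partial>?P') = (\<integral>x. \<integral>y. exp (G (x(n := y)) / a) \<partial>M \<partial>?P)"
    unfolding ins
  proof (rule PP.product_integral_insert)
    have "integrable ?P' (\<lambda>x. exp (G x / a))"
      by (rule P'.integrable_const_bound[where B="exp (B / a)"])
        (use Suc.prems(3) a in \<open>auto intro!: divide_right_mono simp: abs_le_iff\<close>)
    then show "integrable (Pi\<^sub>M (insert n {..<n}) (\<lambda>_. M)) (\<lambda>x. exp (G x / a))" by (simp add: ins)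
  qed auto
  also have "\<dots> = (\<integral>x. exp (G' x / a) \<partial>?P)"
    using a Zpos by (intro Bochner_Integration.integral_cong) (auto simp: G'_def)
  also have "\<dots> \<le> exp (((\<integral>x. H' x \<partial>?P) + real n * b) / a)" by (rule IH)
  also have "(\<integral>x. H' x \<partial>?P) = (\<integral>x. \<integral>y. H (x(n := y)) \<partial>M \<partial>?P) + b"
  proof -
    have "integrable ?P (\<lambda>x. \<integral>y. H (x(n := y)) \<partial>M)"
    proof (rule P.integrable_const_bound[where B=B])
      show "AE x in ?P. norm (\<integral>y. H (x(n := y)) \<partial>M) \<le> B"
      proof (rule AE_I2)
        fix x assume x: "x \<in> space ?P"
        have "\<bar>\<integral>y. H (x(n := y)) \<partial>M\<bar> \<le> (\<integral>y. \<bar>H (x(n := y))\<bar> \<partial>M)"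
          by (rule integral_abs_bound)
        also have "\<dots> \<le> (\<integral>y. B \<partial>M)"
          using Hint[OF x] HB[OF x] by (intro integral_mono) auto
        finally show "norm (\<integral>y. H (x(n := y)) \<partial>M) \<le> B" by (simp add: M.prob_space)
      qed
      show "(\<lambda>x. \<integral>y. H (x(n := y)) \<partial>M) \<in> borel_measurable ?P" using m2(2) by measurable
    qed
    then show ?thesis unfolding H'_def by (simp add: P.prob_space)
  qed
  also have "(\<integral>x. \<integral>y. H (x(n := y)) \<partial>M \<partial>?P) = (\<integral>x. H x \<partial>?P')"
    unfolding ins
  proof (rule PP.product_integral_insert[symmetric])
    have "integrable ?P' H"
      by (rule P'.integrable_const_bound[where B=B]) (use Suc.prems(4) in auto)
    then show "integrable (Pi\<^sub>M (insert n {..<n}) (\<lambda>_. M)) H" by (simp add: ins)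
  qed auto
  finally show ?case by (simp add: algebra_simps)
qed

section \<open>Concentration of Lipschitz functions of the sample\<close>

text \<open>The value \<open>F x\<close> is the infimum of \<open>F y\<close> plus the penalty
  \<open>K * (\<Sum>i<n. vdist d (x i) (y i))\<close> over the countably many \<open>y\<close> with
  rational coordinates, so sublevel sets are countable unions of measurable sets. In this way the
  Wasserstein distance becomes a measurable function of the sample.\<close>

lemma lipschitz_measurable_samples:
  fixes F :: "(nat \<Rightarrow> vec) \<Rightarrow> real"
  assumes K: "0 \<le> K" and lip: "\<And>x y. x \<in> space (Pi\<^sub>M {..<n} (\<lambda>_. Rd d)) \<Longrightarrow> y \<in> space (Pi\<^sub>M {..<n} (\<lambda>_. Rd d)) \<Longrightarrow>
    \<bar>F x - F y\<bar> \<le> K * (\<Sum>i<n. vdist d (x i) (y i))"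
  shows "F \<in> borel_measurable (Pi\<^sub>M {..<n} (\<lambda>_. Rd d))"
proof -
  let ?P = "Pi\<^sub>M {..<n} (\<lambda>_. Rd d)"
  define Q where "Q = (\<Pi>\<^sub>E i\<in>{..<n}. \<Pi>\<^sub>E l\<in>{..<d}. (\<rat> :: real set))"
  have Qc: "countable Q" unfolding Q_def by (intro countable_PiE) (auto simp: countable_rat)
  have Qs: "y \<in> space ?P" if "y \<in> Q" for y
    using that by (auto simp: Q_def space_PiM space_Rd PiE_iff)
  have dense: "\<exists>y\<in>Q. (\<Sum>i<n. vdist d (x i) (y i)) \<le> e" if x: "x \<in> space ?P" and e: "0 < e" for x e
  proof -
    \<comment> \<open>There are \<open>n * d\<close> coordinates, each moved by at most
      \<open>\<delta>\<close>; the \<open>+ 1\<close> covers the case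
      \<open>n * d = 0\<close>.\<close>
    define \<delta> where "\<delta> = e / (real n * real d + 1)"
    have \<delta>: "0 < \<delta>" using e by (auto simp: \<delta>_def intro!: divide_pos_pos add_nonneg_pos)
    have "\<exists>r\<in>\<rat>. \<bar>t - r\<bar> \<le> \<delta>" for t :: real
    proof -
      obtain r where "r \<in> \<rat>" "t < r" "r < t + \<delta>" using Rats_dense_in_real[of t "t + \<delta>"] \<delta> by auto
      then show ?thesis by (intro bexI[of _ r]) auto
    qed
    then obtain r where r: "\<And>t. r t \<in> \<rat>" "\<And>t. \<bar>t - r t\<bar> \<le> \<delta>" by metis
    define y where "y = (\<lambda>i\<in>{..<n}. \<lambda>l\<in>{..<d}. r (x i l))"
    have "y \<in> Q" using r(1) by (auto simp: Q_def y_def)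
    moreover have "(\<Sum>i<n. vdist d (x i) (y i)) \<le> (\<Sum>i<n. \<Sum>l<d. \<delta>)"
    proof (rule sum_mono)
      fix i assume i: "i \<in> {..<n}"
      have "vdist d (x i) (y i) \<le> (\<Sum>l<d. \<bar>x i l - y i l\<bar>)" by (rule vdist_le_sum_abs)
      also have "\<dots> \<le> (\<Sum>l<d. \<delta>)" using r(2) i by (intro sum_mono) (auto simp: y_def)
      finally show "vdist d (x i) (y i) \<le> (\<Sum>l<d. \<delta>)" .
    qed
    moreover have "(\<Sum>i<n. \<Sum>l<d. \<delta>) \<le> e"
    proof -
      have "real n * real d / (real n * real d + 1) \<le> 1" by (simp add: divide_le_eq add_nonneg_pos)
      then have "e * (real n * real d / (real n * real d + 1)) \<le> e * 1"
        using e by (intro mult_left_mono) auto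
      then show ?thesis by (simp add: \<delta>_def ac_simps)
    qed
    ultimately show ?thesis by (meson order_trans)
  qed
  show ?thesis
    unfolding borel_measurable_iff_less
  proof (rule allI)
    fix a
    have "{x \<in> space ?P. F x < a} = (\<Union>y\<in>Q. {x \<in> space ?P. F y + K * (\<Sum>i<n. vdist d (x i) (y i)) < a})"
    proof (intro set_eqI iffI)
      fix x assume "x \<in> {x \<in> space ?P. F x < a}"
      then have x: "x \<in> space ?P" "F x < a" by auto
      \<comment> \<open>Replacing \<open>x\<close> by \<open>y\<close> costs \<open>K * e\<close> in
        the value of \<open>F\<close> and another \<open>K * e\<close> as penalty, so
        \<open>2 * K * e\<close> has to stay below the gap \<open>a - F x\<close>.\<close>
      define e where "e = (a - F x) / (2 * K + 1) / 2"
      have e: "0 < e" using x K by (simp add: e_def)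
      obtain y where y: "y \<in> Q" "(\<Sum>i<n. vdist d (x i) (y i)) \<le> e" using dense[OF x(1) e] by auto
      have "F y + K * (\<Sum>i<n. vdist d (x i) (y i)) \<le> F x + 2 * K * (\<Sum>i<n. vdist d (x i) (y i))"
        using lip[OF x(1) Qs[OF y(1)]] by (simp add: abs_le_iff)
      also have "\<dots> \<le> F x + 2 * K * e" using y K by (intro add_left_mono mult_left_mono) auto
      also have "\<dots> < F x + (2 * K + 1) * (2 * e)"
        using e K by (simp add: algebra_simps add_pos_nonneg)
      also have "(2 * K + 1) * (2 * e) = a - F x" proof -
        have "c * (2 * ((a - F x) / c / 2)) = a - F x" if "0 < c" for c using that by simp
        then have "0 < 2 * K + 1 \<Longrightarrow> ?thesis" unfolding e_def by blast
        then show ?thesis using K by simp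
      qed
      also have "F x + (a - F x) = a" by simp
      finally show "x \<in> (\<Union>y\<in>Q. {x \<in> space ?P. F y + K * (\<Sum>i<n. vdist d (x i) (y i)) < a})"
        using x y by auto
    next
      fix x assume "x \<in> (\<Union>y\<in>Q. {x \<in> space ?P. F y + K * (\<Sum>i<n. vdist d (x i) (y i)) < a})"
      then obtain y where y: "y \<in> Q" "x \<in> space ?P" "F y + K * (\<Sum>i<n. vdist d (x i) (y i)) < a" by auto
      then show "x \<in> {x \<in> space ?P. F x < a}"
        using lip[OF y(2) Qs[OF y(1)]] by (auto simp: abs_le_iff)
    qed
    also have "\<dots> \<in> sets ?P"
    proof (rule sets.countable_UN''[OF Qc])
      fix y assume y: "y \<in> Q"
      have [measurable]: "(\<lambda>x. vdist d (x i) (y i)) \<in> borel_measurable ?P" if "i \<in> {..<n}" for i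
      proof (rule measurable_vdist)
        show "(\<lambda>x. x i) \<in> measurable ?P (Rd d)" by (rule measurable_component_singleton[OF that])
        have "y i \<in> space (Rd d)" using Qs[OF y] that by (auto simp: space_PiM)
        then show "(\<lambda>x. y i) \<in> measurable ?P (Rd d)" by (rule measurable_const)
      qed
      show "{x \<in> space ?P. F y + K * (\<Sum>i<n. vdist d (x i) (y i)) < a} \<in> sets ?P" by measurable
    qed
    finally show "{x \<in> space ?P. F x < a} \<in> sets ?P" .
  qed
qed

lemma zero_in_Rd: "(\<lambda>i\<in>{..<d}. 0) \<in> space (Rd d)"
  by (simp add: space_Rd)

lemma L2_set_eq_vdist: "L2_set x {..<d} = vdist d x (\<lambda>i\<in>{..<d}. 0)"
  unfolding vdist_def by (rule L2_set_cong) auto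

text \<open>The distance to any fixed point is integrable since \<open>t <= 1 + t powr q\<close>,
  followed by a triangle inequality through the origin.\<close>

lemma integrable_vdist:
  assumes \<mu>: "prob_on d \<mu>" and m: "finite_moment d q \<mu>" and q: "1 \<le> q" and x0: "x0 \<in> space (Rd d)"
  shows "integrable \<mu> (\<lambda>x. vdist d x x0)"
proof -
  interpret prob_space \<mu> using \<mu> by (rule prob_onD)
  let ?z = "\<lambda>i\<in>{..<d}. 0 :: real"
  have id: "(\<lambda>x. x) \<in> measurable \<mu> (Rd d)"
    using prob_onD(2)[OF \<mu>] by (simp add: measurable_ident_sets)
  have mz: "(\<lambda>x. vdist d x ?z) \<in> borel_measurable \<mu>" and m0: "(\<lambda>x. vdist d x x0) \<in> borel_measurable \<mu>"
    by (rule measurable_vdist[OF id measurable_const[OF zero_in_Rd]], rule measurable_vdist[OF id measurable_const[OF x0]])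
  have "integrable \<mu> (\<lambda>x. vdist d x ?z powr q)"
  proof (rule integrableI_bounded)
    show "(\<lambda>x. vdist d x ?z powr q) \<in> borel_measurable \<mu>" using mz by measurable
    show "(\<integral>\<^sup>+ x. ennreal (norm (vdist d x ?z powr q)) \<partial>\<mu>) < \<infinity>"
      using m by (simp add: finite_moment_def L2_set_eq_vdist)
  qed
  then have i: "integrable \<mu> (\<lambda>x. 1 + vdist d x ?z powr q + vdist d ?z x0)" by simp
  show ?thesis
  proof (rule Bochner_Integration.integrable_bound[OF i m0])
    show "AE x in \<mu>. norm (vdist d x x0) \<le> norm (1 + vdist d x ?z powr q + vdist d ?z x0)"
    proof (rule AE_I2)
      fix x
      have "t \<le> 1 + t powr q" if "0 \<le> t" for t :: real
      proof (cases "t \<le> 1")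
        case False
        then have "t powr 1 \<le> t powr q" using q by (intro powr_mono) auto
        then show ?thesis using False by simp
      qed (simp add: add_increasing2)
      then have "vdist d x ?z \<le> 1 + vdist d x ?z powr q" by simp
      with vdist_triangle[of d x x0 ?z]
      show "norm (vdist d x x0) \<le> norm (1 + vdist d x ?z powr q + vdist d ?z x0)" by simp
    qed
  qed
qed

lemma lipschitz_integrable_samples:
  fixes F :: "(nat \<Rightarrow> vec) \<Rightarrow> real"
  assumes \<mu>: "prob_on d \<mu>" and m: "finite_moment d q \<mu>" and q: "1 \<le> q" and K: "0 \<le> K"
    and lip: "\<And>x y. x \<in> space (Pi\<^sub>M {..<n} (\<lambda>_. Rd d)) \<Longrightarrow> y \<in> space (Pi\<^sub>M {..<n} (\<lambda>_. Rd d)) \<Longrightarrow>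
    \<bar>F x - F y\<bar> \<le> K * (\<Sum>i<n. vdist d (x i) (y i))"
  shows "integrable (Pi\<^sub>M {..<n} (\<lambda>_. \<mu>)) F"
proof -
  interpret prob_space \<mu> using \<mu> by (rule prob_onD)
  let ?P = "Pi\<^sub>M {..<n} (\<lambda>_. \<mu>)"
  let ?z = "\<lambda>i\<in>{..<d}. 0 :: real"
  interpret P: prob_space ?P by (rule prob_space_PiM) (rule prob_onD[OF \<mu>])
  have sP: "sets ?P = sets (Pi\<^sub>M {..<n} (\<lambda>_. Rd d))"
    by (rule sets_PiM_cong) (use prob_onD(2)[OF \<mu>] in auto)
  have spP: "space ?P = space (Pi\<^sub>M {..<n} (\<lambda>_. Rd d))" using sP by (rule sets_eq_imp_space_eq)
  have F: "F \<in> borel_measurable ?P"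
    unfolding measurable_cong_sets[OF sP refl] using K lip by (rule lipschitz_measurable_samples)
  define x0 where "x0 = (\<lambda>i\<in>{..<n}. ?z)"
  have x0: "x0 \<in> space (Pi\<^sub>M {..<n} (\<lambda>_. Rd d))"
    using zero_in_Rd by (auto simp: x0_def space_PiM)
  have comp: "integrable ?P (\<lambda>x. vdist d (x i) ?z)" if i: "i < n" for i
  proof -
    have e: "distr ?P \<mu> (\<lambda>x. x i) = \<mu>" by (rule distr_PiM_component) (use i prob_space_axioms in auto)
    have "integrable (distr ?P \<mu> (\<lambda>x. x i)) (\<lambda>x. vdist d x ?z)"
      unfolding e by (rule integrable_vdist[OF \<mu> m q zero_in_Rd])
    then show ?thesis
      by (rule integrable_distr[rotated]) (use i in \<open>auto intro!: measurable_component_singleton\<close>)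
  qed
  have i: "integrable ?P (\<lambda>x. \<bar>F x0\<bar> + K * (\<Sum>i<n. vdist d (x i) ?z))"
    using comp by (intro Bochner_Integration.integrable_add integrable_mult_right Bochner_Integration.integrable_sum) auto
  show ?thesis
  proof (rule Bochner_Integration.integrable_bound[OF i F])
    show "AE x in ?P. norm (F x) \<le> norm (\<bar>F x0\<bar> + K * (\<Sum>i<n. vdist d (x i) ?z))"
    proof (rule AE_I2)
      fix x assume x: "x \<in> space ?P"
      have "\<bar>F x - F x0\<bar> \<le> K * (\<Sum>i<n. vdist d (x i) (x0 i))"
        using x x0 unfolding spP by (rule lip)
      also have "(\<Sum>i<n. vdist d (x i) (x0 i)) = (\<Sum>i<n. vdist d (x i) ?z)"
        by (rule sum.cong) (auto simp: x0_def)
      finally show "norm (F x) \<le> norm (\<bar>F x0\<bar> + K * (\<Sum>i<n. vdist d (x i) ?z))" by simp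
    qed
  qed
qed

text \<open>Two roots are linearized: the power \<open>q / 2\<close> in the transport inequality,
  and the power \<open>1 / q\<close> that turns the additive cost into the \<open>l^q\<close>
  metric. With matched tangent points the pair \<open>(\<eta> * F - r) / \<theta>\<close> and
  \<open>\<eta> * F / \<theta>\<close> is admissible for the tensorized inequality, and the
  constants combine to a Gaussian exponent.\<close>

lemma concentration_bounded:
  fixes F :: "(nat \<Rightarrow> vec) \<Rightarrow> real"
  assumes T: "transport_ineq d q (\<sigma>\<^sup>2) \<mu>" and q: "1 \<le> q" "q \<le> 2" and pos: "0 < \<sigma>" "0 < n" "0 < \<eta>" "0 < L"
    and F: "F \<in> borel_measurable (Pi\<^sub>M {..<n} (\<lambda>_. \<mu>))"
    and bd: "\<And>x. x \<in> space (Pi\<^sub>M {..<n} (\<lambda>_. \<mu>)) \<Longrightarrow> \<bar>F x\<bar> \<le> B"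
    and lip: "\<And>x y. x \<in> space (Pi\<^sub>M {..<n} (\<lambda>_. \<mu>)) \<Longrightarrow> y \<in> space (Pi\<^sub>M {..<n} (\<lambda>_. \<mu>)) \<Longrightarrow>
      F x - F y \<le> L * (\<Sum>i<n. vdist d (x i) (y i) powr q) powr (1 / q)"
  shows "(\<integral>x. exp (\<eta> * F x) \<partial>Pi\<^sub>M {..<n} (\<lambda>_. \<mu>))
    \<le> exp (\<eta> * (\<integral>x. F x \<partial>Pi\<^sub>M {..<n} (\<lambda>_. \<mu>)) + \<eta>\<^sup>2 * L\<^sup>2 * \<sigma>\<^sup>2 * real n powr (2 / q - 1) / 2)"
proof -
  have \<mu>: "prob_on d \<mu>" using T by (simp add: transport_ineq_def)
  let ?P = "Pi\<^sub>M {..<n} (\<lambda>_. \<mu>)"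
  \<comment> \<open>\<open>u\<close> solves
    \<open>\<eta> * L * (n * s0) powr (1 / q) = n * u^2\<close>. The tangent points are the
    divergence \<open>u^2 / 2\<close> per sample and the cost \<open>s0\<close> that the transport
    inequality assigns to it. This choice makes the slope in the divergence equal to
    \<open>1 / \<theta>\<close>, as the tensorized inequality requires.\<close>
  define u where "u = \<eta> * L * \<sigma> * real n powr (1 / q - 1)"
  define s0 where "s0 = (\<sigma> * u) powr q"
  define M where "M = real n * u\<^sup>2"
  define \<theta> where "\<theta> = M / (q * (real n * s0))"
  define r where "r = M * (1 - 1 / q)"
  define b where "b = s0 * (1 - q / 2)"
  have u: "0 < u" using pos by (simp add: u_def)
  have s0: "0 < s0" using pos u by (simp add: s0_def)
  have M: "0 < M" using pos u by (simp add: M_def)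
  have \<theta>: "0 < \<theta>" using M q pos s0 by (simp add: \<theta>_def)
  have M': "\<eta> * L * (real n * s0) powr (1 / q) = M"
  proof -
    have "real n powr (1 / q - 1) * real n = real n powr (1 / q)"
      using pos powr_add[of "real n" "1 / q - 1" 1] by simp
    then have un: "u * real n = \<eta> * L * \<sigma> * real n powr (1 / q)" unfolding u_def by (simp add: mult.assoc)
    have "(real n * s0) powr (1 / q) = real n powr (1 / q) * (\<sigma> * u)"
      unfolding s0_def using pos u q by (simp add: powr_mult powr_powr)
    then have "\<eta> * L * (real n * s0) powr (1 / q) = (\<eta> * L * \<sigma> * real n powr (1 / q)) * u" by (simp add: ac_simps)
    also have "\<dots> = M" unfolding un[symmetric] M_def by (simp add: power2_eq_square)
    finally show ?thesis .
  qed
  have "(\<integral>x. exp (((\<eta> * F x - r) / \<theta>) / (1 / \<theta>)) \<partial>?P)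
      \<le> exp (((\<integral>x. \<eta> * F x / \<theta> \<partial>?P) + real n * b) / (1 / \<theta>))"
  proof (rule exp_transport_tensorize[where c="\<lambda>x y. vdist d x y powr q" and B="(\<eta> * B + \<bar>r\<bar>) / \<theta>"])
    fix G H :: "vec \<Rightarrow> real" and B'
    assume GH: "G \<in> borel_measurable \<mu>" "H \<in> borel_measurable \<mu>" "\<And>x. x \<in> space \<mu> \<Longrightarrow> \<bar>G x\<bar> \<le> B'"
      "\<And>x. x \<in> space \<mu> \<Longrightarrow> \<bar>H x\<bar> \<le> B'" "\<And>x y. x \<in> space \<mu> \<Longrightarrow> y \<in> space \<mu> \<Longrightarrow> G x - H y \<le> vdist d x y powr q"
    show "(\<integral>x. exp (G x / (1 / \<theta>)) \<partial>\<mu>) \<le> exp (((\<integral>x. H x \<partial>\<mu>) + b) / (1 / \<theta>))"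
    proof (rule transport_ineq_dual[OF T q(1) _ _ _ GH])
      fix D :: real assume D: "0 \<le> D"
      have "(2 * \<sigma>\<^sup>2 * D) powr (q / 2) \<le> (2 * \<sigma>\<^sup>2 * (u\<^sup>2 / 2)) powr (q / 2) * (1 - q / 2 + q / 2 * (2 * \<sigma>\<^sup>2 * D / (2 * \<sigma>\<^sup>2 * (u\<^sup>2 / 2))))"
        using D pos u q by (intro powr_le_tangent) auto
      also have "(2 * \<sigma>\<^sup>2 * (u\<^sup>2 / 2)) powr (q / 2) = s0"
      proof -
        have "2 * \<sigma>\<^sup>2 * (u\<^sup>2 / 2) = (\<sigma> * u) powr 2" using pos u by (simp add: power_mult_distrib)
        then show ?thesis unfolding s0_def by (simp add: powr_powr)
      qed
      also have "2 * \<sigma>\<^sup>2 * D / (2 * \<sigma>\<^sup>2 * (u\<^sup>2 / 2)) = 2 * D / u\<^sup>2" using pos by simp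
      also have "s0 * (1 - q / 2 + q / 2 * (2 * D / u\<^sup>2)) = 1 / \<theta> * D + b"
        unfolding b_def \<theta>_def M_def using pos u s0 q by (simp add: field_simps)
      finally show "(2 * \<sigma>\<^sup>2 * D) powr (q / 2) \<le> 1 / \<theta> * D + b" .
    qed (use pos \<theta> in auto)
  next
    show "(\<lambda>x. (\<eta> * F x - r) / \<theta>) \<in> borel_measurable ?P" using F by measurable
    show "(\<lambda>x. \<eta> * F x / \<theta>) \<in> borel_measurable ?P" using F by measurable
  next
    fix x assume x: "x \<in> space ?P"
    have l: "\<bar>\<eta> * F x\<bar> \<le> \<eta> * B" using bd[OF x] pos by (simp add: abs_mult)
    show "\<bar>(\<eta> * F x - r) / \<theta>\<bar> \<le> (\<eta> * B + \<bar>r\<bar>) / \<theta>" "\<bar>\<eta> * F x / \<theta>\<bar> \<le> (\<eta> * B + \<bar>r\<bar>) / \<theta>"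
      using l \<theta> by (auto simp: abs_divide intro!: divide_right_mono)
  next
    fix x y assume xy: "x \<in> space ?P" "y \<in> space ?P"
    define S where "S = (\<Sum>i<n. vdist d (x i) (y i) powr q)"
    have S: "0 \<le> S" by (simp add: S_def sum_nonneg)
    have "\<eta> * (F x - F y) \<le> \<eta> * (L * S powr (1 / q))"
      unfolding S_def using pos by (intro mult_left_mono lip[OF xy]) auto
    also have "\<dots> = \<eta> * L * S powr (1 / q)" by simp
    also have "\<dots> \<le> \<eta> * L * ((real n * s0) powr (1 / q) * (1 - 1 / q + 1 / q * (S / (real n * s0))))"
      using pos s0 q S by (intro mult_left_mono powr_le_tangent) auto
    also have "\<dots> = M * (1 - 1 / q + 1 / q * (S / (real n * s0)))"
      unfolding M'[symmetric] by simp
    also have "\<dots> = r + \<theta> * S"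
      unfolding r_def \<theta>_def by (simp add: algebra_simps)
    finally show "(\<eta> * F x - r) / \<theta> - \<eta> * F y / \<theta> \<le> S"
      using \<theta> by (simp add: diff_divide_distrib[symmetric] pos_divide_le_eq algebra_simps)
  qed (use \<theta> prob_onD[OF \<mu>] in auto)
  also have "((\<integral>x. \<eta> * F x / \<theta> \<partial>?P) + real n * b) / (1 / \<theta>) = \<eta> * (\<integral>x. F x \<partial>?P) + real n * b * \<theta>"
    using \<theta> by (simp add: field_simps)
  also have "real n * b * \<theta> = M * (1 / q - 1 / 2)"
    unfolding b_def \<theta>_def using pos s0 q by (simp add: field_simps)
  finally have le: "(\<integral>x. exp (\<eta> * F x - r) \<partial>?P) \<le> exp (\<eta> * (\<integral>x. F x \<partial>?P) + M * (1 / q - 1 / 2))"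
    using \<theta> by simp
  have "(\<integral>x. exp (\<eta> * F x) \<partial>?P) = exp r * (\<integral>x. exp (\<eta> * F x - r) \<partial>?P)"
    by (simp add: exp_diff)
  also have "\<dots> \<le> exp r * exp (\<eta> * (\<integral>x. F x \<partial>?P) + M * (1 / q - 1 / 2))"
    using le by (intro mult_left_mono) auto
  \<comment> \<open>The two linearization errors add up to
    \<open>M * (1 - 1/q) + M * (1/q - 1/2) = M / 2\<close>.\<close>
  also have "\<dots> = exp (\<eta> * (\<integral>x. F x \<partial>?P) + M / 2)"
    unfolding exp_add[symmetric] r_def by (simp add: algebra_simps)
  also have "M = \<eta>\<^sup>2 * L\<^sup>2 * \<sigma>\<^sup>2 * real n powr (2 / q - 1)"
  proof -
    have "(real n powr (1 / q - 1))\<^sup>2 = (real n powr (1 / q - 1)) powr 2"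
      using pos by simp
    also have "\<dots> = real n powr (2 / q - 2)" by (simp only: powr_powr) (simp add: algebra_simps)
    finally have "real n * (real n powr (1 / q - 1))\<^sup>2 = real n powr 1 * real n powr (2 / q - 2)"
      using pos by simp
    also have "\<dots> = real n powr (2 / q - 1)" unfolding powr_add[symmetric] by simp
    finally show ?thesis unfolding M_def u_def by (simp add: power_mult_distrib ac_simps)
  qed
  finally show ?thesis .
qed

text \<open>Truncation at height \<open>N\<close> keeps the Lipschitz bound. As \<open>N\<close>
  grows, Fatou's lemma handles the exponential integral and dominated convergence the means.\<close>

lemma concentration:
  fixes F :: "(nat \<Rightarrow> vec) \<Rightarrow> real"
  assumes T: "transport_ineq d q (\<sigma>\<^sup>2) \<mu>" and q: "1 \<le> q" "q \<le> 2" and pos: "0 < \<sigma>" "0 < n" "0 < \<eta>" "0 < L"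
    and lip: "\<And>x y. x \<in> space (Pi\<^sub>M {..<n} (\<lambda>_. Rd d)) \<Longrightarrow> y \<in> space (Pi\<^sub>M {..<n} (\<lambda>_. Rd d)) \<Longrightarrow>
      F x - F y \<le> L * (\<Sum>i<n. vdist d (x i) (y i) powr q) powr (1 / q)"
  shows "integrable (Pi\<^sub>M {..<n} (\<lambda>_. \<mu>)) F"
    and "(\<integral>\<^sup>+x. ennreal (exp (\<eta> * F x)) \<partial>Pi\<^sub>M {..<n} (\<lambda>_. \<mu>))
    \<le> ennreal (exp (\<eta> * (\<integral>x. F x \<partial>Pi\<^sub>M {..<n} (\<lambda>_. \<mu>)) + \<eta>\<^sup>2 * L\<^sup>2 * \<sigma>\<^sup>2 * real n powr (2 / q - 1) / 2))"
proof -
  have \<mu>: "prob_on d \<mu>" and mom: "finite_moment d q \<mu>" using T by (auto simp: transport_ineq_def)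
  let ?P = "Pi\<^sub>M {..<n} (\<lambda>_. \<mu>)" and ?S = "\<lambda>x y :: nat \<Rightarrow> vec. (\<Sum>i<n. vdist d (x i) (y i) powr q) powr (1 / q)"
  interpret P: prob_space ?P by (rule prob_space_PiM) (rule prob_onD[OF \<mu>])
  have sP: "sets ?P = sets (Pi\<^sub>M {..<n} (\<lambda>_. Rd d))"
    by (rule sets_PiM_cong) (use prob_onD(2)[OF \<mu>] in auto)
  have spP: "space ?P = space (Pi\<^sub>M {..<n} (\<lambda>_. Rd d))" using sP by (rule sets_eq_imp_space_eq)
  have Ssym: "?S x y = ?S y x" for x y by (simp add: vdist_commute)
  have abs: "\<bar>F x - F y\<bar> \<le> L * ?S x y" if "x \<in> space ?P" "y \<in> space ?P" for x y
    using lip[of x y] lip[of y x] that Ssym[of x y] unfolding spP by (simp add: abs_le_iff)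
  have lip1: "\<bar>F x - F y\<bar> \<le> L * (\<Sum>i<n. vdist d (x i) (y i))" if "x \<in> space (Pi\<^sub>M {..<n} (\<lambda>_. Rd d))" "y \<in> space (Pi\<^sub>M {..<n} (\<lambda>_. Rd d))" for x y
  proof -
    have "?S x y \<le> (\<Sum>i<n. vdist d (x i) (y i))" using q by (intro sum_powr_le_powr_sum) auto
    then have "L * ?S x y \<le> L * (\<Sum>i<n. vdist d (x i) (y i))" using pos by (intro mult_left_mono) auto
    with abs[of x y] that show ?thesis unfolding spP by linarith
  qed
  show int: "integrable ?P F"
    by (rule lipschitz_integrable_samples[OF \<mu> mom q(1) less_imp_le[OF pos(4)] lip1])
  define FN where "FN N x = max (- real N) (min (real N) (F x))" for N x
  have Fm[measurable]: "F \<in> borel_measurable ?P" using int by auto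
  have FNm[measurable]: "FN N \<in> borel_measurable ?P" for N unfolding FN_def by measurable
  let ?c = "\<eta>\<^sup>2 * L\<^sup>2 * \<sigma>\<^sup>2 * real n powr (2 / q - 1) / 2"
  have b: "(\<integral>x. exp (\<eta> * FN N x) \<partial>?P) \<le> exp (\<eta> * (\<integral>x. FN N x \<partial>?P) + ?c)" for N
  proof (rule concentration_bounded[OF T q pos FNm, where B="real N"])
    fix x y assume xy: "x \<in> space ?P" "y \<in> space ?P"
    have "FN N x - FN N y \<le> \<bar>F x - F y\<bar>" unfolding FN_def by (auto simp: max_def min_def)
    also have "\<dots> \<le> L * ?S x y" using xy by (rule abs)
    finally show "FN N x - FN N y \<le> L * ?S x y" .
  qed (auto simp: FN_def)
  have lim: "(\<lambda>N. FN N x) \<longlonglongrightarrow> F x" for x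
  proof (rule tendsto_eventually)
    obtain N0 :: nat where "\<bar>F x\<bar> \<le> real N0" using real_arch_simple by blast
    then show "\<forall>\<^sub>F N in sequentially. FN N x = F x"
      unfolding eventually_sequentially FN_def by (intro exI[of _ N0]) (auto simp: max_def min_def)
  qed
  have Elim: "(\<lambda>N. \<integral>x. FN N x \<partial>?P) \<longlonglongrightarrow> (\<integral>x. F x \<partial>?P)"
  proof (rule integral_dominated_convergence[where w="\<lambda>x. \<bar>F x\<bar>"])
    show "AE x in ?P. norm (FN N x) \<le> \<bar>F x\<bar>" for N by (auto simp: FN_def max_def min_def)
  qed (use int lim in auto)
  have "(\<integral>\<^sup>+x. ennreal (exp (\<eta> * F x)) \<partial>?P) = (\<integral>\<^sup>+x. liminf (\<lambda>N. ennreal (exp (\<eta> * FN N x))) \<partial>?P)"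
  proof (rule nn_integral_cong)
    fix x
    have "(\<lambda>N. ennreal (exp (\<eta> * FN N x))) \<longlonglongrightarrow> ennreal (exp (\<eta> * F x))"
      by (intro tendsto_ennrealI tendsto_exp tendsto_mult tendsto_const lim)
    then show "ennreal (exp (\<eta> * F x)) = liminf (\<lambda>N. ennreal (exp (\<eta> * FN N x)))"
      by (rule lim_imp_Liminf[symmetric, rotated]) simp
  qed
  also have "\<dots> \<le> liminf (\<lambda>N. \<integral>\<^sup>+x. ennreal (exp (\<eta> * FN N x)) \<partial>?P)"
    by (rule nn_integral_liminf) measurable
  also have "\<dots> \<le> liminf (\<lambda>N. ennreal (exp (\<eta> * (\<integral>x. FN N x \<partial>?P) + ?c)))"
  proof (rule Liminf_mono, rule always_eventually, rule allI)
    fix N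
    have "integrable ?P (\<lambda>x. exp (\<eta> * FN N x))"
      by (rule P.integrable_const_bound[where B="exp (\<eta> * real N)"])
        (use pos in \<open>auto simp: FN_def max_def min_def\<close>)
    then have "(\<integral>\<^sup>+x. ennreal (exp (\<eta> * FN N x)) \<partial>?P) = ennreal (\<integral>x. exp (\<eta> * FN N x) \<partial>?P)"
      by (intro nn_integral_eq_integral) auto
    then show "(\<integral>\<^sup>+x. ennreal (exp (\<eta> * FN N x)) \<partial>?P) \<le> ennreal (exp (\<eta> * (\<integral>x. FN N x \<partial>?P) + ?c))"
      using b[of N] by (simp add: ennreal_leI)
  qed
  also have "\<dots> = ennreal (exp (\<eta> * (\<integral>x. F x \<partial>?P) + ?c))"
    by (intro lim_imp_Liminf tendsto_ennrealI tendsto_exp tendsto_add tendsto_mult tendsto_const Elim) simp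
  finally show "(\<integral>\<^sup>+x. ennreal (exp (\<eta> * F x)) \<partial>?P) \<le> ennreal (exp (\<eta> * (\<integral>x. F x \<partial>?P) + ?c))" .
qed

text \<open>The case of a single sample, where the power of \<open>n\<close> equals 1: whatever
  \<open>q\<close>, the moment is Gaussian with variance parameter \<open>L^2 * \<sigma>^2\<close>.
  It feeds all moment bounds for projections.\<close>

lemma lipschitz_exp_moment:
  fixes f :: "vec \<Rightarrow> real"
  assumes T: "transport_ineq d q (\<sigma>\<^sup>2) \<mu>" and q: "1 \<le> q" "q \<le> 2" and pos: "0 < \<sigma>" "0 < \<eta>" "0 < L"
    and lip: "\<And>x y. x \<in> space (Rd d) \<Longrightarrow> y \<in> space (Rd d) \<Longrightarrow> f x - f y \<le> L * vdist d x y"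
  shows "integrable \<mu> f"
    and "(\<integral>\<^sup>+x. ennreal (exp (\<eta> * f x)) \<partial>\<mu>) \<le> ennreal (exp (\<eta> * (\<integral>x. f x \<partial>\<mu>) + \<eta>\<^sup>2 * L\<^sup>2 * \<sigma>\<^sup>2 / 2))"
proof -
  have \<mu>: "prob_on d \<mu>" using T by (auto simp: transport_ineq_def)
  interpret prob_space \<mu> using \<mu> by (rule prob_onD)
  let ?P = "Pi\<^sub>M {..<1::nat} (\<lambda>_. \<mu>)"
  have e: "distr ?P \<mu> (\<lambda>x. x 0) = \<mu>" by (rule distr_PiM_component) (use prob_space_axioms in auto)
  have c0: "(\<lambda>x. x 0) \<in> measurable ?P \<mu>" by (rule measurable_component_singleton) simp
  have lip': "f (x 0) - f (y 0) \<le> L * (\<Sum>i<1::nat. vdist d (x i) (y i) powr q) powr (1 / q)"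
    if "x \<in> space (Pi\<^sub>M {..<1::nat} (\<lambda>_. Rd d))" "y \<in> space (Pi\<^sub>M {..<1::nat} (\<lambda>_. Rd d))" for x y
  proof -
    have "x 0 \<in> space (Rd d)" "y 0 \<in> space (Rd d)" using that by (auto simp: space_PiM)
    then show ?thesis using lip[of "x 0" "y 0"] q by (simp add: powr_powr)
  qed
  have fm: "f \<in> borel_measurable \<mu>"
  proof -
    have "f \<in> borel_measurable (Rd d)"
    proof -
      \<comment> \<open>Measurability is proved on samples of size one and pulled back along the map
        that sends a point to the sample consisting of it.\<close>
      have "(\<lambda>x. f (x 0)) \<in> borel_measurable (Pi\<^sub>M {..<1::nat} (\<lambda>_. Rd d))"
      proof (rule lipschitz_measurable_samples[where K=L])
        fix x y assume "x \<in> space (Pi\<^sub>M {..<1::nat} (\<lambda>_. Rd d))" "y \<in> space (Pi\<^sub>M {..<1::nat} (\<lambda>_. Rd d))"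
        then have "x 0 \<in> space (Rd d)" "y 0 \<in> space (Rd d)" by (auto simp: space_PiM)
        then show "\<bar>f (x 0) - f (y 0)\<bar> \<le> L * (\<Sum>i<1::nat. vdist d (x i) (y i))"
          using lip[of "x 0" "y 0"] lip[of "y 0" "x 0"] by (simp add: vdist_commute abs_le_iff)
      qed (use pos in auto)
      moreover have "(\<lambda>x. \<lambda>i\<in>{..<1::nat}. x) \<in> measurable (Rd d) (Pi\<^sub>M {..<1::nat} (\<lambda>_. Rd d))"
        by (rule measurable_restrict) simp
      ultimately have "(\<lambda>x. f ((\<lambda>i\<in>{..<1::nat}. x) 0)) \<in> borel_measurable (Rd d)"
        by (rule measurable_compose[rotated])
      then show ?thesis by simp
    qed
    then show ?thesis unfolding measurable_cong_sets[OF prob_onD(2)[OF \<mu>] refl] .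
  qed
  note c = concentration[OF T q pos(1) zero_less_one pos(2,3) lip']
  have "integrable (distr ?P \<mu> (\<lambda>x. x 0)) f"
    by (subst integrable_distr_eq[OF c0 fm]) (rule c(1))
  then show "integrable \<mu> f" unfolding e .
  have 1: "(\<integral>x. f (x 0) \<partial>?P) = (\<integral>x. f x \<partial>\<mu>)"
    using integral_distr[OF c0 fm] unfolding e by simp
  have "(\<integral>\<^sup>+x. ennreal (exp (\<eta> * f x)) \<partial>distr ?P \<mu> (\<lambda>x. x 0)) = (\<integral>\<^sup>+x. ennreal (exp (\<eta> * f (x 0))) \<partial>?P)"
    by (rule nn_integral_distr[OF c0]) (use fm in measurable)
  also have "\<dots> \<le> ennreal (exp (\<eta> * (\<integral>x. f x \<partial>\<mu>) + \<eta>\<^sup>2 * L\<^sup>2 * \<sigma>\<^sup>2 / 2))"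
    using c(2) unfolding 1 by simp
  finally show "(\<integral>\<^sup>+x. ennreal (exp (\<eta> * f x)) \<partial>\<mu>) \<le> ennreal (exp (\<eta> * (\<integral>x. f x \<partial>\<mu>) + \<eta>\<^sup>2 * L\<^sup>2 * \<sigma>\<^sup>2 / 2))"
    unfolding e .
qed

section \<open>Multiscale couplings\<close>

text \<open>Both sides are the mass of \<open>m\<close> on the block \<open>C\<close> times
  \<open>C\<close>, since no mass joins \<open>C\<close> to its complement. Consequently, matching
  mass inside cells leaves the discrepancy of the two measures on every coarser cell
  unchanged.\<close>

lemma sum_block_symmetric:
  fixes m :: "'a \<Rightarrow> 'a \<Rightarrow> real"
  assumes A: "finite A" and C: "C \<subseteq> A"
    and m: "\<And>x y. x \<in> A \<Longrightarrow> y \<in> A \<Longrightarrow> m x y \<noteq> 0 \<Longrightarrow> x \<in> C \<longleftrightarrow> y \<in> C"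
  shows "(\<Sum>x\<in>C. \<Sum>y\<in>A. m x y) = (\<Sum>y\<in>C. \<Sum>x\<in>A. m x y)"
proof -
  have "(\<Sum>x\<in>C. \<Sum>y\<in>A. m x y) = (\<Sum>x\<in>C. \<Sum>y\<in>C. m x y)"
    using A C m by (intro sum.cong refl sum.mono_neutral_right) auto
  also have "\<dots> = (\<Sum>y\<in>C. \<Sum>x\<in>C. m x y)" by (rule sum.swap)
  also have "\<dots> = (\<Sum>y\<in>C. \<Sum>x\<in>A. m x y)"
    using A C m by (intro sum.cong refl sum.mono_neutral_left) auto
  finally show ?thesis .
qed

text \<open>Proportional matching inside each cell, normalized by the larger of the two cell masses:
  the side with the smaller mass is used up, the other is nowhere exceeded. Cells without mass are
  covered by \<open>0 / 0 = 0\<close>.\<close>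

lemma cell_matching:
  fixes a b :: "'a \<Rightarrow> real" and \<kappa> :: "'a \<Rightarrow> 'c"
  assumes A: "finite A" and a: "\<And>x. x \<in> A \<Longrightarrow> 0 \<le> a x" and b: "\<And>x. x \<in> A \<Longrightarrow> 0 \<le> b x"
  shows "\<exists>m. (\<forall>x\<in>A. \<forall>y\<in>A. 0 \<le> m x y) \<and> (\<forall>x\<in>A. \<forall>y\<in>A. m x y \<noteq> 0 \<longrightarrow> \<kappa> x = \<kappa> y) \<and>
    (\<forall>x\<in>A. (\<Sum>y\<in>A. m x y) \<le> a x) \<and> (\<forall>y\<in>A. (\<Sum>x\<in>A. m x y) \<le> b y) \<and>
    (\<forall>R. (\<forall>x\<in>A. \<kappa> x = R \<longrightarrow> (\<Sum>y\<in>A. m x y) = a x) \<or> (\<forall>y\<in>A. \<kappa> y = R \<longrightarrow> (\<Sum>x\<in>A. m x y) = b y))"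
proof -
  define As where "As R = (\<Sum>x\<in>{x\<in>A. \<kappa> x = R}. a x)" for R
  define Bs where "Bs R = (\<Sum>x\<in>{x\<in>A. \<kappa> x = R}. b x)" for R
  define M where "M R = max (As R) (Bs R)" for R
  define m where "m x y = (if \<kappa> x = \<kappa> y then a x * b y / M (\<kappa> x) else 0)" for x y
  have As0: "0 \<le> As R" "0 \<le> Bs R" for R unfolding As_def Bs_def using a b by (auto intro: sum_nonneg)
  have M0: "0 \<le> M R" "As R \<le> M R" "Bs R \<le> M R" for R using As0[of R] by (auto simp: M_def)
  have aA: "a x \<le> As (\<kappa> x)" if "x \<in> A" for x
    unfolding As_def using A a that by (intro member_le_sum) auto
  have bB: "b x \<le> Bs (\<kappa> x)" if "x \<in> A" for x
    unfolding Bs_def using A b that by (intro member_le_sum) auto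
  have row: "(\<Sum>y\<in>A. m x y) = a x * (Bs (\<kappa> x) / M (\<kappa> x))" for x
  proof -
    have "(\<Sum>y\<in>A. m x y) = (\<Sum>y\<in>{y\<in>A. \<kappa> y = \<kappa> x}. a x * b y / M (\<kappa> x))"
      unfolding m_def by (subst sum.inter_filter[OF A]) (auto intro!: sum.cong)
    then show ?thesis by (simp add: Bs_def sum_distrib_left sum_divide_distrib)
  qed
  have col: "(\<Sum>x\<in>A. m x y) = b y * (As (\<kappa> y) / M (\<kappa> y))" for y
  proof -
    have "(\<Sum>x\<in>A. m x y) = (\<Sum>x\<in>{x\<in>A. \<kappa> x = \<kappa> y}. a x * b y / M (\<kappa> y))"
      unfolding m_def by (subst sum.inter_filter[OF A]) (auto intro!: sum.cong)
    then show ?thesis by (simp add: As_def sum_distrib_left sum_divide_distrib mult.commute)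
  qed
  have le1: "s / M R \<le> 1" if "s \<le> M R" for s R
    using that M0(1)[of R] by (cases "M R = 0") (auto simp: divide_le_eq)
  show ?thesis
  proof (intro exI[of _ m] conjI ballI allI impI)
    fix x y assume "x \<in> A" "y \<in> A"
    then show "0 \<le> m x y" using a b M0 by (auto simp: m_def)
    assume "m x y \<noteq> 0"
    then show "\<kappa> x = \<kappa> y" by (auto simp: m_def split: if_splits)
  next
    fix x assume x: "x \<in> A"
    show "(\<Sum>y\<in>A. m x y) \<le> a x"
      unfolding row using mult_left_mono[OF le1[OF M0(3)] a[OF x]] by simp
    show "(\<Sum>y\<in>A. m y x) \<le> b x"
      unfolding col using mult_left_mono[OF le1[OF M0(2)] b[OF x]] by simp
  next
    fix R
    show "(\<forall>x\<in>A. \<kappa> x = R \<longrightarrow> (\<Sum>y\<in>A. m x y) = a x) \<or> (\<forall>y\<in>A. \<kappa> y = R \<longrightarrow> (\<Sum>x\<in>A. m x y) = b y)"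
    proof (cases "As R \<le> Bs R")
      case True
      have "(\<Sum>y\<in>A. m x y) = a x" if x: "x \<in> A" "\<kappa> x = R" for x
      proof (cases "Bs R = 0")
        case True
        then have "a x = 0" using aA[OF x(1)] a[OF x(1)] \<open>As R \<le> Bs R\<close> x by simp
        then show ?thesis unfolding row by simp
      qed (use True x in \<open>simp add: row M_def\<close>)
      then show ?thesis by blast
    next
      case False
      have "(\<Sum>x\<in>A. m x y) = b y" if y: "y \<in> A" "\<kappa> y = R" for y
      proof (cases "As R = 0")
        case True
        then show ?thesis using False As0[of R] by simp
      qed (use False y in \<open>simp add: col M_def\<close>)
      then show ?thesis by blast
    qed
  qed
qed

text \<open>Greedy matching from the finest partition upwards: the mass matched at level \<open>j\<close> was left over at
  level \<open>j + 1\<close>, hence is at most the discrepancy of the two measures on the cells of that level.\<close>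

lemma tree_coupling:
  fixes a b :: "'a \<Rightarrow> real" and \<kappa> :: "nat \<Rightarrow> 'a \<Rightarrow> 'c"
  assumes A: "finite A" and "\<And>x. x \<in> A \<Longrightarrow> 0 \<le> a x" and "\<And>x. x \<in> A \<Longrightarrow> 0 \<le> b x"
    and "(\<Sum>x\<in>A. a x) = (\<Sum>x\<in>A. b x)"
    and nested: "\<And>j x y. j < N \<Longrightarrow> x \<in> A \<Longrightarrow> y \<in> A \<Longrightarrow> \<kappa> (Suc j) x = \<kappa> (Suc j) y \<Longrightarrow> \<kappa> j x = \<kappa> j y"
    and root: "\<And>x y. x \<in> A \<Longrightarrow> y \<in> A \<Longrightarrow> \<kappa> 0 x = \<kappa> 0 y"
  shows "\<exists>m. (\<forall>j. \<forall>x\<in>A. \<forall>y\<in>A. 0 \<le> m j x y) \<and>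
    (\<forall>j\<le>N. \<forall>x\<in>A. \<forall>y\<in>A. m j x y \<noteq> 0 \<longrightarrow> \<kappa> j x = \<kappa> j y) \<and>
    (\<forall>x\<in>A. (\<Sum>j\<le>N. \<Sum>y\<in>A. m j x y) = a x) \<and> (\<forall>y\<in>A. (\<Sum>j\<le>N. \<Sum>x\<in>A. m j x y) = b y) \<and>
    (\<forall>j<N. \<forall>R. (\<Sum>x\<in>{x\<in>A. \<kappa> (Suc j) x = R}. \<Sum>y\<in>A. m j x y) \<le> \<bar>\<Sum>x\<in>{x\<in>A. \<kappa> (Suc j) x = R}. a x - b x\<bar> \<and>
      (\<Sum>y\<in>{y\<in>A. \<kappa> (Suc j) y = R}. \<Sum>x\<in>A. m j x y) \<le> \<bar>\<Sum>x\<in>{x\<in>A. \<kappa> (Suc j) x = R}. a x - b x\<bar>)"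
  using assms(2-5)
proof (induction N arbitrary: a b)
  case 0
  obtain m where m: "\<forall>x\<in>A. \<forall>y\<in>A. 0 \<le> m x y" "\<forall>x\<in>A. (\<Sum>y\<in>A. m x y) \<le> a x" "\<forall>y\<in>A. (\<Sum>x\<in>A. m x y) \<le> b y"
    "\<forall>R. (\<forall>x\<in>A. \<kappa> 0 x = R \<longrightarrow> (\<Sum>y\<in>A. m x y) = a x) \<or> (\<forall>y\<in>A. \<kappa> 0 y = R \<longrightarrow> (\<Sum>x\<in>A. m x y) = b y)"
    by (rule exE[OF cell_matching[of A a b "\<kappa> 0"]], rule A, erule 0(1), erule 0(2), elim conjE, rule that, assumption+)
  have all: "(\<forall>x\<in>A. (\<Sum>y\<in>A. m x y) = a x) \<or> (\<forall>y\<in>A. (\<Sum>x\<in>A. m x y) = b y)"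
  proof (cases "A = {}")
    case False
    then obtain x0 where x0: "x0 \<in> A" by auto
    show ?thesis using m(4)[rule_format, of "\<kappa> 0 x0"] root x0 by metis
  qed auto
  have swap: "(\<Sum>x\<in>A. \<Sum>y\<in>A. m x y) = (\<Sum>y\<in>A. \<Sum>x\<in>A. m x y)" by (rule sum.swap)
  \<comment> \<open>At the root the totals agree. Once one side is exhausted, the termwise
    inequalities of the other side sum to an equality and are therefore equalities.\<close>
  have tight: "\<forall>x\<in>A. f x = g x" if "\<forall>x\<in>A. f x \<le> g x" "(\<Sum>x\<in>A. f x) = (\<Sum>x\<in>A. g x)" for f g :: "'a \<Rightarrow> real"
    using sum_mono_inv[OF that(2)] that(1) A by auto
  have "(\<forall>x\<in>A. (\<Sum>y\<in>A. m x y) = a x) \<and> (\<forall>y\<in>A. (\<Sum>x\<in>A. m x y) = b y)"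
    using all
  proof
    assume *: "\<forall>x\<in>A. (\<Sum>y\<in>A. m x y) = a x"
    then have "(\<Sum>x\<in>A. \<Sum>y\<in>A. m x y) = (\<Sum>x\<in>A. a x)" by (intro sum.cong) auto
    then have "(\<Sum>y\<in>A. \<Sum>x\<in>A. m x y) = (\<Sum>y\<in>A. b y)" using swap 0(3) by simp
    then show ?thesis using tight[OF m(3)] * by blast
  next
    assume *: "\<forall>y\<in>A. (\<Sum>x\<in>A. m x y) = b y"
    then have "(\<Sum>y\<in>A. \<Sum>x\<in>A. m x y) = (\<Sum>y\<in>A. b y)" by (intro sum.cong) auto
    then have "(\<Sum>x\<in>A. \<Sum>y\<in>A. m x y) = (\<Sum>x\<in>A. a x)" using swap 0(3) by simp
    then show ?thesis using tight[OF m(2)] * by blast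
  qed
  then show ?case using m(1) by (intro exI[of _ "\<lambda>_. m"]) (auto intro: root)
next
  case (Suc N)
  obtain m0 where m0: "\<forall>x\<in>A. \<forall>y\<in>A. 0 \<le> m0 x y" "\<forall>x\<in>A. \<forall>y\<in>A. m0 x y \<noteq> 0 \<longrightarrow> \<kappa> (Suc N) x = \<kappa> (Suc N) y"
    "\<forall>x\<in>A. (\<Sum>y\<in>A. m0 x y) \<le> a x" "\<forall>y\<in>A. (\<Sum>x\<in>A. m0 x y) \<le> b y"
    "\<forall>R. (\<forall>x\<in>A. \<kappa> (Suc N) x = R \<longrightarrow> (\<Sum>y\<in>A. m0 x y) = a x) \<or> (\<forall>y\<in>A. \<kappa> (Suc N) y = R \<longrightarrow> (\<Sum>x\<in>A. m0 x y) = b y)"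
    by (rule exE[OF cell_matching[of A a b "\<kappa> (Suc N)"]], rule A, erule Suc.prems(1), erule Suc.prems(2),
        elim conjE, rule that, assumption+)
  \<comment> \<open>What the finest level leaves over. The induction hypothesis distributes these
    residuals over the coarser levels.\<close>
  define a' where "a' x = a x - (\<Sum>y\<in>A. m0 x y)" for x
  define b' where "b' y = b y - (\<Sum>x\<in>A. m0 x y)" for y
  have sums: "(\<Sum>x\<in>A. a' x) = (\<Sum>x\<in>A. b' x)"
    unfolding a'_def b'_def sum_subtractf using sum.swap[of m0 A A] Suc.prems(3) by simp
  have deep: "\<kappa> j x = \<kappa> j y" if "j \<le> Suc N" "x \<in> A" "y \<in> A" "\<kappa> (Suc N) x = \<kappa> (Suc N) y" for j x y
    using that(1)
  proof (induction rule: inc_induct)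
    case (step i)
    show ?case by (rule Suc.prems(4)[OF _ that(2,3) step.IH]) (use step.hyps in simp)
  qed (rule that(4))
  \<comment> \<open>The discrepancies that the induction hypothesis reports for the residuals are
    those of the original measures.\<close>
  have diff: "(\<Sum>x\<in>{x\<in>A. \<kappa> j x = R}. a' x - b' x) = (\<Sum>x\<in>{x\<in>A. \<kappa> j x = R}. a x - b x)" if j: "j \<le> Suc N" for j R
  proof -
    have "(\<Sum>x\<in>{x\<in>A. \<kappa> j x = R}. \<Sum>y\<in>A. m0 x y) = (\<Sum>y\<in>{x\<in>A. \<kappa> j x = R}. \<Sum>x\<in>A. m0 x y)"
    proof (rule sum_block_symmetric[OF A])
      fix x y assume xy: "x \<in> A" "y \<in> A" "m0 x y \<noteq> 0"
      then have "\<kappa> j x = \<kappa> j y" using deep[OF j] m0(2) by blast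
      then show "x \<in> {x\<in>A. \<kappa> j x = R} \<longleftrightarrow> y \<in> {x\<in>A. \<kappa> j x = R}" using xy by simp
    qed auto
    then show ?thesis unfolding a'_def b'_def by (simp add: sum_subtractf)
  qed
  have res0: "0 \<le> a' x" "0 \<le> b' x" if "x \<in> A" for x
    using m0(3,4) that by (auto simp: a'_def b'_def)
  \<comment> \<open>In every finest cell one residual vanishes identically, so the mass of the other
    is the absolute discrepancy of the cell. This bounds the mass that the next coarser level can
    match.\<close>
  have res: "(\<Sum>x\<in>{x\<in>A. \<kappa> (Suc N) x = R}. a' x) \<le> \<bar>\<Sum>x\<in>{x\<in>A. \<kappa> (Suc N) x = R}. a x - b x\<bar>"
    "(\<Sum>x\<in>{x\<in>A. \<kappa> (Suc N) x = R}. b' x) \<le> \<bar>\<Sum>x\<in>{x\<in>A. \<kappa> (Suc N) x = R}. a x - b x\<bar>" for R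
  proof -
    let ?C = "{x\<in>A. \<kappa> (Suc N) x = R}"
    have n: "0 \<le> (\<Sum>x\<in>?C. a' x)" "0 \<le> (\<Sum>x\<in>?C. b' x)" using res0 by (auto intro: sum_nonneg)
    have d: "(\<Sum>x\<in>?C. a' x) - (\<Sum>x\<in>?C. b' x) = (\<Sum>x\<in>?C. a x - b x)"
      using diff[of "Suc N" R] by (simp add: sum_subtractf)
    have "(\<forall>x\<in>?C. a' x = 0) \<or> (\<forall>x\<in>?C. b' x = 0)"
      using m0(5)[rule_format, of R] unfolding a'_def b'_def by auto
    then have "(\<Sum>x\<in>?C. a' x) = 0 \<or> (\<Sum>x\<in>?C. b' x) = 0" by (auto intro: sum.neutral)
    with n d show "(\<Sum>x\<in>?C. a' x) \<le> \<bar>\<Sum>x\<in>?C. a x - b x\<bar>" "(\<Sum>x\<in>?C. b' x) \<le> \<bar>\<Sum>x\<in>?C. a x - b x\<bar>"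
      by auto
  qed
  have nest': "\<And>j x y. j < N \<Longrightarrow> x \<in> A \<Longrightarrow> y \<in> A \<Longrightarrow> \<kappa> (Suc j) x = \<kappa> (Suc j) y \<Longrightarrow> \<kappa> j x = \<kappa> j y"
    using Suc.prems(4) by (meson less_SucI)
  obtain m1 where m1: "\<forall>j. \<forall>x\<in>A. \<forall>y\<in>A. 0 \<le> m1 j x y"
    "\<forall>j\<le>N. \<forall>x\<in>A. \<forall>y\<in>A. m1 j x y \<noteq> 0 \<longrightarrow> \<kappa> j x = \<kappa> j y"
    "\<forall>x\<in>A. (\<Sum>j\<le>N. \<Sum>y\<in>A. m1 j x y) = a' x" "\<forall>y\<in>A. (\<Sum>j\<le>N. \<Sum>x\<in>A. m1 j x y) = b' y"
    "\<forall>j<N. \<forall>R. (\<Sum>x\<in>{x\<in>A. \<kappa> (Suc j) x = R}. \<Sum>y\<in>A. m1 j x y) \<le> \<bar>\<Sum>x\<in>{x\<in>A. \<kappa> (Suc j) x = R}. a' x - b' x\<bar> \<and>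
      (\<Sum>y\<in>{y\<in>A. \<kappa> (Suc j) y = R}. \<Sum>x\<in>A. m1 j x y) \<le> \<bar>\<Sum>x\<in>{x\<in>A. \<kappa> (Suc j) x = R}. a' x - b' x\<bar>"
    using Suc.IH[OF res0 sums nest'] by blast
  define m where "m j = (if j = Suc N then m0 else m1 j)" for j
  show ?case
  proof (intro exI[of _ m] conjI allI ballI impI)
    fix j x y assume xy: "x \<in> A" "y \<in> A"
    show "0 \<le> m j x y" using xy m0(1) m1(1) by (auto simp: m_def)
    assume "j \<le> Suc N" "m j x y \<noteq> 0"
    then show "\<kappa> j x = \<kappa> j y" using xy m0(2) m1(2) by (auto simp: m_def le_Suc_eq split: if_splits)
  next
    fix x assume x: "x \<in> A"
    have "(\<Sum>j\<le>Suc N. \<Sum>y\<in>A. m j x y) = (\<Sum>j\<le>N. \<Sum>y\<in>A. m1 j x y) + (\<Sum>y\<in>A. m0 x y)"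
      by (simp add: m_def)
    then show "(\<Sum>j\<le>Suc N. \<Sum>y\<in>A. m j x y) = a x" using m1(3) x by (simp add: a'_def)
    have "(\<Sum>j\<le>Suc N. \<Sum>y\<in>A. m j y x) = (\<Sum>j\<le>N. \<Sum>y\<in>A. m1 j y x) + (\<Sum>y\<in>A. m0 y x)"
      by (simp add: m_def)
    then show "(\<Sum>j\<le>Suc N. \<Sum>y\<in>A. m j y x) = b x" using m1(4) x by (simp add: b'_def)
  next
    fix j R assume j: "j < Suc N"
    then have mj: "m j = m1 j" by (simp add: m_def)
    show "(\<Sum>x\<in>{x\<in>A. \<kappa> (Suc j) x = R}. \<Sum>y\<in>A. m j x y) \<le> \<bar>\<Sum>x\<in>{x\<in>A. \<kappa> (Suc j) x = R}. a x - b x\<bar>"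
    proof (cases "j = N")
      case True
      have "(\<Sum>x\<in>{x\<in>A. \<kappa> (Suc N) x = R}. \<Sum>y\<in>A. m1 N x y) \<le> (\<Sum>x\<in>{x\<in>A. \<kappa> (Suc N) x = R}. a' x)"
      proof (rule sum_mono)
        fix x assume "x \<in> {x\<in>A. \<kappa> (Suc N) x = R}"
        then have x: "x \<in> A" by simp
        have "(\<Sum>y\<in>A. m1 N x y) \<le> (\<Sum>j\<le>N. \<Sum>y\<in>A. m1 j x y)"
          using m1(1) x by (intro member_le_sum sum_nonneg) auto
        then show "(\<Sum>y\<in>A. m1 N x y) \<le> a' x" using m1(3) x by simp
      qed
      also note res(1)
      finally show ?thesis unfolding mj using True by simp
    next
      case False
      then show ?thesis using m1(5) j unfolding mj by (simp add: diff)
    qed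
    show "(\<Sum>y\<in>{y\<in>A. \<kappa> (Suc j) y = R}. \<Sum>x\<in>A. m j x y) \<le> \<bar>\<Sum>x\<in>{x\<in>A. \<kappa> (Suc j) x = R}. a x - b x\<bar>"
    proof (cases "j = N")
      case True
      have "(\<Sum>y\<in>{y\<in>A. \<kappa> (Suc N) y = R}. \<Sum>x\<in>A. m1 N x y) \<le> (\<Sum>y\<in>{y\<in>A. \<kappa> (Suc N) y = R}. b' y)"
      proof (rule sum_mono)
        fix y assume "y \<in> {y\<in>A. \<kappa> (Suc N) y = R}"
        then have y: "y \<in> A" by simp
        have "(\<Sum>x\<in>A. m1 N x y) \<le> (\<Sum>j\<le>N. \<Sum>x\<in>A. m1 j x y)"
          using m1(1) y by (intro member_le_sum[of N "{..N}" "\<lambda>j. \<Sum>x\<in>A. m1 j x y"] sum_nonneg) auto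
        then show "(\<Sum>x\<in>A. m1 N x y) \<le> b' y" using m1(4) y by simp
      qed
      also note res(2)
      finally show ?thesis unfolding mj using True by simp
    next
      case False
      then show ?thesis using m1(5) j unfolding mj by (simp add: diff)
    qed
  qed
qed

text \<open>A matrix coupling of the cell masses lifts to a coupling of the measures, by spreading each entry
  as a product measure over the two cells.\<close>

lemma partition_coupling:
  fixes f :: "vec \<Rightarrow> 'a" and \<pi> :: "'a \<Rightarrow> 'a \<Rightarrow> real"
  assumes \<mu>: "prob_on d \<mu>" and \<nu>: "prob_on d \<nu>" and A: "finite A"
    and E: "\<And>a. a \<in> A \<Longrightarrow> {x \<in> space (Rd d). f x = a} \<in> sets (Rd d)"
    and f\<mu>: "AE x in \<mu>. f x \<in> A" and f\<nu>: "AE x in \<nu>. f x \<in> A"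
    and \<pi>0: "\<And>a b. a \<in> A \<Longrightarrow> b \<in> A \<Longrightarrow> 0 \<le> \<pi> a b"
    and row: "\<And>a. a \<in> A \<Longrightarrow> (\<Sum>b\<in>A. \<pi> a b) = measure \<mu> {x \<in> space (Rd d). f x = a}"
    and col: "\<And>b. b \<in> A \<Longrightarrow> (\<Sum>a\<in>A. \<pi> a b) = measure \<nu> {x \<in> space (Rd d). f x = b}"
  shows "\<exists>\<Xi>\<in>couplings d \<mu> \<nu>. \<forall>p. tcost d p \<Xi> \<le> (\<Sum>a\<in>A. \<Sum>b\<in>A. ennreal (\<pi> a b) *
    (SUP z\<in>{z \<in> space (Rd d) \<times> space (Rd d). f (fst z) = a \<and> f (snd z) = b}. ennreal (vdist d (fst z) (snd z) powr p)))"
proof -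
  interpret \<mu>: prob_space \<mu> using \<mu> by (rule prob_onD)
  interpret \<nu>: prob_space \<nu> using \<nu> by (rule prob_onD)
  interpret \<mu>\<nu>: pair_prob_space \<mu> \<nu> ..
  define E where "E a = {x \<in> space (Rd d). f x = a}" for a
  define \<alpha> where "\<alpha> a = measure \<mu> (E a)" for a
  define \<beta> where "\<beta> a = measure \<nu> (E a)" for a
  define G where "G p a b = (SUP z\<in>{z \<in> space (Rd d) \<times> space (Rd d). f (fst z) = a \<and> f (snd z) = b}. ennreal (vdist d (fst z) (snd z) powr p))" for p a b
  have sP: "sets (\<mu> \<Otimes>\<^sub>M \<nu>) = sets (Rd d \<Otimes>\<^sub>M Rd d)"
    using prob_onD(2)[OF \<mu>] prob_onD(2)[OF \<nu>] by (rule sets_pair_measure_cong)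
  have ER: "E a \<in> sets (Rd d)" if "a \<in> A" for a unfolding E_def using E[OF that] .
  have E\<mu>: "E a \<in> sets \<mu>" and E\<nu>: "E a \<in> sets \<nu>" if "a \<in> A" for a
    using ER[OF that] prob_onD(2)[OF \<mu>] prob_onD(2)[OF \<nu>] by simp_all
  have row': "(\<Sum>b\<in>A. \<pi> a b) = \<alpha> a" if "a \<in> A" for a using row[OF that] by (simp add: \<alpha>_def E_def)
  have col': "(\<Sum>a\<in>A. \<pi> a b) = \<beta> b" if "b \<in> A" for b using col[OF that] by (simp add: \<beta>_def E_def)
  \<comment> \<open>An entry is at most its row sum and its column sum, so it vanishes when one of
    the cells has mass zero; the division in \<open>w\<close> below is then harmless.\<close>
  have \<pi>z: "\<pi> a b = 0" if "a \<in> A" "b \<in> A" "\<alpha> a = 0 \<or> \<beta> b = 0" for a b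
  proof -
    have "\<pi> a b \<le> \<alpha> a" unfolding row'[OF that(1), symmetric] using A \<pi>0 that by (intro member_le_sum) auto
    moreover have "\<pi> a b \<le> \<beta> b" unfolding col'[OF that(2), symmetric]
      using A \<pi>0 that by (intro member_le_sum[of a A "\<lambda>a. \<pi> a b"]) auto
    ultimately show ?thesis using that \<pi>0[OF that(1,2)] by auto
  qed
  define w where "w a b = \<pi> a b / (\<alpha> a * \<beta> b)" for a b
  have w0: "0 \<le> w a b" if "a \<in> A" "b \<in> A" for a b using \<pi>0[OF that] by (simp add: w_def \<alpha>_def \<beta>_def)
  have w\<pi>: "w a b * \<alpha> a * \<beta> b = \<pi> a b" if "a \<in> A" "b \<in> A" for a b
    using \<pi>z[OF that] by (auto simp: w_def)
  define h where "h z = (\<Sum>a\<in>A. \<Sum>b\<in>A. ennreal (w a b) * (indicator (E a) (fst z) * indicator (E b) (snd z)))" for z :: "vec \<times> vec"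
  have ind1: "(\<lambda>z. indicator (E a) (fst z) :: ennreal) \<in> borel_measurable (\<mu> \<Otimes>\<^sub>M \<nu>)" if "a \<in> A" for a
    using E\<mu>[OF that] by measurable
  have ind2: "(\<lambda>z. indicator (E a) (snd z) :: ennreal) \<in> borel_measurable (\<mu> \<Otimes>\<^sub>M \<nu>)" if "a \<in> A" for a
    using E\<nu>[OF that] by measurable
  have hm: "h \<in> borel_measurable (\<mu> \<Otimes>\<^sub>M \<nu>)"
    unfolding h_def by (intro borel_measurable_sum borel_measurable_times_ennreal measurable_const ind1 ind2) auto
  have hint: "(\<integral>\<^sup>+z. h z * g z \<partial>(\<mu> \<Otimes>\<^sub>M \<nu>)) = (\<Sum>a\<in>A. \<Sum>b\<in>A. ennreal (w a b) *
      (\<integral>\<^sup>+z. indicator (E a) (fst z) * indicator (E b) (snd z) * g z \<partial>(\<mu> \<Otimes>\<^sub>M \<nu>)))"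
    if g: "g \<in> borel_measurable (\<mu> \<Otimes>\<^sub>M \<nu>)" for g
  proof -
    have "(\<integral>\<^sup>+z. h z * g z \<partial>(\<mu> \<Otimes>\<^sub>M \<nu>))
      = (\<integral>\<^sup>+z. (\<Sum>a\<in>A. \<Sum>b\<in>A. ennreal (w a b) * (indicator (E a) (fst z) * indicator (E b) (snd z) * g z)) \<partial>(\<mu> \<Otimes>\<^sub>M \<nu>))"
      unfolding h_def by (intro nn_integral_cong) (simp add: sum_distrib_right mult.assoc)
    also have "\<dots> = (\<Sum>a\<in>A. \<integral>\<^sup>+z. (\<Sum>b\<in>A. ennreal (w a b) * (indicator (E a) (fst z) * indicator (E b) (snd z) * g z)) \<partial>(\<mu> \<Otimes>\<^sub>M \<nu>))"
      by (intro nn_integral_sum borel_measurable_sum borel_measurable_times_ennreal measurable_const ind1 ind2 g) auto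
    also have "\<dots> = (\<Sum>a\<in>A. \<Sum>b\<in>A. \<integral>\<^sup>+z. ennreal (w a b) * (indicator (E a) (fst z) * indicator (E b) (snd z) * g z) \<partial>(\<mu> \<Otimes>\<^sub>M \<nu>))"
      by (intro sum.cong refl nn_integral_sum borel_measurable_times_ennreal measurable_const ind1 ind2 g) auto
    also have "\<dots> = (\<Sum>a\<in>A. \<Sum>b\<in>A. ennreal (w a b) *
      (\<integral>\<^sup>+z. indicator (E a) (fst z) * indicator (E b) (snd z) * g z \<partial>(\<mu> \<Otimes>\<^sub>M \<nu>)))"
      by (intro sum.cong refl nn_integral_cmult borel_measurable_times_ennreal ind1 ind2 g) auto
    finally show ?thesis .
  qed
  have prodint: "(\<integral>\<^sup>+z. indicator S (fst z) * indicator T (snd z) \<partial>(\<mu> \<Otimes>\<^sub>M \<nu>)) = emeasure \<mu> S * emeasure \<nu> T"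
    if "S \<in> sets \<mu>" "T \<in> sets \<nu>" for S T
  proof -
    have "(\<integral>\<^sup>+z. indicator S (fst z) * indicator T (snd z) \<partial>(\<mu> \<Otimes>\<^sub>M \<nu>)) = (\<integral>\<^sup>+z. indicator (S \<times> T) z \<partial>(\<mu> \<Otimes>\<^sub>M \<nu>))"
      by (intro nn_integral_cong) (auto simp: indicator_def)
    also have "\<dots> = emeasure \<mu> S * emeasure \<nu> T"
      using that by (simp add: \<nu>.emeasure_pair_measure_Times)
    finally show ?thesis .
  qed
  have total: "(\<Sum>a\<in>A. emeasure M (S \<inter> E a)) = emeasure M S"
    if M: "sets M = sets (Rd d)" and AE: "AE x in M. f x \<in> A" and S: "S \<in> sets M" for M S
  proof -
    have sM: "space M = space (Rd d)" using M by (rule sets_eq_imp_space_eq)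
    have EM: "E a \<in> sets M" if "a \<in> A" for a using ER[OF that] M by simp
    have "(\<Sum>a\<in>A. emeasure M (S \<inter> E a)) = emeasure M (\<Union>a\<in>A. S \<inter> E a)"
    proof (rule sum_emeasure)
      show "disjoint_family_on (\<lambda>a. S \<inter> E a) A" by (auto simp: disjoint_family_on_def E_def)
    qed (use A S EM in auto)
    also have "\<dots> = emeasure M S"
    proof (rule emeasure_eq_AE)
      show "AE x in M. x \<in> (\<Union>a\<in>A. S \<inter> E a) \<longleftrightarrow> x \<in> S"
        using AE AE_space[of M] by eventually_elim (auto simp: E_def sM)
      show "(\<Union>a\<in>A. S \<inter> E a) \<in> sets M" using A S EM by (intro sets.finite_UN) auto
    qed (fact S)
    finally show ?thesis .
  qed
  define \<Xi> where "\<Xi> = density (\<mu> \<Otimes>\<^sub>M \<nu>) h"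
  have \<Xi>int: "integral\<^sup>N \<Xi> g = (\<Sum>a\<in>A. \<Sum>b\<in>A. ennreal (w a b) *
      (\<integral>\<^sup>+z. indicator (E a) (fst z) * indicator (E b) (snd z) * g z \<partial>(\<mu> \<Otimes>\<^sub>M \<nu>)))"
    if g: "g \<in> borel_measurable (\<mu> \<Otimes>\<^sub>M \<nu>)" for g
    unfolding \<Xi>_def nn_integral_density[OF hm g] by (rule hint[OF g])
  have s\<Xi>: "sets \<Xi> = sets (Rd d \<Otimes>\<^sub>M Rd d)" unfolding \<Xi>_def sets_density by (rule sP)
  have f1: "fst \<in> measurable \<Xi> (Rd d)" "snd \<in> measurable \<Xi> (Rd d)"
    by (simp_all add: measurable_cong_sets[OF s\<Xi> refl])
  have em\<mu>: "emeasure \<mu> (E a) = ennreal (\<alpha> a)" and em\<nu>: "emeasure \<nu> (E a) = ennreal (\<beta> a)" for a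
    unfolding \<alpha>_def \<beta>_def by (rule \<mu>.emeasure_eq_measure, rule \<nu>.emeasure_eq_measure)
  have "distr \<Xi> (Rd d) fst = \<mu>"
  proof (rule measure_eqI)
    fix S assume "S \<in> sets (distr \<Xi> (Rd d) fst)"
    then have S: "S \<in> sets (Rd d)" "S \<in> sets \<mu>" using prob_onD(2)[OF \<mu>] by auto
    have "emeasure (distr \<Xi> (Rd d) fst) S = (\<integral>\<^sup>+z. indicator S (fst z) \<partial>\<Xi>)"
      by (rule emeasure_distr_indicator[OF f1(1) S(1)])
    also have "\<dots> = (\<Sum>a\<in>A. \<Sum>b\<in>A. ennreal (w a b) *
      (\<integral>\<^sup>+z. indicator (E a) (fst z) * indicator (E b) (snd z) * indicator S (fst z) \<partial>(\<mu> \<Otimes>\<^sub>M \<nu>)))"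
      by (rule \<Xi>int) (use S(2) in measurable)
    also have "\<dots> = (\<Sum>a\<in>A. \<Sum>b\<in>A. ennreal (w a b) * (emeasure \<mu> (S \<inter> E a) * emeasure \<nu> (E b)))"
    proof (intro sum.cong refl)
      fix a b assume ab: "a \<in> A" "b \<in> A"
      have "(\<integral>\<^sup>+z. indicator (E a) (fst z) * indicator (E b) (snd z) * indicator S (fst z) \<partial>(\<mu> \<Otimes>\<^sub>M \<nu>))
        = (\<integral>\<^sup>+z. indicator (S \<inter> E a) (fst z) * indicator (E b) (snd z) \<partial>(\<mu> \<Otimes>\<^sub>M \<nu>))"
        by (intro nn_integral_cong) (auto simp: indicator_def)
      also have "\<dots> = emeasure \<mu> (S \<inter> E a) * emeasure \<nu> (E b)"
        using S(2) E\<mu>[OF ab(1)] E\<nu>[OF ab(2)] by (intro prodint) auto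
      finally show "ennreal (w a b) * (\<integral>\<^sup>+z. indicator (E a) (fst z) * indicator (E b) (snd z) * indicator S (fst z) \<partial>(\<mu> \<Otimes>\<^sub>M \<nu>))
        = ennreal (w a b) * (emeasure \<mu> (S \<inter> E a) * emeasure \<nu> (E b))" by simp
    qed
    also have "\<dots> = (\<Sum>a\<in>A. emeasure \<mu> (S \<inter> E a))"
    proof (rule sum.cong[OF refl])
      fix a assume a: "a \<in> A"
      let ?s = "measure \<mu> (S \<inter> E a)"
      have s: "emeasure \<mu> (S \<inter> E a) = ennreal ?s" by (rule \<mu>.emeasure_eq_measure)
      have sle: "?s \<le> \<alpha> a" unfolding \<alpha>_def using E\<mu>[OF a] by (intro \<mu>.finite_measure_mono) auto
      have "(\<Sum>b\<in>A. ennreal (w a b) * (emeasure \<mu> (S \<inter> E a) * emeasure \<nu> (E b))) = ennreal (\<Sum>b\<in>A. w a b * (?s * \<beta> b))"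
        unfolding s em\<nu> using w0[OF a] by (subst sum_ennreal[symmetric]) (auto simp: \<beta>_def ennreal_mult intro!: sum.cong)
      also have "(\<Sum>b\<in>A. w a b * (?s * \<beta> b)) = ?s"
      proof (cases "\<alpha> a = 0")
        case True
        then have "?s = 0" using sle measure_nonneg[of \<mu> "S \<inter> E a"] by linarith
        then show ?thesis by simp
      next
        case False
        have "(\<Sum>b\<in>A. w a b * (?s * \<beta> b)) = (\<Sum>b\<in>A. ?s / \<alpha> a * \<pi> a b)"
        proof (rule sum.cong[OF refl])
          fix b assume b: "b \<in> A"
          show "w a b * (?s * \<beta> b) = ?s / \<alpha> a * \<pi> a b" unfolding w\<pi>[OF a b, symmetric] using False by simp
        qed
        also have "\<dots> = ?s" unfolding sum_distrib_left[symmetric] row'[OF a] using False by simp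
        finally show ?thesis .
      qed
      finally show "(\<Sum>b\<in>A. ennreal (w a b) * (emeasure \<mu> (S \<inter> E a) * emeasure \<nu> (E b))) = emeasure \<mu> (S \<inter> E a)"
        unfolding s .
    qed
    also have "\<dots> = emeasure \<mu> S" by (rule total[OF prob_onD(2)[OF \<mu>] f\<mu> S(2)])
    finally show "emeasure (distr \<Xi> (Rd d) fst) S = emeasure \<mu> S" .
  qed (use prob_onD(2)[OF \<mu>] in simp)
  moreover have "distr \<Xi> (Rd d) snd = \<nu>"
  proof (rule measure_eqI)
    fix S assume "S \<in> sets (distr \<Xi> (Rd d) snd)"
    then have S: "S \<in> sets (Rd d)" "S \<in> sets \<nu>" using prob_onD(2)[OF \<nu>] by auto
    have "emeasure (distr \<Xi> (Rd d) snd) S = (\<integral>\<^sup>+z. indicator S (snd z) \<partial>\<Xi>)"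
      by (rule emeasure_distr_indicator[OF f1(2) S(1)])
    also have "\<dots> = (\<Sum>a\<in>A. \<Sum>b\<in>A. ennreal (w a b) *
      (\<integral>\<^sup>+z. indicator (E a) (fst z) * indicator (E b) (snd z) * indicator S (snd z) \<partial>(\<mu> \<Otimes>\<^sub>M \<nu>)))"
      by (rule \<Xi>int) (use S(2) in measurable)
    also have "\<dots> = (\<Sum>b\<in>A. \<Sum>a\<in>A. ennreal (w a b) *
      (\<integral>\<^sup>+z. indicator (E a) (fst z) * indicator (E b) (snd z) * indicator S (snd z) \<partial>(\<mu> \<Otimes>\<^sub>M \<nu>)))"
      by (rule sum.swap)
    also have "\<dots> = (\<Sum>b\<in>A. \<Sum>a\<in>A. ennreal (w a b) * (emeasure \<mu> (E a) * emeasure \<nu> (S \<inter> E b)))"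
    proof (intro sum.cong refl)
      fix a b assume ab: "a \<in> A" "b \<in> A"
      have "(\<integral>\<^sup>+z. indicator (E a) (fst z) * indicator (E b) (snd z) * indicator S (snd z) \<partial>(\<mu> \<Otimes>\<^sub>M \<nu>))
        = (\<integral>\<^sup>+z. indicator (E a) (fst z) * indicator (S \<inter> E b) (snd z) \<partial>(\<mu> \<Otimes>\<^sub>M \<nu>))"
        by (intro nn_integral_cong) (auto simp: indicator_def)
      also have "\<dots> = emeasure \<mu> (E a) * emeasure \<nu> (S \<inter> E b)"
        using S(2) E\<mu>[OF ab(1)] E\<nu>[OF ab(2)] by (intro prodint) auto
      finally show "ennreal (w a b) * (\<integral>\<^sup>+z. indicator (E a) (fst z) * indicator (E b) (snd z) * indicator S (snd z) \<partial>(\<mu> \<Otimes>\<^sub>M \<nu>))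
        = ennreal (w a b) * (emeasure \<mu> (E a) * emeasure \<nu> (S \<inter> E b))" by simp
    qed
    also have "\<dots> = (\<Sum>b\<in>A. emeasure \<nu> (S \<inter> E b))"
    proof (rule sum.cong[OF refl])
      fix b assume b: "b \<in> A"
      let ?s = "measure \<nu> (S \<inter> E b)"
      have s: "emeasure \<nu> (S \<inter> E b) = ennreal ?s" by (rule \<nu>.emeasure_eq_measure)
      have sle: "?s \<le> \<beta> b" unfolding \<beta>_def using E\<nu>[OF b] by (intro \<nu>.finite_measure_mono) auto
      have "(\<Sum>a\<in>A. ennreal (w a b) * (emeasure \<mu> (E a) * emeasure \<nu> (S \<inter> E b))) = ennreal (\<Sum>a\<in>A. w a b * (\<alpha> a * ?s))"
        unfolding s em\<mu> using w0[OF _ b] by (subst sum_ennreal[symmetric]) (auto simp: \<alpha>_def ennreal_mult intro!: sum.cong)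
      also have "(\<Sum>a\<in>A. w a b * (\<alpha> a * ?s)) = ?s"
      proof (cases "\<beta> b = 0")
        case True
        then have "?s = 0" using sle measure_nonneg[of \<nu> "S \<inter> E b"] by linarith
        then show ?thesis by simp
      next
        case False
        have "(\<Sum>a\<in>A. w a b * (\<alpha> a * ?s)) = (\<Sum>a\<in>A. ?s / \<beta> b * \<pi> a b)"
        proof (rule sum.cong[OF refl])
          fix a assume a: "a \<in> A"
          show "w a b * (\<alpha> a * ?s) = ?s / \<beta> b * \<pi> a b" unfolding w\<pi>[OF a b, symmetric] using False by simp
        qed
        also have "\<dots> = ?s" unfolding sum_distrib_left[symmetric] col'[OF b] using False by simp
        finally show ?thesis .
      qed
      finally show "(\<Sum>a\<in>A. ennreal (w a b) * (emeasure \<mu> (E a) * emeasure \<nu> (S \<inter> E b))) = emeasure \<nu> (S \<inter> E b)"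
        unfolding s .
    qed
    also have "\<dots> = emeasure \<nu> S" by (rule total[OF prob_onD(2)[OF \<nu>] f\<nu> S(2)])
    finally show "emeasure (distr \<Xi> (Rd d) snd) S = emeasure \<nu> S" .
  qed (use prob_onD(2)[OF \<nu>] in simp)
  ultimately have "\<Xi> \<in> couplings d \<mu> \<nu>" using s\<Xi> by (simp add: couplings_def)
  moreover have "tcost d p \<Xi> \<le> (\<Sum>a\<in>A. \<Sum>b\<in>A. ennreal (\<pi> a b) * G p a b)" for p
  proof -
    have vm: "(\<lambda>z. ennreal (vdist d (fst z) (snd z) powr p)) \<in> borel_measurable (\<mu> \<Otimes>\<^sub>M \<nu>)"
      unfolding measurable_cong_sets[OF sP refl] by measurable
    have "tcost d p \<Xi> = (\<Sum>a\<in>A. \<Sum>b\<in>A. ennreal (w a b) *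
      (\<integral>\<^sup>+z. indicator (E a) (fst z) * indicator (E b) (snd z) * ennreal (vdist d (fst z) (snd z) powr p) \<partial>(\<mu> \<Otimes>\<^sub>M \<nu>)))"
      unfolding tcost_def by (rule \<Xi>int[OF vm])
    also have "\<dots> \<le> (\<Sum>a\<in>A. \<Sum>b\<in>A. ennreal (\<pi> a b) * G p a b)"
    proof (intro sum_mono)
      fix a b assume ab: "a \<in> A" "b \<in> A"
      have "(\<integral>\<^sup>+z. indicator (E a) (fst z) * indicator (E b) (snd z) * ennreal (vdist d (fst z) (snd z) powr p) \<partial>(\<mu> \<Otimes>\<^sub>M \<nu>))
        \<le> (\<integral>\<^sup>+z. indicator (E a) (fst z) * indicator (E b) (snd z) * G p a b \<partial>(\<mu> \<Otimes>\<^sub>M \<nu>))"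
      proof (rule nn_integral_mono)
        fix z
        show "indicator (E a) (fst z) * indicator (E b) (snd z) * ennreal (vdist d (fst z) (snd z) powr p)
          \<le> indicator (E a) (fst z) * indicator (E b) (snd z) * G p a b"
        proof (cases "fst z \<in> E a \<and> snd z \<in> E b")
          case True
          then have "z \<in> {z \<in> space (Rd d) \<times> space (Rd d). f (fst z) = a \<and> f (snd z) = b}"
            by (simp add: E_def mem_Times_iff)
          then have "ennreal (vdist d (fst z) (snd z) powr p) \<le> G p a b" unfolding G_def by (rule SUP_upper)
          then show ?thesis by (intro mult_left_mono) auto
        qed auto
      qed
      also have "\<dots> = (\<integral>\<^sup>+z. indicator (E a) (fst z) * indicator (E b) (snd z) \<partial>(\<mu> \<Otimes>\<^sub>M \<nu>)) * G p a b"
        by (intro nn_integral_multc borel_measurable_times_ennreal ind1 ind2 ab)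
      also have "\<dots> = ennreal (\<alpha> a * \<beta> b) * G p a b"
        using prodint[OF E\<mu>[OF ab(1)] E\<nu>[OF ab(2)]] unfolding em\<mu> em\<nu> by (simp add: ennreal_mult \<alpha>_def \<beta>_def)
      finally have "ennreal (w a b) * (\<integral>\<^sup>+z. indicator (E a) (fst z) * indicator (E b) (snd z) * ennreal (vdist d (fst z) (snd z) powr p) \<partial>(\<mu> \<Otimes>\<^sub>M \<nu>))
        \<le> ennreal (w a b) * (ennreal (\<alpha> a * \<beta> b) * G p a b)" by (rule mult_left_mono) simp
      also have "\<dots> = ennreal (w a b * (\<alpha> a * \<beta> b)) * G p a b"
        using w0[OF ab] by (simp add: ennreal_mult \<alpha>_def \<beta>_def mult.assoc)
      also have "w a b * (\<alpha> a * \<beta> b) = \<pi> a b" using w\<pi>[OF ab] by (simp add: mult.assoc)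
      finally show "ennreal (w a b) * (\<integral>\<^sup>+z. indicator (E a) (fst z) * indicator (E b) (snd z) * ennreal (vdist d (fst z) (snd z) powr p) \<partial>(\<mu> \<Otimes>\<^sub>M \<nu>))
        \<le> ennreal (\<pi> a b) * G p a b" .
    qed
    finally show ?thesis .
  qed
  ultimately show ?thesis unfolding G_def by blast
qed

section \<open>Dyadic cells\<close>

definition cell :: "nat \<Rightarrow> real \<Rightarrow> nat \<Rightarrow> vec \<Rightarrow> nat \<Rightarrow> int" where
  "cell k s j x = (\<lambda>i\<in>{..<k}. \<lfloor>2 ^ j * x i / s\<rfloor>)"

definition box_cells :: "nat \<Rightarrow> int \<Rightarrow> (nat \<Rightarrow> int) set" where
  "box_cells k m = (\<Pi>\<^sub>E i\<in>{..<k}. {- m..m})"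

definition coarsen :: "nat \<Rightarrow> nat \<Rightarrow> (nat \<Rightarrow> int) \<Rightarrow> nat \<Rightarrow> int" where
  "coarsen k t a = (\<lambda>i\<in>{..<k}. a i div 2 ^ t)"

lemma finite_box_cells [simp]: "finite (box_cells k m)"
  by (simp add: box_cells_def finite_PiE)

lemma cell_measurable: "{x \<in> space (Rd k). cell k s j x = R} \<in> sets (Rd k)"
proof (cases "R \<in> extensional {..<k}")
  case True
  have "{x \<in> space (Rd k). cell k s j x = R} = {x \<in> space (Rd k). \<forall>i\<in>{..<k}. \<lfloor>2 ^ j * x i / s\<rfloor> = R i}"
    using True by (auto simp: cell_def intro!: extensionalityI[where A="{..<k}"])
  also have "\<dots> \<in> sets (Rd k)"
  proof (rule sets.sets_Collect_finite_All)
    fix i assume i: "i \<in> {..<k}"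
    have [measurable]: "(\<lambda>x. x i) \<in> borel_measurable (Rd k)"
      using i by (intro measurable_Rd_coord[of "\<lambda>x. x"]) auto
    show "{x \<in> space (Rd k). \<lfloor>2 ^ j * x i / s\<rfloor> = R i} \<in> sets (Rd k)" by measurable
  qed simp
  finally show ?thesis .
next
  case False
  then have "{x \<in> space (Rd k). cell k s j x = R} = {}" by (auto simp: cell_def)
  then show ?thesis by (simp only: sets.empty_sets)
qed

text \<open>Floors compose: the floor of \<open>y / 2^t\<close> is the integer quotient of the floor
  of \<open>y\<close> by \<open>2^t\<close>. All coarser levels are therefore functions of the
  finest index, and the coupling can be built on one finite set of cells.\<close>

lemma coarsen_cell:
  assumes "j \<le> J"
  shows "coarsen k (J - j) (cell k s J x) = cell k s j x"
proof -
  have "\<lfloor>2 ^ J * t / s\<rfloor> div 2 ^ (J - j) = \<lfloor>2 ^ j * t / s\<rfloor>" for t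
  proof -
    have "\<lfloor>2 ^ J * t / s\<rfloor> div 2 ^ (J - j) = \<lfloor>(2 ^ J * t / s) / real_of_int (2 ^ (J - j))\<rfloor>"
      by (rule floor_divide_real_eq_div[symmetric]) simp
    also have "(2 ^ J * t / s) / real_of_int (2 ^ (J - j)) = 2 ^ j * t / s"
      using assms power_add[of "2::real" j "J - j"] by simp
    finally show ?thesis .
  qed
  then show ?thesis by (auto simp: coarsen_def cell_def restrict_def fun_eq_iff)
qed

text \<open>Lets a single finite index set serve all levels: integer division by a positive number
  does not lead out of a symmetric interval.\<close>

lemma coarsen_box:
  assumes a: "a \<in> box_cells k m"
  shows "coarsen k t a \<in> box_cells k m"
proof -
  have "- m \<le> x div c \<and> x div c \<le> m" if "- m \<le> x" "x \<le> m" "1 \<le> c" for x c :: int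
  proof -
    have "x div c \<le> m div c" using that by (intro zdiv_mono1) auto
    also have "m div c \<le> m div 1" using that by (intro zdiv_mono2) auto
    finally have 1: "x div c \<le> m" by simp
    have "- m \<le> (- m) div c"
    proof (cases "m = 0")
      case False
      then have "(- m) div 1 \<le> (- m) div c" using that by (intro zdiv_mono2_neg) auto
      then show ?thesis by simp
    qed simp
    also have "\<dots> \<le> x div c" using that by (intro zdiv_mono1) auto
    finally show ?thesis using 1 by simp
  qed
  then show ?thesis using a by (auto simp: box_cells_def coarsen_def PiE_iff)
qed

lemma sum_measure_preimages:
  fixes f :: "'b \<Rightarrow> 'a"
  assumes M: "prob_space M" and A: "finite A" and AE: "AE x in M. f x \<in> A"
    and sets: "\<And>a. a \<in> A \<Longrightarrow> {x \<in> space M. f x = a} \<in> sets M" and sP: "{x \<in> space M. P (f x)} \<in> sets M"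
  shows "(\<Sum>a\<in>{a\<in>A. P a}. measure M {x \<in> space M. f x = a}) = measure M {x \<in> space M. P (f x)}"
proof -
  interpret prob_space M by fact
  have "(\<Sum>a\<in>{a\<in>A. P a}. measure M {x \<in> space M. f x = a}) = measure M (\<Union>a\<in>{a\<in>A. P a}. {x \<in> space M. f x = a})"
    using A sets by (intro finite_measure_finite_Union[symmetric]) (auto simp: disjoint_family_on_def)
  also have "\<dots> = measure M {x \<in> space M. P (f x)}"
  proof (rule measure_eq_AE)
    show "AE x in M. x \<in> (\<Union>a\<in>{a\<in>A. P a}. {x \<in> space M. f x = a}) \<longleftrightarrow> x \<in> {x \<in> space M. P (f x)}"
      using AE by eventually_elim auto
    show "(\<Union>a\<in>{a\<in>A. P a}. {x \<in> space M. f x = a}) \<in> sets M" using A sets by (intro sets.finite_UN) auto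
  qed (fact sP)
  finally show ?thesis .
qed

lemma vdist_same_cell:
  assumes "cell k s j x = cell k s j y" "0 < s"
  shows "vdist k x y \<le> sqrt (real k) * (s / 2 ^ j)"
proof -
  have "\<bar>x i - y i\<bar> \<le> s / 2 ^ j" if "i < k" for i
  proof -
    have "\<lfloor>2 ^ j * x i / s\<rfloor> = \<lfloor>2 ^ j * y i / s\<rfloor>"
      using fun_cong[OF assms(1), of i] that by (simp add: cell_def)
    then have "\<bar>2 ^ j * x i / s - 2 ^ j * y i / s\<bar> \<le> 1" by linarith
    also have "2 ^ j * x i / s - 2 ^ j * y i / s = (2 ^ j / s) * (x i - y i)" by (simp add: diff_divide_distrib algebra_simps)
    also have "\<bar>(2 ^ j / s) * (x i - y i)\<bar> = (2 ^ j / s) * \<bar>x i - y i\<bar>" using assms by (simp add: abs_mult)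
    finally show ?thesis using assms by (simp add: field_simps)
  qed
  then have "vdist k x y \<le> L2_set (\<lambda>i. s / 2 ^ j) {..<k}"
    unfolding vdist_def L2_set_def using assms by (intro real_sqrt_le_mono sum_mono abs_le_square_iff[THEN iffD1]) auto
  also have "\<dots> = sqrt (real k) * (s / 2 ^ j)" using assms by (subst L2_set_constant) auto
  finally show ?thesis .
qed

text \<open>Bounds the \<open>l^1\<close> norm, hence the Euclidean norm, of the points of a level-0
  cell. The \<open>+ 1\<close> stands inside the sum and pays for the floor in each
  coordinate.\<close>

definition cell_radius :: "nat \<Rightarrow> real \<Rightarrow> (nat \<Rightarrow> int) \<Rightarrow> real" where
  "cell_radius k s R = s * (\<Sum>i<k. real_of_int \<bar>R i\<bar> + 1)"

lemma sum_abs_le_cell_radius: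
  assumes "0 < s"
  shows "(\<Sum>i<k. \<bar>x i\<bar>) \<le> cell_radius k s (cell k s 0 x)"
proof -
  have "\<bar>x i\<bar> \<le> s * (real_of_int \<bar>cell k s 0 x i\<bar> + 1)" if "i < k" for i
  proof -
    have "\<bar>x i / s\<bar> \<le> real_of_int \<bar>\<lfloor>x i / s\<rfloor>\<bar> + 1" by linarith
    then have "s * \<bar>x i / s\<bar> \<le> s * (real_of_int \<bar>\<lfloor>x i / s\<rfloor>\<bar> + 1)" using assms by (intro mult_left_mono) auto
    then show ?thesis using assms that by (simp add: cell_def abs_divide)
  qed
  then show ?thesis unfolding cell_radius_def sum_distrib_left by (intro sum_mono) auto
qed

lemma powr_add_le_double:
  fixes u v p :: real
  assumes "0 \<le> u" "0 \<le> v" "0 \<le> p"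
  shows "(u + v) powr p \<le> 2 powr p * (u powr p + v powr p)"
proof -
  have "(u + v) powr p \<le> (2 * max u v) powr p" using assms by (intro powr_mono2) auto
  also have "\<dots> = 2 powr p * max u v powr p" using assms by (simp add: powr_mult)
  also have "\<dots> \<le> 2 powr p * (u powr p + v powr p)" by (intro mult_left_mono) (auto simp: max_def)
  finally show ?thesis .
qed

text \<open>Mass matched inside a cell of level \<open>i\<close> travels at most
  \<open>sqrt k * s / 2^i\<close>, and below the finest level only the discrepancy left over at
  level \<open>i + 1\<close> is matched there; at level \<open>J\<close> the whole mass 1 is allowed
  for. What remains at the root is matched globally, at a cost bounded through the radii of the two
  level-0 cells.\<close>

lemma multiscale_coupling:
  assumes \<mu>: "prob_on k \<mu>" and \<nu>: "prob_on k \<nu>" and s: "0 < s" and p: "1 \<le> p"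
    and b\<mu>: "AE x in \<mu>. cell k s J x \<in> box_cells k m" and b\<nu>: "AE x in \<nu>. cell k s J x \<in> box_cells k m"
  defines "\<Delta> \<equiv> \<lambda>j R. \<bar>measure \<mu> {x \<in> space (Rd k). cell k s j x = R} - measure \<nu> {x \<in> space (Rd k). cell k s j x = R}\<bar>"
  shows "\<exists>\<Xi>\<in>couplings k \<mu> \<nu>. tcost k p \<Xi> \<le> ennreal (
    (sqrt (real k) * s) powr p * ((\<Sum>i<J. 2 powr (- (real i * p)) * (\<Sum>R\<in>box_cells k m. \<Delta> (Suc i) R)) + 2 powr (- (real J * p)))
    + 2 powr (p + 1) * (\<Sum>R\<in>box_cells k m. cell_radius k s R powr p * \<Delta> 0 R))"
proof -
  let ?A = "box_cells k m" and ?f = "cell k s J"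
  define E where "E a = {x \<in> space (Rd k). ?f x = a}" for a
  define \<alpha> where "\<alpha> a = measure \<mu> (E a)" for a
  define \<beta> where "\<beta> a = measure \<nu> (E a)" for a
  \<comment> \<open>Shifted by one: tree level \<open>Suc i\<close> is dyadic level
    \<open>i\<close>, and tree level 0 is a single artificial cell that joins all dyadic cells of
    level 0.\<close>
  define \<kappa> where "\<kappa> j a = (case j of 0 \<Rightarrow> (\<lambda>_. 0) | Suc i \<Rightarrow> coarsen k (J - i) a)" for j a
  have \<kappa>S: "\<kappa> (Suc i) a = coarsen k (J - i) a" for i a by (simp add: \<kappa>_def)
  have A: "finite ?A" by simp
  have mass: "(\<Sum>a\<in>{a\<in>?A. \<kappa> (Suc j) a = R}. measure M (E a)) = measure M {x \<in> space (Rd k). cell k s j x = R}"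
    if M: "prob_on k M" "AE x in M. ?f x \<in> ?A" and j: "j \<le> J" for M j R
  proof -
    have sp: "space M = space (Rd k)" by (rule prob_on_space[OF M(1)])
    have eq: "\<kappa> (Suc j) (?f x) = cell k s j x" for x unfolding \<kappa>S by (rule coarsen_cell[OF j])
    have "(\<Sum>a\<in>{a\<in>?A. \<kappa> (Suc j) a = R}. measure M {x \<in> space M. ?f x = a}) = measure M {x \<in> space M. \<kappa> (Suc j) (?f x) = R}"
    proof (rule sum_measure_preimages[where P="\<lambda>a. \<kappa> (Suc j) a = R"])
      show "{x \<in> space M. ?f x = a} \<in> sets M" for a
        unfolding sp prob_onD(2)[OF M(1)] by (rule cell_measurable)
      show "{x \<in> space M. \<kappa> (Suc j) (?f x) = R} \<in> sets M"
        unfolding sp prob_onD(2)[OF M(1)] eq by (rule cell_measurable)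
    qed (use M prob_onD(1)[OF M(1)] in simp_all)
    then show ?thesis unfolding E_def sp eq .
  qed
  have total: "(\<Sum>a\<in>?A. measure M (E a)) = 1" if M: "prob_on k M" "AE x in M. ?f x \<in> ?A" for M
  proof -
    interpret prob_space M using M(1) by (rule prob_onD)
    have sp: "space M = space (Rd k)" by (rule prob_on_space[OF M(1)])
    have "(\<Sum>a\<in>{a\<in>?A. True}. measure M {x \<in> space M. ?f x = a}) = measure M {x \<in> space M. True}"
      using M cell_measurable by (intro sum_measure_preimages[where P="\<lambda>_. True"]) (auto simp: sp prob_onD)
    then show ?thesis unfolding E_def sp[symmetric] by (simp add: prob_space)
  qed
  have tot: "(\<Sum>a\<in>?A. \<alpha> a) = 1" "(\<Sum>a\<in>?A. \<beta> a) = 1"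
    unfolding \<alpha>_def \<beta>_def using total[OF \<mu> b\<mu>] total[OF \<nu> b\<nu>] by auto
  have \<delta>: "\<bar>\<Sum>a\<in>{a\<in>?A. \<kappa> (Suc j) a = R}. \<alpha> a - \<beta> a\<bar> = \<Delta> j R" if j: "j \<le> J" for j R
    unfolding sum_subtractf \<alpha>_def \<beta>_def mass[OF \<mu> b\<mu> j] mass[OF \<nu> b\<nu> j] \<Delta>_def ..
  have nested: "\<kappa> j a = \<kappa> j b" if j: "j < Suc J" and ab: "\<kappa> (Suc j) a = \<kappa> (Suc j) b" for j a b
  proof (cases j)
    case (Suc i)
    have eq: "J - i = Suc (J - Suc i)" using j Suc by simp
    have "a l div 2 ^ (J - i) = b l div 2 ^ (J - i)" if "l < k" for l
    proof -
      have "a l div 2 ^ (J - Suc i) = b l div 2 ^ (J - Suc i)"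
        using fun_cong[OF ab, of l] that Suc by (simp add: \<kappa>S coarsen_def)
      then show ?thesis unfolding eq power_Suc2 by (simp add: zdiv_zmult2_eq)
    qed
    then show ?thesis unfolding Suc \<kappa>S coarsen_def by (auto simp: restrict_def fun_eq_iff)
  qed (simp add: \<kappa>_def)
  have "\<exists>M. (\<forall>j. \<forall>x\<in>?A. \<forall>y\<in>?A. 0 \<le> M j x y) \<and>
    (\<forall>j\<le>Suc J. \<forall>x\<in>?A. \<forall>y\<in>?A. M j x y \<noteq> 0 \<longrightarrow> \<kappa> j x = \<kappa> j y) \<and>
    (\<forall>x\<in>?A. (\<Sum>j\<le>Suc J. \<Sum>y\<in>?A. M j x y) = \<alpha> x) \<and> (\<forall>y\<in>?A. (\<Sum>j\<le>Suc J. \<Sum>x\<in>?A. M j x y) = \<beta> y) \<and>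
    (\<forall>j<Suc J. \<forall>R. (\<Sum>x\<in>{x\<in>?A. \<kappa> (Suc j) x = R}. \<Sum>y\<in>?A. M j x y) \<le> \<bar>\<Sum>x\<in>{x\<in>?A. \<kappa> (Suc j) x = R}. \<alpha> x - \<beta> x\<bar> \<and>
      (\<Sum>y\<in>{y\<in>?A. \<kappa> (Suc j) y = R}. \<Sum>x\<in>?A. M j x y) \<le> \<bar>\<Sum>x\<in>{x\<in>?A. \<kappa> (Suc j) x = R}. \<alpha> x - \<beta> x\<bar>)"
  proof (rule tree_coupling)
    show "0 \<le> \<alpha> x" "0 \<le> \<beta> x" for x by (auto simp: \<alpha>_def \<beta>_def)
    show "(\<Sum>x\<in>?A. \<alpha> x) = (\<Sum>x\<in>?A. \<beta> x)" using tot by simp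
    show "\<kappa> 0 x = \<kappa> 0 y" for x y by (simp add: \<kappa>_def)
    show "\<kappa> j x = \<kappa> j y" if "j < Suc J" "\<kappa> (Suc j) x = \<kappa> (Suc j) y" for j x y
      using that by (rule nested)
  qed (rule A)
  then obtain M where MM: "\<forall>j. \<forall>x\<in>?A. \<forall>y\<in>?A. 0 \<le> M j x y"
    "\<forall>j\<le>Suc J. \<forall>x\<in>?A. \<forall>y\<in>?A. M j x y \<noteq> 0 \<longrightarrow> \<kappa> j x = \<kappa> j y"
    "\<forall>x\<in>?A. (\<Sum>j\<le>Suc J. \<Sum>y\<in>?A. M j x y) = \<alpha> x" "\<forall>y\<in>?A. (\<Sum>j\<le>Suc J. \<Sum>x\<in>?A. M j x y) = \<beta> y"
    "\<forall>j<Suc J. \<forall>R. (\<Sum>x\<in>{x\<in>?A. \<kappa> (Suc j) x = R}. \<Sum>y\<in>?A. M j x y) \<le> \<bar>\<Sum>x\<in>{x\<in>?A. \<kappa> (Suc j) x = R}. \<alpha> x - \<beta> x\<bar> \<and>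
      (\<Sum>y\<in>{y\<in>?A. \<kappa> (Suc j) y = R}. \<Sum>x\<in>?A. M j x y) \<le> \<bar>\<Sum>x\<in>{x\<in>?A. \<kappa> (Suc j) x = R}. \<alpha> x - \<beta> x\<bar>"
    by - (elim exE conjE, rule that, assumption+)
  have M0: "0 \<le> M j x y" if "x \<in> ?A" "y \<in> ?A" for j x y using MM(1) that by blast
  have Ms: "\<kappa> j x = \<kappa> j y" if "j \<le> Suc J" "x \<in> ?A" "y \<in> ?A" "M j x y \<noteq> 0" for j x y using MM(2) that by blast
  note Mr = bspec[OF MM(3)] and Mc = bspec[OF MM(4)]
  have Mbr: "(\<Sum>x\<in>{x\<in>?A. \<kappa> (Suc j) x = R}. \<Sum>y\<in>?A. M j x y) \<le> \<Delta> j R"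
    and Mbc: "(\<Sum>y\<in>{y\<in>?A. \<kappa> (Suc j) y = R}. \<Sum>x\<in>?A. M j x y) \<le> \<Delta> j R" if "j \<le> J" for j R
    using MM(5)[rule_format, of j R] that unfolding \<delta>[OF that] by simp_all
  define \<pi> where "\<pi> x y = (\<Sum>j\<le>Suc J. M j x y)" for x y
  have \<pi>r: "(\<Sum>y\<in>?A. \<pi> x y) = \<alpha> x" if "x \<in> ?A" for x
    unfolding \<pi>_def Mr[OF that, symmetric] by (rule sum.swap)
  have \<pi>c: "(\<Sum>x\<in>?A. \<pi> x y) = \<beta> y" if "y \<in> ?A" for y
    unfolding \<pi>_def Mc[OF that, symmetric] by (rule sum.swap)
  define G where "G a b = (SUP z\<in>{z \<in> space (Rd k) \<times> space (Rd k). ?f (fst z) = a \<and> ?f (snd z) = b}. ennreal (vdist k (fst z) (snd z) powr p))" for a b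
  have "\<exists>\<Xi>\<in>couplings k \<mu> \<nu>. \<forall>p. tcost k p \<Xi> \<le> (\<Sum>a\<in>?A. \<Sum>b\<in>?A. ennreal (\<pi> a b) *
    (SUP z\<in>{z \<in> space (Rd k) \<times> space (Rd k). ?f (fst z) = a \<and> ?f (snd z) = b}. ennreal (vdist k (fst z) (snd z) powr p)))"
  proof (rule partition_coupling[OF \<mu> \<nu> A cell_measurable b\<mu> b\<nu>])
    fix a assume a: "a \<in> ?A"
    show "0 \<le> \<pi> a b" if "b \<in> ?A" for b unfolding \<pi>_def by (intro sum_nonneg M0 a that)
    show "(\<Sum>b\<in>?A. \<pi> a b) = measure \<mu> {x \<in> space (Rd k). ?f x = a}"
      using \<pi>r[OF a] unfolding \<alpha>_def E_def .
    show "(\<Sum>b\<in>?A. \<pi> b a) = measure \<nu> {x \<in> space (Rd k). ?f x = a}"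
      using \<pi>c[OF a] unfolding \<beta>_def E_def .
  qed
  then obtain \<Xi> where \<Xi>: "\<Xi> \<in> couplings k \<mu> \<nu>" "tcost k p \<Xi> \<le> (\<Sum>a\<in>?A. \<Sum>b\<in>?A. ennreal (\<pi> a b) * G a b)"
    unfolding G_def by blast
  define W where "W R = cell_radius k s R powr p" for R
  \<comment> \<open>Price per unit of mass at tree level \<open>j\<close>: a power of the cell
    diameter, or, at the root, a bound through the distances of the two cells to the origin.\<close>
  define g where "g j a b = (case j of 0 \<Rightarrow> 2 powr p * (W (\<kappa> 1 a) + W (\<kappa> 1 b))
     | Suc i \<Rightarrow> (sqrt (real k) * s) powr p * 2 powr (- (real i * p)))" for j a b
  have W0: "0 \<le> W R" for R by (simp add: W_def)
  have g0: "0 \<le> g j a b" for j a b using W0 by (auto simp: g_def split: nat.split)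
  have Gg: "G a b \<le> ennreal (g j a b)" if j: "j \<le> Suc J" and ab: "\<kappa> j a = \<kappa> j b" for j a b
    unfolding G_def
  proof (rule SUP_least)
    fix z assume "z \<in> {z \<in> space (Rd k) \<times> space (Rd k). ?f (fst z) = a \<and> ?f (snd z) = b}"
    then have z: "?f (fst z) = a" "?f (snd z) = b" by auto
    have "vdist k (fst z) (snd z) powr p \<le> g j a b"
    proof (cases j)
      case 0
      have k1: "\<kappa> 1 a = cell k s 0 (fst z)" "\<kappa> 1 b = cell k s 0 (snd z)"
        using coarsen_cell[of 0 J k s] z by (auto simp: \<kappa>_def)
      have "vdist k (fst z) (snd z) \<le> (\<Sum>i<k. \<bar>fst z i - snd z i\<bar>)" by (rule vdist_le_sum_abs)
      also have "\<dots> \<le> (\<Sum>i<k. \<bar>fst z i\<bar>) + (\<Sum>i<k. \<bar>snd z i\<bar>)"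
        unfolding sum.distrib[symmetric] by (intro sum_mono) linarith
      also have "\<dots> \<le> cell_radius k s (\<kappa> 1 a) + cell_radius k s (\<kappa> 1 b)"
        unfolding k1 by (intro add_mono sum_abs_le_cell_radius s)
      finally have "vdist k (fst z) (snd z) powr p \<le> (cell_radius k s (\<kappa> 1 a) + cell_radius k s (\<kappa> 1 b)) powr p"
        using p by (intro powr_mono2) auto
      also have "\<dots> \<le> 2 powr p * (W (\<kappa> 1 a) + W (\<kappa> 1 b))"
        unfolding W_def using s p by (intro powr_add_le_double) (auto simp: cell_radius_def intro!: mult_nonneg_nonneg sum_nonneg)
      finally show ?thesis using 0 by (simp add: g_def)
    next
      case (Suc i)
      then have i: "i \<le> J" using j by simp
      have "cell k s i (fst z) = cell k s i (snd z)"
        using ab z coarsen_cell[OF i, of k s] unfolding Suc \<kappa>S by metis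
      then have "vdist k (fst z) (snd z) \<le> sqrt (real k) * s * (1 / 2 ^ i)"
        using vdist_same_cell[OF _ s] by simp
      then have "vdist k (fst z) (snd z) powr p \<le> (sqrt (real k) * s * (1 / 2 ^ i)) powr p"
        using p by (intro powr_mono2) auto
      also have "\<dots> = (sqrt (real k) * s) powr p * (1 / 2 ^ i) powr p"
        using s by (intro powr_mult)
      also have "(1 / 2 ^ i) powr p = 2 powr (- (real i * p))"
        by (simp add: powr_realpow[symmetric] powr_minus_divide[symmetric] powr_powr)
      finally show ?thesis unfolding Suc by (simp add: g_def)
    qed
    then show "ennreal (vdist k (fst z) (snd z) powr p) \<le> ennreal (g j a b)" by (rule ennreal_leI)
  qed
  have "tcost k p \<Xi> \<le> (\<Sum>a\<in>?A. \<Sum>b\<in>?A. ennreal (\<pi> a b) * G a b)" by (rule \<Xi>(2))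
  also have "\<dots> \<le> (\<Sum>a\<in>?A. \<Sum>b\<in>?A. ennreal (\<Sum>j\<le>Suc J. M j a b * g j a b))"
  proof (intro sum_mono)
    fix a b assume ab: "a \<in> ?A" "b \<in> ?A"
    have "ennreal (\<pi> a b) * G a b = (\<Sum>j\<le>Suc J. ennreal (M j a b) * G a b)"
      unfolding \<pi>_def sum_distrib_right[symmetric]
      by (rule arg_cong[where f="\<lambda>t. t * G a b"]) (rule sum_ennreal[symmetric], rule M0[OF ab])
    also have "\<dots> \<le> (\<Sum>j\<le>Suc J. ennreal (M j a b * g j a b))"
    proof (rule sum_mono)
      fix j assume j: "j \<in> {..Suc J}"
      show "ennreal (M j a b) * G a b \<le> ennreal (M j a b * g j a b)"
      proof (cases "M j a b = 0")
        case False
        then have "G a b \<le> ennreal (g j a b)" using j ab by (intro Gg Ms) auto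
        then show ?thesis using M0[OF ab] g0 by (simp add: ennreal_mult mult_left_mono)
      qed simp
    qed
    also have "\<dots> = ennreal (\<Sum>j\<le>Suc J. M j a b * g j a b)"
      using M0[OF ab] g0 by (intro sum_ennreal) auto
    finally show "ennreal (\<pi> a b) * G a b \<le> ennreal (\<Sum>j\<le>Suc J. M j a b * g j a b)" .
  qed
  also have "\<dots> = ennreal (\<Sum>a\<in>?A. \<Sum>b\<in>?A. \<Sum>j\<le>Suc J. M j a b * g j a b)"
  proof -
    have h0: "0 \<le> (\<Sum>j\<le>Suc J. M j a b * g j a b)" if "a \<in> ?A" "b \<in> ?A" for a b
      by (intro sum_nonneg mult_nonneg_nonneg M0 g0 that)
    have "(\<Sum>a\<in>?A. \<Sum>b\<in>?A. ennreal (\<Sum>j\<le>Suc J. M j a b * g j a b)) = (\<Sum>a\<in>?A. ennreal (\<Sum>b\<in>?A. \<Sum>j\<le>Suc J. M j a b * g j a b))"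
      by (rule sum.cong[OF refl], rule sum_ennreal, rule h0)
    also have "\<dots> = ennreal (\<Sum>a\<in>?A. \<Sum>b\<in>?A. \<Sum>j\<le>Suc J. M j a b * g j a b)"
      by (rule sum_ennreal, rule sum_nonneg, rule h0)
    finally show ?thesis .
  qed
  also have "\<dots> \<le> ennreal ((sqrt (real k) * s) powr p * ((\<Sum>i<J. 2 powr (- (real i * p)) * (\<Sum>R\<in>?A. \<Delta> (Suc i) R)) + 2 powr (- (real J * p)))
    + 2 powr (p + 1) * (\<Sum>R\<in>?A. W R * \<Delta> 0 R))"
  proof (rule ennreal_leI)
    have \<kappa>A: "\<kappa> (Suc i) ` ?A \<subseteq> ?A" for i unfolding \<kappa>S using coarsen_box by blast
    have group: "(\<Sum>a\<in>?A. h (\<kappa> (Suc i) a) * q a) = (\<Sum>R\<in>?A. h R * (\<Sum>a\<in>{a\<in>?A. \<kappa> (Suc i) a = R}. q a))" for i and h q :: "(nat \<Rightarrow> int) \<Rightarrow> real"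
    proof -
      have "(\<Sum>a\<in>?A. h (\<kappa> (Suc i) a) * q a) = (\<Sum>R\<in>?A. \<Sum>a\<in>{a\<in>?A. \<kappa> (Suc i) a = R}. h (\<kappa> (Suc i) a) * q a)"
        by (rule sum.group[OF A A \<kappa>A, symmetric])
      also have "\<dots> = (\<Sum>R\<in>?A. h R * (\<Sum>a\<in>{a\<in>?A. \<kappa> (Suc i) a = R}. q a))"
        unfolding sum_distrib_left by (intro sum.cong) auto
      finally show ?thesis .
    qed
    \<comment> \<open>The price splits into one term per endpoint; row sums control the first,
      column sums the second.\<close>
    have root: "(\<Sum>a\<in>?A. \<Sum>b\<in>?A. M 0 a b * g 0 a b) \<le> 2 powr (p + 1) * (\<Sum>R\<in>?A. W R * \<Delta> 0 R)"
    proof -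
      have "(\<Sum>a\<in>?A. \<Sum>b\<in>?A. M 0 a b * g 0 a b)
        = 2 powr p * ((\<Sum>a\<in>?A. \<Sum>b\<in>?A. W (\<kappa> (Suc 0) a) * M 0 a b) + (\<Sum>a\<in>?A. \<Sum>b\<in>?A. W (\<kappa> (Suc 0) b) * M 0 a b))"
        unfolding sum.distrib[symmetric] sum_distrib_left by (simp add: g_def algebra_simps)
      also have "(\<Sum>a\<in>?A. \<Sum>b\<in>?A. W (\<kappa> (Suc 0) a) * M 0 a b) = (\<Sum>R\<in>?A. W R * (\<Sum>a\<in>{a\<in>?A. \<kappa> (Suc 0) a = R}. \<Sum>b\<in>?A. M 0 a b))"
        unfolding sum_distrib_left[symmetric] by (rule group)
      also have "(\<Sum>a\<in>?A. \<Sum>b\<in>?A. W (\<kappa> (Suc 0) b) * M 0 a b) = (\<Sum>b\<in>?A. W (\<kappa> (Suc 0) b) * (\<Sum>a\<in>?A. M 0 a b))"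
        unfolding sum_distrib_left by (rule sum.swap)
      also have "\<dots> = (\<Sum>R\<in>?A. W R * (\<Sum>b\<in>{b\<in>?A. \<kappa> (Suc 0) b = R}. \<Sum>a\<in>?A. M 0 a b))" by (rule group)
      also have "2 powr p * ((\<Sum>R\<in>?A. W R * (\<Sum>a\<in>{a\<in>?A. \<kappa> (Suc 0) a = R}. \<Sum>b\<in>?A. M 0 a b)) + \<dots>)
        \<le> 2 powr p * ((\<Sum>R\<in>?A. W R * \<Delta> 0 R) + (\<Sum>R\<in>?A. W R * \<Delta> 0 R))"
        by (intro mult_left_mono add_mono sum_mono Mbr Mbc W0) auto
      also have "\<dots> = 2 powr (p + 1) * (\<Sum>R\<in>?A. W R * \<Delta> 0 R)" by (simp add: powr_add)
      finally show ?thesis .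
    qed
    have inner: "(\<Sum>a\<in>?A. \<Sum>b\<in>?A. M (Suc i) a b) \<le> (\<Sum>R\<in>?A. \<Delta> (Suc i) R)" if i: "i < J" for i
    proof -
      have "(\<Sum>a\<in>?A. \<Sum>b\<in>?A. M (Suc i) a b) = (\<Sum>R\<in>?A. \<Sum>a\<in>{a\<in>?A. \<kappa> (Suc (Suc i)) a = R}. \<Sum>b\<in>?A. M (Suc i) a b)"
        using group[of "\<lambda>_. 1" "Suc i"] by simp
      also have "\<dots> \<le> (\<Sum>R\<in>?A. \<Delta> (Suc i) R)"
        using i by (intro sum_mono Mbr) auto
      finally show ?thesis .
    qed
    have last: "(\<Sum>a\<in>?A. \<Sum>b\<in>?A. M (Suc J) a b) \<le> 1"
    proof -
      have "(\<Sum>a\<in>?A. \<Sum>b\<in>?A. M (Suc J) a b) \<le> (\<Sum>a\<in>?A. \<alpha> a)"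
      proof (rule sum_mono)
        fix a assume a: "a \<in> ?A"
        show "(\<Sum>b\<in>?A. M (Suc J) a b) \<le> \<alpha> a"
          unfolding Mr[OF a, symmetric] using M0[OF a] by (intro member_le_sum[of "Suc J"] sum_nonneg) auto
      qed
      then show ?thesis using tot by simp
    qed
    define K where "K = (sqrt (real k) * s) powr p"
    have K0: "0 \<le> K" by (simp add: K_def)
    have "(\<Sum>a\<in>?A. \<Sum>b\<in>?A. \<Sum>j\<le>Suc J. M j a b * g j a b) = (\<Sum>j\<le>Suc J. \<Sum>a\<in>?A. \<Sum>b\<in>?A. M j a b * g j a b)"
      by (subst sum.swap[of _ "{..Suc J}"]) (intro sum.cong refl sum.swap)
    also have "\<dots> = (\<Sum>a\<in>?A. \<Sum>b\<in>?A. M 0 a b * g 0 a b) + (\<Sum>i\<le>J. \<Sum>a\<in>?A. \<Sum>b\<in>?A. M (Suc i) a b * g (Suc i) a b)"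
      by (rule sum.atMost_Suc_shift)
    also have "(\<Sum>i\<le>J. \<Sum>a\<in>?A. \<Sum>b\<in>?A. M (Suc i) a b * g (Suc i) a b)
      = (\<Sum>i\<le>J. K * 2 powr (- (real i * p)) * (\<Sum>a\<in>?A. \<Sum>b\<in>?A. M (Suc i) a b))"
      unfolding K_def sum_distrib_left by (intro sum.cong refl) (simp add: g_def mult.commute)
    also have "\<dots> = (\<Sum>i<J. K * 2 powr (- (real i * p)) * (\<Sum>a\<in>?A. \<Sum>b\<in>?A. M (Suc i) a b))
      + K * 2 powr (- (real J * p)) * (\<Sum>a\<in>?A. \<Sum>b\<in>?A. M (Suc J) a b)"
      by (simp add: lessThan_Suc_atMost[symmetric])
    also have "(\<Sum>a\<in>?A. \<Sum>b\<in>?A. M 0 a b * g 0 a b) + \<dots> \<le> 2 powr (p + 1) * (\<Sum>R\<in>?A. W R * \<Delta> 0 R)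
      + ((\<Sum>i<J. K * 2 powr (- (real i * p)) * (\<Sum>R\<in>?A. \<Delta> (Suc i) R)) + K * 2 powr (- (real J * p)) * 1)"
    proof (intro add_mono root)
      show "(\<Sum>i<J. K * 2 powr (- (real i * p)) * (\<Sum>a\<in>?A. \<Sum>b\<in>?A. M (Suc i) a b))
        \<le> (\<Sum>i<J. K * 2 powr (- (real i * p)) * (\<Sum>R\<in>?A. \<Delta> (Suc i) R))"
        by (rule sum_mono, rule mult_left_mono, rule inner) (use K0 in auto)
      show "K * 2 powr (- (real J * p)) * (\<Sum>a\<in>?A. \<Sum>b\<in>?A. M (Suc J) a b) \<le> K * 2 powr (- (real J * p)) * 1"
        by (rule mult_left_mono[OF last]) (use K0 in auto)
    qed
    also have "\<dots> = K * ((\<Sum>i<J. 2 powr (- (real i * p)) * (\<Sum>R\<in>?A. \<Delta> (Suc i) R)) + 2 powr (- (real J * p)))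
      + 2 powr (p + 1) * (\<Sum>R\<in>?A. W R * \<Delta> 0 R)"
      by (simp add: distrib_left sum_distrib_left mult.assoc)
    finally show "(\<Sum>a\<in>?A. \<Sum>b\<in>?A. \<Sum>j\<le>Suc J. M j a b * g j a b)
      \<le> (sqrt (real k) * s) powr p * ((\<Sum>i<J. 2 powr (- (real i * p)) * (\<Sum>R\<in>?A. \<Delta> (Suc i) R)) + 2 powr (- (real J * p)))
      + 2 powr (p + 1) * (\<Sum>R\<in>?A. W R * \<Delta> 0 R)" unfolding K_def .
  qed
  finally show ?thesis using \<Xi>(1) unfolding W_def by blast
qed

section \<open>Mean distance of an empirical measure\<close>

text \<open>Integrating the last coordinate kills the cross term, as \<open>h\<close> is
  centred.\<close>

lemma second_moment_sum_samples:
  fixes h :: "'a \<Rightarrow> real"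
  assumes M: "prob_space M" and h: "h \<in> borel_measurable M" and bd: "\<And>x. x \<in> space M \<Longrightarrow> \<bar>h x\<bar> \<le> B"
    and mean: "(\<integral>x. h x \<partial>M) = 0"
  shows "(\<integral>x. (\<Sum>i<n. h (x i))\<^sup>2 \<partial>Pi\<^sub>M {..<n} (\<lambda>_. M)) = real n * (\<integral>x. (h x)\<^sup>2 \<partial>M)"
proof (induction n)
  case (Suc n)
  interpret M: prob_space M by fact
  interpret PP: product_sigma_finite "\<lambda>_. M" by standard
  interpret P: prob_space "Pi\<^sub>M {..<n} (\<lambda>_. M)" by (rule prob_space_PiM) (rule M)
  interpret P': prob_space "Pi\<^sub>M {..<Suc n} (\<lambda>_. M)" by (rule prob_space_PiM) (rule M)
  have ins: "{..<Suc n} = insert n {..<n}" by auto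
  have bd2: "\<bar>h x\<bar> \<le> \<bar>B\<bar>" if "x \<in> space M" for x using bd[OF that] by linarith
  have hm: "(\<lambda>x. h (x i)) \<in> borel_measurable (Pi\<^sub>M {..<m} (\<lambda>_. M))" if "i < m" for i m
    using measurable_compose[OF measurable_component_singleton[of i "{..<m}" "\<lambda>_. M"] h] that by simp
  have Sm: "(\<lambda>x. (\<Sum>i<m. h (x i))\<^sup>2) \<in> borel_measurable (Pi\<^sub>M {..<m} (\<lambda>_. M))" for m
    by (intro borel_measurable_power borel_measurable_sum hm) simp
  have Sb: "\<bar>(\<Sum>i<m. h (x i))\<^sup>2\<bar> \<le> (real m * \<bar>B\<bar>)\<^sup>2" if "x \<in> space (Pi\<^sub>M {..<m} (\<lambda>_. M))" for m x
  proof -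
    have "\<bar>\<Sum>i<m. h (x i)\<bar> \<le> (\<Sum>i<m. \<bar>h (x i)\<bar>)" by (rule sum_abs)
    also have "\<dots> \<le> (\<Sum>i<m. \<bar>B\<bar>)" using that by (intro sum_mono bd2) (auto simp: space_PiM)
    finally have "\<bar>\<Sum>i<m. h (x i)\<bar> \<le> \<bar>real m * \<bar>B\<bar>\<bar>" by simp
    then show ?thesis by (simp only: abs_le_square_iff abs_power2)
  qed
  have int: "integrable (Pi\<^sub>M {..<m} (\<lambda>_. M)) (\<lambda>x. (\<Sum>i<m. h (x i))\<^sup>2)" for m :: nat
  proof -
    interpret Q: prob_space "Pi\<^sub>M {..<m} (\<lambda>_. M)" by (rule prob_space_PiM) (rule M)
    show ?thesis by (rule Q.integrable_const_bound[where B="(real m * \<bar>B\<bar>)\<^sup>2"]) (use Sb Sm in auto)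
  qed
  have hi: "integrable M h" by (rule M.integrable_const_bound[where B=B]) (use bd h in auto)
  have h2i: "integrable M (\<lambda>x. (h x)\<^sup>2)"
  proof (rule M.integrable_const_bound[where B="\<bar>B\<bar>\<^sup>2"])
    show "AE x in M. norm ((h x)\<^sup>2) \<le> \<bar>B\<bar>\<^sup>2"
      using bd2 by (intro AE_I2) (simp add: abs_le_square_iff)
  qed (use h in auto)
  have "(\<integral>x. (\<Sum>i<Suc n. h (x i))\<^sup>2 \<partial>Pi\<^sub>M {..<Suc n} (\<lambda>_. M))
    = (\<integral>x. \<integral>y. (\<Sum>i<Suc n. h ((x(n := y)) i))\<^sup>2 \<partial>M \<partial>Pi\<^sub>M {..<n} (\<lambda>_. M))"
    unfolding ins by (rule PP.product_integral_insert) (use int[of "Suc n"] in \<open>auto simp: ins\<close>)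
  also have "\<dots> = (\<integral>x. (\<Sum>i<n. h (x i))\<^sup>2 + (\<integral>y. (h y)\<^sup>2 \<partial>M) \<partial>Pi\<^sub>M {..<n} (\<lambda>_. M))"
  proof (rule Bochner_Integration.integral_cong[OF refl])
    fix x
    let ?S = "\<Sum>i<n. h (x i)"
    have "(\<Sum>i<Suc n. h ((x(n := y)) i))\<^sup>2 = ?S\<^sup>2 + 2 * ?S * h y + (h y)\<^sup>2" for y
      by (simp add: power2_sum)
    then have "(\<integral>y. (\<Sum>i<Suc n. h ((x(n := y)) i))\<^sup>2 \<partial>M) = (\<integral>y. ?S\<^sup>2 + 2 * ?S * h y + (h y)\<^sup>2 \<partial>M)" by simp
    also have "\<dots> = ?S\<^sup>2 + (\<integral>y. (h y)\<^sup>2 \<partial>M)" using hi h2i mean by (simp add: M.prob_space)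
    finally show "(\<integral>y. (\<Sum>i<Suc n. h ((x(n := y)) i))\<^sup>2 \<partial>M) = ?S\<^sup>2 + (\<integral>y. (h y)\<^sup>2 \<partial>M)" .
  qed
  also have "\<dots> = real n * (\<integral>x. (h x)\<^sup>2 \<partial>M) + (\<integral>y. (h y)\<^sup>2 \<partial>M)"
    using int[of n] Suc.IH by (simp add: P.prob_space)
  finally show ?case by (simp add: algebra_simps)
qed simp

text \<open>The variance of a function with values between 0 and 1 is at most its mean; applied to
  the indicator of a cell this yields the square root of the cell mass. Instead of the
  Cauchy-Schwarz inequality, \<open>2 * \<bar>D\<bar> <= c + D^2 / c\<close> is integrated and
  \<open>c\<close> optimized; for mean 0 the optimal \<open>c\<close> degenerates and a limit is
  taken.\<close>

lemma abs_mean_deviation: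
  fixes g :: "'a \<Rightarrow> real"
  assumes M: "prob_space M" and g: "g \<in> borel_measurable M" and bd: "\<And>x. x \<in> space M \<Longrightarrow> 0 \<le> g x \<and> g x \<le> 1" and n: "0 < n"
  shows "integrable (Pi\<^sub>M {..<n} (\<lambda>_. M)) (\<lambda>x. \<bar>(\<Sum>i<n. g (x i)) / real n - (\<integral>x. g x \<partial>M)\<bar>)" (is ?A)
    and "(\<integral>x. \<bar>(\<Sum>i<n. g (x i)) / real n - (\<integral>x. g x \<partial>M)\<bar> \<partial>Pi\<^sub>M {..<n} (\<lambda>_. M)) \<le> sqrt ((\<integral>x. g x \<partial>M) / real n)" (is ?B)
proof -
  interpret M: prob_space M by fact
  let ?P = "Pi\<^sub>M {..<n} (\<lambda>_. M)"
  interpret P: prob_space ?P by (rule prob_space_PiM) (rule M)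
  define m where "m = (\<integral>x. g x \<partial>M)"
  define h where "h x = g x - m" for x
  define D where "D x = (\<Sum>i<n. g (x i)) / real n - m" for x :: "nat \<Rightarrow> 'a"
  have gi: "integrable M g" by (rule M.integrable_const_bound[where B=1]) (use bd g in auto)
  have g2i: "integrable M (\<lambda>x. (g x)\<^sup>2)"
    by (rule M.integrable_const_bound[where B=1]) (use bd g in \<open>auto simp: power_le_one abs_le_square_iff\<close>)
  have m01: "0 \<le> m" "m \<le> 1"
  proof -
    show "0 \<le> m" unfolding m_def using bd by (intro integral_nonneg_AE AE_I2) auto
    have "m \<le> (\<integral>x. 1 \<partial>M)" unfolding m_def using gi bd by (intro integral_mono) auto
    then show "m \<le> 1" by (simp add: M.prob_space)
  qed
  have gm: "(\<lambda>x. g (x i)) \<in> borel_measurable ?P" if "i < n" for i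
    using measurable_compose[OF measurable_component_singleton[of i "{..<n}" "\<lambda>_. M"] g] that by simp
  have Dm[measurable]: "D \<in> borel_measurable ?P"
    unfolding D_def by (intro borel_measurable_diff borel_measurable_divide borel_measurable_sum gm) auto
  have Dh: "D x = (\<Sum>i<n. h (x i)) / real n" for x
    using n by (simp add: D_def h_def sum_subtractf diff_divide_distrib)
  have Db: "\<bar>D x\<bar> \<le> 1" if x: "x \<in> space ?P" for x
  proof -
    have "g (x i) \<le> 1 \<and> 0 \<le> g (x i)" if "i < n" for i using bd[of "x i"] x that by (auto simp: space_PiM)
    then have "(\<Sum>i<n. g (x i)) \<le> (\<Sum>i<n. 1) \<and> 0 \<le> (\<Sum>i<n. g (x i))"
      by (intro conjI sum_mono sum_nonneg) simp_all
    then have "0 \<le> (\<Sum>i<n. g (x i)) / real n" "(\<Sum>i<n. g (x i)) / real n \<le> 1" using n by auto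
    then show ?thesis using m01 by (auto simp: D_def abs_le_iff)
  qed
  have Di: "integrable ?P (\<lambda>x. \<bar>D x\<bar>)"
    by (rule P.integrable_const_bound[where B=1]) (use Db in auto)
  then show ?A by (simp add: D_def m_def)
  have D2i: "integrable ?P (\<lambda>x. (D x)\<^sup>2)"
    by (rule P.integrable_const_bound[where B=1]) (use Db in \<open>auto simp: abs_square_le_1\<close>)
  have mean: "(\<integral>x. h x \<partial>M) = 0" unfolding h_def using gi by (simp add: m_def M.prob_space)
  have "(\<integral>x. (h x)\<^sup>2 \<partial>M) = (\<integral>x. (g x)\<^sup>2 - 2 * m * g x + m\<^sup>2 \<partial>M)"
    unfolding h_def by (intro Bochner_Integration.integral_cong refl) (simp add: power2_diff algebra_simps)
  also have "\<dots> = (\<integral>x. (g x)\<^sup>2 \<partial>M) - m\<^sup>2"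
    using g2i gi by (simp add: M.prob_space m_def[symmetric] power2_eq_square)
  also have "\<dots> \<le> (\<integral>x. g x \<partial>M)"
  proof -
    have "(\<integral>x. (g x)\<^sup>2 \<partial>M) \<le> (\<integral>x. g x \<partial>M)"
      using bd g2i gi by (intro integral_mono) (auto simp: power2_eq_square mult_left_le)
    then show ?thesis by (simp add: add_increasing2 algebra_simps)
  qed
  finally have h2: "(\<integral>x. (h x)\<^sup>2 \<partial>M) \<le> m" by (simp add: m_def)
  have "(\<integral>x. (D x)\<^sup>2 \<partial>?P) = (\<integral>x. (\<Sum>i<n. h (x i))\<^sup>2 \<partial>?P) / (real n)\<^sup>2"
    unfolding Dh power_divide by simp
  also have "(\<integral>x. (\<Sum>i<n. h (x i))\<^sup>2 \<partial>?P) = real n * (\<integral>x. (h x)\<^sup>2 \<partial>M)"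
  proof (rule second_moment_sum_samples[OF M, where B=1])
    show "\<bar>h x\<bar> \<le> 1" if "x \<in> space M" for x using bd[OF that] m01 by (auto simp: h_def abs_le_iff)
  qed (use g mean in \<open>auto simp: h_def\<close>)
  also have "\<dots> / (real n)\<^sup>2 = (\<integral>x. (h x)\<^sup>2 \<partial>M) / real n" using n by (simp add: power2_eq_square)
  also have "\<dots> \<le> m / real n" using h2 n by (intro divide_right_mono) auto
  finally have D2: "(\<integral>x. (D x)\<^sup>2 \<partial>?P) \<le> m / real n" .
  have key: "(\<integral>x. \<bar>D x\<bar> \<partial>?P) \<le> (c + m / real n / c) / 2" if c: "0 < c" for c
  proof -
    have "(\<integral>x. \<bar>D x\<bar> \<partial>?P) \<le> (\<integral>x. (c + (D x)\<^sup>2 / c) / 2 \<partial>?P)"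
    proof (rule integral_mono[OF Di])
      show "integrable ?P (\<lambda>x. (c + (D x)\<^sup>2 / c) / 2)" using D2i by simp
      fix x
      have "0 \<le> (c - \<bar>D x\<bar>)\<^sup>2" by simp
      also have "(c - \<bar>D x\<bar>)\<^sup>2 = c * c + (D x)\<^sup>2 - 2 * c * \<bar>D x\<bar>" by (simp add: power2_diff) (simp add: power2_eq_square)
      also have "c * c + (D x)\<^sup>2 = c * (c + (D x)\<^sup>2 / c)" using c by (simp add: distrib_left)
      finally have "2 * c * \<bar>D x\<bar> \<le> c * (c + (D x)\<^sup>2 / c)" by simp
      then have "c * (2 * \<bar>D x\<bar>) \<le> c * (c + (D x)\<^sup>2 / c)" by (simp add: ac_simps)
      then have "2 * \<bar>D x\<bar> \<le> c + (D x)\<^sup>2 / c" using c by (simp only: mult_le_cancel_left_pos)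
      then show "\<bar>D x\<bar> \<le> (c + (D x)\<^sup>2 / c) / 2" by simp
    qed
    also have "\<dots> = (c + (\<integral>x. (D x)\<^sup>2 \<partial>?P) / c) / 2" using D2i by (simp add: P.prob_space)
    also have "\<dots> \<le> (c + m / real n / c) / 2" using D2 c by (intro divide_right_mono add_left_mono) auto
    finally show ?thesis .
  qed
  show ?B
  proof (cases "m = 0")
    case True
    have "(\<integral>x. \<bar>D x\<bar> \<partial>?P) \<le> 0 + e" if "0 < e" for e
      using key[of e] that True by simp
    then have "(\<integral>x. \<bar>D x\<bar> \<partial>?P) \<le> 0" by (rule field_le_epsilon)
    then show ?thesis using True by (simp add: D_def m_def)
  next
    case False
    then have pos: "0 < m / real n" using m01 n by simp
    define c where "c = sqrt (m / real n)"
    have c: "0 < c" using pos by (simp only: c_def real_sqrt_gt_zero)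
    have cc: "m / real n = c * c" unfolding c_def using less_imp_le[OF pos] by (simp only: real_sqrt_mult_self abs_of_nonneg)
    have "(\<integral>x. \<bar>D x\<bar> \<partial>?P) \<le> (c + c * c / c) / 2" using key[OF c] unfolding cc .
    then have "(\<integral>x. \<bar>D x\<bar> \<partial>?P) \<le> c" using c by simp
    then show ?thesis by (simp add: D_def m_def c_def)
  qed
qed

lemma prob_on_empirical:
  assumes "0 < n" "\<And>i. i < n \<Longrightarrow> y i \<in> space (Rd d)"
  shows "prob_on d (empirical d n y)" "y \<in> measurable (uniform_count_measure {..<n}) (Rd d)"
proof -
  have 0: "space (uniform_count_measure {..<n}) = {..<n}" "sets (uniform_count_measure {..<n}) = Pow {..<n}"
    by (simp_all add: space_uniform_count_measure sets_uniform_count_measure)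
  show m: "y \<in> measurable (uniform_count_measure {..<n}) (Rd d)"
    using assms(2) by (auto simp: measurable_def 0)
  show "prob_on d (empirical d n y)"
    unfolding empirical_def using assms(1)
    by (intro prob_on_distr[OF prob_space_uniform_count_measure m]) auto
qed

lemma nn_integral_uniform_count_measure:
  assumes "finite A"
  shows "(\<integral>\<^sup>+x. f x \<partial>uniform_count_measure A) = (\<Sum>x\<in>A. f x) * ennreal (1 / real (card A))"
  unfolding uniform_count_measure_def using assms
  by (subst nn_integral_point_measure_finite) (auto simp: sum_distrib_right mult.commute)

lemma measure_empirical:
  assumes n: "0 < n" and y: "\<And>i. i < n \<Longrightarrow> y i \<in> space (Rd d)" and S: "S \<in> sets (Rd d)"
  shows "measure (empirical d n y) S = (\<Sum>i<n. indicator S (y i)) / real n"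
proof -
  have "emeasure (empirical d n y) S = (\<integral>\<^sup>+i. indicator S (y i) \<partial>uniform_count_measure {..<n})"
    unfolding empirical_def by (rule emeasure_distr_indicator[OF prob_on_empirical(2)[OF n y] S])
  also have "\<dots> = (\<Sum>i<n. ennreal (indicator S (y i))) * ennreal (1 / real n)"
    by (subst nn_integral_uniform_count_measure) (auto simp: ennreal_indicator)
  also have "\<dots> = ennreal ((\<Sum>i<n. indicator S (y i)) / real n)"
    by (simp add: ennreal_mult[symmetric] sum_nonneg)
  finally show ?thesis by (simp add: measure_def sum_nonneg)
qed

text \<open>The one-sided geometric series \<open>x / (1 - x)\<close> with
  \<open>x = exp (- s)\<close> is at most \<open>1 / s\<close>, because
  \<open>exp s >= 1 + s\<close>. The bound is uniform in \<open>m\<close>, so the size of the box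
  never enters.\<close>

lemma sum_exp_int_le:
  fixes s :: real
  assumes s: "0 < s" and m: "0 \<le> m"
  shows "(\<Sum>r\<in>{- m..m::int}. exp (- s * real_of_int \<bar>r\<bar>)) \<le> 1 + 2 / s"
proof -
  define x where "x = exp (- s)"
  have x: "0 < x" "x < 1" using s by (auto simp: x_def)
  have g: "(\<Sum>i\<in>{1..N}. x ^ i) \<le> 1 / s" for N :: nat
  proof -
    have "(1 - x) * (\<Sum>i\<in>{1..N}. x ^ i) = x - x ^ Suc N"
    proof (induction N)
      case (Suc N)
      have "(1 - x) * (\<Sum>i\<in>{1..Suc N}. x ^ i) = (1 - x) * (\<Sum>i\<in>{1..N}. x ^ i) + (1 - x) * x ^ Suc N"
        by (simp add: distrib_left)
      also have "\<dots> = x - x ^ Suc N + (1 - x) * x ^ Suc N" by (simp only: Suc.IH)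
      also have "\<dots> = x - x ^ Suc (Suc N)" by (simp add: algebra_simps)
      finally show ?case .
    qed simp
    also have "\<dots> \<le> x" using x by simp
    finally have "(\<Sum>i\<in>{1..N}. x ^ i) \<le> x / (1 - x)" using x by (simp add: pos_le_divide_eq mult.commute)
    also have "x / (1 - x) \<le> 1 / s"
    proof -
      have "1 + s \<le> exp s" by (rule exp_ge_add_one_self)
      then have "(1 + s) * x \<le> exp s * x" using x by (intro mult_right_mono) auto
      also have "exp s * x = 1" by (simp add: x_def exp_minus)
      finally have "s * x \<le> 1 - x" by (simp add: algebra_simps)
      then show ?thesis using x s by (simp add: divide_simps mult.commute)
    qed
    finally show ?thesis .
  qed
  have pos: "(\<Sum>r\<in>{1..m}. exp (- s * real_of_int r)) \<le> 1 / s"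
  proof -
    have "(\<Sum>r\<in>{1..m}. exp (- s * real_of_int r)) = (\<Sum>i\<in>{1..nat m}. x ^ i)"
      by (rule sum.reindex_bij_witness[of _ int nat])
        (auto simp: x_def exp_of_nat_mult[symmetric] mult.commute)
    then show ?thesis using g by simp
  qed
  have split: "{- m..m} = {- m..-1} \<union> ({0} \<union> {1..m})" using m by auto
  have neg: "(\<Sum>r\<in>{- m..-1}. exp (- s * real_of_int \<bar>r\<bar>)) = (\<Sum>r\<in>{1..m}. exp (- s * real_of_int r))"
    by (rule sum.reindex_bij_witness[of _ uminus uminus]) auto
  have "(\<Sum>r\<in>{- m..m}. exp (- s * real_of_int \<bar>r\<bar>))
      = (\<Sum>r\<in>{- m..-1}. exp (- s * real_of_int \<bar>r\<bar>)) + (1 + (\<Sum>r\<in>{1..m}. exp (- s * real_of_int \<bar>r\<bar>)))"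
    unfolding split by (subst sum.union_disjoint, simp, simp, simp, subst sum.union_disjoint) auto
  also have "(\<Sum>r\<in>{1..m}. exp (- s * real_of_int \<bar>r\<bar>)) = (\<Sum>r\<in>{1..m}. exp (- s * real_of_int r))"
    by (intro sum.cong) auto
  finally show ?thesis unfolding neg using pos by simp
qed

text \<open>The sum factorizes over the coordinates. It is used twice: in a weighted Cauchy-Schwarz
  inequality over cells, and to count the grid points of the net of matrices.\<close>

lemma sum_exp_box_le:
  fixes s :: real
  assumes s: "0 < s" and m: "0 \<le> m"
  shows "(\<Sum>R\<in>box_cells k m. exp (- s * (\<Sum>i<k. real_of_int \<bar>R i\<bar>))) \<le> (1 + 2 / s) ^ k"
proof -
  have "(\<Sum>R\<in>box_cells k m. exp (- s * (\<Sum>i<k. real_of_int \<bar>R i\<bar>)))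
    = (\<Sum>R\<in>box_cells k m. \<Prod>i\<in>{..<k}. exp (- s * real_of_int \<bar>R i\<bar>))"
    by (simp add: exp_sum[symmetric] sum_distrib_left)
  also have "\<dots> = (\<Prod>i\<in>{..<k}. \<Sum>r\<in>{- m..m}. exp (- s * real_of_int \<bar>r\<bar>))"
    unfolding box_cells_def by (rule prod_sum_PiE[symmetric]) auto
  also have "\<dots> \<le> (\<Prod>i\<in>{..<k}. 1 + 2 / s)"
    by (intro prod_mono conjI sum_nonneg sum_exp_int_le s m) auto
  finally show ?thesis by simp
qed

text \<open>Cauchy-Schwarz with an exponential weight in the cell index: the factor containing the
  masses is controlled by the exponential moment, the other by a geometric sum of order
  \<open>2^j\<close> per coordinate. That sum takes the place of the number of cells of a bounded
  support. The weight kept on the left pays for the polynomial cost at the root.\<close>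

lemma sum_sqrt_cell_masses:
  assumes \<mu>: "prob_on k \<mu>" and s: "0 < s" and m: "0 \<le> m"
    and H: "(\<integral>\<^sup>+x. ennreal (exp ((\<Sum>i<k. \<bar>x i\<bar>) / s)) \<partial>\<mu>) \<le> ennreal (exp (2 * real k))"
  shows "(\<Sum>R\<in>box_cells k m. exp ((\<Sum>i<k. real_of_int \<bar>R i\<bar>) / 2 ^ j / 4) * sqrt (measure \<mu> {x \<in> space (Rd k). cell k s j x = R}))
    \<le> (5 * exp 3 * 2 ^ j) powr (real k / 2)"
proof -
  interpret prob_space \<mu> using \<mu> by (rule prob_onD)
  define N where "N R = (\<Sum>i<k. real_of_int \<bar>R i\<bar>)" for R :: "nat \<Rightarrow> int"
  define E where "E R = {x \<in> space (Rd k). cell k s j x = R}" for R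
  define q :: real where "q = 2 ^ j"
  have q: "1 \<le> q" "0 < q" by (simp_all add: q_def)
  have Es: "E R \<in> sets \<mu>" for R unfolding E_def prob_onD(2)[OF \<mu>] by (rule cell_measurable)
  define u where "u R = exp (N R / q / 2) * sqrt (measure \<mu> (E R))" for R
  define v where "v R = exp (- (N R / q / 4))" for R
  have uv: "exp (N R / q / 4) * sqrt (measure \<mu> (E R)) = \<bar>u R\<bar> * \<bar>v R\<bar>" for R
  proof -
    have "exp (N R / q / 4) = exp (N R / q / 2) * exp (- (N R / q / 4))" by (simp add: exp_add[symmetric])
    then show ?thesis by (simp add: u_def v_def abs_mult)
  qed
  have "(\<Sum>R\<in>box_cells k m. exp (N R / q / 4) * sqrt (measure \<mu> (E R))) = (\<Sum>R\<in>box_cells k m. \<bar>u R\<bar> * \<bar>v R\<bar>)"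
    by (simp only: uv)
  also have "\<dots> \<le> L2_set u (box_cells k m) * L2_set v (box_cells k m)" by (rule L2_set_mult_ineq)
  also have "L2_set u (box_cells k m) \<le> sqrt (exp (3 * real k))"
    unfolding L2_set_def
  proof (rule real_sqrt_le_mono)
    have sq: "(u R)\<^sup>2 = exp (N R / q) * measure \<mu> (E R)" for R
      by (simp add: u_def power_mult_distrib exp_double[symmetric])
    have "ennreal (\<Sum>R\<in>box_cells k m. (u R)\<^sup>2) = (\<Sum>R\<in>box_cells k m. ennreal (exp (N R / q)) * emeasure \<mu> (E R))"
      unfolding sq by (simp add: sum_ennreal[symmetric] emeasure_eq_measure ennreal_mult)
    also have "\<dots> = (\<Sum>R\<in>box_cells k m. \<integral>\<^sup>+x. ennreal (exp (N R / q)) * indicator (E R) x \<partial>\<mu>)"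
      using Es by (simp add: nn_integral_cmult_indicator)
    also have "\<dots> = (\<integral>\<^sup>+x. (\<Sum>R\<in>box_cells k m. ennreal (exp (N R / q)) * indicator (E R) x) \<partial>\<mu>)"
      using Es by (intro nn_integral_sum[symmetric]) auto
    also have "\<dots> \<le> (\<integral>\<^sup>+x. ennreal (exp (real k)) * ennreal (exp ((\<Sum>i<k. \<bar>x i\<bar>) / s)) \<partial>\<mu>)"
    proof (rule nn_integral_mono)
      fix x
      let ?R = "cell k s j x"
      have z: "ennreal (exp (N R / q)) * indicator (E R) x = 0" if "R \<noteq> ?R" for R
        using that by (simp add: E_def)
      have "(\<Sum>R\<in>box_cells k m. ennreal (exp (N R / q)) * indicator (E R) x)
        \<le> ennreal (exp (N ?R / q)) * indicator (E ?R) x"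
      proof (cases "?R \<in> box_cells k m")
        case True
        have "(\<Sum>R\<in>box_cells k m - {?R}. ennreal (exp (N R / q)) * indicator (E R) x) = 0"
          by (rule sum.neutral) (use z in blast)
        then show ?thesis by (simp only: sum.remove[OF finite_box_cells True] add_0_right order_refl)
      next
        case False
        then have "(\<Sum>R\<in>box_cells k m. ennreal (exp (N R / q)) * indicator (E R) x) = 0"
          by (intro sum.neutral ballI z) blast
        then show ?thesis by (simp only: zero_le)
      qed
      also have "\<dots> \<le> ennreal (exp (N ?R / q)) * 1" by (intro mult_left_mono) (auto simp: indicator_def)
      also have "\<dots> = ennreal (exp (N ?R / q))" by simp
      \<comment> \<open>Undoing the floor costs at most one unit per coordinate, hence the extra
        factor \<open>exp k\<close>.\<close>
      also have "N ?R / q \<le> real k + (\<Sum>i<k. \<bar>x i\<bar>) / s"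
      proof -
        have "real_of_int \<bar>?R i\<bar> / q \<le> 1 + \<bar>x i\<bar> / s" if i: "i < k" for i
        proof -
          have "real_of_int \<bar>\<lfloor>q * x i / s\<rfloor>\<bar> \<le> \<bar>q * x i / s\<bar> + 1" by linarith
          also have "\<bar>q * x i / s\<bar> = q * (\<bar>x i\<bar> / s)" using q s by (simp add: abs_mult)
          also have "\<dots> + 1 \<le> q * (\<bar>x i\<bar> / s) + q" using q by simp
          finally have "real_of_int \<bar>\<lfloor>q * x i / s\<rfloor>\<bar> / q \<le> (q * (1 + \<bar>x i\<bar> / s)) / q"
            using q by (intro divide_right_mono) (auto simp: algebra_simps)
          then show ?thesis using i q by (simp add: cell_def q_def)
        qed
        then have "(\<Sum>i<k. real_of_int \<bar>?R i\<bar> / q) \<le> (\<Sum>i<k. 1 + \<bar>x i\<bar> / s)" by (intro sum_mono) auto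
        then show ?thesis by (simp add: N_def sum_divide_distrib sum.distrib)
      qed
      finally show "(\<Sum>R\<in>box_cells k m. ennreal (exp (N R / q)) * indicator (E R) x)
        \<le> ennreal (exp (real k)) * ennreal (exp ((\<Sum>i<k. \<bar>x i\<bar>) / s))"
        by (simp add: ennreal_mult[symmetric] exp_add[symmetric])
    qed
    also have "\<dots> = ennreal (exp (real k)) * (\<integral>\<^sup>+x. ennreal (exp ((\<Sum>i<k. \<bar>x i\<bar>) / s)) \<partial>\<mu>)"
    proof (rule nn_integral_cmult)
      have [measurable]: "(\<lambda>x. x i) \<in> borel_measurable \<mu>" if "i \<in> {..<k}" for i
        unfolding measurable_cong_sets[OF prob_onD(2)[OF \<mu>] refl]
        by (rule measurable_Rd_coord[of "\<lambda>x. x"]) (use that in auto)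
      show "(\<lambda>x. ennreal (exp ((\<Sum>i<k. \<bar>x i\<bar>) / s))) \<in> borel_measurable \<mu>" by measurable
    qed
    also have "\<dots> \<le> ennreal (exp (real k)) * ennreal (exp (2 * real k))" using H by (rule mult_left_mono) simp
    also have "\<dots> = ennreal (exp (3 * real k))" by (simp add: ennreal_mult[symmetric] exp_add[symmetric])
    finally show "(\<Sum>R\<in>box_cells k m. (u R)\<^sup>2) \<le> exp (3 * real k)" by (simp add: ennreal_le_iff)
  qed
  also have "L2_set v (box_cells k m) \<le> sqrt ((5 * q) ^ k)"
    unfolding L2_set_def
  proof (rule real_sqrt_le_mono)
    have "(\<Sum>R\<in>box_cells k m. (v R)\<^sup>2) = (\<Sum>R\<in>box_cells k m. exp (- (1 / (2 * q)) * N R))"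
      by (intro sum.cong refl) (simp add: v_def exp_double[symmetric])
    also have "\<dots> \<le> (1 + 2 / (1 / (2 * q))) ^ k"
      unfolding N_def using q m by (intro sum_exp_box_le) auto
    also have "\<dots> \<le> (5 * q) ^ k" using q by (intro power_mono) auto
    finally show "(\<Sum>R\<in>box_cells k m. (v R)\<^sup>2) \<le> (5 * q) ^ k" .
  qed
  also have "sqrt (exp (3 * real k)) * sqrt ((5 * q) ^ k) = (5 * exp 3 * q) powr (real k / 2)"
  proof -
    have "sqrt (exp (3 * real k)) * sqrt ((5 * q) ^ k) = sqrt ((5 * exp 3 * q) ^ k)"
      by (simp add: real_sqrt_mult[symmetric] power_mult_distrib exp_of_nat_mult[symmetric] ac_simps)
    also have "\<dots> = ((5 * exp 3 * q) powr real k) powr (1 / 2)"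
      using q by (simp add: powr_half_sqrt powr_realpow)
    finally show ?thesis by (simp add: powr_powr)
  qed
  finally show ?thesis unfolding N_def E_def q_def
    by (simp add: mult_right_mono mult_left_mono)
qed

text \<open>Mean cost in units of \<open>(sqrt k * s) powr p\<close>: the discretization error of
  the finest level plus, level by level, the sampling error, where
  \<open>(5 * exp 4 * 2 ^ i) powr (k / 2)\<close> bounds the sum of the square roots of the cell
  masses. The depth \<open>J\<close> stays free until \<open>k\<close> is compared with
  \<open>2 * p\<close>.\<close>

definition mean_phi :: "real \<Rightarrow> nat \<Rightarrow> nat \<Rightarrow> nat \<Rightarrow> real" where
  "mean_phi p k n J = 2 powr (- (real J * p)) +
     (\<Sum>i\<le>J. 2 powr (- (real i * p)) * (5 * exp 4 * 2 ^ i) powr (real k / 2)) / sqrt (real n)"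

text \<open>The first summand absorbs the shift between the cost at scale \<open>2^-i\<close> and
  the discrepancy at level \<open>i + 1\<close>; the second is the cost of matching at the
  root.\<close>

definition mean_const :: "real \<Rightarrow> real" where
  "mean_const p = 2 powr p + 2 powr (p + 1) * (4 * p) powr p"

text \<open>From \<open>t <= exp t\<close>, rescaled by \<open>c * p\<close> and raised to the power
  \<open>p\<close>.\<close>

lemma powr_le_exp:
  fixes t p c :: real
  assumes "0 \<le> t" "0 < p" "0 < c"
  shows "t powr p \<le> (c * p) powr p * exp (t / c)"
proof -
  have "t / (c * p) \<le> exp (t / (c * p))" using exp_ge_add_one_self[of "t / (c * p)"] by linarith
  then have "(t / (c * p)) powr p \<le> exp (t / (c * p)) powr p" using assms by (intro powr_mono2) auto
  also have "\<dots> = exp (t / c)" using assms by (simp add: powr_def)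
  finally show ?thesis using assms by (simp add: powr_divide pos_divide_le_eq mult.commute)
qed

text \<open>The cost is dominated by a measurable \<open>T\<close>, a combination of absolute
  deviations of cell frequencies, so that the expectation can be taken term by term; each deviation
  has mean at most the square root of the cell mass over \<open>n\<close>. The variable
  \<open>Y\<close> on an arbitrary space lets the bound be used for projected and truncated
  points.\<close>

lemma bounded_mean_cost:
  assumes M: "prob_space M" and Y: "Y \<in> measurable M (Rd k)" and s: "0 < s" and p: "1 \<le> p"
    and k: "0 < k" and n: "0 < n" and m: "0 \<le> m"
    and box: "\<And>\<omega>. \<omega> \<in> space M \<Longrightarrow> cell k s J (Y \<omega>) \<in> box_cells k m"
    and H: "(\<integral>\<^sup>+\<omega>. ennreal (exp ((\<Sum>i<k. \<bar>Y \<omega> i\<bar>) / s)) \<partial>M) \<le> ennreal (exp (2 * real k))"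
  shows "\<exists>T\<in>borel_measurable (Pi\<^sub>M {..<n} (\<lambda>_. M)). (\<forall>x\<in>space (Pi\<^sub>M {..<n} (\<lambda>_. M)). 0 \<le> T x \<and>
      (\<exists>\<Xi>\<in>couplings k (empirical k n (\<lambda>i. Y (x i))) (distr M (Rd k) Y). tcost k p \<Xi> \<le> ennreal (T x))) \<and>
    (\<integral>\<^sup>+x. ennreal (T x) \<partial>Pi\<^sub>M {..<n} (\<lambda>_. M)) \<le> ennreal ((sqrt (real k) * s) powr p * mean_const p * mean_phi p k n J)"
proof -
  interpret M: prob_space M by fact
  let ?P = "Pi\<^sub>M {..<n} (\<lambda>_. M)" and ?A = "box_cells k m"
  interpret P: prob_space ?P by (rule prob_space_PiM) (rule M)
  define \<mu> where "\<mu> = distr M (Rd k) Y"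
  have \<mu>: "prob_on k \<mu>" unfolding \<mu>_def by (rule prob_on_distr[OF M Y])
  define E where "E j R = {x \<in> space (Rd k). cell k s j x = R}" for j R
  have ES: "E j R \<in> sets (Rd k)" for j R unfolding E_def by (rule cell_measurable)
  define g :: "nat \<Rightarrow> (nat \<Rightarrow> int) \<Rightarrow> 'a \<Rightarrow> real" where "g j R \<omega> = indicator (E j R) (Y \<omega>)" for j R \<omega>
  have gm: "g j R \<in> borel_measurable M" for j R
    unfolding g_def by (rule measurable_compose[OF Y borel_measurable_indicator[OF ES]])
  have gint: "(\<integral>\<omega>. g j R \<omega> \<partial>M) = measure \<mu> (E j R)" for j R
  proof -
    have "(\<integral>\<omega>. g j R \<omega> \<partial>M) = (\<integral>x. indicator (E j R) x \<partial>\<mu>)"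
      unfolding g_def \<mu>_def by (rule integral_distr[OF Y borel_measurable_indicator[OF ES], symmetric])
    also have "\<dots> = measure \<mu> (E j R)"
      using ES[of j R] prob_onD(2)[OF \<mu>] sets.sets_into_space[of "E j R" \<mu>] by (simp add: Int_absorb2)
    finally show ?thesis .
  qed
  define \<Delta> where "\<Delta> j R x = \<bar>(\<Sum>i<n. g j R (x i)) / real n - (\<integral>\<omega>. g j R \<omega> \<partial>M)\<bar>" for j R and x :: "nat \<Rightarrow> 'a"
  have \<Delta>i: "integrable ?P (\<Delta> j R)" and \<Delta>b: "(\<integral>x. \<Delta> j R x \<partial>?P) \<le> sqrt (measure \<mu> (E j R)) / sqrt (real n)" for j R
    unfolding \<Delta>_def using abs_mean_deviation[OF M gm, of j R n] n unfolding gint real_sqrt_divide[symmetric]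
    by (auto simp: g_def)
  define K where "K = (sqrt (real k) * s) powr p"
  have K0: "0 \<le> K" by (simp add: K_def)
  define c where "c i = 2 powr (- (real i * p))" for i :: nat
  have c0: "0 \<le> c i" for i by (simp add: c_def)
  define w where "w R = cell_radius k s R powr p" for R
  have w0: "0 \<le> w R" for R by (simp add: w_def)
  define T where "T x = K * ((\<Sum>i<J. c i * (\<Sum>R\<in>?A. \<Delta> (Suc i) R x)) + c J) + 2 powr (p + 1) * (\<Sum>R\<in>?A. w R * \<Delta> 0 R x)" for x
  have T0: "0 \<le> T x" for x
    unfolding T_def using K0 c0 w0 by (intro add_nonneg_nonneg mult_nonneg_nonneg sum_nonneg) (auto simp: \<Delta>_def)
  have Ti: "integrable ?P T"
    unfolding T_def using \<Delta>i by (intro Bochner_Integration.integrable_add integrable_mult_right Bochner_Integration.integrable_sum P.integrable_const) auto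
  have coup: "\<exists>\<Xi>\<in>couplings k (empirical k n (\<lambda>i. Y (x i))) \<mu>. tcost k p \<Xi> \<le> ennreal (T x)" if x: "x \<in> space ?P" for x
  proof -
    let ?\<nu> = "empirical k n (\<lambda>i. Y (x i))"
    have xi: "x i \<in> space M" if "i < n" for i using x that by (auto simp: space_PiM)
    have yi: "Y (x i) \<in> space (Rd k)" if "i < n" for i using measurable_space[OF Y xi[OF that]] .
    have \<nu>: "prob_on k ?\<nu>" by (rule prob_on_empirical(1)[OF n yi])
    have m\<nu>: "(\<lambda>i. Y (x i)) \<in> measurable (uniform_count_measure {..<n}) (Rd k)" by (rule prob_on_empirical(2)[OF n yi])
    have mb: "{y \<in> space (Rd k). cell k s J y \<in> ?A} \<in> sets (Rd k)"
    proof -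
      have "{y \<in> space (Rd k). cell k s J y \<in> ?A} = (\<Union>R\<in>?A. E J R)" by (auto simp: E_def)
      also have "\<dots> \<in> sets (Rd k)" using ES by (intro sets.finite_UN) auto
      finally show ?thesis .
    qed
    have b\<mu>: "AE y in \<mu>. cell k s J y \<in> ?A"
      unfolding \<mu>_def by (subst AE_distr_iff[OF Y mb]) (use box in auto)
    have b\<nu>: "AE y in ?\<nu>. cell k s J y \<in> ?A"
      unfolding empirical_def by (subst AE_distr_iff[OF m\<nu> mb]) (use box xi in \<open>auto simp: space_uniform_count_measure\<close>)
    have \<Delta>eq: "\<bar>measure ?\<nu> {y \<in> space (Rd k). cell k s j y = R} - measure \<mu> {y \<in> space (Rd k). cell k s j y = R}\<bar> = \<Delta> j R x" for j R
      using measure_empirical[OF n yi ES[of j R]] gint[of j R] unfolding \<Delta>_def g_def E_def by simp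
    show ?thesis
      using multiscale_coupling[OF \<nu> \<mu> s p b\<nu> b\<mu>] unfolding \<Delta>eq T_def K_def c_def w_def .
  qed
  define S where "S i = (5 * exp 4 * 2 ^ i) powr (real k / 2)" for i :: nat
  have S0: "0 \<le> S i" for i by (simp add: S_def)
  have Hm: "(\<integral>\<^sup>+x. ennreal (exp ((\<Sum>i<k. \<bar>x i\<bar>) / s)) \<partial>\<mu>) \<le> ennreal (exp (2 * real k))"
  proof -
    have [measurable]: "(\<lambda>x. x i) \<in> borel_measurable (Rd k)" if "i \<in> {..<k}" for i
      by (rule measurable_Rd_coord[of "\<lambda>x. x"]) (use that in auto)
    have "(\<integral>\<^sup>+x. ennreal (exp ((\<Sum>i<k. \<bar>x i\<bar>) / s)) \<partial>\<mu>) = (\<integral>\<^sup>+\<omega>. ennreal (exp ((\<Sum>i<k. \<bar>Y \<omega> i\<bar>) / s)) \<partial>M)"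
      unfolding \<mu>_def by (rule nn_integral_distr[OF Y]) measurable
    with H show ?thesis by simp
  qed
  note cs = sum_sqrt_cell_masses[OF \<mu> s m Hm]
  \<comment> \<open>The factor \<open>exp (k / 4)\<close> arises at the root only. Rounding it up to
    \<open>exp (k / 2)\<close> turns \<open>exp 3\<close> into \<open>exp 4\<close> and gives one
    base for all levels.\<close>
  have base: "(5 * exp 3 * 2 ^ j) powr (real k / 2) * exp (real k / 4) \<le> S j" for j
  proof -
    have "exp (real k / 4) \<le> exp (real k / 2)" by simp
    also have "\<dots> = exp 1 powr (real k / 2)" by (simp add: powr_def)
    finally have "(5 * exp 3 * 2 ^ j) powr (real k / 2) * exp (real k / 4) \<le> (5 * exp 3 * 2 ^ j) powr (real k / 2) * exp 1 powr (real k / 2)"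
      by (rule mult_left_mono) simp
    also have "\<dots> = (5 * exp 3 * 2 ^ j * exp 1) powr (real k / 2)" by (rule powr_mult[symmetric])
    also have "5 * exp 3 * 2 ^ j * exp 1 = 5 * exp 4 * (2::real) ^ j" by (simp add: exp_add[symmetric])
    finally show ?thesis by (simp add: S_def)
  qed
  have lev: "(\<Sum>R\<in>?A. \<integral>x. \<Delta> j R x \<partial>?P) \<le> S j / sqrt (real n)" for j
  proof -
    have "(\<Sum>R\<in>?A. \<integral>x. \<Delta> j R x \<partial>?P) \<le> (\<Sum>R\<in>?A. sqrt (measure \<mu> (E j R)) / sqrt (real n))"
      by (rule sum_mono) (rule \<Delta>b)
    also have "\<dots> = (\<Sum>R\<in>?A. sqrt (measure \<mu> (E j R))) / sqrt (real n)" by (rule sum_divide_distrib[symmetric])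
    also have "\<dots> \<le> S j / sqrt (real n)"
    proof (rule divide_right_mono)
      have "(\<Sum>R\<in>?A. sqrt (measure \<mu> (E j R)))
        \<le> (\<Sum>R\<in>?A. exp ((\<Sum>i<k. real_of_int \<bar>R i\<bar>) / 2 ^ j / 4) * sqrt (measure \<mu> (E j R)))"
      proof (rule sum_mono)
        fix R
        have "1 \<le> exp ((\<Sum>i<k. real_of_int \<bar>R i\<bar>) / 2 ^ j / 4)" by (simp add: sum_nonneg)
        then have "1 * sqrt (measure \<mu> (E j R)) \<le> exp ((\<Sum>i<k. real_of_int \<bar>R i\<bar>) / 2 ^ j / 4) * sqrt (measure \<mu> (E j R))"
          by (rule mult_right_mono) simp
        then show "sqrt (measure \<mu> (E j R)) \<le> exp ((\<Sum>i<k. real_of_int \<bar>R i\<bar>) / 2 ^ j / 4) * sqrt (measure \<mu> (E j R))" by simp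
      qed
      also have "\<dots> \<le> (5 * exp 3 * 2 ^ j) powr (real k / 2)" unfolding E_def by (rule cs)
      also have "\<dots> \<le> (5 * exp 3 * 2 ^ j) powr (real k / 2) * exp (real k / 4)"
        by (simp add: mult_le_cancel_left1)
      also have "\<dots> \<le> S j" by (rule base)
      finally show "(\<Sum>R\<in>?A. sqrt (measure \<mu> (E j R))) \<le> S j" .
    qed simp
    finally show ?thesis .
  qed
  have rootb: "(\<Sum>R\<in>?A. w R * (\<integral>x. \<Delta> 0 R x \<partial>?P)) \<le> K * (4 * p) powr p * S 0 / sqrt (real n)"
  proof -
    \<comment> \<open>The polynomial radius is traded for \<open>exp (t / 4)\<close>, the weight
      that the cell-mass bound tolerates at level 0; the \<open>+ 1\<close> in each coordinate
      yields \<open>exp (k / 4)\<close>.\<close>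
    have wle: "w R \<le> K * (4 * p) powr p * (exp (real k / 4) * exp ((\<Sum>i<k. real_of_int \<bar>R i\<bar>) / 2 ^ 0 / 4))" for R
    proof -
      let ?t = "\<Sum>i<k. real_of_int \<bar>R i\<bar> + 1"
      have t0: "0 \<le> ?t" by (intro sum_nonneg) auto
      have "w R = s powr p * ?t powr p" unfolding w_def cell_radius_def using s t0 by (intro powr_mult)
      also have "\<dots> \<le> s powr p * ((4 * p) powr p * exp (?t / 4))"
        using p t0 by (intro mult_left_mono powr_le_exp) auto
      also have "\<dots> \<le> K * ((4 * p) powr p * exp (?t / 4))"
      proof (rule mult_right_mono)
        have "1 * s \<le> sqrt (real k) * s" using k s by (intro mult_right_mono) auto
        then show "s powr p \<le> K" unfolding K_def using s p by (intro powr_mono2) auto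
      qed simp
      also have "exp (?t / 4) = exp (real k / 4) * exp ((\<Sum>i<k. real_of_int \<bar>R i\<bar>) / 2 ^ 0 / 4)"
        by (simp add: exp_add[symmetric] sum.distrib add_divide_distrib add.commute)
      finally show ?thesis by (simp add: mult.assoc)
    qed
    have "(\<Sum>R\<in>?A. w R * (\<integral>x. \<Delta> 0 R x \<partial>?P))
      \<le> (\<Sum>R\<in>?A. K * (4 * p) powr p * (exp (real k / 4) * exp ((\<Sum>i<k. real_of_int \<bar>R i\<bar>) / 2 ^ 0 / 4)) * (sqrt (measure \<mu> (E 0 R)) / sqrt (real n)))"
    proof (rule sum_mono, rule mult_mono)
      fix R
      show "0 \<le> (\<integral>x. \<Delta> 0 R x \<partial>?P)" by (rule integral_nonneg_AE) (simp add: \<Delta>_def)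
    qed (use wle \<Delta>b K0 in auto)
    also have "\<dots> = K * (4 * p) powr p * exp (real k / 4) / sqrt (real n)
      * (\<Sum>R\<in>?A. exp ((\<Sum>i<k. real_of_int \<bar>R i\<bar>) / 2 ^ 0 / 4) * sqrt (measure \<mu> (E 0 R)))"
      unfolding sum_distrib_left by (intro sum.cong refl) (simp add: ac_simps)
    also have "\<dots> \<le> K * (4 * p) powr p * exp (real k / 4) / sqrt (real n) * ((5 * exp 3 * 2 ^ 0) powr (real k / 2))"
      unfolding E_def using K0 by (intro mult_left_mono cs) auto
    also have "\<dots> = K * (4 * p) powr p / sqrt (real n) * ((5 * exp 3 * 2 ^ 0) powr (real k / 2) * exp (real k / 4))"
      by (simp add: ac_simps)
    also have "\<dots> \<le> K * (4 * p) powr p / sqrt (real n) * S 0"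
      using K0 by (intro mult_left_mono base) auto
    finally show ?thesis by simp
  qed
  have "(\<integral>x. T x \<partial>?P) = K * ((\<Sum>i<J. c i * (\<Sum>R\<in>?A. \<integral>x. \<Delta> (Suc i) R x \<partial>?P)) + c J) + 2 powr (p + 1) * (\<Sum>R\<in>?A. w R * (\<integral>x. \<Delta> 0 R x \<partial>?P))"
    unfolding T_def using \<Delta>i by (simp add: P.prob_space)
  also have "\<dots> \<le> K * ((\<Sum>i<J. c i * (S (Suc i) / sqrt (real n))) + c J) + 2 powr (p + 1) * (K * (4 * p) powr p * S 0 / sqrt (real n))"
  proof (rule add_mono)
    show "K * ((\<Sum>i<J. c i * (\<Sum>R\<in>?A. \<integral>x. \<Delta> (Suc i) R x \<partial>?P)) + c J) \<le> K * ((\<Sum>i<J. c i * (S (Suc i) / sqrt (real n))) + c J)"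
      by (rule mult_left_mono[OF _ K0], rule add_right_mono, rule sum_mono, rule mult_left_mono[OF lev c0])
    show "2 powr (p + 1) * (\<Sum>R\<in>?A. w R * (\<integral>x. \<Delta> 0 R x \<partial>?P)) \<le> 2 powr (p + 1) * (K * (4 * p) powr p * S 0 / sqrt (real n))"
      by (rule mult_left_mono[OF rootb]) simp
  qed
  also have "\<dots> \<le> K * mean_const p * mean_phi p k n J"
  proof -
    define U where "U = (\<Sum>i\<le>J. c i * S i) / sqrt (real n)"
    have U0: "0 \<le> U" unfolding U_def using c0 S0 by (intro divide_nonneg_nonneg sum_nonneg mult_nonneg_nonneg) auto
    \<comment> \<open>Shift of index: discrepancies of level \<open>i + 1\<close> carry the price of
      level \<open>i\<close>.\<close>
    have cS: "c i = 2 powr p * c (Suc i)" for i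
      unfolding c_def powr_add[symmetric] by (simp add: algebra_simps)
    have "(\<Sum>i<J. c i * (S (Suc i) / sqrt (real n))) = 2 powr p * ((\<Sum>i<J. c (Suc i) * S (Suc i)) / sqrt (real n))"
      unfolding sum_divide_distrib sum_distrib_left by (intro sum.cong refl) (simp add: cS[symmetric] mult.assoc[symmetric])
    also have "(\<Sum>i<J. c (Suc i) * S (Suc i)) \<le> (\<Sum>i\<le>J. c i * S i)"
      unfolding sum.atMost_shift using c0 S0 by simp
    then have "2 powr p * ((\<Sum>i<J. c (Suc i) * S (Suc i)) / sqrt (real n)) \<le> 2 powr p * U"
      unfolding U_def by (intro mult_left_mono divide_right_mono) auto
    finally have 1: "(\<Sum>i<J. c i * (S (Suc i) / sqrt (real n))) + c J \<le> 2 powr p * (c J + U)"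
    proof -
      assume a: "(\<Sum>i<J. c i * (S (Suc i) / sqrt (real n))) \<le> 2 powr p * U"
      have "1 * c J \<le> 2 powr p * c J" using c0 p by (intro mult_right_mono ge_one_powr_ge_zero) auto
      with a show ?thesis by (simp add: distrib_left)
    qed
    have 2: "S 0 / sqrt (real n) \<le> c J + U"
    proof -
      have "c 0 * S 0 \<le> (\<Sum>i\<le>J. c i * S i)" using c0 S0 by (intro member_le_sum mult_nonneg_nonneg) auto
      then have "c 0 * S 0 / sqrt (real n) \<le> U" unfolding U_def by (rule divide_right_mono) simp
      moreover have "c 0 = 1" by (simp add: c_def)
      ultimately show ?thesis using c0[of J] by simp
    qed
    have "K * ((\<Sum>i<J. c i * (S (Suc i) / sqrt (real n))) + c J) \<le> K * (2 powr p * (c J + U))"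
      using 1 K0 by (rule mult_left_mono)
    moreover have "2 powr (p + 1) * (K * (4 * p) powr p * S 0 / sqrt (real n)) \<le> K * (2 powr (p + 1) * (4 * p) powr p * (c J + U))"
    proof -
      have "2 powr (p + 1) * (K * (4 * p) powr p * S 0 / sqrt (real n)) = (K * (2 powr (p + 1) * (4 * p) powr p)) * (S 0 / sqrt (real n))"
        by (simp add: ac_simps)
      also have "\<dots> \<le> (K * (2 powr (p + 1) * (4 * p) powr p)) * (c J + U)"
        using 2 K0 by (intro mult_left_mono) auto
      finally show ?thesis by (simp add: mult.assoc)
    qed
    ultimately have "K * ((\<Sum>i<J. c i * (S (Suc i) / sqrt (real n))) + c J) + 2 powr (p + 1) * (K * (4 * p) powr p * S 0 / sqrt (real n))
      \<le> K * (2 powr p * (c J + U)) + K * (2 powr (p + 1) * (4 * p) powr p * (c J + U))" by (rule add_mono)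
    also have "\<dots> = K * mean_const p * (c J + U)" by (simp add: mean_const_def algebra_simps)
    also have "c J + U = mean_phi p k n J" by (simp add: mean_phi_def c_def U_def S_def)
    finally show ?thesis .
  qed
  finally have Tb: "(\<integral>x. T x \<partial>?P) \<le> K * mean_const p * mean_phi p k n J" .
  have "(\<integral>\<^sup>+x. ennreal (T x) \<partial>?P) = ennreal (\<integral>x. T x \<partial>?P)"
    using Ti T0 by (intro nn_integral_eq_integral) auto
  also have "\<dots> \<le> ennreal (K * mean_const p * mean_phi p k n J)" using Tb by (rule ennreal_leI)
  finally show ?thesis using coup T0 Ti unfolding K_def \<mu>_def by (intro bexI[of _ T]) auto
qed

section \<open>Mean Wasserstein distance of the empirical measure\<close>

text \<open>A bound for the \<open>p\<close>-th root that is affine in \<open>A\<close>: if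
  \<open>A\<close> has mean at most \<open>r powr p\<close>, then
  \<open>r * (1 + A / r powr p)\<close> has mean at most \<open>2 * r\<close>. It takes the place of
  Jensen's inequality.\<close>

lemma le_linearized_powr:
  fixes A r p :: real
  assumes "0 \<le> A" "0 < r" "1 \<le> p"
  shows "A \<le> (r * (1 + A / r powr p)) powr p"
proof -
  let ?t = "A / r powr p"
  have t: "0 \<le> ?t" using assms by simp
  have "?t \<le> (1 + ?t) powr 1" using t by simp
  also have "\<dots> \<le> (1 + ?t) powr p" using t assms by (intro powr_mono) auto
  finally have "r powr p * ?t \<le> r powr p * (1 + ?t) powr p" by (rule mult_left_mono) simp
  then show ?thesis using assms t by (simp add: powr_mult)
qed

lemma wasserstein_le_linearized:
  assumes "\<pi> \<in> couplings d \<mu> \<nu>" "tcost d p \<pi> \<le> ennreal A" "0 \<le> A" "0 < r" "1 \<le> p"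
  shows "wasserstein d p \<mu> \<nu> \<le> ennreal (r * (1 + A / r powr p))"
proof (rule wasserstein_le_coupling[OF assms(1)])
  show "tcost d p \<pi> \<le> ennreal ((r * (1 + A / r powr p)) powr p)"
    using assms(2) ennreal_leI[OF le_linearized_powr[OF assms(3-5)]] by (rule order_trans)
  show "0 \<le> r * (1 + A / r powr p)" using assms by auto
qed (rule assms(5))

lemma nn_integral_sample_average:
  assumes M: "prob_space M" and f: "f \<in> borel_measurable M" and n: "0 < n"
  shows "(\<integral>\<^sup>+x. (\<Sum>i<n. f (x i)) * ennreal (1 / real n) \<partial>Pi\<^sub>M {..<n} (\<lambda>_. M)) = (\<integral>\<^sup>+\<omega>. f \<omega> \<partial>M)"
proof -
  interpret M: prob_space M by fact
  let ?P = "Pi\<^sub>M {..<n} (\<lambda>_. M)"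
  have fm: "(\<lambda>x. f (x i)) \<in> borel_measurable ?P" if "i < n" for i
    using measurable_compose[OF measurable_component_singleton[of i "{..<n}" "\<lambda>_. M"] f] that by simp
  have each: "(\<integral>\<^sup>+x. f (x i) \<partial>?P) = (\<integral>\<^sup>+\<omega>. f \<omega> \<partial>M)" if i: "i < n" for i
  proof -
    have e: "distr ?P M (\<lambda>x. x i) = M" by (rule distr_PiM_component) (use i M in auto)
    have "(\<integral>\<^sup>+\<omega>. f \<omega> \<partial>distr ?P M (\<lambda>x. x i)) = (\<integral>\<^sup>+x. f (x i) \<partial>?P)"
      using i f by (intro nn_integral_distr) auto
    then show ?thesis unfolding e by simp
  qed
  have "(\<integral>\<^sup>+x. (\<Sum>i<n. f (x i)) * ennreal (1 / real n) \<partial>?P) = (\<integral>\<^sup>+x. (\<Sum>i<n. f (x i)) \<partial>?P) * ennreal (1 / real n)"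
    by (intro nn_integral_multc borel_measurable_sum fm) auto
  also have "(\<integral>\<^sup>+x. (\<Sum>i<n. f (x i)) \<partial>?P) = (\<Sum>i<n. \<integral>\<^sup>+x. f (x i) \<partial>?P)"
    by (intro nn_integral_sum fm) auto
  also have "\<dots> = of_nat n * (\<integral>\<^sup>+\<omega>. f \<omega> \<partial>M)" by (simp add: each)
  also have "\<dots> * ennreal (1 / real n) = (of_nat n * ennreal (1 / real n)) * (\<integral>\<^sup>+\<omega>. f \<omega> \<partial>M)" by (simp add: ac_simps)
  also have "of_nat n * ennreal (1 / real n) = 1"
    using n by (simp add: ennreal_of_nat_eq_real_of_nat ennreal_mult[symmetric])
  finally show ?thesis by simp
qed

text \<open>The two empirical measures are coupled by drawing the same index; the resulting cost is
  an average over the samples, whose mean is that of a single pair.\<close>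

lemma mean_empirical_joint:
  assumes M: "prob_space M" and Y: "Y \<in> measurable M (Rd k)" and Z: "Z \<in> measurable M (Rd k)"
    and p: "1 \<le> p" and n: "0 < n" and r: "0 < r"
    and D: "(\<integral>\<^sup>+\<omega>. ennreal (vdist k (Y \<omega>) (Z \<omega>) powr p) \<partial>M) \<le> ennreal (r powr p)"
  shows "\<exists>B\<in>borel_measurable (Pi\<^sub>M {..<n} (\<lambda>_. M)).
    (\<forall>x\<in>space (Pi\<^sub>M {..<n} (\<lambda>_. M)). wasserstein k p (empirical k n (\<lambda>i. Y (x i))) (empirical k n (\<lambda>i. Z (x i))) \<le> B x) \<and>
    (\<integral>\<^sup>+x. B x \<partial>Pi\<^sub>M {..<n} (\<lambda>_. M)) \<le> ennreal (2 * r)"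
proof -
  let ?P = "Pi\<^sub>M {..<n} (\<lambda>_. M)"
  interpret P: prob_space ?P by (rule prob_space_PiM) (rule M)
  define f where "f \<omega> = vdist k (Y \<omega>) (Z \<omega>) powr p" for \<omega>
  have fm: "f \<in> borel_measurable M" unfolding f_def by (intro powr_real_measurable measurable_vdist Y Z) auto
  have f0: "0 \<le> f \<omega>" for \<omega> by (simp add: f_def)
  define A where "A x = (\<Sum>i<n. f (x i)) / real n" for x
  have A0: "0 \<le> A x" for x using f0 by (simp add: A_def sum_nonneg)
  have fxm: "(\<lambda>x. f (x i)) \<in> borel_measurable ?P" if "i < n" for i
    using measurable_compose[OF measurable_component_singleton[of i "{..<n}" "\<lambda>_. M"] fm] that by simp
  have Am[measurable]: "A \<in> borel_measurable ?P"
    unfolding A_def by (intro borel_measurable_divide borel_measurable_sum fxm measurable_const) auto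
  have Ae: "ennreal (A x) = (\<Sum>i<n. ennreal (f (x i))) * ennreal (1 / real n)" for x
    unfolding A_def using f0 by (simp add: ennreal_mult[symmetric] sum_nonneg)
  have IA: "(\<integral>\<^sup>+x. ennreal (A x) \<partial>?P) \<le> ennreal (r powr p)"
  proof -
    have "(\<integral>\<^sup>+x. ennreal (A x) \<partial>?P) = (\<integral>\<^sup>+\<omega>. ennreal (f \<omega>) \<partial>M)"
      unfolding Ae by (rule nn_integral_sample_average[OF M _ n]) (use fm in measurable)
    also have "\<dots> \<le> ennreal (r powr p)" using D unfolding f_def .
    finally show ?thesis .
  qed
  define B where "B x = ennreal (r * (1 + A x / r powr p))" for x
  show ?thesis
  proof (intro bexI[of _ B] conjI ballI)
    show "B \<in> borel_measurable ?P" unfolding B_def by measurable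
    fix x assume x: "x \<in> space ?P"
    have xi: "x i \<in> space M" if "i < n" for i using x that by (auto simp: space_PiM)
    have mY: "(\<lambda>i. Y (x i)) \<in> measurable (uniform_count_measure {..<n}) (Rd k)"
      and mZ: "(\<lambda>i. Z (x i)) \<in> measurable (uniform_count_measure {..<n}) (Rd k)"
      by (intro prob_on_empirical(2)[OF n] measurable_space[OF Y] measurable_space[OF Z] xi; assumption)+
    have "tcost k p (distr (uniform_count_measure {..<n}) (Rd k \<Otimes>\<^sub>M Rd k) (\<lambda>i. (Y (x i), Z (x i)))) = ennreal (A x)"
      unfolding tcost_joint_law[OF mY mZ] Ae by (subst nn_integral_uniform_count_measure) (auto simp: f_def)
    then show "wasserstein k p (empirical k n (\<lambda>i. Y (x i))) (empirical k n (\<lambda>i. Z (x i))) \<le> B x"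
      unfolding B_def empirical_def using A0 r p
      by (intro wasserstein_le_linearized[OF joint_law_coupling[OF mY mZ]]) auto
  next
    define c where "c = r / r powr p"
    have c0: "0 \<le> c" using r by (simp add: c_def)
    have "(\<integral>\<^sup>+x. B x \<partial>?P) = (\<integral>\<^sup>+x. ennreal r + ennreal c * ennreal (A x) \<partial>?P)"
      unfolding B_def c_def using r A0 by (intro nn_integral_cong) (simp add: ennreal_mult[symmetric] ennreal_plus[symmetric] distrib_left del: ennreal_plus)
    also have "\<dots> = ennreal r + ennreal c * (\<integral>\<^sup>+x. ennreal (A x) \<partial>?P)"
      by (simp add: nn_integral_add nn_integral_cmult P.emeasure_space_1)
    also have "\<dots> \<le> ennreal r + ennreal c * ennreal (r powr p)"
      using IA by (intro add_left_mono mult_left_mono) auto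
    also have "\<dots> = ennreal (2 * r)"
      using c0 r by (simp add: ennreal_mult[symmetric] ennreal_plus[symmetric] c_def del: ennreal_plus)
    finally show "(\<integral>\<^sup>+x. B x \<partial>?P) \<le> ennreal (2 * r)" .
  qed
qed

definition moment_const :: "real \<Rightarrow> real" where
  "moment_const p = 2 * exp 2 * p powr p"

text \<open>In units \<open>t\<close> of \<open>s * sqrt k\<close> the hypothesis bounds the mean of
  \<open>exp (k * t)\<close> by \<open>exp (2 * k)\<close>. Splitting at \<open>t = 2\<close>,
  beyond which \<open>exp t <= exp 2 * exp (k * t - 2 * k)\<close>, cancels the factor
  \<open>exp (2 * k)\<close>, so that the constant is free of \<open>k\<close>.\<close>

lemma radial_moment:
  assumes M: "prob_space M" and Y: "Y \<in> measurable M (Rd k)" and s: "0 < s" and p: "1 \<le> p" and k: "0 < k"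
    and H: "(\<integral>\<^sup>+\<omega>. ennreal (exp (sqrt (real k) * L2_set (Y \<omega>) {..<k} / s)) \<partial>M) \<le> ennreal (exp (2 * real k))"
  shows "(\<integral>\<^sup>+\<omega>. ennreal (L2_set (Y \<omega>) {..<k} powr p) \<partial>M) \<le> ennreal ((s * sqrt (real k)) powr p * moment_const p)"
proof -
  interpret M: prob_space M by fact
  let ?N = "\<lambda>\<omega>. L2_set (Y \<omega>) {..<k}" and ?a = "s * sqrt (real k)"
  have Nm[measurable]: "?N \<in> borel_measurable M"
    unfolding L2_set_eq_vdist by (rule measurable_vdist[OF Y measurable_const[OF zero_in_Rd]])
  have a: "0 < ?a" using s k by simp
  define C where "C = ?a powr p * p powr p * exp 2"
  have C0: "0 \<le> C" by (simp add: C_def)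
  have pt: "?N \<omega> powr p \<le> C + C * exp (- 2 * real k) * exp (sqrt (real k) * ?N \<omega> / s)" for \<omega>
  proof -
    define t where "t = ?N \<omega> / ?a"
    have t: "0 \<le> t" using a by (simp add: t_def)
    have Nt: "?N \<omega> = ?a * t" using s k by (simp add: t_def)
    have kt: "sqrt (real k) * ?N \<omega> / s = real k * t" unfolding Nt using s by simp
    have "exp t \<le> exp 2 + exp 2 * exp (real k * t - 2 * real k)"
    proof (cases "t \<le> 2")
      case True
      then have "exp t \<le> exp 2" by simp
      then show ?thesis by (simp add: add_increasing2)
    next
      case False
      have "1 * (t - 2) \<le> real k * (t - 2)" using False k by (intro mult_right_mono) auto
      then have "t \<le> 2 + (real k * t - 2 * real k)" by (simp add: algebra_simps)
      then have "exp t \<le> exp (2 + (real k * t - 2 * real k))" by simp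
      then show ?thesis by (simp add: exp_add add_increasing)
    qed
    then have e: "exp t \<le> exp 2 * (1 + exp (- 2 * real k) * exp (real k * t))"
      by (simp add: exp_diff exp_minus field_simps)
    have "?N \<omega> powr p = ?a powr p * t powr p" unfolding Nt using a t by (intro powr_mult)
    also have "\<dots> \<le> ?a powr p * (p powr p * exp t)"
      using powr_le_exp[OF t, of p 1] p by (intro mult_left_mono) auto
    also have "\<dots> \<le> ?a powr p * (p powr p * (exp 2 * (1 + exp (- 2 * real k) * exp (real k * t))))"
      using e by (intro mult_left_mono) auto
    also have "\<dots> = C + C * exp (- 2 * real k) * exp (real k * t)" by (simp add: C_def algebra_simps)
    finally show ?thesis unfolding kt .
  qed
  have "(\<integral>\<^sup>+\<omega>. ennreal (?N \<omega> powr p) \<partial>M)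
      \<le> (\<integral>\<^sup>+\<omega>. ennreal C + ennreal (C * exp (- 2 * real k)) * ennreal (exp (sqrt (real k) * ?N \<omega> / s)) \<partial>M)"
    using pt C0 by (intro nn_integral_mono) (simp add: ennreal_mult[symmetric] ennreal_plus[symmetric] ennreal_leI del: ennreal_plus)
  also have "\<dots> = ennreal C + ennreal (C * exp (- 2 * real k)) * (\<integral>\<^sup>+\<omega>. ennreal (exp (sqrt (real k) * ?N \<omega> / s)) \<partial>M)"
    by (simp add: nn_integral_add nn_integral_cmult M.emeasure_space_1)
  also have "\<dots> \<le> ennreal C + ennreal (C * exp (- 2 * real k)) * ennreal (exp (2 * real k))"
    using H by (intro add_left_mono mult_left_mono) auto
  also have "\<dots> = ennreal (C + C * (exp (- 2 * real k) * exp (2 * real k)))"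
    using C0 by (simp add: ennreal_mult[symmetric] ennreal_plus[symmetric] mult.assoc del: ennreal_plus)
  also have "C + C * (exp (- 2 * real k) * exp (2 * real k)) = ?a powr p * moment_const p"
    by (simp add: exp_add[symmetric] C_def moment_const_def)
  finally show ?thesis .
qed

text \<open>Truncation coordinate by coordinate: it leaves finitely many cells, and for nonnegative
  \<open>B\<close> it does not increase absolute values, so exponential moments survive.\<close>

definition clamp_box :: "nat \<Rightarrow> real \<Rightarrow> vec \<Rightarrow> vec" where
  "clamp_box k B y = (\<lambda>i\<in>{..<k}. max (- B) (min B (y i)))"

lemma clamp_box_measurable: "clamp_box k B \<in> measurable (Rd k) (Rd k)"
proof (rule measurable_RdI)
  fix i assume i: "i < k"
  have [measurable]: "(\<lambda>x. x i) \<in> borel_measurable (Rd k)"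
    by (rule measurable_Rd_coord[of "\<lambda>x. x"]) (use i in auto)
  show "(\<lambda>x. clamp_box k B x i) \<in> borel_measurable (Rd k)"
    using i by (simp add: clamp_box_def)
qed (simp add: clamp_box_def)

lemma vdist_clamp_box_le: "0 \<le> B \<Longrightarrow> vdist k y (clamp_box k B y) \<le> L2_set y {..<k}"
  unfolding vdist_def L2_set_def
  by (intro real_sqrt_le_mono sum_mono abs_le_square_iff[THEN iffD1]) (auto simp: clamp_box_def max_def min_def)

lemma sum_abs_le_L2: "(\<Sum>i<k. \<bar>y i\<bar>) \<le> sqrt (real k) * L2_set y {..<k}"
  using L2_set_mult_ineq[of "\<lambda>_. 1" y "{..<k}"] by (simp add: L2_set_constant)

text \<open>Pointwise the clamped vector eventually equals the original one, and the norm dominates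
  the difference.\<close>

lemma clamp_box_approx:
  assumes M: "prob_space M" and Y: "Y \<in> measurable M (Rd k)" and p: "1 \<le> p" and e: "0 < e"
    and mom: "(\<integral>\<^sup>+\<omega>. ennreal (L2_set (Y \<omega>) {..<k} powr p) \<partial>M) < \<top>"
  shows "\<exists>B::nat. (\<integral>\<^sup>+\<omega>. ennreal (vdist k (Y \<omega>) (clamp_box k (real B) (Y \<omega>)) powr p) \<partial>M) \<le> ennreal e"
proof -
  let ?f = "\<lambda>B \<omega>. ennreal (vdist k (Y \<omega>) (clamp_box k (real B) (Y \<omega>)) powr p)"
  have "(\<lambda>B. \<integral>\<^sup>+\<omega>. ?f B \<omega> \<partial>M) \<longlonglongrightarrow> (\<integral>\<^sup>+\<omega>. 0 \<partial>M)"
  proof (rule nn_integral_dominated_convergence[where w="\<lambda>\<omega>. ennreal (L2_set (Y \<omega>) {..<k} powr p)"])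
    show "?f B \<in> borel_measurable M" for B :: nat
      using measurable_vdist[OF Y measurable_compose[OF Y clamp_box_measurable]] by measurable
    have "(\<lambda>\<omega>. L2_set (Y \<omega>) {..<k}) \<in> borel_measurable M"
      unfolding L2_set_eq_vdist by (rule measurable_vdist[OF Y measurable_const[OF zero_in_Rd]])
    then show "(\<lambda>\<omega>. ennreal (L2_set (Y \<omega>) {..<k} powr p)) \<in> borel_measurable M" by measurable
    show "AE \<omega> in M. ?f B \<omega> \<le> ennreal (L2_set (Y \<omega>) {..<k} powr p)" for B
      using p by (intro AE_I2 ennreal_leI powr_mono2 vdist_clamp_box_le) auto
    show "AE \<omega> in M. (\<lambda>B. ?f B \<omega>) \<longlonglongrightarrow> 0"
    proof (rule AE_I2, rule tendsto_eventually)
      fix \<omega>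
      obtain N :: nat where N: "(\<Sum>i<k. \<bar>Y \<omega> i\<bar>) \<le> real N" using real_arch_simple by blast
      have "?f B \<omega> = 0" if B: "N \<le> B" for B
      proof -
        have "Y \<omega> i - clamp_box k (real B) (Y \<omega>) i = 0" if i: "i < k" for i
        proof -
          have "\<bar>Y \<omega> i\<bar> \<le> (\<Sum>i<k. \<bar>Y \<omega> i\<bar>)" using i by (intro member_le_sum) auto
          then have "\<bar>Y \<omega> i\<bar> \<le> real B" using N B by linarith
          then show ?thesis using i by (auto simp: clamp_box_def max_def min_def abs_le_iff)
        qed
        then have "vdist k (Y \<omega>) (clamp_box k (real B) (Y \<omega>)) = 0"
          unfolding vdist_def by (intro L2_set_0') auto
        then show ?thesis by simp
      qed
      then show "\<forall>\<^sub>F B in sequentially. ?f B \<omega> = 0" unfolding eventually_sequentially by blast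
    qed
  qed (use mom in \<open>auto simp: less_top\<close>)
  then have "(\<lambda>B. \<integral>\<^sup>+\<omega>. ?f B \<omega> \<partial>M) \<longlonglongrightarrow> 0" by simp
  then have "\<forall>\<^sub>F B in sequentially. (\<integral>\<^sup>+\<omega>. ?f B \<omega> \<partial>M) < ennreal e"
    using e by (intro order_tendstoD(2)) auto
  then obtain B where "(\<integral>\<^sup>+\<omega>. ?f B \<omega> \<partial>M) < ennreal e"
    by (auto simp: eventually_sequentially)
  then show ?thesis by (auto intro: less_imp_le)
qed

lemma empirical_glueable:
  assumes n: "0 < n" and y: "\<And>i. i < n \<Longrightarrow> y i \<in> space (Rd d)" and \<beta>: "prob_on d \<beta>"
  shows "glueable d (empirical d n y) \<beta>"
proof (rule glueable_finite_support[OF prob_on_empirical(1)[OF n y] \<beta>, where A="y ` {..<n}"])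
  let ?U = "uniform_count_measure {..<n}"
  have ym: "y \<in> measurable ?U (Rd d)" by (rule prob_on_empirical(2)[OF n y])
  have "y i \<in> space (Rd d) \<Longrightarrow> {y i} \<in> sets (Rd d)" for i
  proof -
    assume yi: "y i \<in> space (Rd d)"
    have "{y i} = (\<Pi>\<^sub>E l\<in>{..<d}. {y i l})" using PiE_singleton[of "y i" "{..<d}"] yi by (simp add: space_Rd)
    also have "\<dots> \<in> sets (Rd d)" unfolding Rd_def by (rule sets_PiM_I_finite) auto
    finally show ?thesis .
  qed
  then have "(\<Union>i\<in>{..<n}. {y i}) \<in> sets (Rd d)" using y by (intro sets.finite_UN) auto
  moreover have "{x \<in> space (Rd d). x \<in> y ` {..<n}} = (\<Union>i\<in>{..<n}. {y i})" using y by auto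
  ultimately have "{x \<in> space (Rd d). x \<in> y ` {..<n}} \<in> sets (Rd d)" by simp
  then show "AE x in empirical d n y. x \<in> y ` {..<n}"
    unfolding empirical_def by (subst AE_distr_iff[OF ym]) (auto simp: space_uniform_count_measure)
qed auto

text \<open>Three legs: between the empirical measures of \<open>Y\<close> and of its truncation
  \<open>Z\<close>, from the empirical measure of \<open>Z\<close> to its law, and between the laws
  of \<open>Z\<close> and \<open>Y\<close>. Only the middle leg has a size; the outer ones are made
  smaller than any given error by the truncation level.\<close>

lemma mean_wasserstein:
  assumes M: "prob_space M" and Y: "Y \<in> measurable M (Rd k)" and s: "0 < s" and p: "1 \<le> p" and k: "0 < k" and n: "0 < n"
    and H: "(\<integral>\<^sup>+\<omega>. ennreal (exp (sqrt (real k) * L2_set (Y \<omega>) {..<k} / s)) \<partial>M) \<le> ennreal (exp (2 * real k))"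
  shows "(\<integral>\<^sup>+x. wasserstein k p (empirical k n (\<lambda>i. Y (x i))) (distr M (Rd k) Y) \<partial>Pi\<^sub>M {..<n} (\<lambda>_. M))
    \<le> ennreal (2 * (s * sqrt (real k) * (mean_const p * mean_phi p k n J) powr (1 / p)))"
proof (rule ennreal_le_epsilon)
  fix e :: real assume e: "0 < e"
  let ?P = "Pi\<^sub>M {..<n} (\<lambda>_. M)"
  interpret M: prob_space M by fact
  interpret P: prob_space ?P by (rule prob_space_PiM) (rule M)
  define \<epsilon> where "\<epsilon> = e / 3"
  have \<epsilon>: "0 < \<epsilon>" using e by (simp add: \<epsilon>_def)
  have "(\<integral>\<^sup>+\<omega>. ennreal (L2_set (Y \<omega>) {..<k} powr p) \<partial>M) < \<top>"
    by (rule le_less_trans[OF radial_moment[OF M Y s p k H]]) simp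
  then obtain B :: nat where B: "(\<integral>\<^sup>+\<omega>. ennreal (vdist k (Y \<omega>) (clamp_box k (real B) (Y \<omega>)) powr p) \<partial>M) \<le> ennreal (\<epsilon> powr p)"
    using clamp_box_approx[OF M Y p, of "\<epsilon> powr p"] \<epsilon> by auto
  define Z where "Z \<omega> = clamp_box k (real B) (Y \<omega>)" for \<omega>
  have Z: "Z \<in> measurable M (Rd k)" unfolding Z_def by (rule measurable_compose[OF Y clamp_box_measurable])
  obtain B1 where B1: "B1 \<in> borel_measurable ?P"
    "\<And>x. x \<in> space ?P \<Longrightarrow> wasserstein k p (empirical k n (\<lambda>i. Y (x i))) (empirical k n (\<lambda>i. Z (x i))) \<le> B1 x"
    "(\<integral>\<^sup>+x. B1 x \<partial>?P) \<le> ennreal (2 * \<epsilon>)"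
    using mean_empirical_joint[OF M Y Z p n \<epsilon>] B unfolding Z_def by blast
  define m :: int where "m = \<lceil>2 ^ J * real B / s\<rceil> + 1"
  have m0: "0 \<le> m"
  proof -
    have "0 \<le> 2 ^ J * real B / s" using s by simp
    then show ?thesis unfolding m_def by linarith
  qed
  have box: "cell k s J (Z \<omega>) \<in> box_cells k m" for \<omega>
  proof -
    have "- m \<le> \<lfloor>2 ^ J * Z \<omega> i / s\<rfloor> \<and> \<lfloor>2 ^ J * Z \<omega> i / s\<rfloor> \<le> m" if i: "i < k" for i
    proof -
      have "\<bar>Z \<omega> i\<bar> \<le> real B" using i by (auto simp: Z_def clamp_box_def abs_le_iff max_def min_def)
      then have "(2 ^ J / s) * \<bar>Z \<omega> i\<bar> \<le> (2 ^ J / s) * real B" using s by (intro mult_left_mono) auto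
      then have "\<bar>2 ^ J * Z \<omega> i / s\<bar> \<le> 2 ^ J * real B / s" using s by (simp add: abs_mult)
      then show ?thesis unfolding m_def by linarith
    qed
    then show ?thesis by (auto simp: box_cells_def cell_def)
  qed
  have HZ: "(\<integral>\<^sup>+\<omega>. ennreal (exp ((\<Sum>i<k. \<bar>Z \<omega> i\<bar>) / s)) \<partial>M) \<le> ennreal (exp (2 * real k))"
  proof -
    have "(\<Sum>i<k. \<bar>Z \<omega> i\<bar>) \<le> sqrt (real k) * L2_set (Y \<omega>) {..<k}" for \<omega>
    proof -
      have "(\<Sum>i<k. \<bar>Z \<omega> i\<bar>) \<le> (\<Sum>i<k. \<bar>Y \<omega> i\<bar>)"
        by (intro sum_mono) (auto simp: Z_def clamp_box_def max_def min_def)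
      also note sum_abs_le_L2
      finally show ?thesis .
    qed
    then have "(\<integral>\<^sup>+\<omega>. ennreal (exp ((\<Sum>i<k. \<bar>Z \<omega> i\<bar>) / s)) \<partial>M)
      \<le> (\<integral>\<^sup>+\<omega>. ennreal (exp (sqrt (real k) * L2_set (Y \<omega>) {..<k} / s)) \<partial>M)"
      using s by (intro nn_integral_mono ennreal_leI) (simp add: divide_right_mono)
    also note H
    finally show ?thesis .
  qed
  define K where "K = (sqrt (real k) * s) powr p * mean_const p * mean_phi p k n J"
  obtain T where T: "T \<in> borel_measurable ?P" "\<And>x. x \<in> space ?P \<Longrightarrow> 0 \<le> T x"
    "\<And>x. x \<in> space ?P \<Longrightarrow> \<exists>\<Xi>\<in>couplings k (empirical k n (\<lambda>i. Z (x i))) (distr M (Rd k) Z). tcost k p \<Xi> \<le> ennreal (T x)"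
    "(\<integral>\<^sup>+x. ennreal (T x) \<partial>?P) \<le> ennreal K"
    using bounded_mean_cost[OF M Z s p k n m0 box HZ] unfolding K_def by blast
  \<comment> \<open>Chosen so that \<open>r powr p\<close> is the bound \<open>K\<close> on the mean
    cost, for which the linearized root has mean at most \<open>2 * r\<close>.\<close>
  define r where "r = s * sqrt (real k) * (mean_const p * mean_phi p k n J) powr (1 / p)"
  have mc: "0 < mean_const p" using p by (auto simp: mean_const_def intro!: add_pos_nonneg)
  have mp: "0 < mean_phi p k n J" unfolding mean_phi_def by (intro add_pos_nonneg divide_nonneg_nonneg sum_nonneg) auto
  have r: "0 < r" unfolding r_def using s k mc mp by simp
  have rp: "r powr p = K"
    unfolding r_def K_def using s k mc mp p by (simp add: powr_mult powr_powr mult.commute)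
  define B2 where "B2 x = ennreal (r * (1 + T x / r powr p))" for x
  have B2m: "B2 \<in> borel_measurable ?P" unfolding B2_def using T(1) by measurable
  have B2i: "(\<integral>\<^sup>+x. B2 x \<partial>?P) \<le> ennreal (2 * r)"
  proof -
    define c where "c = r / r powr p"
    have c0: "0 \<le> c" using r by (simp add: c_def)
    have "(\<integral>\<^sup>+x. B2 x \<partial>?P) = (\<integral>\<^sup>+x. ennreal r + ennreal c * ennreal (T x) \<partial>?P)"
      unfolding B2_def c_def using r T(2)
      by (intro nn_integral_cong) (simp add: ennreal_mult[symmetric] ennreal_plus[symmetric] distrib_left del: ennreal_plus)
    also have "\<dots> = ennreal r + ennreal c * (\<integral>\<^sup>+x. ennreal (T x) \<partial>?P)"
      using T(1) by (simp add: nn_integral_add nn_integral_cmult P.emeasure_space_1)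
    also have "\<dots> \<le> ennreal r + ennreal c * ennreal (r powr p)"
      using T(4) rp by (intro add_left_mono mult_left_mono) auto
    also have "\<dots> = ennreal (2 * r)"
      using c0 r by (simp add: ennreal_mult[symmetric] ennreal_plus[symmetric] c_def del: ennreal_plus)
    finally show ?thesis .
  qed
  have W3: "wasserstein k p (distr M (Rd k) Z) (distr M (Rd k) Y) \<le> ennreal \<epsilon>"
    using B \<epsilon> p by (intro wasserstein_joint_law_le[OF Z Y]) (auto simp: Z_def vdist_commute)
  have "(\<integral>\<^sup>+x. wasserstein k p (empirical k n (\<lambda>i. Y (x i))) (distr M (Rd k) Y) \<partial>?P)
    \<le> (\<integral>\<^sup>+x. B1 x + (B2 x + ennreal \<epsilon>) \<partial>?P)"
  proof (rule nn_integral_mono)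
    fix x assume x: "x \<in> space ?P"
    have xi: "x i \<in> space M" if "i < n" for i using x that by (auto simp: space_PiM)
    note Yi = measurable_space[OF Y xi] and Zi = measurable_space[OF Z xi]
    have eY: "prob_on k (empirical k n (\<lambda>i. Y (x i)))" and eZ: "prob_on k (empirical k n (\<lambda>i. Z (x i)))"
      using Yi Zi by (auto intro: prob_on_empirical(1)[OF n])
    have t1: "wasserstein k p (empirical k n (\<lambda>i. Y (x i))) (distr M (Rd k) Y)
      \<le> wasserstein k p (empirical k n (\<lambda>i. Y (x i))) (empirical k n (\<lambda>i. Z (x i)))
        + wasserstein k p (empirical k n (\<lambda>i. Z (x i))) (distr M (Rd k) Y)"
      using Yi by (intro wasserstein_triangle[OF eY eZ _ p] empirical_glueable[OF n _ eZ]) auto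
    have t2: "wasserstein k p (empirical k n (\<lambda>i. Z (x i))) (distr M (Rd k) Y)
      \<le> wasserstein k p (empirical k n (\<lambda>i. Z (x i))) (distr M (Rd k) Z) + wasserstein k p (distr M (Rd k) Z) (distr M (Rd k) Y)"
      using Zi by (intro wasserstein_triangle[OF eZ prob_on_distr[OF M Z] _ p] empirical_glueable[OF n _ prob_on_distr[OF M Z]]) auto
    have t3: "wasserstein k p (empirical k n (\<lambda>i. Z (x i))) (distr M (Rd k) Z) \<le> B2 x"
    proof -
      obtain \<Xi> where "\<Xi> \<in> couplings k (empirical k n (\<lambda>i. Z (x i))) (distr M (Rd k) Z)" "tcost k p \<Xi> \<le> ennreal (T x)"
        using T(3)[OF x] by blast
      then show ?thesis unfolding B2_def using T(2)[OF x] r p by (rule wasserstein_le_linearized)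
    qed
    show "wasserstein k p (empirical k n (\<lambda>i. Y (x i))) (distr M (Rd k) Y) \<le> B1 x + (B2 x + ennreal \<epsilon>)"
      by (rule order_trans[OF t1 add_mono[OF B1(2)[OF x] order_trans[OF t2 add_mono[OF t3 W3]]]])
  qed
  also have "\<dots> = (\<integral>\<^sup>+x. B1 x \<partial>?P) + ((\<integral>\<^sup>+x. B2 x \<partial>?P) + ennreal \<epsilon>)"
    using B1(1) B2m by (simp add: nn_integral_add P.emeasure_space_1)
  also have "\<dots> \<le> ennreal (2 * \<epsilon>) + (ennreal (2 * r) + ennreal \<epsilon>)"
    using B1(3) B2i by (intro add_mono) auto
  also have "\<dots> = ennreal (2 * r) + ennreal e"
    using r \<epsilon> by (simp add: ennreal_plus[symmetric] \<epsilon>_def del: ennreal_plus)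
  finally show "(\<integral>\<^sup>+x. wasserstein k p (empirical k n (\<lambda>i. Y (x i))) (distr M (Rd k) Y) \<partial>?P)
    \<le> ennreal (2 * (s * sqrt (real k) * (mean_const p * mean_phi p k n J) powr (1 / p))) + ennreal e"
    unfolding r_def .
qed

text \<open>Comparison with the point mass at the origin, at cost \<open>2 * r\<close> in the mean
  for the empirical measure and \<open>r\<close> for the law. It is the bound of last resort when
  \<open>n\<close> is smaller than an exponential of \<open>k\<close>.\<close>

lemma mean_wasserstein_trivial:
  assumes M: "prob_space M" and Y: "Y \<in> measurable M (Rd k)" and s: "0 < s" and p: "1 \<le> p" and k: "0 < k" and n: "0 < n"
    and H: "(\<integral>\<^sup>+\<omega>. ennreal (exp (sqrt (real k) * L2_set (Y \<omega>) {..<k} / s)) \<partial>M) \<le> ennreal (exp (2 * real k))"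
  shows "(\<integral>\<^sup>+x. wasserstein k p (empirical k n (\<lambda>i. Y (x i))) (distr M (Rd k) Y) \<partial>Pi\<^sub>M {..<n} (\<lambda>_. M))
    \<le> ennreal (3 * (s * sqrt (real k) * moment_const p powr (1 / p)))"
proof -
  let ?P = "Pi\<^sub>M {..<n} (\<lambda>_. M)"
  interpret M: prob_space M by fact
  interpret P: prob_space ?P by (rule prob_space_PiM) (rule M)
  let ?z = "\<lambda>i\<in>{..<k}. 0 :: real"
  define r where "r = s * sqrt (real k) * moment_const p powr (1 / p)"
  have mc: "0 < moment_const p" using p by (simp add: moment_const_def)
  have r: "0 < r" unfolding r_def using s k mc by simp
  have rp: "r powr p = (s * sqrt (real k)) powr p * moment_const p"
    unfolding r_def using s k mc p by (simp add: powr_mult powr_powr)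
  have Z: "(\<lambda>_. ?z) \<in> measurable M (Rd k)" by (rule measurable_const[OF zero_in_Rd])
  have D: "(\<integral>\<^sup>+\<omega>. ennreal (vdist k (Y \<omega>) ?z powr p) \<partial>M) \<le> ennreal (r powr p)"
    using radial_moment[OF M Y s p k H] unfolding L2_set_eq_vdist rp .
  obtain B where B: "B \<in> borel_measurable ?P"
    "\<And>x. x \<in> space ?P \<Longrightarrow> wasserstein k p (empirical k n (\<lambda>i. Y (x i))) (empirical k n (\<lambda>i. ?z)) \<le> B x"
    "(\<integral>\<^sup>+x. B x \<partial>?P) \<le> ennreal (2 * r)"
    using mean_empirical_joint[OF M Y Z p n r D] by blast
  have ez: "empirical k n (\<lambda>i. ?z) = distr M (Rd k) (\<lambda>_. ?z)"
  proof -
    interpret U: prob_space "uniform_count_measure {..<n}" using n by (intro prob_space_uniform_count_measure) auto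
    show ?thesis unfolding empirical_def U.distr_const[OF zero_in_Rd] M.distr_const[OF zero_in_Rd] ..
  qed
  have W3: "wasserstein k p (distr M (Rd k) (\<lambda>_. ?z)) (distr M (Rd k) Y) \<le> ennreal r"
    using D r p by (intro wasserstein_joint_law_le[OF Z Y]) (auto simp: vdist_commute[of k ?z])
  have pz: "prob_on k (distr M (Rd k) (\<lambda>_. ?z))" by (rule prob_on_distr[OF M Z])
  have "(\<integral>\<^sup>+x. wasserstein k p (empirical k n (\<lambda>i. Y (x i))) (distr M (Rd k) Y) \<partial>?P)
    \<le> (\<integral>\<^sup>+x. B x + ennreal r \<partial>?P)"
  proof (rule nn_integral_mono)
    fix x assume x: "x \<in> space ?P"
    have xi: "x i \<in> space M" if "i < n" for i using x that by (auto simp: space_PiM)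
    note Yi = measurable_space[OF Y xi]
    have eY: "prob_on k (empirical k n (\<lambda>i. Y (x i)))"
      using Yi by (auto intro: prob_on_empirical(1)[OF n])
    have "wasserstein k p (empirical k n (\<lambda>i. Y (x i))) (distr M (Rd k) Y)
      \<le> wasserstein k p (empirical k n (\<lambda>i. Y (x i))) (distr M (Rd k) (\<lambda>_. ?z))
        + wasserstein k p (distr M (Rd k) (\<lambda>_. ?z)) (distr M (Rd k) Y)"
      using Yi by (intro wasserstein_triangle[OF eY pz _ p] empirical_glueable[OF n _ pz]) auto
    also have "\<dots> \<le> B x + ennreal r"
      using B(2)[OF x] W3 unfolding ez by (rule add_mono)
    finally show "wasserstein k p (empirical k n (\<lambda>i. Y (x i))) (distr M (Rd k) Y) \<le> B x + ennreal r" .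
  qed
  also have "\<dots> = (\<integral>\<^sup>+x. B x \<partial>?P) + ennreal r"
    using B(1) by (simp add: nn_integral_add P.emeasure_space_1)
  also have "\<dots> \<le> ennreal (2 * r) + ennreal r"
    using B(3) by (rule add_right_mono)
  also have "\<dots> = ennreal (3 * r)" using r by (simp add: ennreal_plus[symmetric] del: ennreal_plus)
  finally show ?thesis unfolding r_def .
qed

section \<open>The three regimes of the rate\<close>

lemma geometric_sum_le:
  fixes q :: real
  assumes "0 \<le> q" "q < 1"
  shows "(\<Sum>i\<le>J. q ^ i) \<le> 1 / (1 - q)"
proof -
  have "(\<Sum>i\<le>J. q ^ i) = (1 - q ^ Suc J) / (1 - q)"
    using assms by (simp add: sum_gp0)
  also have "\<dots> \<le> 1 / (1 - q)" using assms by (intro divide_right_mono) auto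
  finally show ?thesis .
qed

text \<open>The ratio \<open>2 powr (k / 2 - p)\<close> of consecutive levels decides the rate:
  below 1 the coarse levels dominate, at 1 all contribute equally, above 1 the finest
  dominates.\<close>

lemma mean_phi_geometric:
  "mean_phi p k n J = 2 powr (- (real J * p)) +
     (5 * exp 4) powr (real k / 2) * (\<Sum>i\<le>J. (2 powr (real k / 2 - p)) ^ i) / sqrt (real n)"
proof -
  have "2 powr (- (real i * p)) * (5 * exp 4 * 2 ^ i) powr (real k / 2)
    = (5 * exp 4) powr (real k / 2) * (2 powr (real k / 2 - p)) ^ i" for i
  proof -
    have "(5 * exp 4 * 2 ^ i) powr (real k / 2) = (5 * exp 4) powr (real k / 2) * (2 ^ i) powr (real k / 2)"
      by (rule powr_mult)
    also have "(2 ^ i) powr (real k / 2) = 2 powr (real i * (real k / 2))"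
      by (simp add: powr_realpow[symmetric] powr_powr)
    also have "(2 powr (real k / 2 - p)) ^ i = 2 powr (real i * (real k / 2) - real i * p)"
      by (simp add: powr_realpow[symmetric] powr_powr algebra_simps)
    then show ?thesis using calculation by (simp add: powr_diff powr_minus_divide)
  qed
  then show ?thesis unfolding mean_phi_def by (simp add: sum_distrib_left)
qed

lemma dyadic_below:
  assumes "1 \<le> (y::real)"
  obtains J :: nat where "2 ^ J \<le> y" "y < 2 ^ Suc J"
proof -
  obtain N :: nat where N: "y < 2 ^ N" using real_arch_pow[of 2 y] by auto
  define J where "J = (LEAST N. y < 2 ^ Suc N)"
  have ex: "\<exists>N. y < 2 ^ Suc N"
  proof (intro exI[of _ N])
    have "(2::real) ^ N \<le> 2 ^ Suc N" by simp
    with N show "y < 2 ^ Suc N" by linarith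
  qed
  have 1: "y < 2 ^ Suc J" unfolding J_def by (rule LeastI_ex[OF ex])
  have "2 ^ J \<le> y"
  proof (cases J)
    case (Suc i)
    then have "\<not> y < 2 ^ Suc i" using not_less_Least[of i "\<lambda>N. y < 2 ^ Suc N"] unfolding J_def by simp
    then show ?thesis using Suc by simp
  qed (use assms in simp)
  with 1 show ?thesis using that by blast
qed

lemma two_powr_neg_mult: "2 powr (- (real J * p)) = (2 ^ J) powr (- p)"
  by (simp add: powr_realpow[symmetric] powr_powr)

text \<open>The series converges, so the depth may be taken as large as \<open>n\<close>, where the
  discretization error is negligible. The factor \<open>D powr (k / 2)\<close> is at most
  \<open>D powr p\<close>.\<close>

lemma mean_phi_small_dim:
  assumes p: "1 \<le> p"
  shows "\<exists>c>0. \<forall>k n. 0 < k \<and> real k < 2 * p \<and> 0 < n \<longrightarrow> (\<exists>J. mean_phi p k n J \<le> c * real n powr (- 1 / 2))"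
proof -
  define D :: real where "D = 5 * exp 4"
  have D: "1 \<le> D" unfolding D_def using one_le_exp_iff[of 4] by linarith
  \<comment> \<open>Half the distance from \<open>2 * p\<close> down to the largest integer strictly
    below it: a gap that depends on \<open>p\<close> only and bounds the ratio for all admissible
    \<open>k\<close>.\<close>
  define g where "g = p - (of_int \<lceil>2 * p\<rceil> - 1) / 2"
  have g: "0 < g" unfolding g_def by (simp add: field_simps) linarith
  define q where "q = 2 powr (- g)"
  have q: "0 \<le> q" "q < 1" using g powr_less_mono[of "-g" 0 2] by (auto simp: q_def)
  define c where "c = 1 + D powr p * (1 / (1 - q))"
  have c: "0 < c" unfolding c_def using q D by (intro add_pos_nonneg) auto
  show ?thesis
  proof (intro exI[of _ c] conjI c allI impI)
    fix k n :: nat assume kn: "0 < k \<and> real k < 2 * p \<and> 0 < n"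
    have kg: "real k / 2 - p \<le> - g"
    proof -
      have "int k < \<lceil>2 * p\<rceil>" using kn by linarith
      then have "int k \<le> \<lceil>2 * p\<rceil> - 1" by linarith
      then have "real_of_int (int k) \<le> real_of_int (\<lceil>2 * p\<rceil> - 1)" by (simp only: of_int_le_iff)
      then show ?thesis unfolding g_def by simp
    qed
    have 1: "2 powr (- (real n * p)) \<le> real n powr (- 1 / 2)"
    proof -
      have "real n * 1 \<le> real n * p" using p by (intro mult_left_mono) auto
      then have "2 powr (- (real n * p)) \<le> 2 powr (- real n)" by simp
      also have "\<dots> = 1 / 2 ^ n" by (simp add: powr_minus_divide powr_realpow)
      also have "\<dots> \<le> 1 / real n"
        using kn less_exp[of n] by (intro divide_left_mono) (auto simp: of_nat_power[symmetric] simp del: of_nat_power intro: less_imp_le)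
      also have "\<dots> = real n powr (- 1)" using kn by (simp add: powr_minus_divide)
      also have "\<dots> \<le> real n powr (- 1 / 2)" using kn by (intro powr_mono) auto
      finally show ?thesis .
    qed
    have "(\<Sum>i\<le>n. (2 powr (real k / 2 - p)) ^ i) \<le> (\<Sum>i\<le>n. q ^ i)"
      unfolding q_def using kg by (intro sum_mono power_mono) auto
    also have "\<dots> \<le> 1 / (1 - q)" by (rule geometric_sum_le[OF q])
    finally have "D powr (real k / 2) * (\<Sum>i\<le>n. (2 powr (real k / 2 - p)) ^ i) \<le> D powr p * (1 / (1 - q))"
      using D kn by (intro mult_mono powr_mono sum_nonneg) auto
    then have "D powr (real k / 2) * (\<Sum>i\<le>n. (2 powr (real k / 2 - p)) ^ i) / sqrt (real n) \<le> D powr p * (1 / (1 - q)) / sqrt (real n)"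
      by (rule divide_right_mono) simp
    also have "\<dots> = D powr p * (1 / (1 - q)) * real n powr (- 1 / 2)"
      using kn by (simp add: powr_minus_divide powr_half_sqrt)
    finally have "mean_phi p k n n \<le> c * real n powr (- 1 / 2)"
      unfolding mean_phi_geometric D_def[symmetric] c_def using 1 by (simp add: distrib_right)
    then show "\<exists>J. mean_phi p k n J \<le> c * real n powr (- 1 / 2)" ..
  qed
qed

text \<open>About \<open>log n\<close> levels are needed to reach the discretization error, and each
  contributes the same amount: this is the origin of the logarithm.\<close>

lemma mean_phi_critical_dim:
  assumes p: "1 \<le> p"
  shows "\<exists>c>0. \<forall>k n. real k = 2 * p \<and> 2 \<le> n \<longrightarrow> (\<exists>J. mean_phi p k n J \<le> c * (real n powr (- 1 / 2) * ln (real n)))"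
proof -
  define D :: real where "D = 5 * exp 4"
  define c where "c = (1 + 3 * D powr p) / ln 2"
  have c: "0 < c" unfolding c_def D_def by (intro divide_pos_pos add_pos_nonneg) auto
  show ?thesis
  proof (intro exI[of _ c] conjI c allI impI)
    fix k n :: nat assume kn: "real k = 2 * p \<and> 2 \<le> n"
    obtain J :: nat where J: "2 ^ J \<le> real n" "real n < 2 ^ Suc J" using dyadic_below[of "real n"] kn by auto
    have ln2: "0 < ln (2::real)" by simp
    have lnn: "ln 2 \<le> ln (real n)" using kn by simp
    have Jl: "real J * ln 2 \<le> ln (real n)"
    proof -
      have "ln (2 ^ J) \<le> ln (real n)" using J(1) kn by (subst ln_le_cancel_iff) auto
      then show ?thesis by (simp add: ln_realpow)
    qed
    have 1: "2 powr (- (real (Suc J) * p)) \<le> real n powr (- 1 / 2) * (ln (real n) / ln 2)"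
    proof -
      have "2 powr (- (real (Suc J) * p)) = (2 ^ Suc J) powr (- p)" by (rule two_powr_neg_mult)
      also have "\<dots> \<le> (2 ^ Suc J) powr (- (1 / 2))" using p one_le_power[of "2::real" "Suc J"] by (intro powr_mono) auto
      also have "\<dots> \<le> real n powr (- (1 / 2))" using J(2) kn by (intro powr_mono2') auto
      also have "\<dots> * 1 \<le> real n powr (- (1 / 2)) * (ln (real n) / ln 2)" using lnn by (intro mult_left_mono) auto
      finally show ?thesis by simp
    qed
    have q1: "2 powr (real k / 2 - p) = 1" using kn by simp
    have "(\<Sum>i\<le>Suc J. (2 powr (real k / 2 - p)) ^ i) = real J + 2" unfolding q1 by simp
    also have "\<dots> \<le> 3 * (ln (real n) / ln 2)"
    proof -
      have "real J \<le> ln (real n) / ln 2" using Jl by (simp add: pos_le_divide_eq)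
      moreover have "1 \<le> ln (real n) / ln 2" using lnn by (simp add: pos_le_divide_eq)
      ultimately show ?thesis by linarith
    qed
    finally have "D powr (real k / 2) * (\<Sum>i\<le>Suc J. (2 powr (real k / 2 - p)) ^ i) \<le> D powr p * (3 * (ln (real n) / ln 2))"
      using kn by (intro mult_mono) (auto intro!: sum_nonneg)
    then have "D powr (real k / 2) * (\<Sum>i\<le>Suc J. (2 powr (real k / 2 - p)) ^ i) / sqrt (real n) \<le> D powr p * (3 * (ln (real n) / ln 2)) / sqrt (real n)"
      by (rule divide_right_mono) simp
    also have "\<dots> = real n powr (- 1 / 2) * (ln (real n) / ln 2) * (3 * D powr p)"
      using kn by (simp add: powr_minus_divide powr_half_sqrt mult.commute)
    finally have "mean_phi p k n (Suc J) \<le> real n powr (- 1 / 2) * (ln (real n) / ln 2) * (1 + 3 * D powr p)"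
      unfolding mean_phi_geometric D_def[symmetric] using 1 by (simp only: distrib_left mult_1_right)
    also have "\<dots> = c * (real n powr (- 1 / 2) * ln (real n))" by (simp add: c_def ac_simps)
    finally show "\<exists>J. mean_phi p k n J \<le> c * (real n powr (- 1 / 2) * ln (real n))" ..
  qed
qed

text \<open>The sum is dominated by its last term. Choosing \<open>J\<close> with
  \<open>D * 2 ^ J\<close> just below \<open>n^(1/k)\<close> balances sampling against
  discretization and absorbs \<open>D powr (k / 2)\<close>; what remains of it is
  \<open>(2 * D) powr p\<close>, free of \<open>k\<close>. The last hypothesis makes depth 0
  admissible.\<close>

lemma mean_phi_large_dim:
  assumes p: "1 \<le> p"
  shows "\<exists>c>0. \<forall>k n. 2 * p < real k \<and> 0 < n \<and> 5 * exp 4 \<le> real n powr (1 / real k) \<longrightarrow>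
    (\<exists>J. mean_phi p k n J \<le> c * real n powr (- p / real k))"
proof -
  define D :: real where "D = 5 * exp 4"
  have D: "1 \<le> D" unfolding D_def using one_le_exp_iff[of 4] by linarith
  \<comment> \<open>The gap on the other side: half the distance from \<open>2 * p\<close> up to the
    next integer strictly above it.\<close>
  define g where "g = (of_int \<lfloor>2 * p\<rfloor> + 1) / 2 - p"
  have g: "0 < g" unfolding g_def by (simp add: field_simps) linarith
  define r where "r = 2 powr (- g)"
  have r: "0 \<le> r" "r < 1" using g powr_less_mono[of "-g" 0 2] by (auto simp: r_def)
  define c where "c = (2 * D) powr p * (1 + 1 / (1 - r))"
  have c: "0 < c" unfolding c_def using r D by (intro mult_pos_pos add_pos_nonneg) auto
  show ?thesis
  proof (intro exI[of _ c] conjI c allI impI)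
    fix k n :: nat assume kn: "2 * p < real k \<and> 0 < n \<and> 5 * exp 4 \<le> real n powr (1 / real k)"
    define y where "y = real n powr (1 / real k) / D"
    have k: "0 < real k" using kn p by linarith
    have y1: "1 \<le> y" using kn D by (simp add: y_def D_def)
    obtain J :: nat where J: "2 ^ J \<le> y" "y < 2 ^ Suc J" using dyadic_below[OF y1] by auto
    have ym: "y powr (- p) = D powr p * real n powr (- p / real k)"
      unfolding y_def using D by (simp add: powr_divide powr_powr powr_minus_divide)
    have tail: "2 powr (- (real J * p)) \<le> (2 * D) powr p * real n powr (- p / real k)"
    proof -
      have "y / 2 \<le> 2 ^ J" using J(2) by simp
      then have "(2 ^ J) powr (- p) \<le> (y / 2) powr (- p)" using y1 p by (intro powr_mono2') auto
      also have "\<dots> = 2 powr p * y powr (- p)" using y1 by (simp add: powr_divide powr_minus_divide)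
      finally show ?thesis unfolding two_powr_neg_mult ym using D by (simp add: powr_mult mult.assoc)
    qed
    define q where "q = 2 powr (real k / 2 - p)"
    have q0: "0 < q" by (simp add: q_def)
    have qr: "1 / q \<le> r"
    proof -
      have "\<lfloor>2 * p\<rfloor> < int k" using kn by linarith
      then have "\<lfloor>2 * p\<rfloor> + 1 \<le> int k" by linarith
      then have "real_of_int (\<lfloor>2 * p\<rfloor> + 1) \<le> real_of_int (int k)" by (simp only: of_int_le_iff)
      then have "g \<le> real k / 2 - p" unfolding g_def by simp
      then show ?thesis unfolding q_def r_def powr_minus_divide[symmetric] by simp
    qed
    \<comment> \<open>Summed from the finest level downwards the series decays with a ratio at most
      \<open>r\<close>.\<close>
    have "(\<Sum>i\<le>J. q ^ i) = q ^ J * (\<Sum>i\<le>J. (1 / q) ^ i)"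
    proof -
      have "(\<Sum>i\<le>J. q ^ i) = (\<Sum>i\<le>J. q ^ (J - i))" by (rule sum.reindex_bij_witness[of _ "\<lambda>i. J - i" "\<lambda>i. J - i"]) auto
      also have "\<dots> = (\<Sum>i\<le>J. q ^ J * (1 / q) ^ i)"
        using q0 by (intro sum.cong refl) (simp add: power_diff power_one_over divide_inverse power_inverse)
      finally show ?thesis by (simp add: sum_distrib_left)
    qed
    also have "\<dots> \<le> q ^ J * (\<Sum>i\<le>J. r ^ i)"
      using q0 qr by (intro mult_left_mono sum_mono power_mono) auto
    also have "\<dots> \<le> q ^ J * (1 / (1 - r))" using q0 by (intro mult_left_mono geometric_sum_le r) auto
    finally have sq: "(\<Sum>i\<le>J. q ^ i) \<le> q ^ J * (1 / (1 - r))" .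
    \<comment> \<open>The choice of \<open>J\<close> says exactly that the sampling error of the
      finest level does not exceed the discretization error.\<close>
    have lead: "D powr (real k / 2) * q ^ J / sqrt (real n) \<le> 2 powr (- (real J * p))"
    proof -
      have "D * 2 ^ J \<le> real n powr (1 / real k)" using J(1) D by (simp add: y_def pos_le_divide_eq mult.commute)
      then have "(D * 2 ^ J) powr (real k / 2) \<le> (real n powr (1 / real k)) powr (real k / 2)"
        using D by (intro powr_mono2) auto
      also have "\<dots> = sqrt (real n)" using k kn by (simp add: powr_powr powr_half_sqrt)
      finally have le: "(D * 2 ^ J) powr (real k / 2) \<le> sqrt (real n)" .
      have "q ^ J = 2 powr (real J * (real k / 2)) * 2 powr (- (real J * p))"
        unfolding q_def powr_add[symmetric] by (simp add: powr_realpow[symmetric] powr_powr algebra_simps)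
      then have "D powr (real k / 2) * q ^ J = (D * 2 ^ J) powr (real k / 2) * 2 powr (- (real J * p))"
        using D by (simp add: powr_mult powr_realpow[symmetric] powr_powr mult.assoc)
      also have "\<dots> \<le> sqrt (real n) * 2 powr (- (real J * p))" using le by (rule mult_right_mono) simp
      finally show ?thesis using kn by (simp add: pos_divide_le_eq mult.commute)
    qed
    have "D powr (real k / 2) * (\<Sum>i\<le>J. q ^ i) / sqrt (real n) \<le> D powr (real k / 2) * (q ^ J * (1 / (1 - r))) / sqrt (real n)"
      using sq by (intro divide_right_mono mult_left_mono) auto
    also have "\<dots> = D powr (real k / 2) * q ^ J / sqrt (real n) * (1 / (1 - r))" by simp
    also have "\<dots> \<le> 2 powr (- (real J * p)) * (1 / (1 - r))"
      using lead r by (intro mult_right_mono) auto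
    finally have "mean_phi p k n J \<le> 2 powr (- (real J * p)) * (1 + 1 / (1 - r))"
      unfolding mean_phi_geometric D_def[symmetric] q_def[symmetric] by (simp add: distrib_left)
    also have "\<dots> \<le> (2 * D) powr p * real n powr (- p / real k) * (1 + 1 / (1 - r))"
      using tail r by (intro mult_right_mono) auto
    also have "\<dots> = c * real n powr (- p / real k)" by (simp add: c_def)
    finally show "\<exists>J. mean_phi p k n J \<le> c * real n powr (- p / real k)" ..
  qed
qed

text \<open>The disjunction has its reason in the case \<open>k > 2 p\<close> with
  \<open>n^(1/k) < 5 exp 4\<close>: there no depth is provided, but \<open>n^(-1/k)\<close> is
  bounded below, so the comparison with a point mass is of the right order.\<close>

lemma mean_rate_bound:
  assumes p: "1 \<le> p"
  shows "\<exists>c>0. \<forall>k n. 0 < k \<and> 2 \<le> n \<longrightarrow>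
    (\<exists>J. 2 * (sqrt (real k) * (mean_const p * mean_phi p k n J) powr (1 / p)) \<le> rate c p k n) \<or>
    3 * (sqrt (real k) * moment_const p powr (1 / p)) \<le> rate c p k n"
proof -
  obtain c1 where c1: "0 < c1" "\<And>k n. 0 < k \<Longrightarrow> real k < 2 * p \<Longrightarrow> 0 < n \<Longrightarrow> \<exists>J. mean_phi p k n J \<le> c1 * real n powr (- 1 / 2)"
    using mean_phi_small_dim[OF p] by blast
  obtain c2 where c2: "0 < c2" "\<And>k n. real k = 2 * p \<Longrightarrow> 2 \<le> n \<Longrightarrow> \<exists>J. mean_phi p k n J \<le> c2 * (real n powr (- 1 / 2) * ln (real n))"
    using mean_phi_critical_dim[OF p] by blast
  obtain c3 where c3: "0 < c3" "\<And>k n. 2 * p < real k \<Longrightarrow> 0 < n \<Longrightarrow> 5 * exp 4 \<le> real n powr (1 / real k) \<Longrightarrow> \<exists>J. mean_phi p k n J \<le> c3 * real n powr (- p / real k)"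
    using mean_phi_large_dim[OF p] by blast
  have mc: "0 < mean_const p" using p by (auto simp: mean_const_def intro!: add_pos_nonneg)
  define f where "f a = 2 * (mean_const p * a) powr (1 / p)" for a
  define c4 where "c4 = 3 * moment_const p powr (1 / p) * (5 * exp 4)"
  define c where "c = f c1 + f c2 + f c3 + c4"
  have f0: "0 \<le> f a" for a by (simp add: f_def)
  have m0: "0 < moment_const p" using p by (simp add: moment_const_def)
  have c40: "0 < c4" using m0 by (simp add: c4_def)
  have cpos: "0 < c" unfolding c_def by (intro add_nonneg_pos add_nonneg_nonneg f0 c40)
  have cge: "f c1 \<le> c" "f c2 \<le> c" "f c3 \<le> c" "c4 \<le> c" unfolding c_def using f0[of c1] f0[of c2] f0[of c3] c40 by linarith+
  have conv: "2 * (sqrt (real k) * (mean_const p * mean_phi p k n J) powr (1 / p)) \<le> c * sqrt (real k) * X powr (1 / p)"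
    if le: "mean_phi p k n J \<le> a * X" and a: "0 < a" "f a \<le> c" and X: "0 \<le> X" for k n J a X
  proof -
    have mp: "0 \<le> mean_phi p k n J" unfolding mean_phi_def by (intro add_nonneg_nonneg divide_nonneg_nonneg sum_nonneg) auto
    have "(mean_const p * mean_phi p k n J) powr (1 / p) \<le> ((mean_const p * a) * X) powr (1 / p)"
      using le mc mp p by (intro powr_mono2) (auto simp: mult.assoc)
    also have "\<dots> = (mean_const p * a) powr (1 / p) * X powr (1 / p)"
      using mc a X by (intro powr_mult)
    finally have "2 * (mean_const p * mean_phi p k n J) powr (1 / p) \<le> f a * X powr (1 / p)" by (simp add: f_def)
    also have "\<dots> \<le> c * X powr (1 / p)" using a by (intro mult_right_mono) auto
    finally have "sqrt (real k) * (2 * (mean_const p * mean_phi p k n J) powr (1 / p)) \<le> sqrt (real k) * (c * X powr (1 / p))"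
      by (rule mult_left_mono) simp
    then show ?thesis by (simp add: ac_simps)
  qed
  show ?thesis
  proof (intro exI[of _ c] conjI cpos allI impI)
    fix k n :: nat assume kn: "0 < k \<and> 2 \<le> n"
    consider "real k < 2 * p" | "real k = 2 * p" | "2 * p < real k" by linarith
    then show "(\<exists>J. 2 * (sqrt (real k) * (mean_const p * mean_phi p k n J) powr (1 / p)) \<le> rate c p k n) \<or>
      3 * (sqrt (real k) * moment_const p powr (1 / p)) \<le> rate c p k n"
    proof cases
      case 1
      then obtain J where J: "mean_phi p k n J \<le> c1 * real n powr (- 1 / 2)" using c1(2)[of k n] kn by auto
      have "(real n powr (- 1 / 2)) powr (1 / p) = real n powr (- 1 / (2 * p))" by (simp add: powr_powr)
      then show ?thesis using conv[OF J c1(1) cge(1)] 1 by (auto simp: rate_def)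
    next
      case 2
      then obtain J where J: "mean_phi p k n J \<le> c2 * (real n powr (- 1 / 2) * ln (real n))" using c2(2)[of k n] kn by auto
      have l: "0 \<le> ln (real n)" using kn by simp
      have "(real n powr (- 1 / 2) * ln (real n)) powr (1 / p) = real n powr (- 1 / (2 * p)) * ln (real n) powr (1 / p)"
        using l by (simp add: powr_mult powr_powr)
      then show ?thesis using conv[OF J c2(1) cge(2)] 2 l by (auto simp: rate_def mult.assoc)
    next
      case 3
      then have k: "0 < real k" using p by linarith
      have r: "rate c p k n = c * sqrt (real k) * real n powr (- 1 / real k)" using 3 by (simp add: rate_def)
      show ?thesis
      proof (cases "5 * exp 4 \<le> real n powr (1 / real k)")
        case True
        then obtain J where J: "mean_phi p k n J \<le> c3 * real n powr (- p / real k)" using c3(2)[of k n] kn 3 by auto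
        have "(real n powr (- p / real k)) powr (1 / p) = real n powr (- 1 / real k)" using p by (simp add: powr_powr)
        then show ?thesis using conv[OF J c3(1) cge(3)] unfolding r by auto
      next
        case False
        have "1 \<le> 5 * exp 4 * real n powr (- 1 / real k)"
          using False kn by (simp add: powr_minus_divide pos_le_divide_eq)
        then have "3 * moment_const p powr (1 / p) * 1 \<le> 3 * moment_const p powr (1 / p) * (5 * exp 4 * real n powr (- 1 / real k))"
          by (intro mult_left_mono) auto
        also have "\<dots> = c4 * real n powr (- 1 / real k)" by (simp add: c4_def)
        also have "\<dots> \<le> c * real n powr (- 1 / real k)" using cge(4) by (intro mult_right_mono) auto
        finally have "sqrt (real k) * (3 * moment_const p powr (1 / p)) \<le> sqrt (real k) * (c * real n powr (- 1 / real k))"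
          by (intro mult_left_mono) auto
        then show ?thesis unfolding r by (auto simp: ac_simps)
      qed
    qed
  qed
qed

section \<open>Projections and the supremum over them\<close>

text \<open>Centring at \<open>m\<close> is a common translation, invisible to Wasserstein
  distances; it makes the exponential moments independent of the location of the measure.\<close>

definition aff_proj :: "nat \<Rightarrow> nat \<Rightarrow> vec \<Rightarrow> (nat \<Rightarrow> nat \<Rightarrow> real) \<Rightarrow> vec \<Rightarrow> vec" where
  "aff_proj k d m U y = (\<lambda>i\<in>{..<k}. \<Sum>l<d. U i l * (y l - m l))"

lemma aff_proj_measurable: "aff_proj k d m U \<in> measurable (Rd d) (Rd k)"
proof (rule measurable_RdI)
  fix i assume i: "i < k"
  have [measurable]: "(\<lambda>x. x l) \<in> borel_measurable (Rd d)" if "l \<in> {..<d}" for l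
    by (rule measurable_Rd_coord[of "\<lambda>x. x"]) (use that in auto)
  have "(\<lambda>x. \<Sum>l<d. U i l * (x l - m l)) \<in> borel_measurable (Rd d)" by measurable
  then show "(\<lambda>x. aff_proj k d m U x i) \<in> borel_measurable (Rd d)" using i by (simp add: aff_proj_def)
qed (simp add: aff_proj_def)

text \<open>Expand the square and use orthonormality of the rows: the transpose of \<open>U\<close>
  is an isometry.\<close>

lemma stiefel_isometry:
  assumes U: "U \<in> stiefel k d"
  shows "(\<Sum>l<d. (\<Sum>i<k. c i * U i l)\<^sup>2) = (\<Sum>i<k. (c i)\<^sup>2)"
proof -
  have orth: "(\<Sum>l<d. U i l * U j l) = (if i = j then 1 else 0)" if "i < k" "j < k" for i j
    using U that by (auto simp: stiefel_def)
  have "(\<Sum>l<d. (\<Sum>i<k. c i * U i l)\<^sup>2) = (\<Sum>l<d. \<Sum>i<k. \<Sum>j<k. c i * c j * (U i l * U j l))"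
    by (simp add: power2_eq_square sum_product ac_simps)
  also have "\<dots> = (\<Sum>i<k. \<Sum>l<d. \<Sum>j<k. c i * c j * (U i l * U j l))" by (rule sum.swap)
  also have "\<dots> = (\<Sum>i<k. \<Sum>j<k. \<Sum>l<d. c i * c j * (U i l * U j l))" by (intro sum.cong refl sum.swap)
  also have "\<dots> = (\<Sum>i<k. \<Sum>j<k. c i * c j * (if i = j then 1 else 0))"
    unfolding sum_distrib_left[symmetric] by (intro sum.cong refl) (simp add: orth)
  also have "\<dots> = (\<Sum>i<k. (c i)\<^sup>2)" by (simp add: power2_eq_square if_distrib[of "\<lambda>x. _ * x"] cong: if_cong)
  finally show ?thesis .
qed

text \<open>Bessel's inequality, from the nonnegative squared distance of \<open>z\<close> to its
  projection on the row space. It makes projections contractions.\<close>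

lemma bessel_stiefel:
  assumes U: "U \<in> stiefel k d"
  shows "(\<Sum>i<k. (\<Sum>l<d. U i l * z l)\<^sup>2) \<le> (\<Sum>l<d. (z l)\<^sup>2)"
proof -
  define c where "c i = (\<Sum>l<d. U i l * z l)" for i
  have 1: "(\<Sum>l<d. z l * (\<Sum>i<k. c i * U i l)) = (\<Sum>i<k. (c i)\<^sup>2)"
  proof -
    have "(\<Sum>l<d. z l * (\<Sum>i<k. c i * U i l)) = (\<Sum>l<d. \<Sum>i<k. c i * (U i l * z l))"
      by (simp add: sum_distrib_left ac_simps)
    also have "\<dots> = (\<Sum>i<k. \<Sum>l<d. c i * (U i l * z l))" by (rule sum.swap)
    also have "\<dots> = (\<Sum>i<k. c i * c i)" by (simp add: sum_distrib_left[symmetric] c_def)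
    finally show ?thesis by (simp add: power2_eq_square)
  qed
  have 2: "(\<Sum>l<d. (\<Sum>i<k. c i * U i l)\<^sup>2) = (\<Sum>i<k. (c i)\<^sup>2)" by (rule stiefel_isometry[OF U])
  have "0 \<le> (\<Sum>l<d. (z l - (\<Sum>i<k. c i * U i l))\<^sup>2)" by (intro sum_nonneg) auto
  also have "\<dots> = (\<Sum>l<d. (z l)\<^sup>2) + (\<Sum>l<d. (\<Sum>i<k. c i * U i l)\<^sup>2) - 2 * (\<Sum>l<d. z l * (\<Sum>i<k. c i * U i l))"
    by (simp add: power2_diff sum.distrib sum_subtractf sum_distrib_left mult.assoc)
  also have "\<dots> = (\<Sum>l<d. (z l)\<^sup>2) - (\<Sum>i<k. (c i)\<^sup>2)" unfolding 1 2 by simp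
  finally show ?thesis by (simp add: c_def)
qed

lemma aff_proj_diff: "i < k \<Longrightarrow> aff_proj k d m U x i - aff_proj k d m U y i = (\<Sum>l<d. U i l * (x l - y l))"
  unfolding aff_proj_def by (simp add: sum_subtractf[symmetric] right_diff_distrib)

lemma vdist_aff_proj_le:
  assumes U: "U \<in> stiefel k d"
  shows "vdist k (aff_proj k d m U x) (aff_proj k d m U y) \<le> vdist d x y"
proof -
  have "(\<Sum>i<k. (aff_proj k d m U x i - aff_proj k d m U y i)\<^sup>2) = (\<Sum>i<k. (\<Sum>l<d. U i l * (x l - y l))\<^sup>2)"
    by (intro sum.cong refl) (simp add: aff_proj_diff)
  also have "\<dots> \<le> (\<Sum>l<d. (x l - y l)\<^sup>2)" by (rule bessel_stiefel[OF U])
  finally show ?thesis unfolding vdist_def L2_set_def by (rule real_sqrt_le_mono)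
qed

text \<open>Adding back the constant vector \<open>U m\<close> is an isometry that carries the
  centred projections to the plain ones.\<close>

lemma wasserstein_proj_le_aff:
  assumes \<mu>: "prob_on d \<mu>" and \<nu>: "prob_on d \<nu>" and p: "1 \<le> p"
  shows "wasserstein k p (proj_law k d U \<mu>) (proj_law k d U \<nu>)
    \<le> wasserstein k p (distr \<mu> (Rd k) (aff_proj k d m U)) (distr \<nu> (Rd k) (aff_proj k d m U))"
proof -
  define S where "S y = (\<lambda>i\<in>{..<k}. y i + (\<Sum>l<d. U i l * m l))" for y :: vec
  have S: "S \<in> measurable (Rd k) (Rd k)"
  proof (rule measurable_RdI)
    fix i assume i: "i < k"
    have [measurable]: "(\<lambda>x. x i) \<in> borel_measurable (Rd k)"
      by (rule measurable_Rd_coord[of "\<lambda>x. x"]) (use i in auto)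
    show "(\<lambda>x. S x i) \<in> borel_measurable (Rd k)" using i by (simp add: S_def)
  qed (simp add: S_def)
  have eq: "S \<circ> aff_proj k d m U = (\<lambda>y. \<lambda>i\<in>{..<k}. \<Sum>l<d. U i l * y l)"
    by (auto simp: fun_eq_iff S_def aff_proj_def restrict_def sum.distrib[symmetric] algebra_simps)
  have law: "distr (distr \<rho> (Rd k) (aff_proj k d m U)) (Rd k) S = proj_law k d U \<rho>" if "prob_on d \<rho>" for \<rho>
  proof -
    have "aff_proj k d m U \<in> measurable \<rho> (Rd k)"
      using aff_proj_measurable[of k d m U] unfolding measurable_cong_sets[OF prob_onD(2)[OF that] refl] .
    from distr_distr[OF S this] show ?thesis unfolding proj_law_def eq .
  qed
  have "wasserstein k p (distr (distr \<mu> (Rd k) (aff_proj k d m U)) (Rd k) S) (distr (distr \<nu> (Rd k) (aff_proj k d m U)) (Rd k) S)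
    \<le> wasserstein k p (distr \<mu> (Rd k) (aff_proj k d m U)) (distr \<nu> (Rd k) (aff_proj k d m U))"
  proof (rule wasserstein_contraction[OF S])
    fix x y :: vec
    have "vdist k (S x) (S y) = vdist k x y" unfolding vdist_def by (rule L2_set_cong) (auto simp: S_def)
    then show "vdist k (S x) (S y) \<le> vdist k x y" by simp
  qed (use p in auto)
  then show ?thesis unfolding law[OF \<mu>] law[OF \<nu>] .
qed

text \<open>For \<open>t >= 0\<close> use \<open>exp t >= 1 + t + t^2 / 2\<close> and
  \<open>exp (- t) >= 1 - t\<close>; the other sign is symmetric. It converts two exponential
  moments into a variance bound.\<close>

lemma square_le_exp_sum: "t\<^sup>2 \<le> 2 * (exp t + exp (- t) - 2)" for t :: real
proof -
  have *: "s\<^sup>2 \<le> 2 * (exp s + exp (- s) - 2)" if "0 \<le> s" for s :: real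
    using exp_lower_Taylor_quadratic[OF that] exp_ge_add_one_self[of "- s"] by simp
  show ?thesis
  proof (cases "0 \<le> t")
    case False
    then show ?thesis using *[of "- t"] by (simp add: add.commute)
  qed (rule *)
qed

lemma coord_integrable:
  assumes T: "transport_ineq d q (\<sigma>\<^sup>2) \<mu>" and q: "1 \<le> q" and l: "l < d"
  shows "integrable \<mu> (\<lambda>x. x l)"
proof (rule Bochner_Integration.integrable_bound)
  have \<mu>: "prob_on d \<mu>" using T by (simp add: transport_ineq_def)
  show "integrable \<mu> (\<lambda>x. vdist d x (\<lambda>i\<in>{..<d}. 0))"
    using T q by (intro integrable_vdist[OF \<mu> _ q zero_in_Rd]) (simp add: transport_ineq_def)
  show "(\<lambda>x. x l) \<in> borel_measurable \<mu>"
    unfolding measurable_cong_sets[OF prob_onD(2)[OF \<mu>] refl]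
    by (rule measurable_Rd_coord[of "\<lambda>x. x"]) (use l in auto)
  have "\<bar>x l\<bar> \<le> vdist d x (\<lambda>i\<in>{..<d}. 0)" for x
  proof -
    have "\<bar>x l\<bar> \<le> L2_set (\<lambda>i. \<bar>x i\<bar>) {..<d}" using l by (intro member_le_L2_set) auto
    also have "\<dots> = vdist d x (\<lambda>i\<in>{..<d}. 0)" unfolding L2_set_eq_vdist[symmetric] by (simp add: L2_set_def)
    finally show ?thesis .
  qed
  then show "AE x in \<mu>. norm (x l) \<le> norm (vdist d x (\<lambda>i\<in>{..<d}. 0))" by simp
qed

text \<open>The coordinates of a centred projection have variance of order $\sigma^2$, so its norm has mean of order
  $\sigma\sqrt k$; the norm being 1-Lipschitz, this yields an exponential moment with exponent linear in \<open>k\<close>.\<close>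

lemma aff_proj_exp_moment:
  assumes T: "transport_ineq d q (\<sigma>\<^sup>2) \<mu>" and q: "1 \<le> q" "q \<le> 2" and \<sigma>: "0 < \<sigma>" and k: "0 < k" and U: "U \<in> stiefel k d"
    and m: "\<And>l. l < d \<Longrightarrow> m l = (\<integral>x. x l \<partial>\<mu>)"
  shows "(\<integral>\<^sup>+x. ennreal (exp (sqrt (real k) * L2_set (aff_proj k d m U x) {..<k} / (4 * \<sigma>))) \<partial>\<mu>) \<le> ennreal (exp (2 * real k))"
proof -
  have \<mu>: "prob_on d \<mu>" using T by (simp add: transport_ineq_def)
  interpret prob_space \<mu> using \<mu> by (rule prob_onD)
  let ?Y = "aff_proj k d m U"
  define f where "f x = L2_set (?Y x) {..<k}" for x
  have flip: "f x - f y \<le> 1 * vdist d x y" for x y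
  proof -
    have "f x \<le> vdist k (?Y x) (?Y y) + f y"
      unfolding f_def L2_set_eq_vdist by (rule vdist_triangle)
    with vdist_aff_proj_le[OF U, of m x y] show ?thesis by simp
  qed
  have coordlip: "?Y x i - ?Y y i \<le> 1 * vdist d x y" "- ?Y x i - - ?Y y i \<le> 1 * vdist d x y" if i: "i < k" for i x y
  proof -
    have "\<bar>?Y x i - ?Y y i\<bar> \<le> L2_set (\<lambda>i. \<bar>?Y x i - ?Y y i\<bar>) {..<k}" using i by (intro member_le_L2_set) auto
    also have "\<dots> = vdist k (?Y x) (?Y y)" by (simp add: vdist_def L2_set_def)
    also note vdist_aff_proj_le[OF U, of m x y]
    finally show "?Y x i - ?Y y i \<le> 1 * vdist d x y" "- ?Y x i - - ?Y y i \<le> 1 * vdist d x y" by auto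
  qed
  have mean0: "(\<integral>x. ?Y x i \<partial>\<mu>) = 0" if i: "i < k" for i
  proof -
    have "(\<integral>x. ?Y x i \<partial>\<mu>) = (\<integral>x. (\<Sum>l<d. U i l * (x l - m l)) \<partial>\<mu>)" using i by (simp add: aff_proj_def)
    also have "\<dots> = (\<Sum>l<d. U i l * ((\<integral>x. x l \<partial>\<mu>) - m l))"
      using coord_integrable[OF T q(1)] by (simp add: prob_space)
    finally show ?thesis using m by simp
  qed
  \<comment> \<open>At parameter \<open>1 / \<sigma>\<close> both exponential moments are at most
    \<open>exp (1/2) <= 2\<close>, so the variance is at most
    \<open>2 * \<sigma>^2 * (2 + 2 - 2)\<close>. The negative term is carried on the left to avoid
    subtraction of extended reals.\<close>
  have var: "(\<integral>\<^sup>+x. ennreal ((?Y x i)\<^sup>2) \<partial>\<mu>) \<le> ennreal (4 * \<sigma>\<^sup>2)" if i: "i < k" for i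
  proof -
    have e2: "exp (1 / 2) \<le> (2::real)"
    proof -
      have "exp (1 / 2 :: real) * exp (1 / 2) = exp 1" by (simp add: exp_add[symmetric])
      also have "\<dots> \<le> 2 * 2" using exp_le by linarith
      finally show ?thesis using power2_le_imp_le[of "exp (1/2::real)" 2] by (simp add: power2_eq_square)
    qed
    have m1: "(\<integral>\<^sup>+x. ennreal (exp (1 / \<sigma> * ?Y x i)) \<partial>\<mu>) \<le> ennreal 2"
    proof -
      have "(\<integral>\<^sup>+x. ennreal (exp (1 / \<sigma> * ?Y x i)) \<partial>\<mu>) \<le> ennreal (exp (1 / \<sigma> * (\<integral>x. ?Y x i \<partial>\<mu>) + (1 / \<sigma>)\<^sup>2 * 1\<^sup>2 * \<sigma>\<^sup>2 / 2))"
        by (rule lipschitz_exp_moment(2)[OF T q \<sigma>, of "1 / \<sigma>" 1 "\<lambda>x. ?Y x i"]) (use \<sigma> coordlip(1)[OF i] in auto)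
      also have "\<dots> = ennreal (exp (1 / 2))" using mean0[OF i] \<sigma> by (simp add: power_divide)
      also have "\<dots> \<le> ennreal 2" using e2 by (rule ennreal_leI)
      finally show ?thesis .
    qed
    have m2: "(\<integral>\<^sup>+x. ennreal (exp (1 / \<sigma> * - ?Y x i)) \<partial>\<mu>) \<le> ennreal 2"
    proof -
      have "(\<integral>\<^sup>+x. ennreal (exp (1 / \<sigma> * - ?Y x i)) \<partial>\<mu>) \<le> ennreal (exp (1 / \<sigma> * (\<integral>x. - ?Y x i \<partial>\<mu>) + (1 / \<sigma>)\<^sup>2 * 1\<^sup>2 * \<sigma>\<^sup>2 / 2))"
        by (rule lipschitz_exp_moment(2)[OF T q \<sigma>, of "1 / \<sigma>" 1 "\<lambda>x. - ?Y x i"]) (use \<sigma> coordlip(2)[OF i] in auto)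
      also have "\<dots> = ennreal (exp (1 / 2))" using mean0[OF i] \<sigma> by (simp add: power_divide)
      also have "\<dots> \<le> ennreal 2" using e2 by (rule ennreal_leI)
      finally show ?thesis .
    qed
    have Ym: "(\<lambda>x. ?Y x i) \<in> borel_measurable \<mu>"
      unfolding measurable_cong_sets[OF prob_onD(2)[OF \<mu>] refl] by (rule measurable_Rd_coord[OF aff_proj_measurable i])
    define c where "c = 2 * \<sigma>\<^sup>2"
    have c: "0 < c" using \<sigma> by (simp add: c_def)
    have "(\<integral>\<^sup>+x. ennreal ((?Y x i)\<^sup>2) \<partial>\<mu>) + ennreal (2 * c)
      \<le> (\<integral>\<^sup>+x. ennreal c * (ennreal (exp (1 / \<sigma> * ?Y x i)) + ennreal (exp (1 / \<sigma> * - ?Y x i))) \<partial>\<mu>)"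
    proof -
      have "(\<integral>\<^sup>+x. ennreal ((?Y x i)\<^sup>2) \<partial>\<mu>) + ennreal (2 * c) = (\<integral>\<^sup>+x. ennreal ((?Y x i)\<^sup>2) + ennreal (2 * c) \<partial>\<mu>)"
        using Ym by (simp add: nn_integral_add emeasure_space_1)
      also have "\<dots> \<le> (\<integral>\<^sup>+x. ennreal c * (ennreal (exp (1 / \<sigma> * ?Y x i)) + ennreal (exp (1 / \<sigma> * - ?Y x i))) \<partial>\<mu>)"
      proof (rule nn_integral_mono)
        fix x
        have "(?Y x i)\<^sup>2 = \<sigma>\<^sup>2 * (1 / \<sigma> * ?Y x i)\<^sup>2" using \<sigma> by (simp add: power_mult_distrib power_divide)
        also have "\<dots> \<le> \<sigma>\<^sup>2 * (2 * (exp (1 / \<sigma> * ?Y x i) + exp (- (1 / \<sigma> * ?Y x i)) - 2))"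
          by (intro mult_left_mono square_le_exp_sum) auto
        finally have "(?Y x i)\<^sup>2 + 2 * c \<le> c * (exp (1 / \<sigma> * ?Y x i) + exp (1 / \<sigma> * - ?Y x i))"
          by (simp add: c_def algebra_simps)
        then show "ennreal ((?Y x i)\<^sup>2) + ennreal (2 * c) \<le> ennreal c * (ennreal (exp (1 / \<sigma> * ?Y x i)) + ennreal (exp (1 / \<sigma> * - ?Y x i)))"
          using c by (simp add: ennreal_mult[symmetric] ennreal_plus[symmetric] ennreal_leI del: ennreal_plus)
      qed
      finally show ?thesis .
    qed
    also have "\<dots> = ennreal c * ((\<integral>\<^sup>+x. ennreal (exp (1 / \<sigma> * ?Y x i)) \<partial>\<mu>) + (\<integral>\<^sup>+x. ennreal (exp (1 / \<sigma> * - ?Y x i)) \<partial>\<mu>))"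
      using Ym by (simp add: nn_integral_cmult nn_integral_add)
    also have "\<dots> \<le> ennreal c * (ennreal 2 + ennreal 2)" using m1 m2 by (intro mult_left_mono add_mono) auto
    also have "ennreal 2 + ennreal 2 = ennreal 4" by simp
    also have "ennreal c * ennreal 4 = ennreal (c * 4)" using c by (intro ennreal_mult[symmetric]) auto
    also have "c * 4 = 4 * \<sigma>\<^sup>2 + 2 * c" by (simp add: c_def)
    also have "ennreal \<dots> = ennreal (4 * \<sigma>\<^sup>2) + ennreal (2 * c)" using c by (intro ennreal_plus) auto
    finally show ?thesis using c by (simp add: ennreal_add_left_cancel_le add.commute[of _ "ennreal (2 * c)"])
  qed
  define a where "a = sqrt (real k) * \<sigma>"
  have a: "0 < a" using k \<sigma> by (simp add: a_def)
  have fint: "integrable \<mu> f"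
    by (rule lipschitz_exp_moment(1)[OF T q \<sigma>, of 1 1]) (use flip in auto)
  have f0: "0 \<le> f x" for x by (simp add: f_def)
  \<comment> \<open>Integrates \<open>f <= a / 2 + f^2 / (2 * a)\<close>, where the second moment of
    \<open>f\<close> is at most \<open>4 * a^2\<close>.\<close>
  have fmean: "(\<integral>x. f x \<partial>\<mu>) \<le> 5 / 2 * a"
  proof -
    have "ennreal (\<integral>x. f x \<partial>\<mu>) = (\<integral>\<^sup>+x. ennreal (f x) \<partial>\<mu>)"
      using fint f0 by (intro nn_integral_eq_integral[symmetric]) auto
    also have "\<dots> \<le> (\<integral>\<^sup>+x. ennreal (a / 2) + ennreal (1 / (2 * a)) * (\<Sum>i<k. ennreal ((?Y x i)\<^sup>2)) \<partial>\<mu>)"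
    proof (rule nn_integral_mono)
      fix x
      have "0 \<le> (a - f x)\<^sup>2" by simp
      also have "(a - f x)\<^sup>2 = a * a + f x * f x - 2 * a * f x" by (simp add: power2_diff) (simp add: power2_eq_square)
      finally have "2 * a * f x \<le> a * a + f x * f x" by simp
      then have "f x \<le> (a * a + f x * f x) / (2 * a)" using a by (simp add: pos_le_divide_eq mult.commute mult.left_commute)
      also have "\<dots> = a / 2 + 1 / (2 * a) * (f x)\<^sup>2" using a by (simp add: add_divide_distrib power2_eq_square)
      also have "(f x)\<^sup>2 = (\<Sum>i<k. (?Y x i)\<^sup>2)" by (simp add: f_def L2_set_def sum_nonneg)
      finally show "ennreal (f x) \<le> ennreal (a / 2) + ennreal (1 / (2 * a)) * (\<Sum>i<k. ennreal ((?Y x i)\<^sup>2))"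
        using a by (simp add: ennreal_mult[symmetric] ennreal_plus[symmetric] ennreal_leI sum_nonneg del: ennreal_plus)
    qed
    also have "\<dots> = ennreal (a / 2) + ennreal (1 / (2 * a)) * (\<Sum>i<k. \<integral>\<^sup>+x. ennreal ((?Y x i)\<^sup>2) \<partial>\<mu>)"
    proof -
      have Ym[measurable]: "(\<lambda>x. ?Y x i) \<in> borel_measurable \<mu>" if "i \<in> {..<k}" for i
        unfolding measurable_cong_sets[OF prob_onD(2)[OF \<mu>] refl] using that by (intro measurable_Rd_coord[OF aff_proj_measurable]) auto
      have S[measurable]: "(\<lambda>x. \<Sum>i<k. ennreal ((?Y x i)\<^sup>2)) \<in> borel_measurable \<mu>" by measurable
      have "(\<integral>\<^sup>+x. ennreal (a / 2) + ennreal (1 / (2 * a)) * (\<Sum>i<k. ennreal ((?Y x i)\<^sup>2)) \<partial>\<mu>)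
        = ennreal (a / 2) + ennreal (1 / (2 * a)) * (\<integral>\<^sup>+x. (\<Sum>i<k. ennreal ((?Y x i)\<^sup>2)) \<partial>\<mu>)"
        using S by (simp add: nn_integral_add nn_integral_cmult emeasure_space_1 del: sum_ennreal)
      also have "(\<integral>\<^sup>+x. (\<Sum>i<k. ennreal ((?Y x i)\<^sup>2)) \<partial>\<mu>) = (\<Sum>i<k. \<integral>\<^sup>+x. ennreal ((?Y x i)\<^sup>2) \<partial>\<mu>)"
        by (rule nn_integral_sum) measurable
      finally show ?thesis .
    qed
    also have "\<dots> \<le> ennreal (a / 2) + ennreal (1 / (2 * a)) * (\<Sum>i<k. ennreal (4 * \<sigma>\<^sup>2))"
      using var by (intro add_left_mono mult_left_mono sum_mono) auto
    also have "\<dots> = ennreal (a / 2 + 1 / (2 * a) * (real k * (4 * \<sigma>\<^sup>2)))"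
      using a by (simp add: ennreal_mult[symmetric] ennreal_plus[symmetric] ennreal_of_nat_eq_real_of_nat del: ennreal_plus)
    also have "real k * (4 * \<sigma>\<^sup>2) = 4 * a * a" using k by (simp add: a_def power2_eq_square)
    also have "a / 2 + 1 / (2 * a) * (4 * a * a) = 5 / 2 * a" using a by simp
    finally show ?thesis using a by (simp add: ennreal_le_iff)
  qed
  \<comment> \<open>With this parameter the mean contributes at most \<open>5 k / 8\<close> and the
    Gaussian term \<open>k / 32\<close>, together below \<open>2 k\<close>.\<close>
  let ?h = "sqrt (real k) / (4 * \<sigma>)"
  have h: "0 < ?h" using k \<sigma> by simp
  have "(\<integral>\<^sup>+x. ennreal (exp (?h * f x)) \<partial>\<mu>) \<le> ennreal (exp (?h * (\<integral>x. f x \<partial>\<mu>) + ?h\<^sup>2 * 1\<^sup>2 * \<sigma>\<^sup>2 / 2))"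
    by (rule lipschitz_exp_moment(2)[OF T q \<sigma> h, of 1]) (use flip in auto)
  also have "\<dots> \<le> ennreal (exp (2 * real k))"
  proof (intro ennreal_leI, subst exp_le_cancel_iff)
    have "?h * (\<integral>x. f x \<partial>\<mu>) \<le> ?h * (5 / 2 * a)" using fmean h by (intro mult_left_mono) auto
    also have "\<dots> = 5 / 8 * real k" using \<sigma> by (simp add: a_def)
    finally have 1: "?h * (\<integral>x. f x \<partial>\<mu>) \<le> 5 / 8 * real k" .
    have 2: "?h\<^sup>2 * 1\<^sup>2 * \<sigma>\<^sup>2 / 2 = real k / 32" using \<sigma> by (simp add: power_divide power_mult_distrib)
    show "?h * (\<integral>x. f x \<partial>\<mu>) + ?h\<^sup>2 * 1\<^sup>2 * \<sigma>\<^sup>2 / 2 \<le> 2 * real k" unfolding 2 using 1 of_nat_0_le_iff[of k] by linarith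
  qed
  finally show ?thesis by (simp add: f_def)
qed

section \<open>Uniform control over all projections\<close>

text \<open>For \<open>q <= p\<close> the \<open>l^p\<close> norm is below the \<open>l^q\<close>
  norm; otherwise averages of powers are compared by the tangent at the mean. The result is the
  Lipschitz constant of the empirical Wasserstein distance in the \<open>l^q\<close> metric and the
  origin of the exponent \<open>(1/q - 1/p)_+\<close>.\<close>

lemma power_mean_le:
  fixes v :: "nat \<Rightarrow> real"
  assumes n: "0 < n" and v: "\<And>i. i < n \<Longrightarrow> 0 \<le> v i" and p: "1 \<le> p" and q: "1 \<le> q"
  shows "((\<Sum>i<n. v i powr p) / real n) powr (1 / p)
    \<le> real n powr (max (1 / q - 1 / p) 0 - 1 / q) * (\<Sum>i<n. v i powr q) powr (1 / q)"
proof (cases "q \<le> p")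
  case True
  have "(\<Sum>i<n. (v i powr q) powr (p / q)) powr (1 / (p / q)) \<le> (\<Sum>i<n. v i powr q)"
    using True q by (intro sum_powr_le_powr_sum) (auto simp: pos_le_divide_eq)
  then have "((\<Sum>i<n. (v i powr q) powr (p / q)) powr (1 / (p / q))) powr (1 / q) \<le> (\<Sum>i<n. v i powr q) powr (1 / q)"
    using q by (intro powr_mono2) auto
  then have le: "(\<Sum>i<n. v i powr p) powr (1 / p) \<le> (\<Sum>i<n. v i powr q) powr (1 / q)"
    using q by (simp add: powr_powr)
  have "1 / p \<le> 1 / q" using True q by (intro divide_left_mono) auto
  then have e: "max (1 / q - 1 / p) 0 - 1 / q = - (1 / p)" by simp
  have "((\<Sum>i<n. v i powr p) / real n) powr (1 / p) = real n powr (- (1 / p)) * (\<Sum>i<n. v i powr p) powr (1 / p)"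
    by (simp add: powr_divide powr_minus_divide sum_nonneg)
  then show ?thesis unfolding e using le by (simp add: mult_left_mono)
next
  case False
  define t where "t i = v i powr q" for i
  define m where "m = (\<Sum>i<n. t i) / real n"
  have t0: "0 \<le> t i" for i by (simp add: t_def)
  have m0: "0 \<le> m" using t0 by (simp add: m_def sum_nonneg)
  have "1 / q \<le> 1 / p" using False p by (intro divide_left_mono) auto
  then have e: "max (1 / q - 1 / p) 0 - 1 / q = - (1 / q)" by simp
  have pq: "0 < p / q" "p / q \<le> 1" using p q False by auto
  have tp: "v i powr p = t i powr (p / q)" for i using q by (simp add: t_def powr_powr)
  have "(\<Sum>i<n. v i powr p) / real n \<le> m powr (p / q)"
  proof (cases "m = 0")
    case True
    then have "(\<Sum>i<n. t i) = 0" using n by (simp add: m_def)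
    then have "\<forall>i<n. t i = 0" using t0 by (simp add: sum_nonneg_eq_0_iff)
    then show ?thesis by (simp add: tp)
  next
    case False
    then have mp: "0 < m" using m0 by simp
    have "(\<Sum>i<n. v i powr p) \<le> (\<Sum>i<n. m powr (p / q) * (1 - p / q + p / q * (t i / m)))"
      unfolding tp using t0 mp pq by (intro sum_mono powr_le_tangent) auto
    also have "\<dots> = m powr (p / q) * (real n * (1 - p / q) + p / q * ((\<Sum>i<n. t i) / m))"
      by (simp add: sum_distrib_left[symmetric] sum.distrib sum_divide_distrib[symmetric])
    also have "(\<Sum>i<n. t i) / m = real n" using False n by (simp add: m_def)
    also have "m powr (p / q) * (real n * (1 - p / q) + p / q * real n) = m powr (p / q) * real n"
      by (simp add: algebra_simps)
    finally show ?thesis using n by (simp add: pos_divide_le_eq)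
  qed
  then have "((\<Sum>i<n. v i powr p) / real n) powr (1 / p) \<le> (m powr (p / q)) powr (1 / p)"
    using p by (intro powr_mono2) (auto simp: sum_nonneg)
  also have "\<dots> = m powr (1 / q)" using p by (simp add: powr_powr)
  also have "\<dots> = real n powr (- (1 / q)) * (\<Sum>i<n. t i) powr (1 / q)"
    unfolding m_def using t0 by (simp add: powr_divide powr_minus_divide sum_nonneg)
  finally show ?thesis unfolding e t_def .
qed

text \<open>The coupling pairs points with equal index.\<close>

lemma wasserstein_empirical_le:
  assumes n: "0 < n" and x: "\<And>i. i < n \<Longrightarrow> x i \<in> space (Rd k)" and y: "\<And>i. i < n \<Longrightarrow> y i \<in> space (Rd k)" and p: "1 \<le> p"
  shows "wasserstein k p (empirical k n x) (empirical k n y) \<le> ennreal (((\<Sum>i<n. vdist k (x i) (y i) powr p) / real n) powr (1 / p))"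
proof -
  let ?U = "uniform_count_measure {..<n}"
  let ?S = "(\<Sum>i<n. vdist k (x i) (y i) powr p) / real n"
  have S0: "0 \<le> ?S" by (simp add: sum_nonneg)
  have "(\<integral>\<^sup>+ i. ennreal (vdist k (x i) (y i) powr p) \<partial>?U) = ennreal ?S"
    by (subst nn_integral_uniform_count_measure) (auto simp: ennreal_mult[symmetric] sum_nonneg)
  also have "?S = (?S powr (1 / p)) powr p"
  proof -
    have "(t powr (1 / p)) powr p = t" if "0 \<le> t" for t using that p by (simp add: powr_powr)
    from this[OF S0] show ?thesis ..
  qed
  finally have "(\<integral>\<^sup>+ i. ennreal (vdist k (x i) (y i) powr p) \<partial>?U) \<le> ennreal ((?S powr (1 / p)) powr p)" by simp
  then show ?thesis
    unfolding empirical_def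
    using prob_on_empirical(2)[OF n x] prob_on_empirical(2)[OF n y] p by (intro wasserstein_joint_law_le) auto
qed

text \<open>The exponential-moment proof of the maximal inequality, with \<open>u \<le> exp u\<close> in place of Jensen's inequality.\<close>

lemma expected_max_bound:
  fixes F :: "'v \<Rightarrow> 'a \<Rightarrow> real"
  assumes P: "prob_space P" and V: "finite V" and int: "\<And>v. v \<in> V \<Longrightarrow> integrable P (F v)"
    and mgf: "\<And>v \<eta>. v \<in> V \<Longrightarrow> 0 < \<eta> \<Longrightarrow>
      (\<integral>\<^sup>+x. ennreal (exp (\<eta> * F v x)) \<partial>P) \<le> ennreal (exp (\<eta> * (\<integral>x. F v x \<partial>P) + \<eta>\<^sup>2 * \<tau>\<^sup>2 / 2))"
    and mean: "\<And>v. v \<in> V \<Longrightarrow> (\<integral>x. F v x \<partial>P) \<le> r" and card: "real (card V) \<le> exp \<Lambda>" and \<Lambda>: "1 \<le> \<Lambda>" and \<tau>: "0 < \<tau>" and r: "0 \<le> r"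
  shows "\<exists>B\<in>borel_measurable P. (\<forall>x. 0 \<le> B x) \<and> (\<forall>x. \<forall>v\<in>V. F v x \<le> B x) \<and>
    (\<integral>\<^sup>+x. ennreal (B x) \<partial>P) \<le> ennreal (r + 3 * \<tau> * sqrt \<Lambda>)"
proof -
  interpret prob_space P by fact
  \<comment> \<open>The parameter that balances \<open>\<Lambda> / \<eta>\<close> against
    \<open>\<eta> * \<tau>^2\<close>.\<close>
  define \<eta> where "\<eta> = sqrt \<Lambda> / \<tau>"
  have \<eta>: "0 < \<eta>" using \<Lambda> \<tau> by (simp add: \<eta>_def)
  have \<eta>\<tau>: "\<eta>\<^sup>2 * \<tau>\<^sup>2 = \<Lambda>" using \<Lambda> \<tau> by (simp add: \<eta>_def power_divide)
  \<comment> \<open>With this offset each normalized exponential \<open>G v\<close> has mean at most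
    \<open>exp (- \<Lambda>)\<close>, so that the sum over \<open>V\<close> has mean at most
    1.\<close>
  define b where "b = \<Lambda> + \<eta>\<^sup>2 * \<tau>\<^sup>2 / 2"
  define G where "G v x = exp (- (\<eta> * (\<integral>x. F v x \<partial>P) + b)) * exp (\<eta> * F v x)" for v x
  define B where "B x = r + b / \<eta> + (1 / \<eta>) * (\<Sum>v\<in>V. G v x)" for x
  have b0: "0 < b" using \<Lambda> by (simp add: b_def \<eta>\<tau>)
  have G0: "0 \<le> G v x" for v x by (simp add: G_def)
  have Gm: "G v \<in> borel_measurable P" if "v \<in> V" for v
    unfolding G_def using int[OF that] by measurable
  have Gi: "(\<integral>\<^sup>+x. ennreal (G v x) \<partial>P) \<le> ennreal (exp (- \<Lambda>))" if v: "v \<in> V" for v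
  proof -
    have [measurable]: "F v \<in> borel_measurable P" using int[OF v] by auto
    have "(\<integral>\<^sup>+x. ennreal (G v x) \<partial>P) = ennreal (exp (- (\<eta> * (\<integral>x. F v x \<partial>P) + b))) * (\<integral>\<^sup>+x. ennreal (exp (\<eta> * F v x)) \<partial>P)"
      unfolding G_def by (simp add: ennreal_mult nn_integral_cmult)
    also have "\<dots> \<le> ennreal (exp (- (\<eta> * (\<integral>x. F v x \<partial>P) + b))) * ennreal (exp (\<eta> * (\<integral>x. F v x \<partial>P) + \<eta>\<^sup>2 * \<tau>\<^sup>2 / 2))"
      by (intro mult_left_mono mgf v \<eta>) simp
    also have "\<dots> = ennreal (exp (- \<Lambda>))"
      by (simp add: ennreal_mult[symmetric] exp_add[symmetric] b_def)
    finally show ?thesis .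
  qed
  have Bm: "B \<in> borel_measurable P"
    unfolding B_def by (intro borel_measurable_add borel_measurable_times borel_measurable_sum measurable_const Gm) auto
  have B0: "0 \<le> B x" for x
    unfolding B_def using r b0 \<eta> G0 by (intro add_nonneg_nonneg mult_nonneg_nonneg sum_nonneg) auto
  have FB: "F v x \<le> B x" if v: "v \<in> V" for v x
  proof -
    define u where "u = \<eta> * F v x - (\<eta> * (\<integral>x. F v x \<partial>P) + b)"
    have "u \<le> exp u" using exp_ge_add_one_self[of u] by linarith
    also have "exp u = G v x" unfolding G_def u_def exp_add[symmetric] by simp
    also have "\<dots> \<le> (\<Sum>v\<in>V. G v x)" using V v G0 by (intro member_le_sum) auto
    finally have "\<eta> * F v x \<le> \<eta> * (\<integral>x. F v x \<partial>P) + b + (\<Sum>v\<in>V. G v x)" by (simp add: u_def)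
    also have "\<dots> \<le> \<eta> * r + b + (\<Sum>v\<in>V. G v x)" using mean[OF v] \<eta> by (intro add_right_mono mult_left_mono) auto
    also have "\<dots> = \<eta> * B x" unfolding B_def using \<eta> by (simp add: distrib_left)
    finally show ?thesis using \<eta> by simp
  qed
  have "(\<integral>\<^sup>+x. ennreal (B x) \<partial>P) = (\<integral>\<^sup>+x. ennreal (r + b / \<eta>) + ennreal (1 / \<eta>) * (\<Sum>v\<in>V. ennreal (G v x)) \<partial>P)"
    unfolding B_def using r b0 \<eta> G0
    by (intro nn_integral_cong) (simp add: ennreal_mult[symmetric] ennreal_plus[symmetric] sum_nonneg del: ennreal_plus)
  also have "\<dots> = ennreal (r + b / \<eta>) + ennreal (1 / \<eta>) * (\<Sum>v\<in>V. \<integral>\<^sup>+x. ennreal (G v x) \<partial>P)"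
  proof -
    have Sm: "(\<lambda>x. \<Sum>v\<in>V. ennreal (G v x)) \<in> borel_measurable P"
      by (intro borel_measurable_sum measurable_compose[OF Gm measurable_ennreal])
    have "(\<integral>\<^sup>+x. (\<Sum>v\<in>V. ennreal (G v x)) \<partial>P) = (\<Sum>v\<in>V. \<integral>\<^sup>+x. ennreal (G v x) \<partial>P)"
      by (intro nn_integral_sum measurable_compose[OF Gm measurable_ennreal])
    then show ?thesis using Sm by (subst nn_integral_add) (auto simp: nn_integral_cmult emeasure_space_1 simp del: sum_ennreal)
  qed
  also have "\<dots> \<le> ennreal (r + b / \<eta>) + ennreal (1 / \<eta>) * (\<Sum>v\<in>V. ennreal (exp (- \<Lambda>)))"
    using Gi by (intro add_left_mono mult_left_mono sum_mono) auto
  also have "\<dots> = ennreal (r + b / \<eta> + 1 / \<eta> * (real (card V) * exp (- \<Lambda>)))"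
    using r b0 \<eta> by (simp add: ennreal_mult[symmetric] ennreal_plus[symmetric] ennreal_of_nat_eq_real_of_nat del: ennreal_plus)
  also have "\<dots> \<le> ennreal (r + 3 * \<tau> * sqrt \<Lambda>)"
  proof (rule ennreal_leI)
    have "real (card V) * exp (- \<Lambda>) \<le> exp \<Lambda> * exp (- \<Lambda>)" using card by (intro mult_right_mono) auto
    also have "\<dots> = 1" by (simp add: exp_add[symmetric])
    finally have "b / \<eta> + 1 / \<eta> * (real (card V) * exp (- \<Lambda>)) \<le> b / \<eta> + 1 / \<eta> * 1"
      using \<eta> by (intro add_left_mono mult_left_mono) auto
    also have "\<dots> = (3 / 2 * \<Lambda> + 1) / \<eta>" by (simp add: b_def \<eta>\<tau> add_divide_distrib)
    also have "\<dots> \<le> (3 * \<Lambda>) / \<eta>" using \<Lambda> \<eta> by (intro divide_right_mono) auto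
    also have "\<dots> = 3 * \<tau> * (\<Lambda> / sqrt \<Lambda>)" by (simp add: \<eta>_def)
    also have "\<Lambda> / sqrt \<Lambda> = sqrt \<Lambda>" using \<Lambda> by (simp add: real_div_sqrt)
    finally show "r + b / \<eta> + 1 / \<eta> * (real (card V) * exp (- \<Lambda>)) \<le> r + 3 * \<tau> * sqrt \<Lambda>" by simp
  qed
  finally show ?thesis using Bm B0 FB by blast
qed

text \<open>Matrices are flattened to vectors of length \<open>k * d\<close>, so that the
  exponential sums over boxes can count them.\<close>

lemma sum_div_mod:
  fixes f :: "nat \<Rightarrow> nat \<Rightarrow> 'b::comm_monoid_add"
  shows "(\<Sum>t<k * d. f (t div d) (t mod d)) = (\<Sum>i<k. \<Sum>l<d. f i l)"
proof -
  have "(\<Sum>t<k * d. f (t div d) (t mod d)) = (\<Sum>i<k. \<Sum>t\<in>{i * d..<i * d + d}. f (t div d) (t mod d))"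
    by (rule sum.nat_group[symmetric])
  also have "\<dots> = (\<Sum>i<k. \<Sum>l<d. f i l)"
  proof (rule sum.cong[OF refl])
    fix i
    have dm: "t div d = i" "t mod d = t - i * d" if "i * d \<le> t" "t < i * d + d" for t
    proof -
      show 1: "t div d = i" using that by (intro div_nat_eqI) (auto simp: algebra_simps)
      show "t mod d = t - i * d" unfolding minus_div_mult_eq_mod[symmetric] 1 ..
    qed
    show "(\<Sum>t\<in>{i * d..<i * d + d}. f (t div d) (t mod d)) = (\<Sum>l<d. f i l)"
      by (rule sum.reindex_bij_witness[of _ "\<lambda>l. i * d + l" "\<lambda>t. t - i * d"]) (auto simp: dm)
  qed
  finally show ?thesis .
qed

text \<open>Rounding the entries to multiples of $1/\sqrt{dn}$. The number of occurring roundings is controlled through their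
  $\ell_1$-norm; counting grid points of the cube $[-1,1]^{dk}$ instead would cost a factor $\log d$.\<close>

lemma stiefel_net:
  assumes k: "0 < k" and d: "0 < d" and n: "2 \<le> n"
  shows "\<exists>V. V \<subseteq> stiefel k d \<and> finite V \<and> real (card V) \<le> exp (5 * (real d * real k * ln (real n))) \<and>
    (\<forall>U\<in>stiefel k d. \<exists>W\<in>V. (\<Sum>i<k. \<Sum>l<d. (U i l - W i l)\<^sup>2) \<le> real k / real n)"
proof -
  define K where "K = k * d"
  have K: "0 < real K" using k d by (simp add: K_def)
  \<comment> \<open>Entries with the same rounding differ by at most \<open>1 / h\<close>, so the
    squared Frobenius distance is at most \<open>k * d / (d * n) = k / n\<close>.\<close>
  define h where "h = sqrt (real d * real n)"
  have h: "0 < h" "h * h = real d * real n" using d n by (auto simp: h_def)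
  define z where "z U = (\<lambda>t\<in>{..<K}. \<lfloor>h * U (t div d) (t mod d)\<rfloor>)" for U :: "nat \<Rightarrow> nat \<Rightarrow> real"
  define m :: int where "m = \<lceil>h\<rceil> + 1"
  have m0: "0 \<le> m" unfolding m_def using h by linarith
  define Mx where "Mx = sqrt (real n) + 1"
  have Mx: "0 < Mx" unfolding Mx_def by (rule add_nonneg_pos) auto
  \<comment> \<open>By Cauchy-Schwarz the entries of \<open>U\<close> have \<open>l^1\<close> norm
    at most \<open>sqrt K * sqrt k\<close>; scaling by \<open>h\<close> gives
    \<open>K * sqrt n\<close>, and the floors add at most \<open>K\<close>.\<close>
  define S where "S = {a \<in> box_cells K m. (\<Sum>t<K. real_of_int \<bar>a t\<bar>) \<le> real K * Mx}"
  have row: "(\<Sum>l<d. (U i l)\<^sup>2) = 1" if "U \<in> stiefel k d" "i < k" for U i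
    using that by (auto simp: stiefel_def power2_eq_square)
  have zS: "z U \<in> S" if U: "U \<in> stiefel k d" for U
  proof -
    have e1: "\<bar>U i l\<bar> \<le> 1" if "i < k" "l < d" for i l
    proof -
      have "(U i l)\<^sup>2 \<le> (\<Sum>l<d. (U i l)\<^sup>2)" using that by (intro member_le_sum) auto
      then show ?thesis using row[OF U that(1)] by (simp add: abs_square_le_1)
    qed
    have dm: "t div d < k" "t mod d < d" if "t < K" for t
      using that d by (auto simp: K_def less_mult_imp_div_less)
    have "z U \<in> box_cells K m"
    proof -
      have "- m \<le> \<lfloor>h * U (t div d) (t mod d)\<rfloor> \<and> \<lfloor>h * U (t div d) (t mod d)\<rfloor> \<le> m" if t: "t < K" for t
      proof -
        have "\<bar>h * U (t div d) (t mod d)\<bar> \<le> h * 1"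
          using e1[OF dm[OF t]] h by (simp add: abs_mult mult_left_mono del: mult_1_right)
        then show ?thesis unfolding m_def by linarith
      qed
      then show ?thesis by (auto simp: z_def box_cells_def)
    qed
    moreover have "(\<Sum>t<K. real_of_int \<bar>z U t\<bar>) \<le> real K * Mx"
    proof -
      have "(\<Sum>t<K. real_of_int \<bar>z U t\<bar>) \<le> (\<Sum>t<K. h * \<bar>U (t div d) (t mod d)\<bar> + 1)"
      proof (rule sum_mono)
        fix t assume t: "t \<in> {..<K}"
        have "real_of_int \<bar>\<lfloor>h * U (t div d) (t mod d)\<rfloor>\<bar> \<le> \<bar>h * U (t div d) (t mod d)\<bar> + 1" by linarith
        then show "real_of_int \<bar>z U t\<bar> \<le> h * \<bar>U (t div d) (t mod d)\<bar> + 1" using t h by (simp add: z_def abs_mult)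
      qed
      also have "\<dots> = h * (\<Sum>t<K. \<bar>U (t div d) (t mod d)\<bar>) + real K" by (simp add: sum.distrib sum_distrib_left)
      also have "(\<Sum>t<K. \<bar>U (t div d) (t mod d)\<bar>) \<le> sqrt (real K) * L2_set (\<lambda>t. U (t div d) (t mod d)) {..<K}"
        using L2_set_mult_ineq[of "\<lambda>_. 1" "\<lambda>t. U (t div d) (t mod d)" "{..<K}"] by (simp add: L2_set_constant)
      also have "L2_set (\<lambda>t. U (t div d) (t mod d)) {..<K} = sqrt (real k)"
        unfolding L2_set_def K_def sum_div_mod[of "\<lambda>i l. (U i l)\<^sup>2"] using row[OF U] by simp
      also have "h * (sqrt (real K) * sqrt (real k)) + real K = real K * Mx"
        using h(1) d k by (simp add: h_def K_def Mx_def real_sqrt_mult algebra_simps)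
      finally show ?thesis using h by (simp add: mult_left_mono)
    qed
    ultimately show ?thesis by (simp add: S_def)
  qed
  have finS: "finite S" unfolding S_def by simp
  have cS: "real (card S) \<le> exp (5 * (real d * real k * ln (real n)))"
  proof -
    \<comment> \<open>Counting by exponential weights: every point of \<open>S\<close> has weight at
      least \<open>exp (- K)\<close>, and the total weight over the box is known.\<close>
    have "real (card S) * exp (- real K) = (\<Sum>a\<in>S. exp (- real K))" by simp
    also have "\<dots> \<le> (\<Sum>a\<in>S. exp (- (1 / Mx) * (\<Sum>t<K. real_of_int \<bar>a t\<bar>)))"
    proof (rule sum_mono)
      fix a assume "a \<in> S"
      then have "(\<Sum>t<K. real_of_int \<bar>a t\<bar>) \<le> real K * Mx" by (simp add: S_def)
      then show "exp (- real K) \<le> exp (- (1 / Mx) * (\<Sum>t<K. real_of_int \<bar>a t\<bar>))"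
        using Mx by (simp add: pos_divide_le_eq)
    qed
    also have "\<dots> \<le> (\<Sum>a\<in>box_cells K m. exp (- (1 / Mx) * (\<Sum>t<K. real_of_int \<bar>a t\<bar>)))"
      by (rule sum_mono2) (auto simp: S_def)
    also have "\<dots> \<le> (1 + 2 / (1 / Mx)) ^ K" using Mx m0 by (intro sum_exp_box_le) auto
    finally have "real (card S) * exp (- real K) * exp (real K) \<le> (1 + 2 * Mx) ^ K * exp (real K)"
      by (simp add: mult_right_mono)
    then have "real (card S) \<le> ((1 + 2 * Mx) * exp 1) ^ K"
      by (simp add: mult.assoc exp_add[symmetric] power_mult_distrib exp_of_nat_mult[symmetric])
    \<comment> \<open>For \<open>n >= 2\<close> the base is at most \<open>16 * n\<close>, hence at
      most \<open>n^5\<close>; this is the factor 5 in the size of the net.\<close>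
    also have "\<dots> \<le> (real n ^ 5) ^ K"
    proof (rule power_mono)
      have n2: "2 \<le> real n" using n by simp
      have sn: "sqrt (real n) \<le> real n"
        using n2 by (intro real_le_lsqrt) (auto simp: power2_eq_square intro: order_trans[OF _ mult_right_mono[of 1 "real n" "real n"]])
      have "(1 + 2 * Mx) * exp 1 \<le> (3 + 2 * real n) * 3"
        unfolding Mx_def using sn exp_le by (intro mult_mono) auto
      also have "\<dots> \<le> 16 * real n" using n2 by simp
      also have "\<dots> = 2 ^ 4 * real n" by simp
      also have "\<dots> \<le> real n ^ 4 * real n" using n2 by (intro mult_right_mono power_mono) auto
      also have "\<dots> = real n ^ 5" by (simp add: eval_nat_numeral)
      finally show "(1 + 2 * Mx) * exp 1 \<le> real n ^ 5" .
    qed (use Mx in auto)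
    also have "\<dots> = exp (5 * (real d * real k * ln (real n)))"
    proof -
      have "(real n ^ 5) ^ K = exp (ln (real n)) ^ (5 * K)" using n by (simp add: power_mult)
      also have "\<dots> = exp (real (5 * K) * ln (real n))" by (rule exp_of_nat_mult[symmetric])
      finally show ?thesis by (simp add: K_def ac_simps)
    qed
    finally show ?thesis .
  qed
  \<comment> \<open>One matrix is kept for each occurring rounding, so the net consists of matrices
    with orthonormal rows and no rounded matrix has to be orthonormalized again.\<close>
  define rep where "rep a = (SOME U. U \<in> stiefel k d \<and> z U = a)" for a
  have rep: "rep (z U) \<in> stiefel k d \<and> z (rep (z U)) = z U" if "U \<in> stiefel k d" for U
    unfolding rep_def by (rule someI[of "\<lambda>W. W \<in> stiefel k d \<and> z W = z U" U]) (use that in simp)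
  define V where "V = rep ` (z ` stiefel k d)"
  have zsub: "z ` stiefel k d \<subseteq> S" using zS by blast
  then have fz: "finite (z ` stiefel k d)" using finS by (rule finite_subset)
  have "V \<subseteq> stiefel k d" unfolding V_def using rep by auto
  moreover have "finite V" unfolding V_def using fz by simp
  moreover have "real (card V) \<le> exp (5 * (real d * real k * ln (real n)))"
  proof -
    have "card V \<le> card (z ` stiefel k d)" unfolding V_def by (rule card_image_le[OF fz])
    also have "\<dots> \<le> card S" by (rule card_mono[OF finS zsub])
    finally show ?thesis using cS by linarith
  qed
  moreover have "\<exists>W\<in>V. (\<Sum>i<k. \<Sum>l<d. (U i l - W i l)\<^sup>2) \<le> real k / real n" if U: "U \<in> stiefel k d" for U
  proof (intro bexI[of _ "rep (z U)"])
    let ?W = "rep (z U)"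
    show "?W \<in> V" using U by (auto simp: V_def)
    have "(\<Sum>i<k. \<Sum>l<d. (U i l - ?W i l)\<^sup>2) = (\<Sum>t<K. (U (t div d) (t mod d) - ?W (t div d) (t mod d))\<^sup>2)"
      unfolding K_def by (rule sum_div_mod[symmetric])
    also have "\<dots> \<le> (\<Sum>t<K. 1 / (real d * real n))"
    proof (rule sum_mono)
      fix t assume t: "t \<in> {..<K}"
      let ?u = "U (t div d) (t mod d)" and ?w = "?W (t div d) (t mod d)"
      have "\<lfloor>h * ?u\<rfloor> = \<lfloor>h * ?w\<rfloor>"
        using fun_cong[OF conjunct2[OF rep[OF U]], of t] t by (simp add: z_def)
      then have "\<bar>h * ?u - h * ?w\<bar> \<le> 1" by linarith
      then have "(h * ?u - h * ?w)\<^sup>2 \<le> 1" by (simp add: abs_square_le_1)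
      then have "(real d * real n) * (?u - ?w)\<^sup>2 \<le> 1"
        unfolding h(2)[symmetric] by (simp add: right_diff_distrib[symmetric] power_mult_distrib power2_eq_square[of h])
      then show "(?u - ?w)\<^sup>2 \<le> 1 / (real d * real n)"
        using d n by (simp add: pos_le_divide_eq mult.commute)
    qed
    also have "\<dots> = real k / real n" using d by (simp add: K_def)
    finally show "(\<Sum>i<k. \<Sum>l<d. (U i l - ?W i l)\<^sup>2) \<le> real k / real n" .
  qed
  ultimately show ?thesis by blast
qed

text \<open>Cauchy-Schwarz row by row: the Frobenius norm dominates the operator norm.\<close>

lemma vdist_aff_proj_perturb:
  assumes "(\<Sum>i<k. \<Sum>l<d. (U i l - V i l)\<^sup>2) \<le> e\<^sup>2" "0 \<le> e"
  shows "vdist k (aff_proj k d m U y) (aff_proj k d m V y) \<le> e * L2_set (\<lambda>l. y l - m l) {..<d}"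
proof -
  let ?z = "\<lambda>l. y l - m l"
  have "(\<Sum>i<k. (aff_proj k d m U y i - aff_proj k d m V y i)\<^sup>2)
    \<le> (\<Sum>i<k. (\<Sum>l<d. (U i l - V i l)\<^sup>2) * (\<Sum>l<d. (?z l)\<^sup>2))"
  proof (rule sum_mono)
    fix i assume i: "i \<in> {..<k}"
    let ?a = "\<lambda>l. U i l - V i l"
    have "aff_proj k d m U y i - aff_proj k d m V y i = (\<Sum>l<d. ?a l * ?z l)"
      using i by (simp add: aff_proj_def sum_subtractf[symmetric] left_diff_distrib)
    also have "\<bar>\<dots>\<bar> \<le> (\<Sum>l<d. \<bar>?a l\<bar> * \<bar>?z l\<bar>)"
      by (rule order_trans[OF sum_abs]) (simp add: abs_mult)
    also have "\<dots> \<le> L2_set ?a {..<d} * L2_set ?z {..<d}" by (rule L2_set_mult_ineq)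
    finally have "\<bar>aff_proj k d m U y i - aff_proj k d m V y i\<bar> \<le> \<bar>L2_set ?a {..<d} * L2_set ?z {..<d}\<bar>" by simp
    then have "(aff_proj k d m U y i - aff_proj k d m V y i)\<^sup>2 \<le> (L2_set ?a {..<d} * L2_set ?z {..<d})\<^sup>2"
      by (simp only: abs_le_square_iff)
    also have "\<dots> = (\<Sum>l<d. (?a l)\<^sup>2) * (\<Sum>l<d. (?z l)\<^sup>2)"
      by (simp add: power_mult_distrib L2_set_def sum_nonneg)
    finally show "(aff_proj k d m U y i - aff_proj k d m V y i)\<^sup>2 \<le> (\<Sum>l<d. (?a l)\<^sup>2) * (\<Sum>l<d. (?z l)\<^sup>2)" .
  qed
  also have "\<dots> = (\<Sum>i<k. \<Sum>l<d. (U i l - V i l)\<^sup>2) * (\<Sum>l<d. (?z l)\<^sup>2)" by (rule sum_distrib_right[symmetric])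
  also have "\<dots> \<le> e\<^sup>2 * (\<Sum>l<d. (?z l)\<^sup>2)" using assms(1) by (intro mult_right_mono sum_nonneg) auto
  finally have "vdist k (aff_proj k d m U y) (aff_proj k d m V y) \<le> sqrt (e\<^sup>2 * (\<Sum>l<d. (?z l)\<^sup>2))"
    unfolding vdist_def L2_set_def by (rule real_sqrt_le_mono)
  also have "\<dots> = e * L2_set ?z {..<d}" using assms(2) by (simp add: real_sqrt_mult L2_set_def)
  finally show ?thesis .
qed

lemma rate_mono: "0 \<le> a \<Longrightarrow> a \<le> b \<Longrightarrow> 2 \<le> n \<Longrightarrow> rate a p k n \<le> rate b p k n"
  unfolding rate_def by (auto intro!: mult_right_mono)

lemma rate_nonneg: "0 \<le> a \<Longrightarrow> 2 \<le> n \<Longrightarrow> 0 \<le> rate a p k n"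
  unfolding rate_def by (auto intro!: mult_nonneg_nonneg)

lemma proj_law_empirical:
  assumes n: "0 < n" and x: "\<And>i. i < n \<Longrightarrow> x i \<in> space (Rd d)" and T: "T \<in> measurable (Rd d) (Rd k)"
  shows "distr (empirical d n x) (Rd k) T = empirical k n (\<lambda>i. T (x i))"
  unfolding empirical_def
  by (subst distr_distr[OF T prob_on_empirical(2)[OF n x]]) (auto simp: comp_def)

text \<open>For fixed \<open>U\<close> the distance is a Lipschitz function of the sample with mean
  bounded by the rate, hence sub-Gaussian around it. The maximum over the net costs the square root
  of the logarithm of its size; leaving the net costs its radius times
  \<open>\<sigma> * sqrt d\<close>, the order of a typical centred point. The majorant
  \<open>B\<close> replaces the supremum.\<close>

lemma projected_deviation_bound:
  assumes p: "1 \<le> p"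
  shows "\<exists>c>0. \<forall>d k n \<sigma> q \<mu>. 1 \<le> q \<and> q \<le> 2 \<and> 0 < \<sigma> \<and> 2 \<le> n \<and> 0 < k \<and> 0 < d \<and> transport_ineq d q (\<sigma>\<^sup>2) \<mu> \<longrightarrow>
    (\<exists>B\<in>borel_measurable (Pi\<^sub>M {..<n} (\<lambda>_. \<mu>)).
      (\<forall>x\<in>space (Pi\<^sub>M {..<n} (\<lambda>_. \<mu>)). \<forall>U\<in>stiefel k d.
        wasserstein k p (proj_law k d U (empirical d n x)) (proj_law k d U \<mu>) \<le> B x) \<and>
      (\<integral>\<^sup>+x. B x \<partial>Pi\<^sub>M {..<n} (\<lambda>_. \<mu>)) \<le> ennreal (4 * \<sigma> * (rate c p k n
        + c * real n powr (max (1 / q - 1 / p) 0) * sqrt (real d * real k * ln (real n) / real n))))"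
proof -
  obtain c0 where c0: "0 < c0" and rates: "\<And>k n. 0 < k \<Longrightarrow> 2 \<le> n \<Longrightarrow>
    (\<exists>J. 2 * (sqrt (real k) * (mean_const p * mean_phi p k n J) powr (1 / p)) \<le> rate c0 p k n) \<or>
    3 * (sqrt (real k) * moment_const p powr (1 / p)) \<le> rate c0 p k n"
    using mean_rate_bound[OF p] by blast
  define mm where "mm = moment_const p powr (1 / p)"
  have mc: "0 < moment_const p" using p by (simp add: moment_const_def)
  have mm: "0 < mm" unfolding mm_def using mc by simp
  \<comment> \<open>In units of \<open>4 * \<sigma>\<close>, the 2 pays for the maximum over the net
    and \<open>6 * mm\<close> for the perturbation terms, which sum to \<open>3 * r\<close>.\<close>
  define c where "c = c0 + 2 + 6 * mm"
  have c: "0 < c" "c0 \<le> c" "2 + 6 * mm \<le> c" using c0 mm by (auto simp: c_def)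
  show ?thesis
  proof (intro exI[of _ c] conjI c(1) allI impI)
    fix d k n :: nat and \<sigma> q :: real and \<mu> :: "vec measure"
    assume "1 \<le> q \<and> q \<le> 2 \<and> 0 < \<sigma> \<and> 2 \<le> n \<and> 0 < k \<and> 0 < d \<and> transport_ineq d q (\<sigma>\<^sup>2) \<mu>"
    then have q: "1 \<le> q" "q \<le> 2" and \<sigma>: "0 < \<sigma>" and n2: "2 \<le> n" and k: "0 < k" and d: "0 < d"
      and T: "transport_ineq d q (\<sigma>\<^sup>2) \<mu>" by auto
    have n: "0 < n" using n2 by simp
    have \<mu>: "prob_on d \<mu>" using T by (simp add: transport_ineq_def)
    have M: "prob_space \<mu>" using \<mu> by (rule prob_onD)
    interpret M: prob_space \<mu> by fact
    let ?P = "Pi\<^sub>M {..<n} (\<lambda>_. \<mu>)"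
    interpret P: prob_space ?P by (rule prob_space_PiM) (rule M)
    have sP: "sets ?P = sets (Pi\<^sub>M {..<n} (\<lambda>_. Rd d))"
      by (rule sets_PiM_cong) (use prob_onD(2)[OF \<mu>] in auto)
    have spP: "space ?P = space (Pi\<^sub>M {..<n} (\<lambda>_. Rd d))" using sP by (rule sets_eq_imp_space_eq)
    have xs: "x i \<in> space (Rd d)" if "x \<in> space ?P" "i < n" for x i
      using that unfolding spP by (auto simp: space_PiM)
    define m where "m l = (\<integral>x. x l \<partial>\<mu>)" for l
    define Y where "Y = aff_proj k d m"
    have YR: "Y U \<in> measurable (Rd d) (Rd k)" for U unfolding Y_def by (rule aff_proj_measurable)
    have Ym: "Y U \<in> measurable \<mu> (Rd k)" for U
      unfolding measurable_cong_sets[OF prob_onD(2)[OF \<mu>] refl] by (rule YR)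
    define law where "law U = distr \<mu> (Rd k) (Y U)" for U
    define emp where "emp U x = empirical k n (\<lambda>i. Y U (x i))" for U and x :: "nat \<Rightarrow> vec"
    define W where "W U x = wasserstein k p (emp U x) (law U)" for U x
    have plaw: "prob_on k (law U)" for U unfolding law_def by (rule prob_on_distr[OF M Ym])
    have Yx: "Y U (x i) \<in> space (Rd k)" if "x \<in> space ?P" "i < n" for U x i
      by (rule measurable_space[OF YR xs[OF that]])
    have pemp: "prob_on k (emp U x)" if "x \<in> space ?P" for U x
      unfolding emp_def using Yx[OF that] by (rule prob_on_empirical(1)[OF n])
    have glue: "glueable k (emp U x) \<beta>" if "x \<in> space ?P" "prob_on k \<beta>" for U x \<beta>
      unfolding emp_def using Yx[OF that(1)] that(2) by (rule empirical_glueable[OF n])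
    have H: "(\<integral>\<^sup>+x. ennreal (exp (sqrt (real j) * L2_set (aff_proj j d m U x) {..<j} / (4 * \<sigma>))) \<partial>\<mu>) \<le> ennreal (exp (2 * real j))"
      if "0 < j" "U \<in> stiefel j d" for j U
      by (rule aff_proj_exp_moment[OF T q \<sigma> that]) (simp add: m_def)
    define R where "R = rate c0 p k n"
    have R0: "0 \<le> R" unfolding R_def using c0 n2 by (intro rate_nonneg) auto
    have mean: "(\<integral>\<^sup>+x. W U x \<partial>?P) \<le> ennreal (4 * \<sigma> * R)" if U: "U \<in> stiefel k d" for U
    proof -
      have s4: "0 < 4 * \<sigma>" using \<sigma> by simp
      note HU = H[OF k U, folded Y_def]
      from rates[OF k n2] show ?thesis
      proof
        assume "\<exists>J. 2 * (sqrt (real k) * (mean_const p * mean_phi p k n J) powr (1 / p)) \<le> rate c0 p k n"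
        then obtain J where J: "2 * (sqrt (real k) * (mean_const p * mean_phi p k n J) powr (1 / p)) \<le> R"
          unfolding R_def by blast
        have "(\<integral>\<^sup>+x. W U x \<partial>?P) \<le> ennreal (2 * (4 * \<sigma> * sqrt (real k) * (mean_const p * mean_phi p k n J) powr (1 / p)))"
          unfolding W_def emp_def law_def by (rule mean_wasserstein[OF M Ym s4 p k n HU])
        also have "\<dots> \<le> ennreal (4 * \<sigma> * R)"
          using mult_left_mono[OF J, of "4 * \<sigma>"] \<sigma> by (intro ennreal_leI) (simp add: ac_simps)
        finally show ?thesis .
      next
        assume J: "3 * (sqrt (real k) * moment_const p powr (1 / p)) \<le> rate c0 p k n"
        have "(\<integral>\<^sup>+x. W U x \<partial>?P) \<le> ennreal (3 * (4 * \<sigma> * sqrt (real k) * moment_const p powr (1 / p)))"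
          unfolding W_def emp_def law_def by (rule mean_wasserstein_trivial[OF M Ym s4 p k n HU])
        also have "\<dots> \<le> ennreal (4 * \<sigma> * R)"
          using mult_left_mono[OF J, of "4 * \<sigma>"] \<sigma> unfolding R_def by (intro ennreal_leI) (simp add: ac_simps)
        finally show ?thesis .
      qed
    qed
    define a where "a = max (1 / q - 1 / p) 0"
    define L where "L = real n powr (a - 1 / q)"
    have L: "0 < L" using n by (simp add: L_def)
    let ?S = "\<lambda>x y :: nat \<Rightarrow> vec. (\<Sum>i<n. vdist d (x i) (y i) powr q) powr (1 / q)"
    have Wlip: "W U x \<le> ennreal (L * ?S x y) + W U y" if U: "U \<in> stiefel k d" and x: "x \<in> space ?P" and y: "y \<in> space ?P" for U x y
    proof -
      have "W U x \<le> wasserstein k p (emp U x) (emp U y) + W U y"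
        unfolding W_def by (rule wasserstein_triangle[OF pemp[OF x] pemp[OF y] glue[OF x pemp[OF y]] p])
      also have "wasserstein k p (emp U x) (emp U y) \<le> ennreal (((\<Sum>i<n. vdist k (Y U (x i)) (Y U (y i)) powr p) / real n) powr (1 / p))"
        unfolding emp_def by (rule wasserstein_empirical_le[OF n Yx[OF x] Yx[OF y] p])
      also have "((\<Sum>i<n. vdist k (Y U (x i)) (Y U (y i)) powr p) / real n) powr (1 / p)
        \<le> ((\<Sum>i<n. vdist d (x i) (y i) powr p) / real n) powr (1 / p)"
        unfolding Y_def using p U n
        by (intro powr_mono2 divide_right_mono sum_mono vdist_aff_proj_le) (auto intro!: divide_nonneg_nonneg sum_nonneg)
      also have "\<dots> \<le> L * ?S x y"
        unfolding L_def a_def by (rule power_mean_le[OF n _ p q(1)]) simp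
      finally show ?thesis by (simp add: add_right_mono ennreal_leI)
    qed
    \<comment> \<open>A finite mean forces a finite value at some sample, and the Lipschitz bound
      spreads finiteness to all samples.\<close>
    have Wfin: "W U x < \<top>" if U: "U \<in> stiefel k d" and x: "x \<in> space ?P" for U x
    proof -
      have "\<exists>y\<in>space ?P. W U y < \<top>"
      proof (rule ccontr)
        assume "\<not> (\<exists>y\<in>space ?P. W U y < \<top>)"
        then have "W U y = \<top>" if "y \<in> space ?P" for y using that by (metis top.not_eq_extremum)
        then have "(\<integral>\<^sup>+x. W U x \<partial>?P) = (\<integral>\<^sup>+x. \<top> \<partial>?P)" by (intro nn_integral_cong)
        also have "\<dots> = \<top>" by (simp add: P.emeasure_space_1)
        finally show False using mean[OF U] by (simp add: top_unique)
      qed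
      then obtain y where y: "y \<in> space ?P" "W U y < \<top>" by blast
      then have "ennreal (L * ?S x y) + W U y < \<top>" by simp
      with Wlip[OF U x y(1)] show ?thesis by (rule le_less_trans)
    qed
    define F where "F U x = enn2real (W U x)" for U x
    have WF: "W U x = ennreal (F U x)" if "U \<in> stiefel k d" "x \<in> space ?P" for U x
      unfolding F_def using Wfin[OF that] by simp
    have F0: "0 \<le> F U x" for U x by (simp add: F_def)
    have Flip: "F U x - F U y \<le> L * ?S x y" if U: "U \<in> stiefel k d"
      and x: "x \<in> space (Pi\<^sub>M {..<n} (\<lambda>_. Rd d))" and y: "y \<in> space (Pi\<^sub>M {..<n} (\<lambda>_. Rd d))" for U x y
    proof -
      have x': "x \<in> space ?P" and y': "y \<in> space ?P" using x y unfolding spP by auto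
      have S0: "0 \<le> L * ?S x y" using L by simp
      have "ennreal (F U x) \<le> ennreal (L * ?S x y + F U y)"
        using Wlip[OF U x' y'] unfolding WF[OF U x'] WF[OF U y'] using S0 F0 by simp
      then have "F U x \<le> L * ?S x y + F U y" using S0 F0 by (simp add: ennreal_le_iff del: ennreal_plus)
      then show ?thesis by simp
    qed
    \<comment> \<open>The sub-Gaussian parameter
      \<open>L * \<sigma> * n powr (1 / q - 1 / 2)\<close>; the powers \<open>n powr (1 / q)\<close>
      cancel and leave \<open>n powr (a - 1 / 2)\<close>.\<close>
    define \<tau> where "\<tau> = \<sigma> * real n powr a / sqrt (real n)"
    have \<tau>: "0 < \<tau>" using \<sigma> n by (simp add: \<tau>_def)
    have \<tau>2: "L\<^sup>2 * \<sigma>\<^sup>2 * real n powr (2 / q - 1) = \<tau>\<^sup>2"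
    proof -
      have "L\<^sup>2 * real n powr (2 / q - 1) = L powr 2 * real n powr (2 / q - 1)" using L by simp
      also have "L powr 2 = real n powr (2 * a - 2 / q)" unfolding L_def powr_powr by (simp add: algebra_simps)
      also have "real n powr (2 * a - 2 / q) * real n powr (2 / q - 1) = real n powr (2 * a - 1)"
        unfolding powr_add[symmetric] by simp
      also have "\<dots> = (real n powr a) powr 2 / real n" using n by (simp add: powr_powr powr_diff mult.commute)
      finally have e: "L\<^sup>2 * real n powr (2 / q - 1) = (real n powr a)\<^sup>2 / real n" using n by simp
      have "L\<^sup>2 * \<sigma>\<^sup>2 * real n powr (2 / q - 1) = \<sigma>\<^sup>2 * (L\<^sup>2 * real n powr (2 / q - 1))" by simp
      also have "\<dots> = \<tau>\<^sup>2" unfolding e \<tau>_def by (simp add: power_divide power_mult_distrib)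
      finally show ?thesis .
    qed
    have Fint: "integrable ?P (F U)" if U: "U \<in> stiefel k d" for U
      by (rule concentration(1)[OF T q \<sigma> n zero_less_one L Flip[OF U]])
    have Fmgf: "(\<integral>\<^sup>+x. ennreal (exp (\<eta> * F U x)) \<partial>?P) \<le> ennreal (exp (\<eta> * (\<integral>x. F U x \<partial>?P) + \<eta>\<^sup>2 * \<tau>\<^sup>2 / 2))"
      if U: "U \<in> stiefel k d" and \<eta>: "0 < \<eta>" for U \<eta>
    proof -
      have e: "\<eta>\<^sup>2 * L\<^sup>2 * \<sigma>\<^sup>2 * real n powr (2 / q - 1) = \<eta>\<^sup>2 * \<tau>\<^sup>2"
        by (simp only: \<tau>2[symmetric] mult.assoc)
      show ?thesis
        unfolding e[symmetric] by (rule concentration(2)[OF T q \<sigma> n \<eta> L Flip[OF U]])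
    qed
    have Fmean: "(\<integral>x. F U x \<partial>?P) \<le> 4 * \<sigma> * R" if U: "U \<in> stiefel k d" for U
    proof -
      have "ennreal (\<integral>x. F U x \<partial>?P) = (\<integral>\<^sup>+x. ennreal (F U x) \<partial>?P)"
        using Fint[OF U] F0 by (intro nn_integral_eq_integral[symmetric]) auto
      also have "\<dots> = (\<integral>\<^sup>+x. W U x \<partial>?P)" using WF[OF U] by (intro nn_integral_cong) simp
      also note mean[OF U]
      finally show ?thesis using \<sigma> R0 by (simp add: ennreal_le_iff)
    qed
    obtain V where V: "V \<subseteq> stiefel k d" "finite V" "real (card V) \<le> exp (5 * (real d * real k * ln (real n)))"
      "\<forall>U\<in>stiefel k d. \<exists>W\<in>V. (\<Sum>i<k. \<Sum>l<d. (U i l - W i l)\<^sup>2) \<le> real k / real n"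
      using stiefel_net[OF k d n2] by blast
    define D where "D = real d * real k * ln (real n)"
    have lnn: "1 / 4 \<le> ln (real n)" "ln (real n) \<le> real n"
    proof -
      have "exp (1 / 4) \<le> (2::real)" using exp_bound[of "1 / 4"] by (simp add: power2_eq_square)
      also have "\<dots> \<le> real n" using n2 by simp
      finally show "1 / 4 \<le> ln (real n)" using n by (simp only: ln_ge_iff of_nat_0_less_iff)
      show "ln (real n) \<le> real n" using ln_bound n by simp
    qed
    have dk: "1 \<le> real d * real k" using d k by (simp add: real_of_nat_ge_one_iff flip: of_nat_mult)
    have \<Lambda>: "1 \<le> 5 * D"
    proof -
      have "1 * (1 / 4) \<le> real d * real k * ln (real n)" using dk lnn by (intro mult_mono) auto
      then show ?thesis unfolding D_def by simp
    qed
    have fourR: "0 \<le> 4 * \<sigma> * R" using \<sigma> R0 by simp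
    obtain B1 where B1: "B1 \<in> borel_measurable ?P" "\<And>x. 0 \<le> B1 x" "\<And>x U. U \<in> V \<Longrightarrow> F U x \<le> B1 x"
      "(\<integral>\<^sup>+x. ennreal (B1 x) \<partial>?P) \<le> ennreal (4 * \<sigma> * R + 3 * \<tau> * sqrt (5 * D))"
    proof -
      have "\<exists>B\<in>borel_measurable ?P. (\<forall>x. 0 \<le> B x) \<and> (\<forall>x. \<forall>v\<in>V. F v x \<le> B x) \<and>
        (\<integral>\<^sup>+x. ennreal (B x) \<partial>?P) \<le> ennreal (4 * \<sigma> * R + 3 * \<tau> * sqrt (5 * D))"
        using V(1,3) by (intro expected_max_bound[OF P.prob_space_axioms V(2) _ _ _ _ \<Lambda> \<tau> fourR] Fint Fmgf Fmean) (auto simp: D_def)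
      then show ?thesis using that by blast
    qed
    \<comment> \<open>Radius of the net. Below, \<open>r\<close> is this radius times the bound on
      the \<open>p\<close>-norm of a centred point, of order
      \<open>\<sigma> * sqrt d\<close>.\<close>
    define e where "e = sqrt (real k / real n)"
    have e: "0 < e" "e\<^sup>2 = real k / real n" using k n by (auto simp: e_def)
    define N where "N y = L2_set (\<lambda>l. y l - m l) {..<d}" for y :: vec
    have N0: "0 \<le> N y" for y by (simp add: N_def)
    define r where "r = e * (4 * \<sigma> * sqrt (real d) * mm)"
    have r: "0 < r" using e \<sigma> d mm by (simp add: r_def)
    define f where "f y = (e * N y) powr p" for y
    have f0: "0 \<le> f y" for y by (simp add: f_def)
    \<comment> \<open>The identity has orthonormal rows, so the moment bound for projections, taken
      with target dimension \<open>d\<close>, covers the whole centred vector.\<close>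
    define Id where "Id i l = (if i = l then 1 else 0 :: real)" for i l :: nat
    have Ids: "Id \<in> stiefel d d"
    proof -
      have "(\<Sum>l<d. Id i l * Id j l) = (if i = j then 1 else 0)" if "i < d" "j < d" for i j
      proof -
        have "(\<Sum>l<d. Id i l * Id j l) = (\<Sum>l<d. if l = i then Id j i else 0)"
          by (intro sum.cong) (auto simp: Id_def)
        also have "\<dots> = (if i = j then 1 else 0)" using that by (simp add: Id_def)
        finally show ?thesis .
      qed
      then show ?thesis by (auto simp: stiefel_def)
    qed
    have NId: "N y = L2_set (aff_proj d d m Id y) {..<d}" for y
    proof -
      have "aff_proj d d m Id y l = y l - m l" if "l < d" for l
      proof -
        have "aff_proj d d m Id y l = (\<Sum>j<d. Id l j * (y j - m j))" using that by (simp add: aff_proj_def)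
        also have "\<dots> = (\<Sum>j<d. if j = l then y l - m l else 0)"
          by (rule sum.cong) (auto simp: Id_def)
        also have "\<dots> = y l - m l" using that by simp
        finally show ?thesis .
      qed
      then show ?thesis unfolding N_def by (intro L2_set_cong) auto
    qed
    have Im: "aff_proj d d m Id \<in> measurable \<mu> (Rd d)"
      unfolding measurable_cong_sets[OF prob_onD(2)[OF \<mu>] refl] by (rule aff_proj_measurable)
    have Nm: "N \<in> borel_measurable \<mu>"
      unfolding NId[abs_def] L2_set_eq_vdist by (rule measurable_vdist[OF Im measurable_const[OF zero_in_Rd]])
    have fm: "f \<in> borel_measurable \<mu>" unfolding f_def by (intro powr_real_measurable borel_measurable_times Nm) auto
    have rp: "r powr p = e powr p * ((4 * \<sigma> * sqrt (real d)) powr p * moment_const p)"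
    proof -
      have "mm powr p = moment_const p" unfolding mm_def using mc p by (simp add: powr_powr)
      then show ?thesis unfolding r_def using e \<sigma> d mm by (simp add: powr_mult)
    qed
    have If: "(\<integral>\<^sup>+y. ennreal (f y) \<partial>\<mu>) \<le> ennreal (r powr p)"
    proof -
      have "(\<integral>\<^sup>+y. ennreal (f y) \<partial>\<mu>) = (\<integral>\<^sup>+y. ennreal (e powr p) * ennreal (N y powr p) \<partial>\<mu>)"
        unfolding f_def using e N0 by (intro nn_integral_cong) (simp add: powr_mult ennreal_mult)
      also have "\<dots> = ennreal (e powr p) * (\<integral>\<^sup>+y. ennreal (N y powr p) \<partial>\<mu>)"
        by (intro nn_integral_cmult measurable_compose[OF _ measurable_ennreal] powr_real_measurable Nm) auto
      also have "\<dots> \<le> ennreal (e powr p) * ennreal ((4 * \<sigma> * sqrt (real d)) powr p * moment_const p)"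
        unfolding NId using \<sigma> by (intro mult_left_mono radial_moment[OF M Im _ p d H[OF d Ids]]) auto
      also have "\<dots> = ennreal (r powr p)" unfolding rp using mc by (simp add: ennreal_mult)
      finally show ?thesis .
    qed
    define A where "A x = (\<Sum>i<n. f (x i)) / real n" for x :: "nat \<Rightarrow> vec"
    have A0: "0 \<le> A x" for x using f0 by (simp add: A_def sum_nonneg)
    have fxm: "(\<lambda>x. f (x i)) \<in> borel_measurable ?P" if "i < n" for i
      using measurable_compose[OF measurable_component_singleton[of i "{..<n}" "\<lambda>_. \<mu>"] fm] that by simp
    have Am: "A \<in> borel_measurable ?P"
      unfolding A_def by (intro borel_measurable_divide borel_measurable_sum fxm borel_measurable_const) auto
    have Ae: "ennreal (A x) = (\<Sum>i<n. ennreal (f (x i))) * ennreal (1 / real n)" for x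
      unfolding A_def using f0 by (simp add: ennreal_mult[symmetric] sum_nonneg)
    have IA: "(\<integral>\<^sup>+x. ennreal (A x) \<partial>?P) \<le> ennreal (r powr p)"
    proof -
      have "(\<integral>\<^sup>+x. ennreal (A x) \<partial>?P) = (\<integral>\<^sup>+y. ennreal (f y) \<partial>\<mu>)"
        unfolding Ae by (rule nn_integral_sample_average[OF M measurable_compose[OF fm measurable_ennreal] n])
      with If show ?thesis by simp
    qed
    define h where "h = r / r powr p"
    have h0: "0 \<le> h" using r by (simp add: h_def)
    \<comment> \<open>The terms are the move from \<open>U\<close> to its net point in the empirical
      measure, linearized so that its mean is at most \<open>2 * r\<close>; the maximum over the
      net; and the same move in the law.\<close>
    define B where "B x = (ennreal r + ennreal h * ennreal (A x)) + (ennreal (B1 x) + ennreal r)" for x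
    have Bm: "B \<in> borel_measurable ?P"
      unfolding B_def using Am B1(1) by measurable
    have BI: "(\<integral>\<^sup>+x. B x \<partial>?P) \<le> ennreal (4 * \<sigma> * (rate c p k n + c * real n powr a * sqrt (D / real n)))"
    proof -
      have "(\<integral>\<^sup>+x. B x \<partial>?P) = (ennreal r + ennreal h * (\<integral>\<^sup>+x. ennreal (A x) \<partial>?P)) + ((\<integral>\<^sup>+x. ennreal (B1 x) \<partial>?P) + ennreal r)"
        unfolding B_def using Am B1(1) by (simp add: nn_integral_add nn_integral_cmult P.emeasure_space_1)
      also have "\<dots> \<le> (ennreal r + ennreal h * ennreal (r powr p)) + (ennreal (4 * \<sigma> * R + 3 * \<tau> * sqrt (5 * D)) + ennreal r)"
        using IA B1(4) by (intro add_mono mult_left_mono order_refl) auto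
      also have "\<dots> = ennreal (3 * r + (4 * \<sigma> * R + 3 * \<tau> * sqrt (5 * D)))"
      proof -
        have "0 \<le> 3 * \<tau> * sqrt (5 * D)" using \<tau> \<Lambda> by simp
        moreover have "h * r powr p = r" using r by (simp add: h_def)
        ultimately show ?thesis using r h0 fourR
          by (simp add: ennreal_mult[symmetric] ennreal_plus[symmetric] del: ennreal_plus)
      qed
      also have "\<dots> \<le> ennreal (4 * \<sigma> * (rate c p k n + c * real n powr a * sqrt (D / real n)))"
      proof (rule ennreal_leI)
        define Q where "Q = real n powr a * sqrt (D / real n)"
        have na: "1 \<le> real n powr a" using n2 by (intro ge_one_powr_ge_zero) (auto simp: a_def)
        have Q0: "0 \<le> Q" unfolding Q_def using \<Lambda> by simp
        have "R \<le> rate c p k n" unfolding R_def using c0 c n2 by (intro rate_mono) auto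
        then have 1: "4 * \<sigma> * R \<le> 4 * \<sigma> * rate c p k n" using \<sigma> by (intro mult_left_mono) auto
        have 2: "3 * \<tau> * sqrt (5 * D) \<le> 8 * \<sigma> * Q"
        proof -
          have "sqrt 5 \<le> 8 / 3" by (intro real_le_lsqrt) (auto simp: power2_eq_square)
          then have "(\<sigma> * Q) * (3 * sqrt 5) \<le> (\<sigma> * Q) * 8" using \<sigma> Q0 by (intro mult_left_mono) auto
          then show ?thesis by (simp add: \<tau>_def Q_def real_sqrt_mult real_sqrt_divide ac_simps)
        qed
        have 3: "3 * r \<le> 24 * \<sigma> * mm * Q"
        proof -
          have "e * sqrt (real d) = sqrt (real d * real k / real n)"
            by (simp add: e_def real_sqrt_mult[symmetric] mult.commute)
          also have "\<dots> \<le> sqrt (4 * (D / real n))"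
          proof (rule real_sqrt_le_mono)
            have "real d * real k * 1 \<le> real d * real k * (4 * ln (real n))" using lnn by (intro mult_left_mono) auto
            then have "real d * real k \<le> 4 * D" by (simp add: D_def)
            then have "real d * real k / real n \<le> 4 * D / real n" by (intro divide_right_mono) auto
            then show "real d * real k / real n \<le> 4 * (D / real n)" by simp
          qed
          also have "\<dots> = 2 * sqrt (D / real n)" by (simp only: real_sqrt_mult real_sqrt_four)
          also have "\<dots> \<le> 2 * Q" unfolding Q_def using mult_right_mono[OF na, of "sqrt (D / real n)"] \<Lambda> by simp
          finally have "e * sqrt (real d) * (12 * \<sigma> * mm) \<le> 2 * Q * (12 * \<sigma> * mm)"
            using \<sigma> mm by (intro mult_right_mono) auto
          then show ?thesis by (simp add: r_def ac_simps)
        qed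
        have "3 * r + (4 * \<sigma> * R + 3 * \<tau> * sqrt (5 * D)) \<le> 4 * \<sigma> * rate c p k n + 4 * \<sigma> * ((2 + 6 * mm) * Q)"
          using 1 2 3 by (simp add: algebra_simps)
        also have "(2 + 6 * mm) * Q \<le> c * Q" using c(3) Q0 by (rule mult_right_mono)
        finally show "3 * r + (4 * \<sigma> * R + 3 * \<tau> * sqrt (5 * D)) \<le> 4 * \<sigma> * (rate c p k n + c * real n powr a * sqrt (D / real n))"
          using \<sigma> by (simp add: Q_def distrib_left mult.assoc mult_left_mono)
      qed
      finally show ?thesis .
    qed
    have WB: "W U x \<le> B x" if U: "U \<in> stiefel k d" and x: "x \<in> space ?P" for U x
    proof -
      obtain U' where U': "U' \<in> V" "(\<Sum>i<k. \<Sum>l<d. (U i l - U' i l)\<^sup>2) \<le> e\<^sup>2"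
        using V(4) U unfolding e(2) by blast
      have U's: "U' \<in> stiefel k d" using U'(1) V(1) by auto
      have pert: "vdist k (Y U y) (Y U' y) powr p \<le> f y" for y
        unfolding f_def N_def Y_def using p e by (intro powr_mono2 vdist_aff_proj_perturb U'(2)) auto
      have t1: "W U x \<le> wasserstein k p (emp U x) (emp U' x) + wasserstein k p (emp U' x) (law U)"
        unfolding W_def by (rule wasserstein_triangle[OF pemp[OF x] pemp[OF x] glue[OF x pemp[OF x]] p])
      have t2: "wasserstein k p (emp U' x) (law U) \<le> W U' x + wasserstein k p (law U') (law U)"
        unfolding W_def by (rule wasserstein_triangle[OF pemp[OF x] plaw glue[OF x plaw] p])
      have t3: "wasserstein k p (emp U x) (emp U' x) \<le> ennreal r + ennreal h * ennreal (A x)"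
      proof -
        let ?a = "(\<Sum>i<n. vdist k (Y U (x i)) (Y U' (x i)) powr p) / real n"
        have a0: "0 \<le> ?a" by (simp add: sum_nonneg)
        have aA: "?a \<le> A x" unfolding A_def by (intro divide_right_mono sum_mono pert) auto
        have "wasserstein k p (emp U x) (emp U' x) \<le> ennreal (?a powr (1 / p))"
          unfolding emp_def by (rule wasserstein_empirical_le[OF n Yx[OF x] Yx[OF x] p])
        also have "?a powr (1 / p) \<le> ((r * (1 + A x / r powr p)) powr p) powr (1 / p)"
          using order_trans[OF aA le_linearized_powr[OF A0 r p]] a0 p by (intro powr_mono2) auto
        also have "\<dots> = r + h * A x"
          using r A0[of x] p by (simp add: powr_powr h_def distrib_left)
        finally show ?thesis using r h0 A0[of x] by (simp add: ennreal_mult ennreal_leI)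
      qed
      have t4: "W U' x \<le> ennreal (B1 x)"
        unfolding WF[OF U's x] by (intro ennreal_leI B1(3) U'(1))
      have t5: "wasserstein k p (law U') (law U) \<le> ennreal r"
        unfolding law_def
      proof (rule wasserstein_joint_law_le[OF Ym Ym])
        have "(\<integral>\<^sup>+y. ennreal (vdist k (Y U' y) (Y U y) powr p) \<partial>\<mu>) \<le> (\<integral>\<^sup>+y. ennreal (f y) \<partial>\<mu>)"
          using pert by (intro nn_integral_mono ennreal_leI) (simp add: vdist_commute)
        then show "(\<integral>\<^sup>+y. ennreal (vdist k (Y U' y) (Y U y) powr p) \<partial>\<mu>) \<le> ennreal (r powr p)"
          using If by (rule order_trans)
      qed (use r p in auto)
      show ?thesis
        unfolding B_def by (rule order_trans[OF t1 add_mono[OF t3 order_trans[OF t2 add_mono[OF t4 t5]]]])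
    qed
    show "\<exists>B\<in>borel_measurable ?P.
      (\<forall>x\<in>space ?P. \<forall>U\<in>stiefel k d. wasserstein k p (proj_law k d U (empirical d n x)) (proj_law k d U \<mu>) \<le> B x) \<and>
      (\<integral>\<^sup>+x. B x \<partial>?P) \<le> ennreal (4 * \<sigma> * (rate c p k n
        + c * real n powr (max (1 / q - 1 / p) 0) * sqrt (real d * real k * ln (real n) / real n)))"
    proof (intro bexI[of _ B] conjI ballI Bm)
      fix x U assume x: "x \<in> space ?P" and U: "U \<in> stiefel k d"
      have "wasserstein k p (proj_law k d U (empirical d n x)) (proj_law k d U \<mu>)
        \<le> wasserstein k p (distr (empirical d n x) (Rd k) (Y U)) (law U)"
        unfolding law_def Y_def by (rule wasserstein_proj_le_aff[OF prob_on_empirical(1)[OF n xs[OF x]] \<mu> p])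
      also have "distr (empirical d n x) (Rd k) (Y U) = emp U x"
        unfolding emp_def by (rule proj_law_empirical[OF n xs[OF x] YR])
      also have "wasserstein k p (emp U x) (law U) \<le> B x" using WB[OF U x] unfolding W_def .
      finally show "wasserstein k p (proj_law k d U (empirical d n x)) (proj_law k d U \<mu>) \<le> B x" .
    qed (use BI in \<open>simp add: a_def D_def\<close>)
  qed
qed

section \<open>The spiked transport model\<close>

text \<open>Gram-Schmidt by induction on the number of vectors. The expansion of \<open>U\<close> in
  \<open>b\<close> belongs to the invariant because linear independence speaks about
  \<open>b\<close> and has to exclude a zero residual; the expansion of \<open>b\<close> in
  \<open>U\<close> yields the reconstruction of spike vectors from their projections.\<close>

lemma gram_schmidt:
  assumes ind: "lin_indep d k b"
  shows "m \<le> k \<Longrightarrow> \<exists>U :: nat \<Rightarrow> nat \<Rightarrow> real. (\<forall>i<m. \<forall>j<m. (\<Sum>l<d. U i l * U j l) = (if i = j then 1 else 0)) \<and>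
    (\<forall>i<m. \<exists>a. \<forall>l<d. U i l = (\<Sum>j<m. a j * b j l)) \<and>
    (\<forall>j<m. \<forall>l<d. b j l = (\<Sum>i<m. (\<Sum>t<d. U i t * b j t) * U i l))"
proof (induction m)
  case (Suc m)
  have "m \<le> k" using Suc.prems by simp
  from Suc.IH[OF this] obtain U :: "nat \<Rightarrow> nat \<Rightarrow> real" where
    orth0: "\<forall>i<m. \<forall>j<m. (\<Sum>l<d. U i l * U j l) = (if i = j then 1 else 0)"
    and comb0: "\<forall>i<m. \<exists>a. \<forall>l<d. U i l = (\<Sum>j<m. a j * b j l)"
    and span0: "\<forall>j<m. \<forall>l<d. b j l = (\<Sum>i<m. (\<Sum>t<d. U i t * b j t) * U i l)"
    by (elim exE conjE) (rule that, assumption+)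
  have orth: "(\<Sum>l<d. U i l * U j l) = (if i = j then 1 else 0)" if "i < m" "j < m" for i j
    using orth0 that by blast
  have comb: "\<exists>a. \<forall>l<d. U i l = (\<Sum>j<m. a j * b j l)" if "i < m" for i using comb0 that by blast
  have span: "b j l = (\<Sum>i<m. (\<Sum>t<d. U i t * b j t) * U i l)" if "j < m" "l < d" for j l
    using span0 that by blast
  from comb obtain a where a: "\<And>i l. i < m \<Longrightarrow> l < d \<Longrightarrow> U i l = (\<Sum>j<m. a i j * b j l)" by metis
  define c where "c i = (\<Sum>t<d. U i t * b m t)" for i
  define v where "v l = b m l - (\<Sum>i<m. c i * U i l)" for l
  define A where "A j = (\<Sum>i<m. c i * a i j)" for j
  have vb: "v l = b m l - (\<Sum>j<m. A j * b j l)" if l: "l < d" for l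
  proof -
    have "(\<Sum>i<m. c i * U i l) = (\<Sum>i<m. \<Sum>j<m. c i * a i j * b j l)"
      by (intro sum.cong refl) (simp add: a l sum_distrib_left mult.assoc)
    also have "\<dots> = (\<Sum>j<m. \<Sum>i<m. c i * a i j * b j l)" by (rule sum.swap)
    also have "\<dots> = (\<Sum>j<m. A j * b j l)" by (simp add: A_def sum_distrib_right)
    finally show ?thesis by (simp add: v_def)
  qed
  have "\<exists>l<d. v l \<noteq> 0"
  proof (rule ccontr)
    assume "\<not> (\<exists>l<d. v l \<noteq> 0)"
    then have v0: "v l = 0" if "l < d" for l using that by blast
    \<comment> \<open>If the residual vanished, these coefficients, with 1 at \<open>m\<close>,
      would be a nontrivial relation among the vectors \<open>b j\<close>.\<close>
    define A' where "A' j = (if j < m then - A j else if j = m then 1 else 0)" for j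
    have "lincomb d k A' b = (\<lambda>i\<in>{..<d}. 0)"
    proof (rule extensionalityI[where A="{..<d}"])
      fix l assume l: "l \<in> {..<d}"
      have "(\<Sum>j<k. A' j * b j l) = (\<Sum>j<Suc m. A' j * b j l)"
        using Suc.prems by (intro sum.mono_neutral_right) (auto simp: A'_def)
      also have "\<dots> = (\<Sum>j<m. - (A j * b j l)) + b m l" by (simp add: A'_def)
      also have "\<dots> = v l" using l by (simp add: vb sum_negf)
      finally show "lincomb d k A' b l = (\<lambda>i\<in>{..<d}. 0) l" using v0 l by (simp add: lincomb_def)
    qed (auto simp: lincomb_def)
    then have "A' m = 0" using ind Suc.prems unfolding lin_indep_def by auto
    then show False by (simp add: A'_def)
  qed
  then obtain l0 where l0: "l0 < d" "v l0 \<noteq> 0" by blast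
  define N where "N = sqrt (\<Sum>l<d. (v l)\<^sup>2)"
  have N2: "N * N = (\<Sum>l<d. (v l)\<^sup>2)" by (simp add: N_def sum_nonneg)
  have Np: "0 < N"
  proof -
    have "0 < (v l0)\<^sup>2" using l0 by simp
    also have "\<dots> \<le> (\<Sum>l<d. (v l)\<^sup>2)" using l0 by (intro member_le_sum) auto
    finally show ?thesis by (simp add: N_def)
  qed
  have Uv: "(\<Sum>l<d. U i l * v l) = 0" if i: "i < m" for i
  proof -
    have "(\<Sum>l<d. U i l * v l) = c i - (\<Sum>l<d. \<Sum>j<m. c j * (U i l * U j l))"
      by (simp add: v_def c_def right_diff_distrib sum_subtractf sum_distrib_left ac_simps)
    also have "(\<Sum>l<d. \<Sum>j<m. c j * (U i l * U j l)) = (\<Sum>j<m. \<Sum>l<d. c j * (U i l * U j l))" by (rule sum.swap)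
    also have "\<dots> = (\<Sum>j<m. c j * (if i = j then 1 else 0))"
      unfolding sum_distrib_left[symmetric] by (intro sum.cong refl) (simp add: orth i)
    also have "\<dots> = c i" using i by (simp add: if_distrib[of "\<lambda>x. _ * x"] cong: if_cong)
    finally show ?thesis by simp
  qed
  have vbm: "(\<Sum>l<d. v l * b m l) = N * N"
  proof -
    have "(\<Sum>l<d. v l * b m l) = (\<Sum>l<d. (v l)\<^sup>2 + (\<Sum>i<m. c i * (U i l * v l)))"
    proof (intro sum.cong refl)
      fix l
      have "b m l = v l + (\<Sum>i<m. c i * U i l)" by (simp add: v_def)
      then show "v l * b m l = (v l)\<^sup>2 + (\<Sum>i<m. c i * (U i l * v l))"
        by (simp add: power2_eq_square distrib_left sum_distrib_left ac_simps)
    qed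
    also have "\<dots> = N * N + (\<Sum>i<m. \<Sum>l<d. c i * (U i l * v l))"
      unfolding sum.distrib N2 by (simp add: sum.swap[of _ "{..<m}"])
    also have "(\<Sum>i<m. \<Sum>l<d. c i * (U i l * v l)) = 0"
      unfolding sum_distrib_left[symmetric] by (intro sum.neutral) (simp add: Uv)
    finally show ?thesis by simp
  qed
  define U' where "U' = U(m := (\<lambda>l. v l / N))"
  have U'm: "U' m l = v l / N" for l by (simp add: U'_def)
  have U'i: "U' i l = U i l" if "i < m" for i l using that by (simp add: U'_def)
  show ?case
  proof (intro exI[of _ U'] conjI allI impI)
    fix i j assume ij: "i < Suc m" "j < Suc m"
    consider "i < m" "j < m" | "i < m" "j = m" | "i = m" "j < m" | "i = m" "j = m" using ij by linarith
    then show "(\<Sum>l<d. U' i l * U' j l) = (if i = j then 1 else 0)"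
    proof cases
      case 1
      then show ?thesis by (simp add: U'i orth)
    next
      case 2
      then show ?thesis by (simp add: U'i U'm Uv sum_divide_distrib[symmetric])
    next
      case 3
      then show ?thesis by (simp add: U'i U'm Uv sum_divide_distrib[symmetric] mult.commute[of "v _"])
    next
      case 4
      have "(\<Sum>l<d. v l / N * (v l / N)) = (\<Sum>l<d. (v l)\<^sup>2) / (N * N)"
        by (simp add: power2_eq_square sum_divide_distrib)
      then show ?thesis using 4 Np by (simp add: U'm N2[symmetric])
    qed
  next
    fix i assume i: "i < Suc m"
    show "\<exists>a. \<forall>l<d. U' i l = (\<Sum>j<Suc m. a j * b j l)"
    proof (cases "i = m")
      case True
      have "U' i l = (\<Sum>j<Suc m. (if j < m then - A j / N else 1 / N) * b j l)" if "l < d" for l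
        using that by (simp add: True U'm vb diff_divide_distrib sum_divide_distrib sum_negf)
      then show ?thesis by (intro exI[of _ "\<lambda>j. if j < m then - A j / N else 1 / N"]) simp
    next
      case False
      then have im: "i < m" using i by simp
      have "U' i l = (\<Sum>j<Suc m. (if j < m then a i j else 0) * b j l)" if "l < d" for l
        using that im by (simp add: U'i a)
      then show ?thesis by (intro exI[of _ "\<lambda>j. if j < m then a i j else 0"]) simp
    qed
  next
    fix j l assume j: "j < Suc m" and l: "l < d"
    have split: "(\<Sum>i<Suc m. (\<Sum>t<d. U' i t * b j t) * U' i l)
      = (\<Sum>i<m. (\<Sum>t<d. U i t * b j t) * U i l) + (\<Sum>t<d. v t * b j t) / N * (v l / N)"
      by (simp add: U'i U'm sum_divide_distrib)
    show "b j l = (\<Sum>i<Suc m. (\<Sum>t<d. U' i t * b j t) * U' i l)"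
    proof (cases "j = m")
      case True
      have "(\<Sum>t<d. v t * b j t) / N * (v l / N) = v l" using Np by (simp add: True vbm)
      moreover have "b m l = (\<Sum>i<m. c i * U i l) + v l" by (simp add: v_def)
      ultimately show ?thesis unfolding split by (simp add: True c_def)
    next
      case False
      then have jm: "j < m" using j by simp
      define e where "e i = (\<Sum>r<d. U i r * b j r)" for i
      have "(\<Sum>t<d. v t * b j t) = (\<Sum>t<d. \<Sum>i<m. e i * (U i t * v t))"
      proof (intro sum.cong refl)
        fix t assume "t \<in> {..<d}"
        then have "b j t = (\<Sum>i<m. e i * U i t)" unfolding e_def using span[OF jm] by blast
        then have "v t * b j t = v t * (\<Sum>i<m. e i * U i t)" by (rule arg_cong)
        then show "v t * b j t = (\<Sum>i<m. e i * (U i t * v t))" by (simp add: sum_distrib_left ac_simps)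
      qed
      also have "\<dots> = (\<Sum>i<m. \<Sum>t<d. e i * (U i t * v t))" by (rule sum.swap)
      also have "\<dots> = 0" unfolding sum_distrib_left[symmetric] by (intro sum.neutral) (simp add: Uv)
      finally have 0: "(\<Sum>t<d. v t * b j t) = 0" .
      show ?thesis unfolding split 0 div_0 mult_zero_left add_0_right by (rule span[OF jm l])
    qed
  qed
qed simp

text \<open>The rows are combinations of the basis, hence lie in \<open>S\<close>, and the expansion
  of the basis vectors extends to \<open>S\<close> by linearity.\<close>

lemma orthonormal_basis:
  assumes "has_dim d k S"
  shows "\<exists>U. U \<in> stiefel k d \<and> (\<forall>i<k. (\<lambda>l\<in>{..<d}. U i l) \<in> S) \<and>
    (\<forall>x\<in>S. \<forall>l<d. x l = (\<Sum>i<k. (\<Sum>t<d. U i t * x t) * U i l))"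
proof -
  obtain b where ind: "lin_indep d k b" and S: "S = {lincomb d k a b | a. True}"
    using assms by (auto simp: has_dim_def)
  obtain U :: "nat \<Rightarrow> nat \<Rightarrow> real" where
    orth: "\<forall>i<k. \<forall>j<k. (\<Sum>l<d. U i l * U j l) = (if i = j then 1 else 0)"
    and comb: "\<forall>i<k. \<exists>a. \<forall>l<d. U i l = (\<Sum>j<k. a j * b j l)"
    and span: "\<forall>j<k. \<forall>l<d. b j l = (\<Sum>i<k. (\<Sum>t<d. U i t * b j t) * U i l)"
    using gram_schmidt[OF ind order_refl] by (elim exE conjE) (rule that, assumption+)
  show ?thesis
  proof (intro exI[of _ U] conjI allI impI ballI)
    show "U \<in> stiefel k d" using orth by (simp add: stiefel_def)
  next
    fix i assume "i < k"
    then obtain a where "\<forall>l<d. U i l = (\<Sum>j<k. a j * b j l)" using comb by blast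
    then have "(\<lambda>l\<in>{..<d}. U i l) = lincomb d k a b" by (auto simp: lincomb_def restrict_def fun_eq_iff)
    then show "(\<lambda>l\<in>{..<d}. U i l) \<in> S" unfolding S by blast
  next
    fix x l assume "x \<in> S" and l: "l < d"
    then obtain a where x: "x = lincomb d k a b" unfolding S by blast
    have xt: "x t = (\<Sum>j<k. a j * b j t)" if "t < d" for t using that by (simp add: x lincomb_def)
    have ip: "(\<Sum>t<d. U i t * x t) = (\<Sum>j<k. a j * (\<Sum>t<d. U i t * b j t))" for i
    proof -
      have "(\<Sum>t<d. U i t * x t) = (\<Sum>t<d. \<Sum>j<k. a j * (U i t * b j t))"
        by (intro sum.cong refl) (simp add: xt sum_distrib_left ac_simps)
      also have "\<dots> = (\<Sum>j<k. \<Sum>t<d. a j * (U i t * b j t))" by (rule sum.swap)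
      finally show ?thesis by (simp add: sum_distrib_left)
    qed
    define g where "g i j = (\<Sum>t<d. U i t * b j t)" for i j
    have bg: "b j l = (\<Sum>i<k. g i j * U i l)" if "j < k" for j using span that l unfolding g_def by blast
    have "x l = (\<Sum>j<k. a j * (\<Sum>i<k. g i j * U i l))"
      unfolding xt[OF l] by (intro sum.cong refl arg_cong2[where f="(*)"] bg) simp
    also have "\<dots> = (\<Sum>j<k. \<Sum>i<k. a j * g i j * U i l)"
      by (simp add: sum_distrib_left mult.assoc)
    also have "\<dots> = (\<Sum>i<k. \<Sum>j<k. a j * g i j * U i l)" by (rule sum.swap)
    also have "\<dots> = (\<Sum>i<k. (\<Sum>t<d. U i t * x t) * U i l)"
      unfolding ip g_def[symmetric] by (simp add: sum_distrib_right)
    finally show "x l = (\<Sum>i<k. (\<Sum>t<d. U i t * x t) * U i l)" .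
  qed
qed

section \<open>Lifting couplings of the projections\<close>

text \<open>Rebuilds a point from its spike coordinates \<open>a\<close> and its noise
  \<open>z\<close>: the transpose of \<open>U\<close> applied to \<open>a\<close>, plus
  \<open>z\<close>.\<close>

definition embed :: "nat \<Rightarrow> nat \<Rightarrow> (nat \<Rightarrow> nat \<Rightarrow> real) \<Rightarrow> vec \<Rightarrow> vec \<Rightarrow> vec" where
  "embed k d U a z = (\<lambda>l\<in>{..<d}. (\<Sum>i<k. a i * U i l) + z l)"

lemma embed_measurable:
  assumes f: "f \<in> measurable M (Rd k)" and g: "g \<in> measurable M (Rd d)"
  shows "(\<lambda>w. embed k d U (f w) (g w)) \<in> measurable M (Rd d)"
proof (rule measurable_RdI)
  fix l assume l: "l < d"
  have fi: "(\<lambda>w. f w i) \<in> borel_measurable M" if "i \<in> {..<k}" for i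
    by (rule measurable_Rd_coord[OF f]) (use that in simp)
  have "(\<lambda>w. (\<Sum>i<k. f w i * U i l) + g w l) \<in> borel_measurable M"
    by (intro borel_measurable_add borel_measurable_sum borel_measurable_times fi borel_measurable_const measurable_Rd_coord[OF g l])
  then show "(\<lambda>w. embed k d U (f w) (g w) l) \<in> borel_measurable M" using l by (simp add: embed_def)
qed (simp add: embed_def)

text \<open>The common noise cancels and the transpose of \<open>U\<close> is isometric, so lifting
  a coupling preserves its cost.\<close>

lemma vdist_embed:
  assumes "U \<in> stiefel k d"
  shows "vdist d (embed k d U a z) (embed k d U b z) = vdist k a b"
proof -
  have "(\<Sum>l<d. (embed k d U a z l - embed k d U b z l)\<^sup>2) = (\<Sum>l<d. (\<Sum>i<k. (a i - b i) * U i l)\<^sup>2)"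
    by (intro sum.cong refl) (simp add: embed_def sum_subtractf[symmetric] left_diff_distrib)
  also have "\<dots> = (\<Sum>i<k. (a i - b i)\<^sup>2)" by (rule stiefel_isometry[OF assms])
  finally show ?thesis by (simp add: vdist_def L2_set_def)
qed

definition lin_proj :: "nat \<Rightarrow> nat \<Rightarrow> (nat \<Rightarrow> nat \<Rightarrow> real) \<Rightarrow> vec \<Rightarrow> vec" where
  "lin_proj k d U y = (\<lambda>i\<in>{..<k}. \<Sum>l<d. U i l * y l)"

lemma lin_proj_eq_aff: "lin_proj k d U = aff_proj k d (\<lambda>_. 0) U"
  by (auto simp: lin_proj_def aff_proj_def fun_eq_iff)

lemma lin_proj_measurable: "lin_proj k d U \<in> measurable (Rd d) (Rd k)"
  unfolding lin_proj_eq_aff by (rule aff_proj_measurable)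

lemma proj_law_eq: "proj_law k d U \<mu> = distr \<mu> (Rd k) (lin_proj k d U)"
proof -
  have "lin_proj k d U = (\<lambda>y. \<lambda>i\<in>{..<k}. \<Sum>l<d. U i l * y l)" by (rule ext) (simp add: lin_proj_def)
  then show ?thesis by (simp add: proj_law_def)
qed

lemma (in prob_space) indep_set_mono:
  assumes "indep_set A B" "A' \<subseteq> A" "B' \<subseteq> B"
  shows "indep_set A' B'"
  using assms(1) unfolding indep_set_def
  by (rule indep_sets_mono_sets) (use assms(2,3) in \<open>auto split: bool.split\<close>)

text \<open>Independence of the noise enters here: the law of \<open>X + Z\<close> is rebuilt from the law of the projection of \<open>X\<close>
  and an independent copy of \<open>Z\<close>.\<close>

lemma embed_law:
  assumes \<Omega>: "prob_space \<Omega>" and X: "X \<in> measurable \<Omega> (Rd d)" and X': "X' \<in> measurable \<Omega> N" and Z: "Z \<in> measurable \<Omega> (Rd d)"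
    and U: "\<And>\<omega> l. \<omega> \<in> space \<Omega> \<Longrightarrow> l < d \<Longrightarrow> X \<omega> l = (\<Sum>i<k. (\<Sum>t<d. U i t * X \<omega> t) * U i l)"
    and UZ: "\<And>\<omega> i. \<omega> \<in> space \<Omega> \<Longrightarrow> i < k \<Longrightarrow> (\<Sum>l<d. U i l * Z \<omega> l) = 0"
    and h: "h \<in> measurable N (Rd d)" and hX: "\<And>\<omega>. \<omega> \<in> space \<Omega> \<Longrightarrow> h (X' \<omega>) = X \<omega>"
    and ind: "prob_space.indep_set \<Omega> (sets (vimage_algebra (space \<Omega>) X' N)) (sets (vimage_algebra (space \<Omega>) Z (Rd d)))"
    and \<pi>: "sigma_finite_measure \<pi>" and f: "f \<in> measurable \<pi> (Rd k)"
    and \<pi>f: "distr \<pi> (Rd k) f = proj_law k d U (distr \<Omega> (Rd d) (\<lambda>\<omega>. \<lambda>i\<in>{..<d}. X \<omega> i + Z \<omega> i))"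
  shows "distr (\<pi> \<Otimes>\<^sub>M distr \<Omega> (Rd d) Z) (Rd d) (\<lambda>w. embed k d U (f (fst w)) (snd w))
    = distr \<Omega> (Rd d) (\<lambda>\<omega>. \<lambda>i\<in>{..<d}. X \<omega> i + Z \<omega> i)"
proof -
  interpret \<Omega>: prob_space \<Omega> by fact
  let ?\<zeta> = "distr \<Omega> (Rd d) Z"
  interpret \<zeta>: prob_space ?\<zeta> by (rule \<Omega>.prob_space_distr[OF Z])
  let ?XZ = "\<lambda>\<omega>. \<lambda>i\<in>{..<d}. X \<omega> i + Z \<omega> i"
  have XZ: "?XZ \<in> measurable \<Omega> (Rd d)"
  proof (rule measurable_RdI)
    fix i assume i: "i < d"
    have "(\<lambda>\<omega>. X \<omega> i + Z \<omega> i) \<in> borel_measurable \<Omega>"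
      by (intro borel_measurable_add measurable_Rd_coord[OF X i] measurable_Rd_coord[OF Z i])
    then show "(\<lambda>\<omega>. ?XZ \<omega> i) \<in> borel_measurable \<Omega>" using i by simp
  qed simp
  define Q where "Q \<omega> = lin_proj k d U (X \<omega>)" for \<omega>
  have Q: "Q \<in> measurable \<Omega> (Rd k)" unfolding Q_def by (rule measurable_compose[OF X lin_proj_measurable])
  \<comment> \<open>The noise is orthogonal to the rows of \<open>U\<close>, so the noisy vector and
    \<open>X\<close> have the same projection.\<close>
  have QXZ: "lin_proj k d U (?XZ \<omega>) = Q \<omega>" if "\<omega> \<in> space \<Omega>" for \<omega>
    using UZ[OF that] unfolding Q_def lin_proj_def by (auto simp: fun_eq_iff restrict_def distrib_left sum.distrib)
  have lawQ: "distr \<pi> (Rd k) f = distr \<Omega> (Rd k) Q"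
    unfolding \<pi>f proj_law_eq
    by (subst distr_distr[OF lin_proj_measurable XZ]) (auto intro!: distr_cong simp: QXZ)
  \<comment> \<open>\<open>Q\<close> is a measurable function of \<open>X'\<close>, here applied to
    the pair of spike variables, so each projected component inherits independence from the
    noise.\<close>
  have "\<Omega>.indep_set (sigma_sets (space \<Omega>) {Q -` A \<inter> space \<Omega> | A. A \<in> sets (Rd k)})
    (sigma_sets (space \<Omega>) {Z -` A \<inter> space \<Omega> | A. A \<in> sets (Rd d)})"
  proof (rule \<Omega>.indep_set_mono[OF ind])
    show "sigma_sets (space \<Omega>) {Q -` A \<inter> space \<Omega> | A. A \<in> sets (Rd k)} \<subseteq> sets (vimage_algebra (space \<Omega>) X' N)"
    proof -
      have "{Q -` A \<inter> space \<Omega> | A. A \<in> sets (Rd k)} \<subseteq> sets (vimage_algebra (space \<Omega>) X' N)"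
      proof clarify
        fix A assume A: "A \<in> sets (Rd k)"
        have m: "(\<lambda>y. lin_proj k d U (h y)) \<in> measurable N (Rd k)"
          by (rule measurable_compose[OF h lin_proj_measurable])
        have "Q -` A \<inter> space \<Omega> = X' -` ((\<lambda>y. lin_proj k d U (h y)) -` A \<inter> space N) \<inter> space \<Omega>"
          using measurable_space[OF X'] by (auto simp: Q_def hX)
        also have "\<dots> \<in> sets (vimage_algebra (space \<Omega>) X' N)"
          by (intro in_vimage_algebra measurable_sets[OF m A])
        finally show "Q -` A \<inter> space \<Omega> \<in> sets (vimage_algebra (space \<Omega>) X' N)" .
      qed
      from sets.sigma_sets_subset[OF this] show ?thesis by simp
    qed
    show "sigma_sets (space \<Omega>) {Z -` A \<inter> space \<Omega> | A. A \<in> sets (Rd d)} \<subseteq> sets (vimage_algebra (space \<Omega>) Z (Rd d))"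
      by (simp add: sets_vimage_algebra)
  qed
  then have "\<Omega>.indep_var (Rd k) Q (Rd d) Z" unfolding \<Omega>.indep_var_eq using Q Z by simp
  then have prod: "distr \<Omega> (Rd k) Q \<Otimes>\<^sub>M ?\<zeta> = distr \<Omega> (Rd k \<Otimes>\<^sub>M Rd d) (\<lambda>\<omega>. (Q \<omega>, Z \<omega>))"
    unfolding \<Omega>.indep_var_distribution_eq by simp
  have idz: "(\<lambda>z. z) \<in> measurable ?\<zeta> (Rd d)" by (simp add: measurable_ident_sets)
  have sfz: "sigma_finite_measure (distr ?\<zeta> (Rd d) (\<lambda>z. z))"
    using prob_space_imp_sigma_finite[OF \<zeta>.prob_space_distr[OF idz]] .
  have idd: "distr ?\<zeta> (Rd d) (\<lambda>z. z) = ?\<zeta>" by (rule distr_id2) simp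
  have joint: "distr (\<pi> \<Otimes>\<^sub>M ?\<zeta>) (Rd k \<Otimes>\<^sub>M Rd d) (\<lambda>(x, y). (f x, y)) = distr \<Omega> (Rd k \<Otimes>\<^sub>M Rd d) (\<lambda>\<omega>. (Q \<omega>, Z \<omega>))"
    using pair_measure_distr[OF f idz sfz] unfolding idd lawQ prod by simp
  have em: "(\<lambda>w. embed k d U (fst w) (snd w)) \<in> measurable (Rd k \<Otimes>\<^sub>M Rd d) (Rd d)"
    by (rule embed_measurable[OF measurable_fst measurable_snd])
  have fm: "(\<lambda>(x, y). (f x, y)) \<in> measurable (\<pi> \<Otimes>\<^sub>M ?\<zeta>) (Rd k \<Otimes>\<^sub>M Rd d)"
  proof -
    have "(\<lambda>w. (f (fst w), snd w)) \<in> measurable (\<pi> \<Otimes>\<^sub>M ?\<zeta>) (Rd k \<Otimes>\<^sub>M Rd d)"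
      by (intro measurable_Pair measurable_compose[OF measurable_fst f] measurable_compose[OF measurable_snd idz])
    then show ?thesis by (simp add: split_beta')
  qed
  have "distr (\<pi> \<Otimes>\<^sub>M ?\<zeta>) (Rd d) (\<lambda>w. embed k d U (f (fst w)) (snd w))
    = distr (distr (\<pi> \<Otimes>\<^sub>M ?\<zeta>) (Rd k \<Otimes>\<^sub>M Rd d) (\<lambda>(x, y). (f x, y))) (Rd d) (\<lambda>w. embed k d U (fst w) (snd w))"
    by (subst distr_distr[OF em fm]) (simp add: comp_def split_beta')
  also have "\<dots> = distr \<Omega> (Rd d) (\<lambda>\<omega>. embed k d U (Q \<omega>) (Z \<omega>))"
    unfolding joint by (subst distr_distr[OF em measurable_Pair[OF Q Z]]) (simp add: comp_def)
  also have "\<dots> = distr \<Omega> (Rd d) ?XZ"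
  proof (rule distr_cong[OF refl refl])
    fix \<omega> assume \<omega>: "\<omega> \<in> space \<Omega>"
    have "(\<Sum>i<k. Q \<omega> i * U i l) = X \<omega> l" if "l < d" for l
      unfolding U[OF \<omega> that] by (intro sum.cong) (auto simp: Q_def lin_proj_def)
    then show "embed k d U (Q \<omega>) (Z \<omega>) = ?XZ \<omega>" by (auto simp: embed_def fun_eq_iff restrict_def)
  qed
  finally show ?thesis .
qed

lemma spiked_wasserstein_le:
  assumes spiked: "spiked_by d S \<mu>1 \<mu>2" and dim: "has_dim d k S" and p: "1 \<le> p"
  shows "\<exists>U\<in>stiefel k d. wasserstein d p \<mu>1 \<mu>2 \<le> wasserstein k p (proj_law k d U \<mu>1) (proj_law k d U \<mu>2)"
proof -
  obtain U where U0: "U \<in> stiefel k d" "\<forall>i<k. (\<lambda>l\<in>{..<d}. U i l) \<in> S"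
    "\<forall>x\<in>S. \<forall>l<d. x l = (\<Sum>i<k. (\<Sum>t<d. U i t * x t) * U i l)"
    using orthonormal_basis[OF dim] by (elim exE conjE) (rule that, assumption+)
  have U: "U \<in> stiefel k d" "\<And>i. i < k \<Longrightarrow> (\<lambda>l\<in>{..<d}. U i l) \<in> S"
    "\<And>x l. x \<in> S \<Longrightarrow> l < d \<Longrightarrow> x l = (\<Sum>i<k. (\<Sum>t<d. U i t * x t) * U i l)"
    using U0 by blast+
  obtain \<Omega> :: "(nat \<Rightarrow> real) measure" and X1 X2 Z where \<Omega>: "prob_space \<Omega>"
    and X: "X1 \<in> measurable \<Omega> (Rd d)" "X2 \<in> measurable \<Omega> (Rd d)" and Z: "Z \<in> measurable \<Omega> (Rd d)"
    and val: "\<forall>\<omega>\<in>space \<Omega>. X1 \<omega> \<in> S \<and> X2 \<omega> \<in> S \<and> Z \<omega> \<in> orth_compl d S"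
    and ind: "prob_space.indep_set \<Omega>
          (sets (vimage_algebra (space \<Omega>) (\<lambda>\<omega>. (X1 \<omega>, X2 \<omega>)) (Rd d \<Otimes>\<^sub>M Rd d)))
          (sets (vimage_algebra (space \<Omega>) Z (Rd d)))"
    and \<mu>1: "\<mu>1 = distr \<Omega> (Rd d) (\<lambda>\<omega>. \<lambda>i\<in>{..<d}. X1 \<omega> i + Z \<omega> i)"
    and \<mu>2: "\<mu>2 = distr \<Omega> (Rd d) (\<lambda>\<omega>. \<lambda>i\<in>{..<d}. X2 \<omega> i + Z \<omega> i)"
    using spiked unfolding spiked_by_def by blast
  interpret \<Omega>: prob_space \<Omega> by fact
  let ?\<zeta> = "distr \<Omega> (Rd d) Z"
  interpret \<zeta>: prob_space ?\<zeta> by (rule \<Omega>.prob_space_distr[OF Z])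
  have UZ: "(\<Sum>l<d. U i l * Z \<omega> l) = 0" if "\<omega> \<in> space \<Omega>" "i < k" for \<omega> i
    using val that U(2)[OF that(2)] by (force simp: orth_compl_def)
  have exp1: "X1 \<omega> l = (\<Sum>i<k. (\<Sum>t<d. U i t * X1 \<omega> t) * U i l)" if "\<omega> \<in> space \<Omega>" "l < d" for \<omega> l
    by (rule U(3)) (use val that in auto)
  have exp2: "X2 \<omega> l = (\<Sum>i<k. (\<Sum>t<d. U i t * X2 \<omega> t) * U i l)" if "\<omega> \<in> space \<Omega>" "l < d" for \<omega> l
    by (rule U(3)) (use val that in auto)
  have XX: "(\<lambda>\<omega>. (X1 \<omega>, X2 \<omega>)) \<in> measurable \<Omega> (Rd d \<Otimes>\<^sub>M Rd d)" using X by (rule measurable_Pair)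
  have XZm: "(\<lambda>\<omega>. \<lambda>i\<in>{..<d}. X \<omega> i + Z \<omega> i) \<in> measurable \<Omega> (Rd d)" if X: "X \<in> measurable \<Omega> (Rd d)" for X
  proof (rule measurable_RdI)
    fix i assume i: "i < d"
    have "(\<lambda>\<omega>. X \<omega> i + Z \<omega> i) \<in> borel_measurable \<Omega>"
      by (intro borel_measurable_add measurable_Rd_coord[OF X i] measurable_Rd_coord[OF Z i])
    then show "(\<lambda>\<omega>. (\<lambda>i\<in>{..<d}. X \<omega> i + Z \<omega> i) i) \<in> borel_measurable \<Omega>" using i by simp
  qed simp
  have \<mu>1p: "prob_on d \<mu>1" unfolding \<mu>1 by (rule prob_on_distr[OF \<Omega> XZm[OF X(1)]])
  have pp: "prob_on k (proj_law k d U \<mu>1)"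
    unfolding proj_law_eq
    by (rule prob_on_distr[OF prob_onD(1)[OF \<mu>1p]])
      (simp add: measurable_cong_sets[OF prob_onD(2)[OF \<mu>1p] refl] lin_proj_measurable)
  have "wasserstein d p \<mu>1 \<mu>2 \<le> wasserstein k p (proj_law k d U \<mu>1) (proj_law k d U \<mu>2)"
  proof (rule wasserstein_mono_of_couplings[OF _ p])
    fix \<pi> assume \<pi>: "\<pi> \<in> couplings k (proj_law k d U \<mu>1) (proj_law k d U \<mu>2)"
    interpret \<pi>: prob_space \<pi> by (rule coupling_prob_space[OF \<pi> pp])
    interpret \<pi>\<zeta>: pair_prob_space \<pi> ?\<zeta> ..
    \<comment> \<open>Both components use the same noise coordinate \<open>snd w\<close>, which is
      independent of the coupling of the projections; each component separately has the right law by
      \<open>embed_law\<close>.\<close>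
    let ?e = "\<lambda>f w. embed k d U (f (fst w)) (snd w)"
    have l1: "distr (\<pi> \<Otimes>\<^sub>M ?\<zeta>) (Rd d) (?e fst) = \<mu>1"
      unfolding \<mu>1
      by (rule embed_law[OF \<Omega> X(1) XX Z exp1 UZ measurable_fst _ ind \<pi>.sigma_finite_measure_axioms couplingsD(5)[OF \<pi>]])
        (auto simp: couplingsD(2)[OF \<pi>] \<mu>1)
    have l2: "distr (\<pi> \<Otimes>\<^sub>M ?\<zeta>) (Rd d) (?e snd) = \<mu>2"
      unfolding \<mu>2
      by (rule embed_law[OF \<Omega> X(2) XX Z exp2 UZ measurable_snd _ ind \<pi>.sigma_finite_measure_axioms couplingsD(6)[OF \<pi>]])
        (auto simp: couplingsD(3)[OF \<pi>] \<mu>2)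
    have z: "snd \<in> measurable (\<pi> \<Otimes>\<^sub>M ?\<zeta>) (Rd d)"
      using measurable_snd[of \<pi> ?\<zeta>] unfolding measurable_cong_sets[OF refl sets_distr] .
    have e1: "?e fst \<in> measurable (\<pi> \<Otimes>\<^sub>M ?\<zeta>) (Rd d)" and e2: "?e snd \<in> measurable (\<pi> \<Otimes>\<^sub>M ?\<zeta>) (Rd d)"
      by (intro embed_measurable measurable_compose[OF measurable_fst couplingsD(5)[OF \<pi>]] z,
          intro embed_measurable measurable_compose[OF measurable_fst couplingsD(6)[OF \<pi>]] z)
    let ?\<Xi> = "distr (\<pi> \<Otimes>\<^sub>M ?\<zeta>) (Rd d \<Otimes>\<^sub>M Rd d) (\<lambda>w. (?e fst w, ?e snd w))"
    have \<Xi>: "?\<Xi> \<in> couplings d \<mu>1 \<mu>2" using joint_law_coupling[OF e1 e2] unfolding l1 l2 .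
    have cost: "tcost d p ?\<Xi> = tcost k p \<pi>"
    proof -
      have vm: "(\<lambda>z. ennreal (vdist k (fst z) (snd z) powr p)) \<in> borel_measurable \<pi>"
        by (intro measurable_compose[OF _ measurable_ennreal] powr_real_measurable
            measurable_vdist[OF couplingsD(5)[OF \<pi>] couplingsD(6)[OF \<pi>]]) auto
      have "tcost d p ?\<Xi> = (\<integral>\<^sup>+w. ennreal (vdist k (fst (fst w)) (snd (fst w)) powr p) \<partial>(\<pi> \<Otimes>\<^sub>M ?\<zeta>))"
        unfolding tcost_joint_law[OF e1 e2] by (simp add: vdist_embed[OF U(1)])
      also have "\<dots> = (\<integral>\<^sup>+z. \<integral>\<^sup>+y. ennreal (vdist k (fst z) (snd z) powr p) \<partial>?\<zeta> \<partial>\<pi>)"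
        using \<zeta>.nn_integral_fst[OF measurable_compose[OF measurable_fst vm]] by simp
      also have "\<dots> = tcost k p \<pi>" unfolding tcost_def nn_integral_const \<zeta>.emeasure_space_1 by simp
      finally show ?thesis .
    qed
    show "\<exists>\<pi>'\<in>couplings d \<mu>1 \<mu>2. tcost d p \<pi>' \<le> tcost k p \<pi>"
      by (rule bexI[OF _ \<Xi>]) (simp only: cost order_refl)
  qed
  then show ?thesis using U(1) by blast
qed

lemma wasserstein_proj_le:
  assumes U: "U \<in> stiefel k d" and s: "sets \<mu> = sets (Rd d)" "sets \<nu> = sets (Rd d)" and p: "1 \<le> p"
  shows "wasserstein k p (proj_law k d U \<mu>) (proj_law k d U \<nu>) \<le> wasserstein d p \<mu> \<nu>"
  unfolding proj_law_eq
  by (rule wasserstein_contraction[OF lin_proj_measurable s _ p]) (simp add: lin_proj_eq_aff vdist_aff_proj_le[OF U])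

lemma wasserstein_same:
  assumes \<mu>: "prob_on d \<mu>" and p: "1 \<le> p"
  shows "wasserstein d p \<mu> \<mu> = 0"
proof -
  have id: "(\<lambda>x. x) \<in> measurable \<mu> (Rd d)"
    using prob_onD(2)[OF \<mu>] by (simp add: measurable_ident_sets)
  have "wasserstein d p (distr \<mu> (Rd d) (\<lambda>x. x)) (distr \<mu> (Rd d) (\<lambda>x. x)) \<le> ennreal 0"
    by (rule wasserstein_joint_law_le[OF id id]) (use p in auto)
  moreover have "distr \<mu> (Rd d) (\<lambda>x. x) = \<mu>" by (rule distr_id2) (simp add: prob_onD[OF \<mu>])
  ultimately show ?thesis by simp
qed

text \<open>The target is a one-point space, so all projected laws coincide. This settles
  \<open>k = 0\<close>, which the moment bounds exclude.\<close>

lemma proj_law_dim_zero: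
  assumes "prob_space \<mu>"
  shows "proj_law 0 d U \<mu> = return (Rd 0) (\<lambda>_. undefined)"
proof -
  interpret prob_space \<mu> by fact
  have "lin_proj 0 d U = (\<lambda>_ _. undefined)" by (auto simp: lin_proj_def fun_eq_iff)
  then show ?thesis unfolding proj_law_eq by (simp add: distr_const space_Rd)
qed

text \<open>\<open>ennreal_dist\<close> is infinite even between two infinite arguments, so
  finiteness of \<open>a\<close> is asked for; \<open>b\<close> is then finite unless
  \<open>c\<close> is infinite.\<close>

lemma ennreal_dist_le:
  assumes "a < \<top>" "a \<le> b + c" "b \<le> a + c"
  shows "ennreal_dist a b \<le> c"
proof (cases "c = \<top>")
  case False
  then obtain r where r: "c = ennreal r" "0 \<le> r" by (cases c) auto
  obtain s where s: "a = ennreal s" "0 \<le> s" using assms(1) by (cases a) auto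
  have "b < \<top>" using assms(3) r s by (simp add: le_less_trans less_top)
  then obtain t where t: "b = ennreal t" "0 \<le> t" by (cases b) auto
  have "s \<le> t + r" using assms(2) r s t by (simp add: ennreal_plus[symmetric] ennreal_le_iff del: ennreal_plus)
  moreover have "t \<le> s + r" using assms(3) r s t by (simp add: ennreal_plus[symmetric] ennreal_le_iff del: ennreal_plus)
  ultimately have "\<bar>s - t\<bar> \<le> r" by linarith
  moreover have "ennreal_dist a b = ennreal \<bar>s - t\<bar>"
    using s t by (simp add: ennreal_dist_def ennreal.rep_eq e2ennreal_ereal)
  ultimately show ?thesis using r by (simp add: ennreal_leI)
qed simp

text \<open>Transfers expectations from the sample space to the product measure, where concentration
  was proved.\<close>

lemma iid_samples_law:
  assumes \<Omega>: "prob_space \<Omega>" and iid: "iid_samples d n \<mu> \<Omega> X" and n: "0 < n"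
  shows "(\<lambda>\<omega>. \<lambda>i\<in>{..<n}. X i \<omega>) \<in> measurable \<Omega> (Pi\<^sub>M {..<n} (\<lambda>_. \<mu>))"
    "distr \<Omega> (Pi\<^sub>M {..<n} (\<lambda>_. \<mu>)) (\<lambda>\<omega>. \<lambda>i\<in>{..<n}. X i \<omega>) = Pi\<^sub>M {..<n} (\<lambda>_. \<mu>)"
    "\<And>i. i < n \<Longrightarrow> X i \<in> measurable \<Omega> (Rd d)"
proof -
  interpret \<Omega>: prob_space \<Omega> by fact
  have ind: "\<Omega>.indep_vars (\<lambda>_. Rd d) X {..<n}" and law: "\<And>i. i < n \<Longrightarrow> distr \<Omega> (Rd d) (X i) = \<mu>"
    using iid by (auto simp: iid_samples_def)
  show rv: "X i \<in> measurable \<Omega> (Rd d)" if "i < n" for i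
    using ind that by (auto simp: \<Omega>.indep_vars_def)
  have s: "sets \<mu> = sets (Rd d)" using law[OF n] by (metis sets_distr)
  have sP: "sets (Pi\<^sub>M {..<n} (\<lambda>_. \<mu>)) = sets (Pi\<^sub>M {..<n} (\<lambda>_. Rd d))"
    by (rule sets_PiM_cong) (use s in auto)
  have m: "(\<lambda>\<omega>. \<lambda>i\<in>{..<n}. X i \<omega>) \<in> measurable \<Omega> (Pi\<^sub>M {..<n} (\<lambda>_. Rd d))"
    by (rule measurable_restrict) (use rv in auto)
  then show "(\<lambda>\<omega>. \<lambda>i\<in>{..<n}. X i \<omega>) \<in> measurable \<Omega> (Pi\<^sub>M {..<n} (\<lambda>_. \<mu>))"
    unfolding measurable_cong_sets[OF refl sP] .
  have "distr \<Omega> (Pi\<^sub>M {..<n} (\<lambda>_. \<mu>)) (\<lambda>\<omega>. \<lambda>i\<in>{..<n}. X i \<omega>) = distr \<Omega> (Pi\<^sub>M {..<n} (\<lambda>_. Rd d)) (\<lambda>\<omega>. \<lambda>i\<in>{..<n}. X i \<omega>)"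
    by (rule distr_cong[OF refl sP]) simp
  also have "\<dots> = Pi\<^sub>M {..<n} (\<lambda>i. distr \<Omega> (Rd d) (X i))"
    using ind n rv by (subst (asm) \<Omega>.indep_vars_iff_distr_eq_PiM') auto
  also have "\<dots> = Pi\<^sub>M {..<n} (\<lambda>_. \<mu>)" by (rule PiM_cong) (use law in auto)
  finally show "distr \<Omega> (Pi\<^sub>M {..<n} (\<lambda>_. \<mu>)) (\<lambda>\<omega>. \<lambda>i\<in>{..<n}. X i \<omega>) = Pi\<^sub>M {..<n} (\<lambda>_. \<mu>)" .
qed

text \<open>A statement about two fixed samples, so that the expectation later splits into one
  integral per sample. One direction uses the deviation bounds for all projections, the other only
  for the projection to the spike.\<close>

lemma proj_wasserstein_deviation:
  assumes spiked: "spiked_transport_model d k \<mu>1 \<mu>2" and p: "1 \<le> p" and n: "0 < n"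
    and \<mu>: "prob_on d \<mu>1" "prob_on d \<mu>2"
    and x: "\<And>i. i < n \<Longrightarrow> x i \<in> space (Rd d)" and y: "\<And>i. i < n \<Longrightarrow> y i \<in> space (Rd d)"
    and b1: "\<And>U. U \<in> stiefel k d \<Longrightarrow> wasserstein k p (proj_law k d U (empirical d n x)) (proj_law k d U \<mu>1) \<le> \<beta>1"
    and b2: "\<And>U. U \<in> stiefel k d \<Longrightarrow> wasserstein k p (proj_law k d U (empirical d n y)) (proj_law k d U \<mu>2) \<le> \<beta>2"
  shows "ennreal_dist (proj_wasserstein k d p (empirical d n x) (empirical d n y)) (wasserstein d p \<mu>1 \<mu>2) \<le> \<beta>1 + \<beta>2"
proof -
  let ?e1 = "empirical d n x" and ?e2 = "empirical d n y"
  let ?W = "wasserstein k p" and ?L = "proj_law k d"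
  have e: "prob_on d ?e1" "prob_on d ?e2" using prob_on_empirical(1)[OF n] x y by auto
  have pl: "prob_on k (?L U \<nu>)" if "prob_on d \<nu>" for U \<nu>
    unfolding proj_law_eq
    by (rule prob_on_distr[OF prob_onD(1)[OF that]])
      (simp add: measurable_cong_sets[OF prob_onD(2)[OF that] refl] lin_proj_measurable)
  have g1: "glueable k (?L U ?e1) \<nu>" if \<nu>: "prob_on k \<nu>" for U \<nu>
  proof -
    have "distr ?e1 (Rd k) (lin_proj k d U) = empirical k n (\<lambda>i. lin_proj k d U (x i))"
      by (rule proj_law_empirical[OF n _ lin_proj_measurable]) (rule x)
    moreover have "glueable k (empirical k n (\<lambda>i. lin_proj k d U (x i))) \<nu>"
      by (rule empirical_glueable[OF n _ \<nu>]) (rule measurable_space[OF lin_proj_measurable x])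
    ultimately show ?thesis unfolding proj_law_eq by simp
  qed
  have g2: "glueable k (?L U ?e2) \<nu>" if \<nu>: "prob_on k \<nu>" for U \<nu>
  proof -
    have "distr ?e2 (Rd k) (lin_proj k d U) = empirical k n (\<lambda>i. lin_proj k d U (y i))"
      by (rule proj_law_empirical[OF n _ lin_proj_measurable]) (rule y)
    moreover have "glueable k (empirical k n (\<lambda>i. lin_proj k d U (y i))) \<nu>"
      by (rule empirical_glueable[OF n _ \<nu>]) (rule measurable_space[OF lin_proj_measurable y])
    ultimately show ?thesis unfolding proj_law_eq by simp
  qed
  obtain S where S: "has_dim d k S" "spiked_by d S \<mu>1 \<mu>2" using spiked by (auto simp: spiked_transport_model_def)
  obtain U0 where U0: "U0 \<in> stiefel k d" "wasserstein d p \<mu>1 \<mu>2 \<le> ?W (?L U0 \<mu>1) (?L U0 \<mu>2)"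
    using spiked_wasserstein_le[OF S(2,1) p] by blast
  show ?thesis
  proof (rule ennreal_dist_le)
    \<comment> \<open>Two empirical measures are at finite distance, which provides the finiteness
      for \<open>ennreal_dist_le\<close>.\<close>
    have "proj_wasserstein k d p ?e1 ?e2 \<le> wasserstein d p ?e1 ?e2"
      unfolding proj_wasserstein_def by (rule SUP_least) (rule wasserstein_proj_le[OF _ prob_onD(2)[OF e(1)] prob_onD(2)[OF e(2)] p])
    also have "\<dots> < \<top>"
      by (rule le_less_trans[OF wasserstein_empirical_le[OF n x y p]]) simp_all
    finally show "proj_wasserstein k d p ?e1 ?e2 < \<top>" .
    show "proj_wasserstein k d p ?e1 ?e2 \<le> wasserstein d p \<mu>1 \<mu>2 + (\<beta>1 + \<beta>2)"
      unfolding proj_wasserstein_def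
    proof (rule SUP_least)
      fix U assume U: "U \<in> stiefel k d"
      have 1: "?W (?L U ?e1) (?L U ?e2) \<le> ?W (?L U ?e1) (?L U \<mu>1) + ?W (?L U \<mu>1) (?L U ?e2)"
        by (rule wasserstein_triangle[OF pl[OF e(1)] pl[OF \<mu>(1)] g1[OF pl[OF \<mu>(1)]] p])
      \<comment> \<open>Read from the side of the empirical measure, since the first leg of a
        triangle has to be glueable; symmetry of the distance turns the inequality around
        below.\<close>
      have 2: "?W (?L U ?e2) (?L U \<mu>1) \<le> ?W (?L U ?e2) (?L U \<mu>2) + ?W (?L U \<mu>2) (?L U \<mu>1)"
        by (rule wasserstein_triangle[OF pl[OF e(2)] pl[OF \<mu>(2)] g2[OF pl[OF \<mu>(2)]] p])
      have 3: "?W (?L U \<mu>1) (?L U \<mu>2) \<le> wasserstein d p \<mu>1 \<mu>2"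
        by (rule wasserstein_proj_le[OF U prob_onD(2)[OF \<mu>(1)] prob_onD(2)[OF \<mu>(2)] p])
      have "?W (?L U ?e1) (?L U ?e2) \<le> \<beta>1 + (\<beta>2 + wasserstein d p \<mu>1 \<mu>2)"
        using order_trans[OF 1 add_mono[OF b1[OF U] order_trans[OF 2[unfolded wasserstein_commute[of k p "?L U ?e2" "?L U \<mu>1"] wasserstein_commute[of k p "?L U \<mu>2" "?L U \<mu>1"]] add_mono[OF b2[OF U] 3]]]] .
      then show "?W (?L U ?e1) (?L U ?e2) \<le> wasserstein d p \<mu>1 \<mu>2 + (\<beta>1 + \<beta>2)" by (simp add: ac_simps)
    qed
    show "wasserstein d p \<mu>1 \<mu>2 \<le> proj_wasserstein k d p ?e1 ?e2 + (\<beta>1 + \<beta>2)"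
    proof -
      have 1: "?W (?L U0 \<mu>1) (?L U0 \<mu>2) \<le> ?W (?L U0 \<mu>1) (?L U0 ?e1) + ?W (?L U0 ?e1) (?L U0 \<mu>2)"
        by (rule wasserstein_triangle[OF pl[OF \<mu>(1)] pl[OF e(1)] glueable_commute[OF pl[OF e(1)] pl[OF \<mu>(1)] g1[OF pl[OF \<mu>(1)]]] p])
      have 2: "?W (?L U0 ?e1) (?L U0 \<mu>2) \<le> ?W (?L U0 ?e1) (?L U0 ?e2) + ?W (?L U0 ?e2) (?L U0 \<mu>2)"
        by (rule wasserstein_triangle[OF pl[OF e(1)] pl[OF e(2)] g1[OF pl[OF e(2)]] p])
      have 3: "?W (?L U0 ?e1) (?L U0 ?e2) \<le> proj_wasserstein k d p ?e1 ?e2"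
        unfolding proj_wasserstein_def by (rule SUP_upper[OF U0(1)])
      have "wasserstein d p \<mu>1 \<mu>2 \<le> \<beta>1 + (proj_wasserstein k d p ?e1 ?e2 + \<beta>2)"
        using order_trans[OF U0(2) order_trans[OF 1[unfolded wasserstein_commute[of k p "?L U0 \<mu>1" "?L U0 ?e1"]]
            add_mono[OF b1[OF U0(1)] order_trans[OF 2 add_mono[OF 3 b2[OF U0(1)]]]]]] .
      then show ?thesis by (simp add: ac_simps)
    qed
  qed
qed

theorem theorem8:
  shows "\<exists>(C :: real) (c :: real \<Rightarrow> real). C > 0 \<and> (\<forall>p\<ge>1. c p > 0) \<and>
    (\<forall>(p' :: real) (p :: real) (\<sigma> :: real) (d :: nat) (k :: nat) (n :: nat)
        (\<mu>1 :: vec measure) (\<mu>2 :: vec measure)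
        (\<Omega> :: (nat \<Rightarrow> real) measure) X Y.
      1 \<le> p' \<and> p' \<le> 2 \<and> 1 \<le> p \<and> \<sigma> > 0 \<and> n \<ge> 2 \<and>
      spiked_transport_model d k \<mu>1 \<mu>2 \<and>
      transport_ineq d p' (\<sigma>\<^sup>2) \<mu>1 \<and> transport_ineq d p' (\<sigma>\<^sup>2) \<mu>2 \<and>
      prob_space \<Omega> \<and> iid_samples d n \<mu>1 \<Omega> X \<and> iid_samples d n \<mu>2 \<Omega> Y
      \<longrightarrow>
      (\<integral>\<^sup>+ \<omega>. ennreal_dist
          (proj_wasserstein k d p (empirical d n (\<lambda>i. X i \<omega>)) (empirical d n (\<lambda>i. Y i \<omega>)))
          (wasserstein d p \<mu>1 \<mu>2) \<partial>\<Omega>)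
      \<le> ennreal (C * \<sigma> * (rate (c p) p k n
           + c p * real n powr (max (1 / p' - 1 / p) 0)
               * sqrt (real d * real k * ln (real n) / real n))))"
proof -
  \<comment> \<open>The constant has to be a function of \<open>p\<close> alone, so it is chosen
    from the existence statement before any other parameter is fixed.\<close>
  define good where "good p c \<longleftrightarrow> (0 < c \<and> (\<forall>d k n \<sigma> q \<mu>. 1 \<le> q \<and> q \<le> 2 \<and> 0 < \<sigma> \<and> 2 \<le> n \<and> 0 < k \<and> 0 < d \<and> transport_ineq d q (\<sigma>\<^sup>2) \<mu> \<longrightarrow>
    (\<exists>B\<in>borel_measurable (Pi\<^sub>M {..<n} (\<lambda>_. \<mu>)).
      (\<forall>x\<in>space (Pi\<^sub>M {..<n} (\<lambda>_. \<mu>)). \<forall>U\<in>stiefel k d.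
        wasserstein k p (proj_law k d U (empirical d n x)) (proj_law k d U \<mu>) \<le> B x) \<and>
      (\<integral>\<^sup>+x. B x \<partial>Pi\<^sub>M {..<n} (\<lambda>_. \<mu>)) \<le> ennreal (4 * \<sigma> * (rate c p k n
        + c * real n powr (max (1 / q - 1 / p) 0) * sqrt (real d * real k * ln (real n) / real n))))))" for p c
  define c where "c p = (SOME a. good p a)" for p
  have good: "good p (c p)" if "1 \<le> p" for p
    unfolding c_def by (rule someI_ex) (use projected_deviation_bound[OF that] in \<open>simp only: good_def\<close>)
  show ?thesis
  \<comment> \<open>Each of the two samples contributes \<open>4 * \<sigma>\<close>, the scale of
    the exponential moments of the projections.\<close>
  proof (rule exI[of _ 8], rule exI[of _ c], intro conjI allI impI)
    show "0 < c p" if "1 \<le> p" for p using good[OF that] by (simp add: good_def)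
  next
    fix p' p \<sigma> :: real and d k n :: nat and \<mu>1 \<mu>2 :: "vec measure" and \<Omega> :: "(nat \<Rightarrow> real) measure" and X Y
    assume "1 \<le> p' \<and> p' \<le> 2 \<and> 1 \<le> p \<and> \<sigma> > 0 \<and> n \<ge> 2 \<and>
      spiked_transport_model d k \<mu>1 \<mu>2 \<and>
      transport_ineq d p' (\<sigma>\<^sup>2) \<mu>1 \<and> transport_ineq d p' (\<sigma>\<^sup>2) \<mu>2 \<and>
      prob_space \<Omega> \<and> iid_samples d n \<mu>1 \<Omega> X \<and> iid_samples d n \<mu>2 \<Omega> Y"
    then have p': "1 \<le> p'" "p' \<le> 2" and p: "1 \<le> p" and \<sigma>: "0 < \<sigma>" and n2: "2 \<le> n"
      and spiked: "spiked_transport_model d k \<mu>1 \<mu>2"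
      and T1: "transport_ineq d p' (\<sigma>\<^sup>2) \<mu>1" and T2: "transport_ineq d p' (\<sigma>\<^sup>2) \<mu>2"
      and \<Omega>: "prob_space \<Omega>" and iX: "iid_samples d n \<mu>1 \<Omega> X" and iY: "iid_samples d n \<mu>2 \<Omega> Y" by auto
    interpret \<Omega>: prob_space \<Omega> by fact
    have n: "0 < n" using n2 by simp
    have \<mu>: "prob_on d \<mu>1" "prob_on d \<mu>2" using T1 T2 by (auto simp: transport_ineq_def)
    note X = iid_samples_law[OF \<Omega> iX n] and Y = iid_samples_law[OF \<Omega> iY n]
    let ?D = "\<lambda>\<omega>. ennreal_dist (proj_wasserstein k d p (empirical d n (\<lambda>i. X i \<omega>)) (empirical d n (\<lambda>i. Y i \<omega>))) (wasserstein d p \<mu>1 \<mu>2)"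
    define R where "R = rate (c p) p k n + c p * real n powr (max (1 / p' - 1 / p) 0) * sqrt (real d * real k * ln (real n) / real n)"
    have cp: "0 < c p" using good[OF p] by (simp add: good_def)
    have R0: "0 \<le> R" unfolding R_def using cp n2 by (intro add_nonneg_nonneg rate_nonneg mult_nonneg_nonneg) auto
    show "(\<integral>\<^sup>+ \<omega>. ?D \<omega> \<partial>\<Omega>) \<le> ennreal (8 * \<sigma> * (rate (c p) p k n
           + c p * real n powr (max (1 / p' - 1 / p) 0) * sqrt (real d * real k * ln (real n) / real n)))"
    proof (cases "k = 0")
      case True
      have eq: "wasserstein 0 p (proj_law 0 d U \<nu>) (proj_law 0 d U \<nu>') = 0" if "prob_on d \<nu>" "prob_on d \<nu>'" for U \<nu> \<nu>'
      proof -
        have "prob_on 0 (return (Rd 0) (\<lambda>_. undefined))"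
          by (simp add: prob_on_def prob_space_return space_Rd)
        then show ?thesis
          unfolding proj_law_dim_zero[OF prob_onD(1)[OF that(1)]] proj_law_dim_zero[OF prob_onD(1)[OF that(2)]]
          by (rule wasserstein_same[OF _ p])
      qed
      have "?D \<omega> \<le> 0 + 0" if \<omega>: "\<omega> \<in> space \<Omega>" for \<omega>
      proof (rule proj_wasserstein_deviation[OF spiked p n \<mu>])
        show xs: "X i \<omega> \<in> space (Rd d)" if "i < n" for i using measurable_space[OF X(3)[OF that] \<omega>] .
        show ys: "Y i \<omega> \<in> space (Rd d)" if "i < n" for i using measurable_space[OF Y(3)[OF that] \<omega>] .
        show "wasserstein k p (proj_law k d U (empirical d n (\<lambda>i. X i \<omega>))) (proj_law k d U \<mu>1) \<le> 0" for U
          unfolding True by (subst eq[OF prob_on_empirical(1)[OF n xs] \<mu>(1)]) auto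
        show "wasserstein k p (proj_law k d U (empirical d n (\<lambda>i. Y i \<omega>))) (proj_law k d U \<mu>2) \<le> 0" for U
          unfolding True by (subst eq[OF prob_on_empirical(1)[OF n ys] \<mu>(2)]) auto
      qed
      then have "(\<integral>\<^sup>+ \<omega>. ?D \<omega> \<partial>\<Omega>) \<le> (\<integral>\<^sup>+ \<omega>. 0 \<partial>\<Omega>)" by (intro nn_integral_mono) simp
      then show ?thesis by simp
    next
      case False
      then have k: "0 < k" by simp
      \<comment> \<open>An orthonormal row in dimension 0 would have norm 0 instead of 1.\<close>
      have d: "0 < d"
      proof (rule ccontr)
        assume "\<not> 0 < d"
        obtain S where S: "has_dim d k S" using spiked by (auto simp: spiked_transport_model_def)
        obtain U where "U \<in> stiefel k d" using orthonormal_basis[OF S] by (elim exE conjE)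
        then have "(\<Sum>l<d. U 0 l * U 0 l) = 1" using k by (auto simp: stiefel_def)
        then show False using \<open>\<not> 0 < d\<close> by simp
      qed
      have ex: "\<exists>B\<in>borel_measurable (Pi\<^sub>M {..<n} (\<lambda>_. \<mu>)).
        (\<forall>x\<in>space (Pi\<^sub>M {..<n} (\<lambda>_. \<mu>)). \<forall>U\<in>stiefel k d.
          wasserstein k p (proj_law k d U (empirical d n x)) (proj_law k d U \<mu>) \<le> B x) \<and>
        (\<integral>\<^sup>+x. B x \<partial>Pi\<^sub>M {..<n} (\<lambda>_. \<mu>)) \<le> ennreal (4 * \<sigma> * R)"
        if "transport_ineq d p' (\<sigma>\<^sup>2) \<mu>" for \<mu>
        using conjunct2[OF good[OF p, unfolded good_def], THEN spec[of _ d], THEN spec[of _ k], THEN spec[of _ n],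
          THEN spec[of _ \<sigma>], THEN spec[of _ p'], THEN spec[of _ \<mu>], THEN mp] p' \<sigma> n2 k d that
        unfolding R_def by simp
      obtain B1 where B1: "B1 \<in> borel_measurable (Pi\<^sub>M {..<n} (\<lambda>_. \<mu>1))"
        "\<And>x U. x \<in> space (Pi\<^sub>M {..<n} (\<lambda>_. \<mu>1)) \<Longrightarrow> U \<in> stiefel k d \<Longrightarrow>
          wasserstein k p (proj_law k d U (empirical d n x)) (proj_law k d U \<mu>1) \<le> B1 x"
        "(\<integral>\<^sup>+x. B1 x \<partial>Pi\<^sub>M {..<n} (\<lambda>_. \<mu>1)) \<le> ennreal (4 * \<sigma> * R)" using ex[OF T1] by blast
      obtain B2 where B2: "B2 \<in> borel_measurable (Pi\<^sub>M {..<n} (\<lambda>_. \<mu>2))"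
        "\<And>x U. x \<in> space (Pi\<^sub>M {..<n} (\<lambda>_. \<mu>2)) \<Longrightarrow> U \<in> stiefel k d \<Longrightarrow>
          wasserstein k p (proj_law k d U (empirical d n x)) (proj_law k d U \<mu>2) \<le> B2 x"
        "(\<integral>\<^sup>+x. B2 x \<partial>Pi\<^sub>M {..<n} (\<lambda>_. \<mu>2)) \<le> ennreal (4 * \<sigma> * R)" using ex[OF T2] by blast
      define xs where "xs \<omega> = (\<lambda>i\<in>{..<n}. X i \<omega>)" for \<omega>
      define ys where "ys \<omega> = (\<lambda>i\<in>{..<n}. Y i \<omega>)" for \<omega>
      have xm: "xs \<in> measurable \<Omega> (Pi\<^sub>M {..<n} (\<lambda>_. \<mu>1))" and ym: "ys \<in> measurable \<Omega> (Pi\<^sub>M {..<n} (\<lambda>_. \<mu>2))"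
        unfolding xs_def ys_def by (rule X(1), rule Y(1))
      \<comment> \<open>Only the first \<open>n\<close> values enter, so each sample may be
        restricted to an element of the product space.\<close>
      have emp: "empirical d n (\<lambda>i. X i \<omega>) = empirical d n (xs \<omega>)" "empirical d n (\<lambda>i. Y i \<omega>) = empirical d n (ys \<omega>)" for \<omega>
        unfolding empirical_def xs_def ys_def by (auto intro!: distr_cong simp: space_uniform_count_measure)
      have I1: "(\<integral>\<^sup>+\<omega>. B1 (xs \<omega>) \<partial>\<Omega>) \<le> ennreal (4 * \<sigma> * R)"
      proof -
        have "(\<integral>\<^sup>+x. B1 x \<partial>distr \<Omega> (Pi\<^sub>M {..<n} (\<lambda>_. \<mu>1)) xs) = (\<integral>\<^sup>+\<omega>. B1 (xs \<omega>) \<partial>\<Omega>)"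
          by (rule nn_integral_distr[OF xm]) (simp add: B1(1))
        moreover have "distr \<Omega> (Pi\<^sub>M {..<n} (\<lambda>_. \<mu>1)) xs = Pi\<^sub>M {..<n} (\<lambda>_. \<mu>1)"
          using X(2) unfolding xs_def .
        ultimately show ?thesis using B1(3) by simp
      qed
      have I2: "(\<integral>\<^sup>+\<omega>. B2 (ys \<omega>) \<partial>\<Omega>) \<le> ennreal (4 * \<sigma> * R)"
      proof -
        have "(\<integral>\<^sup>+x. B2 x \<partial>distr \<Omega> (Pi\<^sub>M {..<n} (\<lambda>_. \<mu>2)) ys) = (\<integral>\<^sup>+\<omega>. B2 (ys \<omega>) \<partial>\<Omega>)"
          by (rule nn_integral_distr[OF ym]) (simp add: B2(1))
        moreover have "distr \<Omega> (Pi\<^sub>M {..<n} (\<lambda>_. \<mu>2)) ys = Pi\<^sub>M {..<n} (\<lambda>_. \<mu>2)"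
          using Y(2) unfolding ys_def .
        ultimately show ?thesis using B2(3) by simp
      qed
      have "(\<integral>\<^sup>+ \<omega>. ?D \<omega> \<partial>\<Omega>) \<le> (\<integral>\<^sup>+ \<omega>. B1 (xs \<omega>) + B2 (ys \<omega>) \<partial>\<Omega>)"
      proof (rule nn_integral_mono)
        fix \<omega> assume \<omega>: "\<omega> \<in> space \<Omega>"
        have 1: "xs \<omega> \<in> space (Pi\<^sub>M {..<n} (\<lambda>_. \<mu>1))" "ys \<omega> \<in> space (Pi\<^sub>M {..<n} (\<lambda>_. \<mu>2))"
          by (rule measurable_space[OF xm \<omega>], rule measurable_space[OF ym \<omega>])
        show "?D \<omega> \<le> B1 (xs \<omega>) + B2 (ys \<omega>)"
          unfolding emp
        proof (rule proj_wasserstein_deviation[OF spiked p n \<mu>])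
          show "xs \<omega> i \<in> space (Rd d)" if "i < n" for i using measurable_space[OF X(3)[OF that] \<omega>] that by (simp add: xs_def)
          show "ys \<omega> i \<in> space (Rd d)" if "i < n" for i using measurable_space[OF Y(3)[OF that] \<omega>] that by (simp add: ys_def)
        qed (rule B1(2)[OF 1(1)], assumption, rule B2(2)[OF 1(2)], assumption)
      qed
      also have "\<dots> = (\<integral>\<^sup>+ \<omega>. B1 (xs \<omega>) \<partial>\<Omega>) + (\<integral>\<^sup>+ \<omega>. B2 (ys \<omega>) \<partial>\<Omega>)"
        by (rule nn_integral_add[OF measurable_compose[OF xm B1(1)] measurable_compose[OF ym B2(1)]])
      also have "\<dots> \<le> ennreal (4 * \<sigma> * R) + ennreal (4 * \<sigma> * R)" using I1 I2 by (rule add_mono)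
      also have "\<dots> = ennreal (8 * \<sigma> * R)" using \<sigma> R0 by (simp add: ennreal_plus[symmetric] del: ennreal_plus)
      finally show ?thesis unfolding R_def .
    qed
  qed simp
qed

end
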